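(* Let $A=(a_{i,j})_{i,j\in I}$ be an indecomposable Cartan matrix of finite type with Weyl group $W$. For every Coxeter element $c$ of $W$, there exists a cluster algebra $\widetilde{\mathcal{A}}(c)$ of geometric type satisfying the following properties: (1) The coefficient semifield of $\widetilde{\mathcal{A}}(c)$ is $\widetilde{\mathbb{P}}(c)=\mathrm{Trop}(p[\gamma]:\gamma\in\Pi(c))$. (2) The cluster variables in $\widetilde{\mathcal{A}}(c)$ are labeled by the set $\Pi(c)$, the variable corresponding to $\gamma\in\Pi(c)$ being denoted $x[\gamma]$. (3) The initial seed of $\widetilde{\mathcal{A}}(c)$ is of the form $(\mathbf{x},\mathbf{y},B(c))$, where $\mathbf{x}=(x[\omega_i]:i\in I)$ and $\mathbf{y}=(y_j:j\in I)$ with $$y_j=p[\omega_j]\,p[c\,\omega_j]^{-1}\prod_{\gamma\in\Pi(c)-\{\omega_j,c\omega_j\}}p[\gamma]^{(\gamma\|c\omega_j)_c+\sum_{i\prec_c j}a_{i,j}(\gamma\|c\omega_i)_c}.$$ (4) The primitive exchange relations in $\widetilde{\mathcal{A}}(c)$ are exactly the following (for $k\in I$ and $1\le m\le h(k;c)$): $$x[-\omega_k]\,x[\omega_k]=p[\omega_k]\prod_{i\prec_c k}x[\omega_i]^{-a_{i,k}}\prod_{k\prec_c i}x[-\omega_i]^{-a_{i,k}}+\prod_{\gamma\in\Pi(c)}p[\gamma]^{(\gamma\|\omega_k)_c};$$ $$x[c^{m-1}\omega_k]\,x[c^m\omega_k]=p[c^m\omega_k]\prod_{i\prec_c k}x[c^m\omega_i]^{-a_{i,k}}\prod_{k\prec_c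 i}x[c^{m-1}\omega_i]^{-a_{i,k}}+\prod_{\gamma\in\Pi(c)}p[\gamma]^{(\gamma\|c^m\omega_k)_c}.$$
   Context: Root data. $\alpha_i$ are the simple roots, $\omega_i$ the fundamental weights ($\alpha_j=\sum_i a_{i,j}\omega_i$), $|I|=n$, $W$ is generated by the simple reflections $s_i$, $s_i\alpha_j=\alpha_j-a_{i,j}\alpha_i$, with longest element $w_\circ$; $\omega_{i^\star}=-w_\circ\omega_i$. A Coxeter element $c$ is a product of all simple reflections, each once, in some order. Write $i\prec_c j$ if $i\ne j$, $a_{i,j}\ne0$, and $s_i$ precedes $s_j$ in the factorization of $c$. $B(c)=(b_{i,j})$: $b_{i,j}=-a_{i,j}$ if $i\prec_c j$, $b_{i,j}=a_{i,j}$ if $j\prec_c i$, $b_{i,j}=0$ otherwise. Order weights by $\gamma\ge\delta$ iff $\gamma-\delta$ is a nonnegative integer combination of simple roots; $h(i;c)$ is the (unique) positive integer with $\omega_i>c\omega_i>\cdots>c^{h(i;c)}\omega_i=-\omega_{i^\star}$; $\Pi(c)=\{c^m\omega_i:i\in I,\ 0\le m\le h(i;c)\}$. $\tau_c$ is the permutation of $\Pi(c)$ with $\tau_c(c^{m-1}\omega_i)=c^m\omega_i$ for $1\le m\le h(i;c)$ and $\tau_c(-\omega_i)=\omega_i$. The $c$-compatibility degree $(\gamma\|\delta)_c\in\mathbb{Z}_{\ge0}$ ($\gamma,\delta\in\Pi(c)$) is the unique function with $(\omega_i\|\omega_j)_c=0$; $(\omega_i\|\gamma)_c=[c^{-1}\gamma-\gamma:\alpha_i]$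 (coefficient of $\alpha_i$ in the basis of simple roots) for $\gamma\in\Pi(c)-\{\omega_j:j\in I\}$; and $(\tau_c\gamma\|\tau_c\delta)_c=(\gamma\|\delta)_c$. Cluster algebras. A semifield $\mathbb{P}$ is an abelian multiplicative group with a commutative, associative addition $\oplus$ over which multiplication distributes. $\mathrm{Trop}(u_j:j\in J)$ is the free abelian multiplicative group on the $u_j$ with $\prod u_j^{a_j}\oplus\prod u_j^{b_j}=\prod u_j^{\min(a_j,b_j)}$; a cluster algebra over such a semifield is of geometric type. Let $\mathbb{ZP}$ be the group ring, $\mathbb{Q}(\mathbb{P})$ its fraction field, $\mathcal{F}$ a field isomorphic to the rational functions in $n$ variables over $\mathbb{Q}(\mathbb{P})$. A seed is $(\mathbf{x},\mathbf{y},B)$ with $\mathbf{x}=(x_i)_{i\in I}$ a free generating set of $\mathcal{F}$ over $\mathbb{Q}(\mathbb{P})$ (the cluster), $\mathbf{y}=(y_i)_{i\in I}$ a tuple in $\mathbb{P}$, $B$ a skew-symmetrizable integer matrix. With $[b]_+=\max(b,0)$, the mutation $\mu_k$ gives $(\mathbf{x}',\mathbf{y}',B')$: $b'_{i,j}=-b_{i,j}$ if $i=k$ or $j=k$, otherwise $b'_{i,j}=b_{i,j}+[b_{i,k}]_+[b_{k,j}]_+-[-b_{i,k}]_+[-b_{k,j}]_+$; $y'_k=y_k^{-1}$, $y'_j=y_jy_k^{[b_{k,j}]_+}(y_k\oplus1)^{-b_{k,j}}$ for $j\ne k$; $x'_j=x_j$ for $j\ne k$, and $x'_k$ is given by the exchange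 relation $x_kx'_k=\dfrac{y_k\prod_i x_i^{[b_{i,k}]_+}+\prod_i x_i^{[-b_{i,k}]_+}}{y_k\oplus1}$. Cluster variables are all elements of clusters of seeds obtained from the initial seed by sequences of mutations; exchange relations are those of all mutations of such seeds; the cluster algebra is the $\mathbb{ZP}$-subalgebra of $\mathcal{F}$ generated by all cluster variables. An exchange relation is primitive if one of the two products of cluster variables on its right-hand side is empty (equal to $1$). *)

theory Defs
  imports
    "HOL-Algebra.Free_Abelian_Groups"
    "HOL-Analysis.Finite_Cartesian_Product"
    "HOL-Combinatorics.Permutations"
    "HOL-Computational_Algebra.Fraction_Field"
    "HOL-Library.Multiset"
begin

section \<open>Root data\<close>

definition finite_type_cartan :: "int^'i^'i \<Rightarrow> bool" where
  "finite_type_cartan A \<longleftrightarrow>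
     (\<forall>i. A$i$i = 2) \<and>
     (\<forall>i j. i \<noteq> j \<longrightarrow> A$i$j \<le> 0 \<and> (A$i$j = 0 \<longleftrightarrow> A$j$i = 0)) \<and>
     (\<exists>d :: 'i \<Rightarrow> int. (\<forall>i. d i > 0) \<and>
        (\<forall>i j. d i * A$i$j = d j * A$j$i) \<and>
        (\<forall>v :: 'i \<Rightarrow> real. (\<exists>i. v i \<noteq> 0) \<longrightarrow>
           (\<Sum>i\<in>UNIV. \<Sum>j\<in>UNIV. v i * real_of_int (d i * A$i$j) * v j) > 0))"

definition indecomposable :: "int^'i^'i \<Rightarrow> bool" where
  "indecomposable A \<longleftrightarrow>
     \<not> (\<exists>J. J \<noteq> {} \<and> J \<noteq> UNIV \<and> (\<forall>i\<in>J. \<forall>j\<in>-J. A$i$j = 0 \<and> A$j$i = 0))"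

text \<open>Weights are written in the basis of fundamental weights: \<open>\<gamma> :: int^'i\<close> stands for the
  sum of the \<open>\<gamma>$i\<close> times the \<open>i\<close>-th fundamental weight. Hence \<open>\<alpha>\<^sub>j\<close> is the \<open>j\<close>-th column of \<open>A\<close>.\<close>

definition fundamental_weight :: "'i \<Rightarrow> int^'i"  (\<open>\<omega>\<close>) where
  "\<omega> i = axis i 1"

definition simple_root :: "int^'i^'i \<Rightarrow> 'i \<Rightarrow> int^'i" where
  "simple_root A j = column j A"

definition simple_refl :: "int^'i^'i \<Rightarrow> 'i \<Rightarrow> int^'i \<Rightarrow> int^'i" where
  "simple_refl A i \<gamma> = \<gamma> - (\<gamma>$i) *s simple_root A i"

lemma simple_refl_simple_root:
  "simple_refl A i (simple_root A j) = simple_root A j - (A$i$j) *s simple_root A i"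
  by (simp add: simple_refl_def simple_root_def column_def)

definition word_prod :: "int^'i^'i \<Rightarrow> 'i list \<Rightarrow> int^'i \<Rightarrow> int^'i" where
  "word_prod A w = foldr (\<circ>) (map (simple_refl A) w) id"

text \<open>The simple reflections are involutions (when \<open>A$i$i = 2\<close>), so the products of words form the
  group they generate.\<close>

definition weyl_group :: "int^'i^'i \<Rightarrow> (int^'i \<Rightarrow> int^'i) set" where
  "weyl_group A = range (word_prod A)"

definition weyl_length :: "int^'i^'i \<Rightarrow> (int^'i \<Rightarrow> int^'i) \<Rightarrow> nat" where
  "weyl_length A u = (LEAST k. \<exists>w. length w = k \<and> word_prod A w = u)"

definition longest_element :: "int^'i^'i \<Rightarrow> int^'i \<Rightarrow> int^'i" where
  "longest_element A =
     (THE u. u \<in> weyl_group A \<and> (\<forall>v\<in>weyl_group A. weyl_length A v \<le> weyl_length A u))"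

definition star :: "int^'i^'i \<Rightarrow> 'i \<Rightarrow> 'i" where
  "star A i = (THE j. \<omega> j = - longest_element A (\<omega> i))"

definition coxeter_word :: "int^'i^'i \<Rightarrow> (int^'i \<Rightarrow> int^'i) \<Rightarrow> 'i list \<Rightarrow> bool" where
  "coxeter_word A c w \<longleftrightarrow> distinct w \<and> set w = UNIV \<and> word_prod A w = c"

definition coxeter_element :: "int^'i^'i \<Rightarrow> (int^'i \<Rightarrow> int^'i) \<Rightarrow> bool" where
  "coxeter_element A c \<longleftrightarrow> (\<exists>w. coxeter_word A c w)"

text \<open>Two factorizations of \<open>c\<close> differ by commutations of reflections, so the relation below does
  not depend on the choice of \<open>w\<close>.\<close>

definition prec :: "int^'i^'i \<Rightarrow> (int^'i \<Rightarrow> int^'i) \<Rightarrow> 'i \<Rightarrow> 'i \<Rightarrow> bool" where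
  "prec A c i j \<longleftrightarrow> i \<noteq> j \<and> A$i$j \<noteq> 0 \<and>
     (\<exists>w. coxeter_word A c w \<and> (\<exists>p q. p < q \<and> q < length w \<and> w!p = i \<and> w!q = j))"

definition exch_matrix :: "int^'i^'i \<Rightarrow> (int^'i \<Rightarrow> int^'i) \<Rightarrow> int^'i^'i" where
  "exch_matrix A c =
     (\<chi> i j. if prec A c i j then - A$i$j else if prec A c j i then A$i$j else 0)"

definition weight_ge :: "int^'i^'i \<Rightarrow> int^'i \<Rightarrow> int^'i \<Rightarrow> bool" where
  "weight_ge A \<gamma> \<delta> \<longleftrightarrow>
     (\<exists>v :: 'i \<Rightarrow> nat. \<gamma> - \<delta> = (\<Sum>i\<in>UNIV. int (v i) *s simple_root A i))"

definition cox_h :: "int^'i^'i \<Rightarrow> (int^'i \<Rightarrow> int^'i) \<Rightarrow> 'i \<Rightarrow> nat" where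
  "cox_h A c i = (THE h. 0 < h \<and>
     (\<forall>m<h. weight_ge A ((c^^m) (\<omega> i)) ((c^^Suc m) (\<omega> i)) \<and> (c^^m) (\<omega> i) \<noteq> (c^^Suc m) (\<omega> i)) \<and>
     (c^^h) (\<omega> i) = - \<omega> (star A i))"

definition cox_weights :: "int^'i^'i \<Rightarrow> (int^'i \<Rightarrow> int^'i) \<Rightarrow> (int^'i) set" where
  "cox_weights A c = {(c^^m) (\<omega> i) | i m. m \<le> cox_h A c i}"

definition tau :: "int^'i^'i \<Rightarrow> (int^'i \<Rightarrow> int^'i) \<Rightarrow> int^'i \<Rightarrow> int^'i" where
  "tau A c = (THE f. f permutes cox_weights A c \<and>
     (\<forall>i m. 1 \<le> m \<and> m \<le> cox_h A c i \<longrightarrow> f ((c^^(m-1)) (\<omega> i)) = (c^^m) (\<omega> i)) \<and>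
     (\<forall>i. f (- \<omega> i) = \<omega> i))"

text \<open>Coefficient of \<open>\<alpha>\<^sub>i\<close> in the expansion of \<open>\<gamma>\<close> in simple roots. It is only used for \<open>\<gamma>\<close> in the
  root lattice, where the coefficients are integers.\<close>

definition root_coeff :: "int^'i^'i \<Rightarrow> int^'i \<Rightarrow> 'i \<Rightarrow> int" where
  "root_coeff A \<gamma> i = (THE v :: 'i \<Rightarrow> int. \<gamma> = (\<Sum>j\<in>UNIV. v j *s simple_root A j)) i"

text \<open>The compatibility degree lives on pairs from \<open>cox_weights A c\<close>; outside it is set to \<open>0\<close>.\<close>

definition compat :: "int^'i^'i \<Rightarrow> (int^'i \<Rightarrow> int^'i) \<Rightarrow> int^'i \<Rightarrow> int^'i \<Rightarrow> nat" where
  "compat A c = (THE d.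
     (\<forall>\<gamma> \<delta>. \<not> (\<gamma> \<in> cox_weights A c \<and> \<delta> \<in> cox_weights A c) \<longrightarrow> d \<gamma> \<delta> = 0) \<and>
     (\<forall>i j. d (\<omega> i) (\<omega> j) = 0) \<and>
     (\<forall>i. \<forall>\<gamma> \<in> cox_weights A c - range \<omega>.
        int (d (\<omega> i) \<gamma>) = root_coeff A (inv_into UNIV c \<gamma> - \<gamma>) i) \<and>
     (\<forall>\<gamma> \<in> cox_weights A c. \<forall>\<delta> \<in> cox_weights A c. d (tau A c \<gamma>) (tau A c \<delta>) = d \<gamma> \<delta>))"


section \<open>Semifields\<close>

record 'p semifield = "'p monoid" +
  splus :: "'p \<Rightarrow> 'p \<Rightarrow> 'p"

definition is_semifield :: "'p semifield \<Rightarrow> bool" where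
  "is_semifield P \<longleftrightarrow> comm_group P \<and>
     (\<forall>a\<in>carrier P. \<forall>b\<in>carrier P. splus P a b \<in> carrier P \<and> splus P a b = splus P b a \<and>
        (\<forall>d\<in>carrier P. splus P (splus P a b) d = splus P a (splus P b d) \<and>
            d \<otimes>\<^bsub>P\<^esub> splus P a b = splus P (d \<otimes>\<^bsub>P\<^esub> a) (d \<otimes>\<^bsub>P\<^esub> b)))"

lift_definition trop_plus :: "('j \<Rightarrow>\<^sub>0 int) \<Rightarrow> ('j \<Rightarrow>\<^sub>0 int) \<Rightarrow> ('j \<Rightarrow>\<^sub>0 int)" is
  "\<lambda>a b j. min (a j) (b j)"
proof -
  fix a b :: "'j \<Rightarrow> int"
  assume "finite {x. a x \<noteq> 0}" "finite {x. b x \<noteq> 0}"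
  moreover have "{x. min (a x) (b x) \<noteq> 0} \<subseteq> {x. a x \<noteq> 0} \<union> {x. b x \<noteq> 0}"
    by (auto simp: min_def)
  ultimately show "finite {x. min (a x) (b x) \<noteq> 0}"
    by (meson finite_UnI finite_subset)
qed

text \<open>Multiplicatively written, \<open>a :: 'j \<Rightarrow>\<^sub>0 int\<close> is the Laurent monomial with exponents \<open>a\<close>; the
  generator indexed by \<open>j\<close> is \<open>frag_of j\<close>.\<close>

definition Trop :: "'j set \<Rightarrow> ('j \<Rightarrow>\<^sub>0 int) semifield" where
  "Trop J = monoid.extend (free_Abelian_group J) (semifield.fields trop_plus)"

lemma Trop_simps [simp]:
  "carrier (Trop J) = {a. Poly_Mapping.keys a \<subseteq> J}"
  "a \<otimes>\<^bsub>Trop J\<^esub> b = a + b"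
  "\<one>\<^bsub>Trop J\<^esub> = 0"
  "splus (Trop J) a b = trop_plus a b"
  by (simp_all add: Trop_def monoid.defs semifield.defs free_Abelian_group_def)

lemma is_semifield_Trop: "is_semifield (Trop J)"
proof -
  have ex: "\<exists>b. Poly_Mapping.keys b \<subseteq> J \<and> a + b = 0"
    if "Poly_Mapping.keys a \<subseteq> J" for a :: "'a \<Rightarrow>\<^sub>0 int"
    using that by (intro exI[of _ "- a"]) simp
  have keys_plus: "Poly_Mapping.keys (a + b) \<subseteq> J"
    if "Poly_Mapping.keys a \<subseteq> J" "Poly_Mapping.keys b \<subseteq> J" for a b :: "'a \<Rightarrow>\<^sub>0 int"
    using that Poly_Mapping.keys_add[of a b] by blast
  have "comm_group (Trop J)"
    by (rule comm_groupI) (auto simp: ac_simps ex dest: subsetD[OF keys_plus])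
  moreover have "Poly_Mapping.keys (trop_plus a b) \<subseteq> Poly_Mapping.keys a \<union> Poly_Mapping.keys b"
    for a b :: "'a \<Rightarrow>\<^sub>0 int"
    by transfer (auto simp: min_def)
  then have "Poly_Mapping.keys (trop_plus a b) \<subseteq> J"
    if "Poly_Mapping.keys a \<subseteq> J" "Poly_Mapping.keys b \<subseteq> J" for a b :: "'a \<Rightarrow>\<^sub>0 int"
    using that by blast
  moreover have "trop_plus a b = trop_plus b a" for a b :: "'a \<Rightarrow>\<^sub>0 int"
    by transfer (auto simp: min.commute)
  moreover have "trop_plus (trop_plus a b) d = trop_plus a (trop_plus b d)"
    for a b d :: "'a \<Rightarrow>\<^sub>0 int"
    by transfer (auto simp: min.assoc)
  moreover have "d + trop_plus a b = trop_plus (d + a) (d + b)" for a b d :: "'a \<Rightarrow>\<^sub>0 int"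
    by transfer (auto simp: min_add_distrib_right)
  ultimately show ?thesis
    by (simp add: is_semifield_def)
qed


section \<open>Coefficients and the ambient field\<close>

text \<open>An element of the group ring of \<open>P\<close> is a finitely supported \<open>r :: 'p \<Rightarrow>\<^sub>0 int\<close> with support in
  \<open>carrier P\<close>. The group ring and its fraction field are realized inside a field \<open>'f\<close> through a map
  \<open>\<iota>\<close> on \<open>P\<close>: \<open>\<iota>\<close> is multiplicative and its linear extension \<open>group_ring_map \<iota>\<close> is injective, so the
  latter is an isomorphism of rings from the group ring onto \<open>group_ring P \<iota>\<close>.\<close>

definition group_ring_map :: "('p \<Rightarrow> 'f::field) \<Rightarrow> ('p \<Rightarrow>\<^sub>0 int) \<Rightarrow> 'f" where
  "group_ring_map \<iota> r =
     (\<Sum>g\<in>Poly_Mapping.keys r. of_int (Poly_Mapping.lookup r g) * \<iota> g)"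

definition coeff_embedding :: "'p semifield \<Rightarrow> ('p \<Rightarrow> 'f::field) \<Rightarrow> bool" where
  "coeff_embedding P \<iota> \<longleftrightarrow>
     \<iota> \<one>\<^bsub>P\<^esub> = 1 \<and> (\<forall>a\<in>carrier P. \<forall>b\<in>carrier P. \<iota> (a \<otimes>\<^bsub>P\<^esub> b) = \<iota> a * \<iota> b) \<and>
     inj_on (group_ring_map \<iota>) {r. Poly_Mapping.keys r \<subseteq> carrier P}"

definition group_ring :: "'p semifield \<Rightarrow> ('p \<Rightarrow> 'f::field) \<Rightarrow> 'f set" where
  "group_ring P \<iota> = group_ring_map \<iota> ` {r. Poly_Mapping.keys r \<subseteq> carrier P}"

definition coeff_field :: "'p semifield \<Rightarrow> ('p \<Rightarrow> 'f::field) \<Rightarrow> 'f set" where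
  "coeff_field P \<iota> = {a / b | a b. a \<in> group_ring P \<iota> \<and> b \<in> group_ring P \<iota> \<and> b \<noteq> 0}"

text \<open>Polynomials over a subset \<open>K\<close> of \<open>'f\<close> in variables indexed by \<open>'i\<close>: finitely supported functions
  from exponent vectors to coefficients.\<close>

definition polys_over :: "'f::field set \<Rightarrow> (('i \<Rightarrow>\<^sub>0 nat) \<Rightarrow>\<^sub>0 'f) set" where
  "polys_over K = {f. \<forall>m. Poly_Mapping.lookup f m \<in> K}"

definition poly_eval :: "('i::finite \<Rightarrow> 'f::field) \<Rightarrow> (('i \<Rightarrow>\<^sub>0 nat) \<Rightarrow>\<^sub>0 'f) \<Rightarrow> 'f" where
  "poly_eval x f =
     (\<Sum>m\<in>Poly_Mapping.keys f. Poly_Mapping.lookup f m * (\<Prod>i\<in>UNIV. x i ^ Poly_Mapping.lookup m i))"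

text \<open>\<open>x\<close> is algebraically independent over \<open>K\<close> and \<open>F = K(x)\<close>. In particular \<open>F\<close> is then isomorphic
  over \<open>K\<close> to the field of rational functions in variables indexed by \<open>'i\<close>.\<close>

definition free_generating_set :: "'f::field set \<Rightarrow> 'f set \<Rightarrow> ('i::finite \<Rightarrow> 'f) \<Rightarrow> bool" where
  "free_generating_set K F x \<longleftrightarrow>
     (\<forall>f\<in>polys_over K. poly_eval x f = 0 \<longrightarrow> f = 0) \<and>
     F = {poly_eval x f / poly_eval x g | f g. f \<in> polys_over K \<and> g \<in> polys_over K \<and> g \<noteq> 0}"


section \<open>Seeds and mutations\<close>

type_synonym ('i, 'p, 'f) seed = "('i \<Rightarrow> 'f) \<times> ('i \<Rightarrow> 'p) \<times> (int^'i^'i)"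

definition skew_symmetrizable :: "int^'i^'i \<Rightarrow> bool" where
  "skew_symmetrizable B \<longleftrightarrow>
     (\<exists>d :: 'i \<Rightarrow> int. (\<forall>i. d i > 0) \<and> (\<forall>i j. d i * B$i$j = - (d j * B$j$i)))"

definition is_seed ::
    "'p semifield \<Rightarrow> ('p \<Rightarrow> 'f::field) \<Rightarrow> 'f set \<Rightarrow> ('i::finite, 'p, 'f) seed \<Rightarrow> bool" where
  "is_seed P \<iota> F = (\<lambda>(x, y, B).
     free_generating_set (coeff_field P \<iota>) F x \<and> (\<forall>i. y i \<in> carrier P) \<and> skew_symmetrizable B)"

definition pos :: "int \<Rightarrow> int" where
  "pos b = max b 0"

definition matrix_mutation :: "'i \<Rightarrow> int^'i^'i \<Rightarrow> int^'i^'i" where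
  "matrix_mutation k B =
     (\<chi> i j. if i = k \<or> j = k then - B$i$j
             else B$i$j + pos (B$i$k) * pos (B$k$j) - pos (- B$i$k) * pos (- B$k$j))"

definition coeff_mutation ::
    "'p semifield \<Rightarrow> 'i \<Rightarrow> ('i \<Rightarrow> 'p) \<Rightarrow> int^'i^'i \<Rightarrow> 'i \<Rightarrow> 'p" where
  "coeff_mutation P k y B j =
     (if j = k then inv\<^bsub>P\<^esub> (y k)
      else y j \<otimes>\<^bsub>P\<^esub> (y k [^]\<^bsub>P\<^esub> pos (B$k$j)) \<otimes>\<^bsub>P\<^esub> (splus P (y k) \<one>\<^bsub>P\<^esub> [^]\<^bsub>P\<^esub> (- B$k$j)))"

definition exchange_variable ::
    "'p semifield \<Rightarrow> ('p \<Rightarrow> 'f::field) \<Rightarrow> 'i \<Rightarrow> ('i::finite, 'p, 'f) seed \<Rightarrow> 'f" where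
  "exchange_variable P \<iota> k = (\<lambda>(x, y, B).
     (\<iota> (y k) * (\<Prod>i\<in>UNIV. x i ^ nat (pos (B$i$k))) + (\<Prod>i\<in>UNIV. x i ^ nat (pos (- B$i$k))))
       / (\<iota> (splus P (y k) \<one>\<^bsub>P\<^esub>) * x k))"

definition seed_mutation ::
    "'p semifield \<Rightarrow> ('p \<Rightarrow> 'f::field) \<Rightarrow> 'i \<Rightarrow> ('i::finite, 'p, 'f) seed \<Rightarrow> ('i, 'p, 'f) seed" where
  "seed_mutation P \<iota> k = (\<lambda>(x, y, B).
     (x(k := exchange_variable P \<iota> k (x, y, B)), coeff_mutation P k y B, matrix_mutation k B))"

inductive_set mutation_class ::
    "'p semifield \<Rightarrow> ('p \<Rightarrow> 'f::field) \<Rightarrow> ('i::finite, 'p, 'f) seed \<Rightarrow> ('i, 'p, 'f) seed set"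
  for P \<iota> s0 where
  initial: "s0 \<in> mutation_class P \<iota> s0"
| mutate: "s \<in> mutation_class P \<iota> s0 \<Longrightarrow> seed_mutation P \<iota> k s \<in> mutation_class P \<iota> s0"

text \<open>An exchange relation \<open>z z' = q\<^sub>1 M\<^sub>1 + q\<^sub>2 M\<^sub>2\<close> with \<open>q\<^sub>1, q\<^sub>2\<close> in \<open>P\<close> and products \<open>M\<^sub>1, M\<^sub>2\<close> of
  cluster variables is recorded as the formal object \<open>({#z, z'#}, {#(q\<^sub>1, M\<^sub>1), (q\<^sub>2, M\<^sub>2)#})\<close>, where each
  product is kept as the multiset of its factors. Neither the two factors on the left nor the two
  terms on the right are ordered: a mutation and the inverse mutation give the same relation.\<close>

type_synonym ('p, 'f) exch_rel = "'f multiset \<times> ('p \<times> 'f multiset) multiset"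

definition exchange_relation ::
    "'p semifield \<Rightarrow> ('p \<Rightarrow> 'f::field) \<Rightarrow> 'i \<Rightarrow> ('i::finite, 'p, 'f) seed \<Rightarrow> ('p, 'f) exch_rel" where
  "exchange_relation P \<iota> k = (\<lambda>(x, y, B).
     ({# x k, exchange_variable P \<iota> k (x, y, B) #},
      {# (y k \<otimes>\<^bsub>P\<^esub> inv\<^bsub>P\<^esub> (splus P (y k) \<one>\<^bsub>P\<^esub>),
            \<Sum>i\<in>UNIV. replicate_mset (nat (pos (B$i$k))) (x i)),
         (inv\<^bsub>P\<^esub> (splus P (y k) \<one>\<^bsub>P\<^esub>),
            \<Sum>i\<in>UNIV. replicate_mset (nat (pos (- B$i$k))) (x i)) #}))"

definition primitive :: "('p, 'f) exch_rel \<Rightarrow> bool" where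
  "primitive R \<longleftrightarrow> (\<exists>q. (q, {#}) \<in># snd R)"


section \<open>Cluster algebras\<close>

text \<open>The field \<open>ambient\<close> is a subfield of the type \<open>'f\<close>, which only serves as a universe.\<close>

record ('i, 'p, 'f) cluster_algebra =
  coeff_semifield :: "'p semifield"
  coeff_emb :: "'p \<Rightarrow> 'f"
  ambient :: "'f set"
  initial_seed :: "('i::finite, 'p, 'f) seed"
  elements :: "'f set"

definition seeds :: "('i::finite, 'p, 'f::field) cluster_algebra \<Rightarrow> ('i, 'p, 'f) seed set" where
  "seeds \<A> = mutation_class (coeff_semifield \<A>) (coeff_emb \<A>) (initial_seed \<A>)"

definition cluster_variables :: "('i::finite, 'p, 'f::field) cluster_algebra \<Rightarrow> 'f set" where
  "cluster_variables \<A> = {x i | x y B i. (x, y, B) \<in> seeds \<A>}"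

definition exchange_relations ::
    "('i::finite, 'p, 'f::field) cluster_algebra \<Rightarrow> ('p, 'f) exch_rel set" where
  "exchange_relations \<A> =
     {exchange_relation (coeff_semifield \<A>) (coeff_emb \<A>) k s | k s. s \<in> seeds \<A>}"

text \<open>Subalgebra over the subring \<open>R\<close>, generated by \<open>X\<close>.\<close>

inductive_set generated_subalgebra :: "'f::field set \<Rightarrow> 'f set \<Rightarrow> 'f set" for R X where
  scalar: "r \<in> R \<Longrightarrow> r \<in> generated_subalgebra R X"
| generator: "z \<in> X \<Longrightarrow> z \<in> generated_subalgebra R X"
| add: "a \<in> generated_subalgebra R X \<Longrightarrow> b \<in> generated_subalgebra R X \<Longrightarrow>
          a + b \<in> generated_subalgebra R X"
| mult: "a \<in> generated_subalgebra R X \<Longrightarrow> b \<in> generated_subalgebra R X \<Longrightarrow>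
          a * b \<in> generated_subalgebra R X"

definition is_cluster_algebra :: "('i::finite, 'p, 'f::field) cluster_algebra \<Rightarrow> bool" where
  "is_cluster_algebra \<A> \<longleftrightarrow>
     is_semifield (coeff_semifield \<A>) \<and>
     coeff_embedding (coeff_semifield \<A>) (coeff_emb \<A>) \<and>
     is_seed (coeff_semifield \<A>) (coeff_emb \<A>) (ambient \<A>) (initial_seed \<A>) \<and>
     elements \<A> =
       generated_subalgebra (group_ring (coeff_semifield \<A>) (coeff_emb \<A>)) (cluster_variables \<A>)"

definition geometric_type :: "('i::finite, 'j \<Rightarrow>\<^sub>0 int, 'f::field) cluster_algebra \<Rightarrow> bool" where
  "geometric_type \<A> \<longleftrightarrow> (\<exists>J. coeff_semifield \<A> = Trop J)"

text \<open>Rational functions over the rationals in countably many variables. Every field of rational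
  functions in finitely many variables over the fraction field of the group ring of \<open>Trop J\<close>, with \<open>J\<close>
  finite, is isomorphic to a subfield of this type; so it is a large enough universe for the ambient
  fields of cluster algebras of geometric type with finite \<open>J\<close>.\<close>

type_synonym ratfun = "((nat \<Rightarrow>\<^sub>0 nat) \<Rightarrow>\<^sub>0 int) fract"

end

(* Order the pairs (i, m) with 0 <= m <= h(i) by m first and then by the position of s_i in c. They
   spell a word Q whose subword complex, with facets the complements of the reduced words of the
   longest element, models the cluster complex; the pair (i, m) carries the weight c^m omega_i.
   A facet I has a basis of roots, and flipping a position of I changes the exchange matrix
   (pairings of these roots, with signs given by the order of the positions) and the exponents of
   the coefficients by the mutation rules. The signs needed for this are read off from the links of
   codimension two, where everything happens in a rank two root system.

   Each position that is not initial is the only descent of exactly one facet, and the exchange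
   relation there defines its variable. All other exchange relations follow by induction from the
   polygons of the rank two links, that is, from the periodicity in types A1 x A1, A2, B2 and G2.
   Setting the coefficients p[omega_i] to 0 turns x[gamma] into the monomial with exponent vector
   gamma, so distinct labels have distinct variables.

   With F(l, m) the pairing of (1 - c) l and m, the compatibility degree of the weights gamma and
   delta at two positions is -F(l, m) / d, where l and m are the weights at the smaller and at the
   larger position and d is half the squared length of the roots belonging to gamma. A relation is
   primitive precisely if the two exchanged weights are gamma and -gamma, or gamma and c gamma. *)
theory Submission
  imports Defs "HOL-Analysis.Analysis"
begin

section \<open>Roots and weights\<close>

text \<open>A variable must depend on its weight alone although many seeds lead to it. A relation at
  a facet with several descents is therefore deduced from relations at facets with a smaller sum of
  positions, by walking around the polygon of the facets that share all but two positions. Divisions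
  are harmless because all variables are rational functions with a positive value at the point with
  all coordinates 1.

  Weights and roots are linked by \<open>G\<close>, the lift of 1 - c to a map from weights to
  roots: it takes the weight of a position to the root of that position in Q. So F is an Euler form,
  F l (c m) = - F m l. It is nonpositive on positions in increasing order and triangular on a facet,
  whose weights are dual to its roots. A vanishing sum of nonpositive numbers has vanishing terms;
  this locates the positions of a rank two link. The orbits of c differ in length, so Q omits
  letters of the periodic word c c c ...; they can be omitted because certain pairings are both
  nonnegative and nonpositive.\<close>

lemma axis_1_nth [simp]: "(axis i (1::int)) $ j = (if i = j then 1 else 0)"
  by (simp add: axis_def)

lemma matrix_vector_mult_scale:
  fixes A :: "'a::comm_semiring_1^'m^'n"
  shows "A *v (k *s x) = k *s (A *v x)"
  by (simp add: vec_eq_iff matrix_vector_mult_def sum_distrib_left ac_simps)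

lemma matrix_vector_mult_axis:
  fixes A :: "int^'m^'n"
  shows "A *v axis i 1 = column i A"
proof -
  have "(\<Sum>k\<in>UNIV. A$j$k * axis i 1 $ k) = (\<Sum>k\<in>UNIV. if k = i then A$j$i else 0)" for j
    by (intro sum.cong) auto
  then show ?thesis by (simp add: matrix_vector_mult_def column_def)
qed

text \<open>The symmetrizer is part of the data: \<open>d i\<close> is half the squared length of
  the i-th simple root, which keeps all pairings integral.\<close>

locale cartan =
  fixes A :: "int^'i^'i" and d :: "'i \<Rightarrow> int"
  assumes diag [simp]: "A$i$i = 2"
    and off_diag: "i \<noteq> j \<Longrightarrow> A$i$j \<le> 0"
    and zero_sym: "A$i$j = 0 \<longleftrightarrow> A$j$i = 0"
    and d_pos: "d i > 0"
    and symmetrizes: "d i * A$i$j = d j * A$j$i"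
    and form_pos: "\<And>v :: 'i \<Rightarrow> real. (\<exists>i. v i \<noteq> 0) \<Longrightarrow>
          (\<Sum>i\<in>UNIV. \<Sum>j\<in>UNIV. v i * real_of_int (d i * A$i$j) * v j) > 0"
begin

text \<open>Roots are written in the basis of simple roots and weights in the basis of fundamental
  weights; then \<open>(*v) A\<close> is the inclusion of the root lattice into the weight lattice, and \<open>pr\<close> is
  the invariant pairing between them.\<close>

definition sr :: "'i \<Rightarrow> int^'i \<Rightarrow> int^'i" where
  "sr i v = v - (A *v v)$i *s axis i 1"

definition pr :: "int^'i \<Rightarrow> int^'i \<Rightarrow> int" where
  "pr v l = (\<Sum>i\<in>UNIV. d i * v$i * l$i)"

definition bf :: "int^'i \<Rightarrow> int^'i \<Rightarrow> int" where
  "bf u v = pr u (A *v v)"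

abbreviation sw :: "'i \<Rightarrow> int^'i \<Rightarrow> int^'i" where
  "sw \<equiv> simple_refl A"

text \<open>A word acts on both lattices. \<open>A\<close> intertwines the two actions
  (\<open>A_rw\<close>), and the pairing is invariant under them (\<open>pr_rw_ww\<close>).\<close>

definition rw :: "'i list \<Rightarrow> int^'i \<Rightarrow> int^'i" where "rw w v = foldr sr w v"
definition ww :: "'i list \<Rightarrow> int^'i \<Rightarrow> int^'i" where "ww w l = foldr sw w l"

lemma rw_simps [simp]: "rw [] v = v" "rw (i # w) v = sr i (rw w v)" "rw (w @ w') v = rw w (rw w' v)"
  by (simp_all add: rw_def)

lemma ww_simps [simp]: "ww [] v = v" "ww (i # w) v = sw i (ww w v)" "ww (w @ w') v = ww w (ww w' v)"
  by (simp_all add: ww_def)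

lemma word_prod_ww: "word_prod A w = ww w"
  by (induction w) (auto simp: word_prod_def fun_eq_iff)

lemma sw_eq: "sw i l = l - l$i *s (A *v axis i 1)"
  by (simp add: simple_refl_def simple_root_def matrix_vector_mult_axis)

lemma A_axis_nth: "(A *v axis i 1)$j = A$j$i"
  by (simp add: matrix_vector_mult_axis column_def)

lemma A_sr: "A *v sr i v = sw i (A *v v)"
  by (simp add: sr_def sw_eq matrix_vector_mult_diff_distrib matrix_vector_mult_scale)

lemma A_rw: "A *v rw w v = ww w (A *v v)"
  by (induction w) (auto simp: A_sr)

lemma pr_add_left: "pr (u + v) l = pr u l + pr v l"
  and pr_diff_left: "pr (u - v) l = pr u l - pr v l"
  and pr_minus_left: "pr (- u) l = - pr u l"
  and pr_scale_left: "pr (k *s u) l = k * pr u l"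
  and pr_add_right: "pr u (l + m) = pr u l + pr u m"
  and pr_diff_right: "pr u (l - m) = pr u l - pr u m"
  and pr_minus_right: "pr u (- l) = - pr u l"
  and pr_scale_right: "pr u (k *s l) = k * pr u l"
  and pr_zero_left: "pr 0 l = 0"
  and pr_zero_right: "pr u 0 = 0"
  by (simp_all add: pr_def algebra_simps sum.distrib sum_subtractf sum_negf sum_distrib_left)

lemmas pr_simps = pr_add_left pr_diff_left pr_minus_left pr_scale_left
  pr_add_right pr_diff_right pr_minus_right pr_scale_right pr_zero_left pr_zero_right

lemma pr_sum_left: "pr (\<Sum>x\<in>S. g x) l = (\<Sum>x\<in>S. pr (g x) l)"
  by (induction S rule: infinite_finite_induct) (auto simp: pr_simps)

lemma pr_sum_right: "pr u (\<Sum>x\<in>S. g x) = (\<Sum>x\<in>S. pr u (g x))"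
  by (induction S rule: infinite_finite_induct) (auto simp: pr_simps)

lemma pr_axis_left: "pr (axis i 1) l = d i * l$i"
proof -
  have "(\<Sum>k\<in>UNIV. d k * (axis i 1 :: int^'i)$k * l$k) = (\<Sum>k\<in>UNIV. if k = i then d i * l$i else 0)"
    by (intro sum.cong) auto
  then show ?thesis by (simp add: pr_def)
qed

lemma pr_axis_right: "pr v (axis i 1) = d i * v$i"
proof -
  have "(\<Sum>k\<in>UNIV. d k * v$k * (axis i 1 :: int^'i)$k) = (\<Sum>k\<in>UNIV. if k = i then d i * v$i else 0)"
    by (intro sum.cong) auto
  then show ?thesis by (simp add: pr_def)
qed

lemma pr_right_eqI:
  assumes "\<And>v. pr v l = pr v m" shows "l = m"
proof -
  have "l$i = m$i" for i
    using assms[of "axis i 1"] d_pos[of i] by (simp add: pr_axis_left)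
  then show ?thesis by (simp add: vec_eq_iff)
qed

lemma pr_left_eqI:
  assumes "\<And>l. pr u l = pr v l" shows "u = v"
proof -
  have "u$i = v$i" for i
    using assms[of "axis i 1"] d_pos[of i] by (simp add: pr_axis_right)
  then show ?thesis by (simp add: vec_eq_iff)
qed

lemma bf_sum: "bf u v = (\<Sum>i\<in>UNIV. \<Sum>j\<in>UNIV. u$i * (d i * A$i$j) * v$j)"
  by (simp add: bf_def pr_def matrix_vector_mult_def sum_distrib_left ac_simps)

lemma bf_sym: "bf u v = bf v u"
proof -
  have "bf u v = (\<Sum>j\<in>UNIV. \<Sum>i\<in>UNIV. u$i * (d i * A$i$j) * v$j)"
    unfolding bf_sum by (rule sum.swap)
  also have "\<dots> = bf v u"
    unfolding bf_sum by (intro sum.cong refl) (simp add: symmetrizes ac_simps)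
  finally show ?thesis .
qed

lemma bf_simps:
  "bf (u + v) x = bf u x + bf v x" "bf (u - v) x = bf u x - bf v x" "bf (- u) x = - bf u x"
  "bf (k *s u) x = k * bf u x"
  "bf x (u + v) = bf x u + bf x v" "bf x (u - v) = bf x u - bf x v" "bf x (- u) = - bf x u"
  "bf x (k *s u) = k * bf x u" "bf 0 x = 0" "bf x 0 = 0"
  using matrix_vector_mult_diff_distrib[of A 0 u]
  by (simp_all add: bf_def pr_simps matrix_vector_right_distrib matrix_vector_mult_diff_distrib
      matrix_vector_mult_scale)

lemma pr_A: "pr u (A *v v) = bf u v"
  by (simp add: bf_def)

lemma bf_axis: "bf (axis i 1) (axis j 1) = d i * A$i$j"
  by (simp add: bf_def pr_axis_left A_axis_nth)

lemma bf_pos: assumes "v \<noteq> 0" shows "bf v v > 0"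
proof -
  have "\<exists>i. real_of_int (v$i) \<noteq> 0" using assms by (auto simp: vec_eq_iff)
  from form_pos[OF this] have "real_of_int (bf v v) > 0"
    by (simp add: bf_sum)
  then show ?thesis by simp
qed

lemma A_inj: assumes "A *v u = A *v v" shows "u = v"
proof (rule ccontr)
  assume "u \<noteq> v"
  then have "bf (u - v) (u - v) > 0" using bf_pos[of "u - v"] by simp
  moreover have "A *v (u - v) = 0" using assms by (simp add: matrix_vector_mult_diff_distrib)
  ultimately show False by (simp add: bf_def pr_simps)
qed

lemma A_uminus: "A *v (- v) = - (A *v v)"
  using matrix_vector_mult_diff_distrib[of A 0 v] by simp

lemma pr_sr_sw: "pr (sr i v) (sw i l) = pr v l"
proof -
  have "pr v (A *v axis i 1) = d i * (A *v v)$i"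
    using bf_sym[of v "axis i 1"] by (simp add: bf_def pr_axis_left)
  then show ?thesis
    by (simp add: sr_def sw_eq pr_simps pr_axis_left A_axis_nth algebra_simps)
qed

lemma sr_sr [simp]: "sr i (sr i v) = v"
  by (simp add: vec_eq_iff sr_def matrix_vector_mult_diff_distrib matrix_vector_mult_scale A_axis_nth)

lemma sw_sw [simp]: "sw i (sw i v) = v"
  by (simp add: vec_eq_iff sw_eq A_axis_nth algebra_simps)

lemma rw_rev [simp]: "rw (rev w) (rw w v) = v" "rw w (rw (rev w) v) = v"
  by (induction w arbitrary: v) auto

lemma ww_rev [simp]: "ww (rev w) (ww w v) = v" "ww w (ww (rev w) v) = v"
  by (induction w arbitrary: v) auto

lemma pr_rw_ww: "pr (rw w v) (ww w l) = pr v l"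
  by (induction w) (auto simp: pr_sr_sw)

lemma pr_rw: "pr (rw w v) l = pr v (ww (rev w) l)"
  using pr_rw_ww[of w v "ww (rev w) l"] by simp

lemma pr_ww: "pr v (ww w l) = pr (rw (rev w) v) l"
  using pr_rw_ww[of w "rw (rev w) v" l] by simp

lemma bf_rw: "bf (rw w u) (rw w v) = bf u v"
  by (simp add: bf_def A_rw pr_rw_ww)

lemma sr_axis [simp]: "sr i (axis i 1) = - axis i 1"
  by (simp add: vec_eq_iff sr_def A_axis_nth)

lemma sr_linear: "sr i (u + v) = sr i u + sr i v" "sr i (u - v) = sr i u - sr i v"
  "sr i (- u) = - sr i u" "sr i (k *s u) = k *s sr i u" "sr i 0 = 0"
  by (simp_all add: vec_eq_iff sr_def matrix_vector_right_distrib matrix_vector_mult_diff_distrib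
      matrix_vector_mult_scale A_uminus algebra_simps)

lemma sw_linear: "sw i (u + v) = sw i u + sw i v" "sw i (u - v) = sw i u - sw i v"
  "sw i (- u) = - sw i u" "sw i (k *s u) = k *s sw i u" "sw i 0 = 0"
  by (simp_all add: vec_eq_iff sw_eq algebra_simps)

lemma rw_linear: "rw w (u + v) = rw w u + rw w v" "rw w (u - v) = rw w u - rw w v"
  "rw w (- u) = - rw w u" "rw w (k *s u) = k *s rw w u" "rw w 0 = 0"
  by (induction w) (auto simp: sr_linear)

lemma ww_linear: "ww w (u + v) = ww w u + ww w v" "ww w (u - v) = ww w u - ww w v"
  "ww w (- u) = - ww w u" "ww w (k *s u) = k *s ww w u" "ww w 0 = 0"
  by (induction w) (auto simp: sw_linear)

lemma ww_sum: "ww w (\<Sum>x\<in>S. g x) = (\<Sum>x\<in>S. ww w (g x))"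
  by (induction S rule: infinite_finite_induct) (auto simp: ww_linear)

text \<open>Towards weights by adjointness for the nondegenerate pairing, towards roots by
  restriction along the injective \<open>A\<close>.\<close>

lemma rw_eq_iff_ww_eq: "rw w = rw w' \<longleftrightarrow> ww w = ww w'"
proof
  assume eq: "rw w = rw w'"
  have "rw (rev w) v = rw (rev w') v" for v
    using rw_rev(1)[of w "rw (rev w') v"] by (simp add: eq)
  then show "ww w = ww w'"
    by (intro ext pr_right_eqI) (simp add: pr_ww)
next
  assume eq: "ww w = ww w'"
  have "A *v rw w v = A *v rw w' v" for v by (simp add: A_rw eq)
  then show "rw w = rw w'" using A_inj by blast
qed

section \<open>The root system, coroots and reflections\<close>

definition roots :: "(int^'i) set" where
  "roots = {rw w (axis i 1) | w i. True}"

definition vp :: "int^'i \<Rightarrow> bool" where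
  "vp v \<longleftrightarrow> (\<forall>i. 0 \<le> v$i)"

lemma axis_roots [simp]: "axis i 1 \<in> roots"
  unfolding roots_def by (auto intro!: exI[of _ "[]"])

lemma rw_roots [simp]: "v \<in> roots \<Longrightarrow> rw w v \<in> roots"
  unfolding roots_def using rw_simps(3) by (smt (verit) mem_Collect_eq)

lemma sr_roots [simp]: "v \<in> roots \<Longrightarrow> sr i v \<in> roots"
  using rw_roots[of v "[i]"] by simp

lemma uminus_roots [simp]: "v \<in> roots \<Longrightarrow> - v \<in> roots"
proof -
  assume "v \<in> roots"
  then obtain w i where "v = rw w (axis i 1)" unfolding roots_def by auto
  then have "- v = rw (w @ [i]) (axis i 1)" by (simp add: rw_linear)
  then show ?thesis unfolding roots_def by blast
qed

lemma roots_nonzero: assumes "v \<in> roots" shows "v \<noteq> 0"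
proof
  assume "v = 0"
  then obtain w i where "0 = rw w (axis i 1)" using assms by (auto simp: roots_def)
  then have "rw (rev w) 0 = axis i 1" by (metis rw_rev(1))
  then show False by (auto simp: rw_linear vec_eq_iff split: if_splits)
qed

text \<open>Half the squared length; the division is exact on roots
  (\<open>bf_root\<close>).\<close>

definition dd :: "int^'i \<Rightarrow> int" where
  "dd v = bf v v div 2"

text \<open>The value of the coroot of v on the weight l; the quotient is exact on roots
  (\<open>dd_dvd\<close>).\<close>

definition cp :: "int^'i \<Rightarrow> int^'i \<Rightarrow> int" where
  "cp v l = pr v l div dd v"

lemma dd_rw [simp]: "dd (rw w v) = dd v"
  by (simp add: dd_def bf_rw)

lemma dd_axis [simp]: "dd (axis i 1) = d i"
  by (simp add: dd_def bf_axis)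

lemma dd_uminus [simp]: "dd (- v) = dd v"
  by (simp add: dd_def bf_simps)

lemma bf_root: "v \<in> roots \<Longrightarrow> bf v v = 2 * dd v"
  unfolding roots_def by (auto simp: bf_rw bf_axis)

lemma dd_pos: "v \<in> roots \<Longrightarrow> dd v > 0"
  unfolding roots_def by (auto simp: d_pos)

lemma dd_dvd: "v \<in> roots \<Longrightarrow> dd v dvd pr v l"
  unfolding roots_def by (auto simp: pr_rw pr_axis_left)

lemma pr_cp: "v \<in> roots \<Longrightarrow> pr v l = dd v * cp v l"
  by (simp add: cp_def dd_dvd)

lemma cp_unique: "v \<in> roots \<Longrightarrow> pr v l = dd v * k \<Longrightarrow> cp v l = k"
  using pr_cp[of v l] dd_pos[of v] by simp

lemma cp_self: "v \<in> roots \<Longrightarrow> cp v (A *v v) = 2"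
  by (rule cp_unique) (auto simp: pr_A bf_root)

lemma cp_axis: "cp (axis i 1) l = l$i"
  by (rule cp_unique) (auto simp: pr_axis_left)

lemma cp_linear:
  assumes "v \<in> roots"
  shows "cp v (l + m) = cp v l + cp v m" "cp v (l - m) = cp v l - cp v m"
    "cp v (- l) = - cp v l" "cp v (k *s l) = k * cp v l" "cp v 0 = 0" "cp (- v) l = - cp v l"
  by (rule cp_unique; use assms in \<open>simp add: pr_simps pr_cp algebra_simps\<close>)+

lemma cp_sum: "v \<in> roots \<Longrightarrow> cp v (\<Sum>x\<in>S. g x) = (\<Sum>x\<in>S. cp v (g x))"
  by (induction S rule: infinite_finite_induct) (auto simp: cp_linear)

lemma cp_rw_ww: "v \<in> roots \<Longrightarrow> cp (rw w v) (ww w l) = cp v l"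
  by (rule cp_unique) (auto simp: pr_rw_ww pr_cp)

lemma cp_zero_sym: "u \<in> roots \<Longrightarrow> v \<in> roots \<Longrightarrow> cp u (A *v v) = 0 \<longleftrightarrow> bf u v = 0"
  using pr_cp[of u "A *v v"] dd_pos[of u] by (simp add: pr_A)

lemma bf_cp: "u \<in> roots \<Longrightarrow> bf u v = dd u * cp u (A *v v)"
  using pr_cp[of u "A *v v"] by (simp add: pr_A)

lemma cp_sign: "u \<in> roots \<Longrightarrow> (0 \<le> cp u (A *v v) \<longleftrightarrow> 0 \<le> bf u v) \<and> (cp u (A *v v) \<le> 0 \<longleftrightarrow> bf u v \<le> 0)"
  using bf_cp[of u v] dd_pos[of u] by (simp add: zero_le_mult_iff mult_le_0_iff)

definition refl :: "int^'i \<Rightarrow> int^'i \<Rightarrow> int^'i" where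
  "refl b v = v - cp b (A *v v) *s b"

definition wrefl :: "int^'i \<Rightarrow> int^'i \<Rightarrow> int^'i" where
  "wrefl b l = l - cp b l *s (A *v b)"

lemma A_refl: "A *v refl b v = wrefl b (A *v v)"
  by (simp add: refl_def wrefl_def matrix_vector_mult_diff_distrib matrix_vector_mult_scale)

lemma refl_axis: "refl (axis i 1) = sr i"
  by (simp add: fun_eq_iff refl_def sr_def cp_axis)

lemma wrefl_axis: "wrefl (axis i 1) = sw i"
  by (simp add: fun_eq_iff wrefl_def sw_eq cp_axis)

lemma rw_refl: "b \<in> roots \<Longrightarrow> rw w (refl b v) = refl (rw w b) (rw w v)"
  by (simp add: refl_def rw_linear A_rw cp_rw_ww)

lemma ww_wrefl: "b \<in> roots \<Longrightarrow> ww w (wrefl b v) = wrefl (rw w b) (ww w v)"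
  by (simp add: wrefl_def ww_linear A_rw cp_rw_ww)

text \<open>The reflection in w \<alpha>_i is w s_i w^-1, so the invariance properties of words pass
  to reflections in arbitrary roots.\<close>

lemma refl_word:
  assumes "b \<in> roots" obtains w where "refl b = rw w" "wrefl b = ww w"
proof -
  obtain w i where b: "b = rw w (axis i 1)" using assms unfolding roots_def by auto
  have 1: "refl b v = rw (w @ [i] @ rev w) v" for v
    using rw_refl[of "axis i 1" w "rw (rev w) v"] by (simp add: b refl_axis)
  have 2: "wrefl b v = ww (w @ [i] @ rev w) v" for v
    using ww_wrefl[of "axis i 1" w "ww (rev w) v"] by (simp add: b wrefl_axis)
  show ?thesis using 1 2 by (intro that[of "w @ [i] @ rev w"]) (auto simp: fun_eq_iff)
qed

lemma refl_roots [simp]: "b \<in> roots \<Longrightarrow> v \<in> roots \<Longrightarrow> refl b v \<in> roots"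
  by (metis refl_word rw_roots)

lemma pr_refl_wrefl: "b \<in> roots \<Longrightarrow> pr (refl b v) (wrefl b l) = pr v l"
  by (metis refl_word pr_rw_ww)

lemma refl_refl [simp]: "b \<in> roots \<Longrightarrow> refl b (refl b v) = v"
  by (simp add: refl_def cp_linear matrix_vector_mult_diff_distrib matrix_vector_mult_scale cp_self
      algebra_simps vec_eq_iff)

lemma wrefl_wrefl [simp]: "b \<in> roots \<Longrightarrow> wrefl b (wrefl b v) = v"
  by (simp add: wrefl_def cp_linear cp_self algebra_simps vec_eq_iff)

lemma refl_self [simp]: "b \<in> roots \<Longrightarrow> refl b b = - b"
  by (simp add: refl_def cp_self vec_eq_iff)

lemma refl_uminus: "b \<in> roots \<Longrightarrow> refl (- b) = refl b"
  by (simp add: fun_eq_iff refl_def cp_linear vec_eq_iff)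

lemma cp_refl: "b \<in> roots \<Longrightarrow> u \<in> roots \<Longrightarrow> cp (refl b u) (wrefl b l) = cp u l"
  by (metis refl_word cp_rw_ww)

text \<open>Write a root as \<open>u = x - y\<close> with \<open>x, y \<ge> 0\<close> of disjoint support. The divisibility
  \<open>dd u dvd d i * u $ i\<close> makes the squared lengths of \<open>x\<close> and \<open>y\<close> multiples of that of \<open>u\<close>, and
  \<open>bf x y \<le> 0\<close>; so \<open>x\<close> or \<open>y\<close> vanishes.\<close>

lemma dvd_bf_self:
  assumes "\<And>i. D dvd d i * x$i"
  shows "2 * D dvd bf x x"
proof -
  define g where "g i j = x$i * (d i * A$i$j) * x$j" for i j
  have gsym: "g i j = g j i" for i j
    using symmetrizes[of i j] by (simp add: g_def)
  have gD: "D dvd g i j" for i j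
  proof -
    have "g i j = (d i * x$i) * (A$i$j * x$j)" by (simp add: g_def)
    then show ?thesis using assms[of i] by simp
  qed
  have gd: "2 * D dvd g i i" for i
  proof -
    have "g i i = 2 * (d i * x$i) * x$i" by (simp add: g_def)
    then show ?thesis using assms[of i] by (simp add: mult_dvd_mono)
  qed
  \<comment> \<open>Off-diagonal terms come in equal pairs and diagonal terms carry the 2 of the
    Cartan matrix; either way D is doubled.\<close>
  have "2 * D dvd (\<Sum>i\<in>S. \<Sum>j\<in>S. g i j)" if "finite S" for S
    using that
  proof induction
    case (insert a S)
    have "(\<Sum>i\<in>insert a S. \<Sum>j\<in>insert a S. g i j) =
        g a a + 2 * (\<Sum>j\<in>S. g a j) + (\<Sum>i\<in>S. \<Sum>j\<in>S. g i j)"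
      using insert.hyps gsym by (simp add: sum.distrib)
    moreover have "2 * D dvd 2 * (\<Sum>j\<in>S. g a j)"
      using gD by (intro mult_dvd_mono dvd_sum) auto
    ultimately show ?case using gd[of a] insert.IH by (metis dvd_add)
  qed simp
  then show ?thesis by (simp add: bf_sum g_def)
qed

lemma root_dvd: "v \<in> roots \<Longrightarrow> dd v dvd d i * v$i"
  using dd_dvd[of v "axis i 1"] by (simp add: pr_axis_right)

lemma root_cases:
  assumes "u \<in> roots" shows "vp u \<or> vp (- u)"
proof (rule ccontr)
  assume neg: "\<not> ?thesis"
  define x where "x = (\<chi> i. max (u$i) 0)"
  define y where "y = (\<chi> i. max (- u$i) 0)"
  have u: "u = x - y" by (simp add: x_def y_def vec_eq_iff max_def)
  obtain i j where "u$i < 0" "- u$j < 0" using neg by (auto simp: vp_def not_le)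
  then have "y$i \<noteq> 0" "x$j \<noteq> 0" by (auto simp: x_def y_def)
  then have x0: "x \<noteq> 0" "y \<noteq> 0" by auto
  have dx: "dd u dvd d i * x$i" "dd u dvd d i * y$i" for i
    using root_dvd[OF assms, of i] by (auto simp: x_def y_def max_def)
  have "2 * dd u \<le> bf x x" "2 * dd u \<le> bf y y"
    using dvd_bf_self[of "dd u" x] dvd_bf_self[of "dd u" y] dx bf_pos[of x] bf_pos[of y] x0
    by (auto intro!: zdvd_imp_le)
  moreover have "bf x y \<le> 0"
    unfolding bf_sum
  proof (intro sum_nonpos)
    fix i j
    show "x$i * (d i * A$i$j) * y$j \<le> 0"
    proof (cases "i = j")
      case False
      then have "A$i$j \<le> 0" by (rule off_diag)
      then have "d i * A$i$j \<le> 0" using d_pos[of i] by (simp add: mult_le_0_iff)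
      moreover have "x$i \<ge> 0" "y$j \<ge> 0" by (auto simp: x_def y_def)
      ultimately show ?thesis by (simp add: mult_le_0_iff zero_le_mult_iff)
    qed (auto simp: x_def y_def max_def)
  qed
  \<comment> \<open>With both parts nonzero the right-hand side is at least 4 \<open>dd u\<close>,
    while the left-hand side is 2 \<open>dd u\<close>.\<close>
  moreover have "bf u u = bf x x + bf y y - 2 * bf x y"
    using bf_sym[of x y] by (simp add: u bf_simps)
  ultimately show False using bf_root[OF assms] dd_pos[OF assms] by simp
qed

lemma vp_not_uminus: "v \<in> roots \<Longrightarrow> vp v \<Longrightarrow> \<not> vp (- v)"
  using roots_nonzero[of v] by (auto simp: vp_def vec_eq_iff) (metis dual_order.antisym)

lemma not_vp_iff: "v \<in> roots \<Longrightarrow> \<not> vp v \<longleftrightarrow> vp (- v)"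
  using root_cases[of v] vp_not_uminus[of v] by auto

lemma vp_axis [simp]: "vp (axis i 1)"
  by (simp add: vp_def)

lemma vp_add: "vp u \<Longrightarrow> vp v \<Longrightarrow> vp (u + v)"
  by (simp add: vp_def)

lemma vp_scale: "vp u \<Longrightarrow> 0 \<le> k \<Longrightarrow> vp (k *s u)"
  by (simp add: vp_def)

lemma vp_pos_coord: "v \<in> roots \<Longrightarrow> v$i > 0 \<Longrightarrow> vp v"
  using root_cases[of v] by (auto simp: vp_def) (metis leD)

text \<open>If v = m \<alpha>_i, then \<open>dd v\<close> = d_i m^2 must divide d_i m, which forces
  m = 1: the root system is reduced.\<close>

lemma root_multiple_axis:
  assumes "v \<in> roots" "vp v" "\<And>j. j \<noteq> i \<Longrightarrow> v$j = 0"
  shows "v = axis i 1"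
proof -
  define m where "m = v$i"
  have v: "v = m *s axis i 1" using assms(3) by (auto simp: vec_eq_iff m_def)
  have "m \<ge> 0" using assms(2) by (simp add: m_def vp_def)
  moreover have "m \<noteq> 0"
    using roots_nonzero[OF assms(1)] v by (metis vector_smult_lzero)
  ultimately have m: "m > 0" by simp
  have "bf v v = m * m * (2 * d i)"
    by (subst (1 2) v) (simp only: bf_simps bf_axis diag ac_simps)
  then have "dd v = (d i * m) * m"
    using bf_root[OF assms(1)] by simp
  moreover have "dd v dvd d i * m" using root_dvd[OF assms(1), of i] by (simp only: m_def)
  ultimately have "(d i * m) * m dvd (d i * m) * 1" by simp
  then have "m dvd 1" using m d_pos[of i] by (subst (asm) dvd_mult_cancel_left) auto
  then have "m = 1" using m by simp
  then show ?thesis using v by simp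
qed

text \<open>A simple reflection changes one coordinate only, so another positive coordinate survives
  and fixes the sign.\<close>

lemma vp_sr:
  assumes "v \<in> roots" "vp v" "v \<noteq> axis i 1" shows "vp (sr i v)"
proof -
  obtain j where j: "j \<noteq> i" "v$j \<noteq> 0" using root_multiple_axis[OF assms(1,2)] assms(3) by metis
  then have "v$j > 0" using assms(2) by (simp add: vp_def less_le)
  then have "sr i v$j > 0" using j by (auto simp: sr_def)
  then show ?thesis using vp_pos_coord[of "sr i v" j] assms by simp
qed

lemma sr_sign_change:
  assumes "v \<in> roots" "vp v" "\<not> vp (sr i v)" shows "v = axis i 1"
  using vp_sr assms by blast

text \<open>Simple roots are extreme in the cone of positive roots. This is what turns sign patterns
  in a rank two link into contradictions.\<close>

lemma indecomposable_axis:
  assumes "u \<in> roots" "v \<in> roots" "vp u" "vp v" "x > 0" "y > 0" "z > 0"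
    and eq: "z *s axis i 1 = x *s u + y *s v"
  shows "u = axis i 1" "v = axis i 1"
proof -
  have nn: "u$j \<ge> 0" "v$j \<ge> 0" for j using assms(3,4) by (auto simp: vp_def)
  have *: "u$j = 0 \<and> v$j = 0" if "j \<noteq> i" for j
  proof -
    have "0 = x * u$j + y * v$j"
      using arg_cong[OF eq, of "\<lambda>v. v$j"] that by simp
    moreover have "x * u$j \<ge> 0" "y * v$j \<ge> 0" using nn[of j] assms by auto
    ultimately have "x * u$j = 0" "y * v$j = 0" by linarith+
    then show ?thesis using assms by auto
  qed
  show "u = axis i 1" using * by (intro root_multiple_axis assms) blast
  show "v = axis i 1" using * by (intro root_multiple_axis assms) blast
qed

section \<open>Finiteness of the root system\<close>

lemma finite_bounded_vectors: "finite {v :: int^'i. \<forall>i. \<bar>v$i\<bar> \<le> B}"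
proof -
  have "{v :: int^'i. \<forall>i. \<bar>v$i\<bar> \<le> B} \<subseteq> vec_lambda ` (\<Pi>\<^sub>E i\<in>UNIV. {-B..B})"
  proof
    fix v :: "int^'i" assume "v \<in> {v. \<forall>i. \<bar>v$i\<bar> \<le> B}"
    then have "-B \<le> v$i \<and> v$i \<le> B" for i by (simp add: abs_le_iff) (metis minus_le_iff)
    then have "vec_nth v \<in> (\<Pi>\<^sub>E i\<in>UNIV. {-B..B})" by auto
    then show "v \<in> vec_lambda ` (\<Pi>\<^sub>E i\<in>UNIV. {-B..B})"
      by (metis imageI vec_lambda_eta)
  qed
  then show ?thesis by (rule finite_subset) (auto intro!: finite_imageI finite_PiE)
qed

text \<open>On the unit sphere the real form has a positive minimum, so it bounds the norm; on roots
  its values are bounded by the finitely many numbers 2 \<open>d i\<close>.\<close>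

lemma finite_roots: "finite roots"
proof -
  define q where "q x = (\<Sum>i\<in>UNIV. \<Sum>j\<in>UNIV. x$i * real_of_int (d i * A$i$j) * x$j)" for x :: "real^'i"
  have "continuous_on (sphere 0 1) q"
    unfolding q_def by (intro continuous_intros)
  moreover have "axis undefined 1 \<in> sphere (0 :: real^'i) 1" by (simp add: norm_axis_1)
  ultimately obtain x0 where x0: "x0 \<in> sphere 0 1" "\<And>y. y \<in> sphere 0 1 \<Longrightarrow> q x0 \<le> q y"
    using continuous_attains_inf[of "sphere 0 1" q] by (metis compact_sphere empty_iff)
  have "x0 \<noteq> 0" using x0 by auto
  then have m: "q x0 > 0" unfolding q_def by (intro form_pos) (auto simp: vec_eq_iff)
  have scale: "q (r *\<^sub>R x) = r\<^sup>2 * q x" for r x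
    by (simp add: q_def sum_distrib_left power2_eq_square ac_simps)
  have low: "q x0 * (norm x)\<^sup>2 \<le> q x" for x
  proof (cases "x = 0")
    case False
    then have "q x0 \<le> q (inverse (norm x) *\<^sub>R x)" by (intro x0) simp
    then show ?thesis using False by (simp add: scale power_inverse field_simps)
  qed (simp add: q_def)
  define M where "M = Max (range d)"
  have M: "d i \<le> M" for i by (simp add: M_def)
  define B where "B = \<lceil>2 * real_of_int M / q x0\<rceil> + 1"
  have "roots \<subseteq> {v. \<forall>i. \<bar>v$i\<bar> \<le> B}"
  proof safe
    fix v i assume v: "v \<in> roots"
    define x where "x = (\<chi> i. real_of_int (v$i))"
    have "q x = real_of_int (bf v v)" by (simp add: q_def x_def bf_sum)
    also have "bf v v = 2 * dd v" using v by (rule bf_root)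
    also have "dd v \<le> M" using v M unfolding roots_def by auto
    finally have "q x \<le> 2 * real_of_int M" by simp
    with low[of x] have "(norm x)\<^sup>2 \<le> 2 * real_of_int M / q x0" using m by (simp add: field_simps)
    moreover have "\<bar>x$i\<bar> \<le> norm x" by (rule component_le_norm_cart)
    then have "\<bar>x$i\<bar>\<^sup>2 \<le> (norm x)\<^sup>2" by (intro power_mono) auto
    ultimately have "(real_of_int \<bar>v$i\<bar>)\<^sup>2 \<le> 2 * real_of_int M / q x0"
      by (simp add: x_def)
    moreover have "real_of_int \<bar>v$i\<bar> \<le> (real_of_int \<bar>v$i\<bar>)\<^sup>2"
    proof -
      have "k \<le> k\<^sup>2" if "0 \<le> k" for k :: int
        using mult_left_mono[of 1 k k] that by (cases "k = 0") (auto simp: power2_eq_square)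
      from this[of "\<bar>v$i\<bar>"] have "real_of_int \<bar>v$i\<bar> \<le> real_of_int (\<bar>v$i\<bar>\<^sup>2)"
        by (simp only: of_int_le_iff abs_ge_zero)
      then show ?thesis by simp
    qed
    ultimately have "real_of_int \<bar>v$i\<bar> \<le> real_of_int B" unfolding B_def by linarith
    then show "\<bar>v$i\<bar> \<le> B" by linarith
  qed
  then show ?thesis by (rule finite_subset) (rule finite_bounded_vectors)
qed

definition proots :: "(int^'i) set" where
  "proots = {v \<in> roots. vp v}"

lemma finite_proots: "finite proots"
  using finite_roots by (simp add: proots_def)

end

section \<open>Subwords\<close>

context cartan
begin

text \<open>The lift of 1 - w to a map from the weight lattice to the root lattice: l - w l always
  lies in the root lattice (\<open>A_Gw\<close>).\<close>

primrec Gw :: "'i list \<Rightarrow> int^'i \<Rightarrow> int^'i" where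
  "Gw [] l = 0"
| "Gw (i # w) l = l$i *s axis i 1 + sr i (Gw w l)"

lemma A_Gw: "A *v Gw w l = l - ww w l"
  by (induction w) (simp_all add: matrix_vector_right_distrib matrix_vector_mult_scale A_sr sw_linear
      sw_eq[of _ l])

lemma pr_Gw_ww: "pr (Gw w l) (ww w m) = - pr (Gw w m) l"
proof (induction w)
  case (Cons i w)
  have 1: "pr (Gw w m) (A *v axis i 1) = d i * (m$i - (ww w m)$i)"
    using bf_sym[of "Gw w m" "axis i 1"] by (simp add: bf_def pr_axis_left A_Gw)
  have 2: "pr (sr i (Gw w l)) (sw i (ww w m)) = pr (Gw w l) (ww w m)" by (rule pr_sr_sw)
  have 3: "pr (sr i (Gw w m)) l = pr (Gw w m) (sw i l)"
    using pr_sr_sw[of i "Gw w m" "sw i l"] by simp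
  have 4: "(sw i (ww w m))$i = - (ww w m)$i" by (simp add: sw_eq A_axis_nth)
  have "pr (Gw (i # w) l) (ww (i # w) m) = - (l$i * (d i * (ww w m)$i)) - pr (Gw w m) l"
    using Cons.IH by (simp add: pr_simps pr_axis_left 2 4)
  also have "\<dots> = - pr (Gw (i # w) m) l"
    by (simp add: pr_simps pr_axis_left 3 sw_eq[of i l] 1 algebra_simps)
  finally show ?case .
qed (simp add: pr_simps)

lemma Gw_outside: "i \<notin> set w \<Longrightarrow> Gw w l $ i = 0"
proof (induction w)
  case (Cons j w)
  then show ?case by (auto simp: sr_def)
qed simp

text \<open>When the letters are distinct, the tail of the word does not touch the coordinate of the
  first letter, so the coordinates of l can be peeled off one by one. For a Coxeter word this makes
  1 - c injective.\<close>

lemma Gw_inj_aux: "distinct w \<Longrightarrow> Gw w l = 0 \<Longrightarrow> i \<in> set w \<Longrightarrow> l$i = 0"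
proof (induction w arbitrary: i)
  case (Cons j w)
  have "Gw w l = 0"
  proof -
    have "Gw w l $ k = 0" for k
    proof (cases "k = j")
      case True then show ?thesis using Cons.prems Gw_outside[of j w l] by simp
    next
      case False
      then show ?thesis using arg_cong[OF Cons.prems(2), of "\<lambda>v. v$k"] by (simp add: sr_def)
    qed
    then show ?thesis by (simp add: vec_eq_iff)
  qed
  moreover from this have "l$j = 0"
    using arg_cong[OF Cons.prems(2), of "\<lambda>v. v$j"] by (simp add: sr_linear)
  ultimately show ?case using Cons by auto
qed simp

lemma Gw_linear: "Gw w (l + m) = Gw w l + Gw w m" "Gw w (l - m) = Gw w l - Gw w m"
  "Gw w (k *s l) = k *s Gw w l" "Gw w 0 = 0" "Gw w (- l) = - Gw w l"
proof -
  have add: "Gw w (l + m) = Gw w l + Gw w m" for l m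
    by (induction w) (simp_all add: sr_linear vec.scale_left_distrib)
  have scale: "Gw w (k *s l) = k *s Gw w l" for k l
    by (induction w) (simp_all add: sr_linear vec.scale_right_distrib)
  show "Gw w (l + m) = Gw w l + Gw w m" "Gw w (k *s l) = k *s Gw w l" by (fact add scale)+
  have minus: "Gw w (- l) = - Gw w l" for l
  proof -
    have "(-1) *s v = - v" for v :: "int^'i" by (simp add: vec_eq_iff)
    then show ?thesis using scale[of "-1" l] by metis
  qed
  then show "Gw w (- l) = - Gw w l" .
  show "Gw w (l - m) = Gw w l - Gw w m" using add[of l "-m"] minus[of m] by simp
  show "Gw w 0 = 0" using scale[of 0 l] by simp
qed

lemma Gw_sum: "Gw w (\<Sum>x\<in>S. g x) = (\<Sum>x\<in>S. Gw w (g x))"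
  by (induction S rule: infinite_finite_induct) (auto simp: Gw_linear)

lemma A_sum: "A *v (\<Sum>x\<in>S. g x) = (\<Sum>x\<in>S. A *v (g x))"
proof (induction S rule: infinite_finite_induct)
  case (insert x S) then show ?case by (simp add: matrix_vector_right_distrib)
qed (use matrix_vector_mult_diff_distrib[of A 0 0] in auto)

end

locale qword = cartan A d for A :: "int^'i^'i" and d +
  fixes Q :: "'i list"
begin

text \<open>The letters before p when those at positions in I are left out. \<open>vv\<close> and
  \<open>vw\<close> are the product of this word on roots and on weights, \<open>vi\<close> is the
  inverse of \<open>vv\<close>.\<close>

definition com :: "nat set \<Rightarrow> nat \<Rightarrow> 'i list" where
  "com I p = map ((!) Q) (filter (\<lambda>q. q \<notin> I) [0..<p])"

definition vv :: "nat set \<Rightarrow> nat \<Rightarrow> int^'i \<Rightarrow> int^'i" where "vv I p = rw (com I p)"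
definition vi :: "nat set \<Rightarrow> nat \<Rightarrow> int^'i \<Rightarrow> int^'i" where "vi I p = rw (rev (com I p))"
definition vw :: "nat set \<Rightarrow> nat \<Rightarrow> int^'i \<Rightarrow> int^'i" where "vw I p = ww (com I p)"

text \<open>The root function of the subword complex; \<open>f\<close> and \<open>\<gamma>\<close>
  are the root and the weight of a position when no letter is left out.\<close>

definition R :: "nat set \<Rightarrow> nat \<Rightarrow> int^'i" where "R I p = vv I p (axis (Q!p) 1)"

definition f :: "nat \<Rightarrow> int^'i" where "f p = R {} p"
definition \<gamma> :: "nat \<Rightarrow> int^'i" where "\<gamma> p = vw {} p (axis (Q!p) 1)"

abbreviation "L \<equiv> length Q"

lemma com_0 [simp]: "com I 0 = []"
  by (simp add: com_def)

lemma com_Suc: "com I (Suc p) = com I p @ (if p \<in> I then [] else [Q!p])"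
  by (simp add: com_def)

lemma vv_0 [simp]: "vv I 0 v = v" and vi_0 [simp]: "vi I 0 v = v" and vw_0 [simp]: "vw I 0 v = v"
  by (simp_all add: vv_def vi_def vw_def)

lemma vv_Suc: "vv I (Suc p) v = vv I p (if p \<in> I then v else sr (Q!p) v)"
  by (simp add: vv_def com_Suc)

lemma vw_Suc: "vw I (Suc p) v = vw I p (if p \<in> I then v else sw (Q!p) v)"
  by (simp add: vw_def com_Suc)

lemma vi_Suc: "vi I (Suc p) v = (if p \<in> I then vi I p v else sr (Q!p) (vi I p v))"
  by (simp add: vi_def com_Suc)

lemma vv_vi [simp]: "vv I p (vi I p v) = v" and vi_vv [simp]: "vi I p (vv I p v) = v"
  by (simp_all add: vv_def vi_def)

lemma vi_roots [simp]: "v \<in> roots \<Longrightarrow> vi I p v \<in> roots"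
  and R_roots [simp]: "R I p \<in> roots"
  and f_roots [simp]: "f p \<in> roots"
  by (simp_all add: vv_def vi_def R_def f_def)

lemma vv_linear: "vv I p (u + v) = vv I p u + vv I p v" "vv I p (u - v) = vv I p u - vv I p v"
  "vv I p (- u) = - vv I p u" "vv I p (k *s u) = k *s vv I p u" "vv I p 0 = 0"
  by (simp_all add: vv_def rw_linear)

lemma vi_linear: "vi I p (u + v) = vi I p u + vi I p v" "vi I p (u - v) = vi I p u - vi I p v"
  "vi I p (- u) = - vi I p u" "vi I p (k *s u) = k *s vi I p u" "vi I p 0 = 0"
  by (simp_all add: vi_def rw_linear)

lemma vi_R [simp]: "vi I p (R I p) = axis (Q!p) 1"
  by (simp add: R_def)

lemma A_vv: "A *v vv I p v = vw I p (A *v v)"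
  by (simp add: vv_def vw_def A_rw)

lemma vv_sr: "vv I p (sr (Q!p) v) = refl (R I p) (vv I p v)"
  using rw_refl[of "axis (Q!p) 1" "com I p" v] by (simp add: R_def vv_def refl_axis)

lemma vw_sw: "vw I p (sw (Q!p) v) = wrefl (R I p) (vw I p v)"
  using ww_wrefl[of "axis (Q!p) 1" "com I p" v] by (simp add: R_def vv_def vw_def wrefl_axis)

lemma dd_R [simp]: "dd (R I p) = d (Q!p)" and dd_f [simp]: "dd (f p) = d (Q!p)"
  by (simp_all add: R_def vv_def f_def)

lemma pr_vv_vw: "pr (vv I p u) (vw I p l) = pr u l"
  by (simp add: vv_def vw_def pr_rw_ww)

text \<open>The product of all letters before \<open>p\<close> equals the product of the reflections in the \<open>R I i\<close>
  for \<open>i \<in> I\<close>, \<open>i < p\<close>, times the product of the remaining letters.\<close>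

lemma vw_prefix:
  "vw {} p l = vw I p l - (\<Sum>i\<in>I \<inter> {..<p}. cp (R I i) (vw I p l) *s (A *v f i))"
proof (induction p arbitrary: l)
  case (Suc p)
  define u where "u = vw I p l"
  show ?case
  proof (cases "p \<in> I")
    case False
    then have "I \<inter> {..<Suc p} = I \<inter> {..<p}" by (auto simp: less_Suc_eq)
    then show ?thesis using False Suc.IH[of "sw (Q!p) l"] by (simp add: vw_Suc)
  next
    case True
    let ?b = "R I p"
    have IP: "I \<inter> {..<Suc p} = insert p (I \<inter> {..<p})" using True by (auto simp: less_Suc_eq)
    have fp: "A *v f p = A *v ?b - (\<Sum>i\<in>I \<inter> {..<p}. cp (R I i) (A *v ?b) *s (A *v f i))"
      using Suc.IH[of "A *v axis (Q!p) 1"] by (simp add: f_def R_def A_vv)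
    have "vw {} (Suc p) l = vw {} p (sw (Q!p) l)" by (simp add: vw_Suc)
    also have "\<dots> = wrefl ?b u - (\<Sum>i\<in>I \<inter> {..<p}. cp (R I i) (wrefl ?b u) *s (A *v f i))"
      by (subst Suc.IH) (simp add: vw_sw u_def)
    also have "(\<Sum>i\<in>I \<inter> {..<p}. cp (R I i) (wrefl ?b u) *s (A *v f i)) =
        (\<Sum>i\<in>I \<inter> {..<p}. cp (R I i) u *s (A *v f i)) -
        cp ?b u *s (\<Sum>i\<in>I \<inter> {..<p}. cp (R I i) (A *v ?b) *s (A *v f i))"
      by (simp add: wrefl_def cp_linear vec_eq_iff sum_distrib_left sum_subtractf[symmetric] algebra_simps)
    also have "wrefl ?b u - \<dots> = u - (\<Sum>i\<in>I \<inter> {..<p}. cp (R I i) u *s (A *v f i)) - cp ?b u *s (A *v f p)"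
      unfolding fp wrefl_def by (simp add: vec_eq_iff algebra_simps)
    finally show ?thesis
      using True by (simp add: vw_Suc IP u_def)
  qed
qed simp

text \<open>This is \<open>vw_prefix\<close> applied to the simple root at p. On I it is a
  unitriangular change between the roots of the full word and the root configuration of I.\<close>

lemma f_expand: "f p = R I p - (\<Sum>i\<in>I \<inter> {..<p}. cp (R I i) (A *v R I p) *s f i)"
proof -
  have "A *v f p = A *v (R I p - (\<Sum>i\<in>I \<inter> {..<p}. cp (R I i) (A *v R I p) *s f i))"
    using vw_prefix[of p "A *v axis (Q!p) 1" I]
    by (simp add: f_def[of p] R_def[of _ p] A_vv A_sum matrix_vector_mult_diff_distrib matrix_vector_mult_scale)
  then show ?thesis by (rule A_inj)
qed

end

text \<open>Interface to the word Q, which is constructed later. \<open>label\<close> says that 1 -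
  c takes the weight of a position to its root, \<open>label_neg\<close> is the only link between
  the order of the positions and the pairing, and \<open>R0_bij\<close> says that the letters after
  the initial copy of c form a reduced word of the longest element.\<close>

locale coxeter_complex = qword A d Q for A :: "int^'i^'i" and d Q +
  fixes cw :: "'i list"
  assumes cw_distinct: "distinct cw" and cw_set: "set cw = UNIV"
    and Q_prefix: "take (length cw) Q = cw"
    and label: "p < L \<Longrightarrow> \<gamma> p - ww cw (\<gamma> p) = A *v f p"
    and label_neg: "p < q \<Longrightarrow> q < L \<Longrightarrow> pr (f p) (\<gamma> q) \<le> 0"
    and R0_bij: "bij_betw (R {..<length cw}) {length cw..<L} proots"
begin

abbreviation "N \<equiv> length cw"
abbreviation "I0 \<equiv> {..<N}"

abbreviation "c \<equiv> ww cw"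
abbreviation "G \<equiv> Gw cw"

definition F :: "int^'i \<Rightarrow> int^'i \<Rightarrow> int" where "F l m = pr (G l) m"

lemma length_cw: "N = CARD('i)"
  using distinct_card[OF cw_distinct] cw_set by simp

lemma N_pos: "N > 0"
  by (simp add: length_cw)

lemma N_le_L: "N \<le> L"
  using arg_cong[OF Q_prefix, of length] by simp

lemma A_G: "A *v G l = l - c l"
  by (rule A_Gw)

lemma G_label: "p < L \<Longrightarrow> G (\<gamma> p) = f p"
  using label[of p] by (intro A_inj[of "G (\<gamma> p)"]) (simp add: A_G)

lemma G_zero_iff: "G l = 0 \<longleftrightarrow> l = 0"
proof
  assume "G l = 0"
  then have "l$i = 0" for i using Gw_inj_aux[OF cw_distinct, of l i] cw_set by auto
  then show "l = 0" by (simp add: vec_eq_iff)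
qed (simp add: Gw_linear)

lemma G_inj: "G l = G m \<longleftrightarrow> l = m"
  using G_zero_iff[of "l - m"] by (simp add: Gw_linear)

lemma F_linear: "F (l + l') m = F l m + F l' m" "F (l - l') m = F l m - F l' m"
  "F (k *s l) m = k * F l m" "F (- l) m = - F l m" "F 0 m = 0"
  "F l (m + m') = F l m + F l m'" "F l (m - m') = F l m - F l m'"
  "F l (k *s m) = k * F l m" "F l (- m) = - F l m" "F l 0 = 0"
  by (simp_all add: F_def Gw_linear pr_simps)

lemma F_sum: "F (\<Sum>x\<in>S. g x) m = (\<Sum>x\<in>S. F (g x) m)" "F m (\<Sum>x\<in>S. g x) = (\<Sum>x\<in>S. F m (g x))"
  by (simp_all add: F_def Gw_sum pr_sum_left pr_sum_right)

lemma F_c: "F l (c m) = - F m l"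
  by (simp add: F_def pr_Gw_ww)

lemma F_cc: "F (c l) (c m) = F l m"
  by (simp add: F_c)

lemma F_neg: "p < q \<Longrightarrow> q < L \<Longrightarrow> F (\<gamma> p) (\<gamma> q) \<le> 0"
  using label_neg[of p q] by (simp add: F_def G_label)

text \<open>Prescribing the cardinality and the product of the complement makes the complement a
  reduced word of the longest element (\<open>facet_bij\<close>).\<close>

definition facet :: "nat set \<Rightarrow> bool" where
  "facet I \<longleftrightarrow> I \<subseteq> {..<L} \<and> card I = N \<and> vv I L = vv I0 L"

lemma facet_I0: "facet I0"
  using N_le_L by (auto simp: facet_def)

lemma facetD: assumes "facet I" shows "I \<subseteq> {..<L}" "card I = N" "finite I" "vv I L = vv I0 L"
  using assms finite_subset[of I "{..<L}"] by (auto simp: facet_def)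

lemma facet_less: "facet I \<Longrightarrow> i \<in> I \<Longrightarrow> i < L"
  using facetD(1) by auto

text \<open>A simple reflection changes the sign of a root only if the root is that simple root up
  to sign. Transported along the word this happens exactly at positions whose root is the given one,
  that is, only at \<open>p0\<close>.\<close>

lemma sign_track:
  assumes p0: "p0 < L" "p0 \<notin> I" and pos: "\<And>p. p < L \<Longrightarrow> p \<notin> I \<Longrightarrow> R I p \<in> proots"
    and uniq: "\<And>p. p < L \<Longrightarrow> p \<notin> I \<Longrightarrow> R I p = R I p0 \<Longrightarrow> p = p0"
  shows "q \<le> L \<Longrightarrow> vp (vi I q (R I p0)) \<longleftrightarrow> q \<le> p0"
proof (induction q)
  case 0 then show ?case using pos[OF p0] by (simp add: proots_def)
next
  case (Suc q)
  then have IH: "vp (vi I q (R I p0)) \<longleftrightarrow> q \<le> p0" and q: "q < L" by auto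
  let ?u = "vi I q (R I p0)"
  show ?case
  proof (cases "q \<in> I \<or> q = p0")
    case True
    have "\<not> vp (- axis (Q!p0) 1)" by (simp add: vp_not_uminus)
    moreover have "q \<in> I \<Longrightarrow> q \<noteq> p0" using p0 by auto
    ultimately show ?thesis using True IH p0(2) by (cases "q = p0") (auto simp: vi_Suc)
  next
    case False
    have ne: "?u \<noteq> axis (Q!q) 1" "- ?u \<noteq> axis (Q!q) 1"
    proof -
      show "?u \<noteq> axis (Q!q) 1"
      proof
        assume "?u = axis (Q!q) 1"
        then have "R I p0 = R I q" by (metis vv_vi R_def)
        then show False using uniq[of q] q False by simp
      qed
      show "- ?u \<noteq> axis (Q!q) 1"
      proof
        assume "- ?u = axis (Q!q) 1"
        then have "- R I p0 = R I q" by (metis vv_vi R_def vi_linear(3))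
        then show False using pos[of q] pos[of p0] q False p0 vp_not_uminus[of "R I p0"]
          by (auto simp: proots_def)
      qed
    qed
    have "vp (sr (Q!q) ?u) \<longleftrightarrow> vp ?u"
    proof (cases "vp ?u")
      case True then show ?thesis using vp_sr[of ?u "Q!q"] ne by simp
    next
      case nv: False
      then have "vp (- ?u)" using not_vp_iff[of ?u] by simp
      then have "vp (sr (Q!q) (- ?u))" using vp_sr[of "- ?u" "Q!q"] ne by simp
      then show ?thesis using nv vp_not_uminus[of "sr (Q!q) (- ?u)"] by (auto simp: sr_linear)
    qed
    then show ?thesis using IH False by (auto simp: vi_Suc)
  qed
qed

lemma w0_negative:
  assumes "b \<in> proots" shows "\<not> vp (vi I0 L b)"
proof -
  have "b \<in> R I0 ` {N..<L}" using R0_bij assms by (simp add: bij_betw_def)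
  then obtain p0 where p0: "p0 \<in> {N..<L}" "b = R I0 p0" by blast
  have pos: "R I0 p \<in> proots" if "p < L" "p \<notin> I0" for p
    using bij_betwE[OF R0_bij] that by auto
  have inj: "p = p0" if "p < L" "p \<notin> I0" "R I0 p = R I0 p0" for p
    using inj_onD[OF bij_betw_imp_inj_on[OF R0_bij] that(3)] that(1,2) p0 by simp
  have "vp (vi I0 L (R I0 p0)) \<longleftrightarrow> L \<le> p0"
    by (rule sign_track) (use p0 pos inj in auto)
  then show ?thesis using p0 by simp
qed

lemma facet_vi: assumes "facet I" shows "vi I L v = vi I0 L v"
proof -
  have "vi I L v = vi I L (vv I (L) (vi I0 L v))" using facetD(4)[OF assms] by simp
  then show ?thesis by simp
qed

text \<open>Each positive root ends up negative, so at the first change of sign it is the root of a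
  letter outside I. This gives surjectivity, and counting gives the rest.\<close>

lemma facet_bij: assumes "facet I" shows "bij_betw (R I) ({..<L} - I) proots"
proof -
  let ?C = "{..<L} - I"
  have sub: "proots \<subseteq> R I ` ?C"
  proof
    fix b assume b: "b \<in> proots"
    have nL: "\<not> vp (vi I L b)" using w0_negative[OF b] facet_vi[OF assms] by simp
    define q where "q = (LEAST q. \<not> vp (vi I q b))"
    have q: "\<not> vp (vi I q b)" "q \<le> L" unfolding q_def using nL by (rule LeastI, rule Least_le)
    have "q \<noteq> 0" using q b by (intro notI) (simp add: proots_def)
    then obtain r where r: "q = Suc r" by (cases q) auto
    then have vr: "vp (vi I r b)" using not_less_Least[of r "\<lambda>q. \<not> vp (vi I q b)"] by (auto simp: q_def)
    have rI: "r \<notin> I" using q vr r by (auto simp: vi_Suc)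
    then have "vi I r b = axis (Q!r) 1"
      using sr_sign_change[of "vi I r b" "Q!r"] q vr r b by (auto simp: vi_Suc proots_def)
    then have "b = R I r" by (metis vv_vi R_def)
    then show "b \<in> R I ` ?C" using rI r q by auto
  qed
  have cC: "card ?C = card proots"
  proof -
    have "card ?C = L - N" using facetD[OF assms] by (simp add: card_Diff_subset)
    moreover have "card proots = L - N" using bij_betw_same_card[OF R0_bij] by simp
    ultimately show ?thesis by simp
  qed
  have "card (R I ` ?C) \<le> card proots" using card_image_le[of ?C "R I"] cC by simp
  then have im: "R I ` ?C = proots" using sub by (metis card_seteq finite_imageI finite_Diff finite_lessThan)
  then have "inj_on (R I) ?C" using cC by (intro eq_card_imp_inj_on) auto
  then show ?thesis using im by (simp add: bij_betw_def)
qed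

lemma R_pos: "facet I \<Longrightarrow> p < L \<Longrightarrow> p \<notin> I \<Longrightarrow> vp (R I p)"
  using bij_betwE[OF facet_bij, of I] by (auto simp: proots_def)

lemma R_inj: "facet I \<Longrightarrow> p < L \<Longrightarrow> p \<notin> I \<Longrightarrow> q < L \<Longrightarrow> q \<notin> I \<Longrightarrow> R I p = R I q \<Longrightarrow> p = q"
  using facet_bij[of I] by (auto simp: bij_betw_def inj_on_def)

lemma vi_sign:
  assumes "facet I" "p < L" "p \<notin> I" "q \<le> L"
  shows "vp (vi I q (R I p)) \<longleftrightarrow> q \<le> p"
  using assms by (intro sign_track) (auto intro: R_inj bij_betwE[OF facet_bij, THEN bspec])

lemma root_position:
  assumes "facet I" "b \<in> roots"
  shows "\<exists>!p. p < L \<and> p \<notin> I \<and> (R I p = b \<or> R I p = - b)"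
proof -
  define b' where "b' = (if vp b then b else - b)"
  have b': "b' \<in> proots" using assms root_cases[of b] by (auto simp: b'_def proots_def)
  have eq: "(R I p = b \<or> R I p = - b) \<longleftrightarrow> R I p = b'" if "p < L" "p \<notin> I" for p
    using R_pos[OF assms(1) that] vp_not_uminus[of b] vp_not_uminus[of "- b"] root_cases[of b] assms(2)
    by (auto simp: b'_def)
  have "b' \<in> R I ` ({..<L} - I)" using facet_bij[OF assms(1)] b' by (simp add: bij_betw_def)
  then obtain p where "p < L" "p \<notin> I" "R I p = b'" by blast
  then show ?thesis using eq R_inj[OF assms(1)] by metis
qed

section \<open>Flips of facets\<close>

definition opp :: "nat set \<Rightarrow> nat \<Rightarrow> nat" where
  "opp I k = (THE p. p < L \<and> p \<notin> I \<and> (R I p = R I k \<or> R I p = - R I k))"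

definition flip :: "nat set \<Rightarrow> nat \<Rightarrow> nat set" where
  "flip I k = insert (opp I k) (I - {k})"

lemma opp: assumes "facet I"
  shows "opp I k < L" "opp I k \<notin> I" "R I (opp I k) = R I k \<or> R I (opp I k) = - R I k"
  using theI'[OF root_position[OF assms, of "R I k"]] unfolding opp_def by auto

lemma opp_eqI: "facet I \<Longrightarrow> p < L \<Longrightarrow> p \<notin> I \<Longrightarrow> R I p = R I k \<or> R I p = - R I k \<Longrightarrow> opp I k = p"
  unfolding opp_def using root_position[of I "R I k"] by (intro the1_equality) auto

text \<open>The root of a position outside I is positive when transported up to that position and
  negative beyond it. Read at k, this tells on which side of k the opposite position lies;
  \<open>opp_neg\<close> is the other case.\<close>

lemma opp_pos: assumes "facet I" "k \<in> I" "vp (R I k)"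
  shows "k < opp I k" "R I (opp I k) = R I k"
proof -
  show 1: "R I (opp I k) = R I k"
    using opp[OF assms(1), of k] R_pos[OF assms(1), of "opp I k"] vp_not_uminus[of "R I k"] assms by auto
  have "vp (vi I k (R I (opp I k)))" by (simp add: 1)
  then have "k \<le> opp I k"
    using vi_sign[OF assms(1), of "opp I k" k] opp[OF assms(1), of k] facet_less[OF assms(1,2)] by auto
  then show "k < opp I k" using opp[OF assms(1), of k] assms(2) by (metis le_neq_implies_less)
qed

lemma opp_neg: assumes "facet I" "k \<in> I" "\<not> vp (R I k)"
  shows "opp I k < k" "R I (opp I k) = - R I k"
proof -
  show 1: "R I (opp I k) = - R I k"
    using opp[OF assms(1), of k] R_pos[OF assms(1), of "opp I k"] assms by auto
  have "\<not> vp (vi I k (R I (opp I k)))"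
    using vp_not_uminus[of "axis (Q!k) 1"] by (auto simp: 1 vi_linear)
  then show "opp I k < k"
    using vi_sign[OF assms(1), of "opp I k" k] opp[OF assms(1), of k] facet_less[OF assms(1,2)] by auto
qed

text \<open>Between the two exchanged positions exactly one of the two words has used the letter
  with root \<open>R I k\<close>, so the prefixes differ by the reflection in that root; elsewhere
  the differences cancel.\<close>

lemma vv_flip:
  assumes "facet I" "k \<in> I" "p \<le> L"
  shows "vv (flip I k) p v =
    (if min k (opp I k) < p \<and> p \<le> max k (opp I k) then refl (R I k) (vv I p v) else vv I p v)"
  using assms(3)
proof (induction p arbitrary: v)
  case (Suc p)
  let ?k = "opp I k" and ?b = "R I k"
  have k: "?k \<notin> I" "?k \<noteq> k" using opp[OF assms(1), of k] assms(2) by auto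
  have rk: "refl (R I ?k) = refl ?b" using opp(3)[OF assms(1), of k] refl_uminus[of ?b] by auto
  show ?case
  proof (cases "p = k")
    case True
    have "vv (flip I k) (Suc p) v = vv (flip I k) p (sr (Q!p) v)"
      using True k by (simp add: vv_Suc flip_def)
    then show ?thesis using Suc True k assms(2) by (auto simp: vv_Suc[of I] vv_sr[of I] min_def max_def)
  next
    case False
    show ?thesis
    proof (cases "p = ?k")
      case True
      have "vv (flip I k) (Suc p) v = vv (flip I k) p v"
        using True k by (simp add: vv_Suc flip_def)
      then show ?thesis using Suc True k assms(2) by (auto simp: vv_Suc[of I] vv_sr[of I] rk min_def max_def)
    next
      case F2: False
      then have "p \<in> flip I k \<longleftrightarrow> p \<in> I" using False by (auto simp: flip_def)
      then show ?thesis using Suc False F2 by (auto simp: vv_Suc min_def max_def)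
    qed
  qed
qed simp

lemma R_flip:
  assumes "facet I" "k \<in> I" "p < L"
  shows "R (flip I k) p =
    (if min k (opp I k) < p \<and> p \<le> max k (opp I k) then refl (R I k) (R I p) else R I p)"
  using vv_flip[OF assms(1,2), of p] assms(3) by (simp add: R_def)

lemma facet_flip: assumes "facet I" "k \<in> I" shows "facet (flip I k)"
proof -
  have k: "opp I k < L" "opp I k \<notin> I" using opp[OF assms(1)] by auto
  have "card (flip I k) = N"
    using k facetD[OF assms(1)] assms(2) by (simp add: flip_def card.insert_remove card_Diff_singleton)
      (metis card_gt_0_iff One_nat_def Suc_pred empty_iff)
  moreover have "vv (flip I k) L v = vv I L v" for v
    using vv_flip[OF assms, of L v] k facet_less[OF assms] by auto
  ultimately show ?thesis using facetD[OF assms(1)] k by (auto simp: facet_def flip_def fun_eq_iff)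
qed

lemma R_flip_opp: assumes "facet I" "k \<in> I" shows "R (flip I k) (opp I k) = - R I k"
proof (cases "vp (R I k)")
  case True
  then show ?thesis
    using R_flip[OF assms, of "opp I k"] opp[OF assms(1), of k] opp_pos[OF assms] by auto
next
  case False
  then show ?thesis
    using R_flip[OF assms, of "opp I k"] opp[OF assms(1), of k] opp_neg[OF assms] by auto
qed

lemma opp_flip: assumes "facet I" "k \<in> I" shows "opp (flip I k) (opp I k) = k"
proof (rule opp_eqI[OF facet_flip[OF assms]])
  show "k < L" using facet_less[OF assms] .
  show "k \<notin> flip I k" using opp(2)[OF assms(1), of k] assms(2) by (auto simp: flip_def)
  have "R (flip I k) k = R I k \<or> R (flip I k) k = - R I k"
    using R_flip[OF assms, of k] facet_less[OF assms] by auto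
  then show "R (flip I k) k = R (flip I k) (opp I k) \<or> R (flip I k) k = - R (flip I k) (opp I k)"
    by (auto simp: R_flip_opp[OF assms])
qed

lemma flip_flip: assumes "facet I" "k \<in> I" shows "flip (flip I k) (opp I k) = I"
  using opp(2)[OF assms(1), of k] assms(2) unfolding flip_def[of "flip I k"] opp_flip[OF assms]
  by (auto simp: flip_def)

lemma opp_mem_flip: "opp I k \<in> flip I k"
  by (simp add: flip_def)

lemma vv_suffix_eq:
  assumes "vv I L = vv J L" "\<And>q. p \<le> q \<Longrightarrow> q < L \<Longrightarrow> q \<in> I \<longleftrightarrow> q \<in> J" "p \<le> L"
  shows "vv I p = vv J p"
  using assms(3,2)
proof (induction p rule: inc_induct)
  case (step p)
  then have "vv I (Suc p) = vv J (Suc p)" by auto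
  moreover have "p \<in> I \<longleftrightarrow> p \<in> J" using step by auto
  moreover have "vv K (Suc p) (if p \<in> K then v else sr (Q!p) v) = vv K p v" for K v
    by (simp add: vv_Suc)
  ultimately have "vv I p v = vv J p v" for v
    by metis
  then show ?case by auto
qed (use assms(1) in simp)

text \<open>Beyond the maximum neither I nor \<open>I0\<close> leaves out a letter, and the total
  products agree, so the prefixes up to there agree too. The letter at the maximum is used by
  \<open>I0\<close> but not by I, which reverses the root.\<close>

lemma facet_max_neg:
  assumes "facet I" "I \<noteq> I0" shows "\<not> vp (R I (Max I))"
proof -
  let ?k = "Max I"
  have fin: "finite I" "I \<noteq> {}" using facetD[OF assms(1)] N_pos by (auto simp del: length_greater_0_conv)
  have kI: "?k \<in> I" and kL: "?k < L" using Max_in[OF fin] facet_less[OF assms(1)] by auto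
  have "\<not> I \<subseteq> I0"
    using assms(2) facetD[OF assms(1)] card_subset_eq[of I0 I] by auto
  then obtain i where "i \<in> I" "i \<ge> N" by (meson lessThan_iff not_le subsetI)
  then have kn: "?k \<ge> N" using Max_ge[OF fin(1)] by (meson order_trans)
  have "q \<in> I \<longleftrightarrow> q \<in> I0" if "Suc ?k \<le> q" for q
    using that kn Max_ge[OF fin(1), of q] by auto
  then have "vv I (Suc ?k) = vv I0 (Suc ?k)"
    using vv_suffix_eq[of I I0 "Suc ?k"] facetD[OF assms(1)] kL by auto
  moreover have "vv I (Suc ?k) (axis (Q!?k) 1) = R I ?k"
    using kI by (simp add: vv_Suc R_def)
  moreover have "vv I0 (Suc ?k) (axis (Q!?k) 1) = - R I0 ?k"
    using kn by (simp add: vv_Suc R_def vv_linear)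
  ultimately have "R I ?k = - R I0 ?k" by simp
  moreover have "vp (R I0 ?k)" using R_pos[OF facet_I0 kL] kn by simp
  ultimately show ?thesis using vp_not_uminus[of "R I0 ?k"] by auto
qed

text \<open>Flipping the maximum of a facet other than \<open>I0\<close> goes to the left and lowers
  the sum of the positions. Reversed, all facets arise from \<open>I0\<close> by flips to the
  right.\<close>

lemma facet_induct [consumes 1, case_names base step]:
  assumes "facet I" "P I0"
    and step: "\<And>I k. facet I \<Longrightarrow> k \<in> I \<Longrightarrow> vp (R I k) \<Longrightarrow> P I \<Longrightarrow> P (flip I k)"
  shows "P I"
  using assms(1)
proof (induction "\<Sum>I" arbitrary: I rule: less_induct)
  case less
  show ?case
  proof (cases "I = I0")
    case False
    let ?k = "Max I"
    have fin: "finite I" "I \<noteq> {}" using facetD[OF less.prems] N_pos by (auto simp del: length_greater_0_conv)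
    have k: "?k \<in> I" using Max_in[OF fin] .
    have neg: "\<not> vp (R I ?k)" by (rule facet_max_neg[OF less.prems False])
    let ?k' = "opp I ?k" and ?J = "flip I ?k"
    have k': "?k' < ?k" "R I ?k' = - R I ?k" "?k' \<notin> I" "?k' < L"
      using opp_neg[OF less.prems k neg] opp[OF less.prems, of ?k] by auto
    have "\<Sum>?J = ?k' + (\<Sum>I - ?k)"
      using k' fin k by (simp add: flip_def sum.insert_remove sum_diff1_nat)
    moreover have "?k \<le> \<Sum>I" using member_le_sum[of ?k I "\<lambda>x. x"] fin k by simp
    ultimately have "\<Sum>?J < \<Sum>I" using k' by linarith
    then have "P ?J" using less.hyps facet_flip[OF less.prems k] by blast
    moreover have "vp (R ?J ?k')"
      using neg not_vp_iff[of "R I ?k"] by (simp add: R_flip_opp[OF less.prems k])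
    ultimately have "P (flip ?J ?k')"
      using step[OF facet_flip[OF less.prems k] opp_mem_flip] by blast
    then show ?thesis by (simp add: flip_flip[OF less.prems k])
  qed (use assms(2) in simp)
qed

text \<open>A facet containing \<open>K\<close> all of whose roots outside \<open>K\<close> are positive is determined by reading
  \<open>Q\<close> from right to left, since such a facet uses a letter whenever this increases the length; dually
  for negative roots and reading from left to right.\<close>

lemma greedy_unique:
  assumes "facet I" "facet J" "K \<subseteq> I" "K \<subseteq> J"
    and "\<And>j. j \<in> I - K \<Longrightarrow> vp (R I j)" "\<And>j. j \<in> J - K \<Longrightarrow> vp (R J j)"
  shows "I = J"
proof -
  have aux: False if *: "facet I'" "facet J'" "p < L" "p \<in> I'" "p \<notin> J'" "vp (R I' p)"
      "vv I' (Suc p) = vv J' (Suc p)" for I' J' p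
  proof -
    have "R I' p = vv J' p (sr (Q!p) (axis (Q!p) 1))"
      using fun_cong[OF *(7), of "axis (Q!p) 1"] *(4,5) by (simp add: vv_Suc R_def del: sr_axis)
    then have "R I' p = - R J' p" by (simp add: R_def vv_linear)
    then show False using R_pos[OF *(2,3,5)] vp_not_uminus[of "R J' p"] *(6) by auto
  qed
  have "vv I p = vv J p \<and> (\<forall>q. p \<le> q \<and> q < L \<longrightarrow> (q \<in> I \<longleftrightarrow> q \<in> J))" if "p \<le> L" for p
    using that
  proof (induction p rule: inc_induct)
    case base then show ?case using facetD(4) assms(1,2) by auto
  next
    case (step p)
    have pp: "p \<in> I \<longleftrightarrow> p \<in> J"
      using aux[of I J p] aux[of J I p] assms step by (metis DiffI subsetD)
    then have all: "\<forall>q. p \<le> q \<and> q < L \<longrightarrow> (q \<in> I \<longleftrightarrow> q \<in> J)"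
      using step.IH by (metis Suc_leI le_neq_implies_less)
    then show ?case using vv_suffix_eq[of I J p] facetD(4) assms(1,2) step.hyps by auto
  qed
  from this[of 0] show ?thesis using facetD(1) assms(1,2) by blast
qed

lemma greedy_unique_neg:
  assumes "facet I" "facet J" "K \<subseteq> I" "K \<subseteq> J"
    and "\<And>j. j \<in> I - K \<Longrightarrow> \<not> vp (R I j)" "\<And>j. j \<in> J - K \<Longrightarrow> \<not> vp (R J j)"
  shows "I = J"
proof -
  have aux: False if *: "facet I'" "facet J'" "p < L" "p \<in> I'" "p \<notin> J'" "\<not> vp (R I' p)"
      "vv I' p = vv J' p" for I' J' p
  proof -
    have "R I' p = R J' p" using * by (simp add: R_def)
    then show False using R_pos[OF *(2,3,5)] *(6) by auto
  qed
  have "p \<le> L \<Longrightarrow> vv I p = vv J p \<and> (\<forall>q<p. q \<in> I \<longleftrightarrow> q \<in> J)" for p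
  proof (induction p)
    case (Suc p)
    have pp: "p \<in> I \<longleftrightarrow> p \<in> J"
      using aux[of I J p] aux[of J I p] assms Suc by (metis DiffI subsetD Suc_le_eq less_imp_le)
    then show ?case using Suc by (auto simp: less_Suc_eq vv_Suc fun_eq_iff)
  qed (simp add: fun_eq_iff)
  from this[of L] show ?thesis using facetD(1) assms(1,2) by blast
qed

section \<open>Duality between labels and root configurations\<close>

lemma com_empty_L: "com {} L = cw @ com I0 L"
proof -
  have "filter (\<lambda>q. q \<notin> I0) [0..<L] = filter (\<lambda>q. q \<notin> I0) ([0..<N] @ [N..<L])"
    using N_le_L by (metis le0 upt_add_eq_append ordered_cancel_comm_monoid_diff_class.add_diff_inverse)
  also have "\<dots> = [N..<L]" by (auto simp: filter_empty_conv filter_id_conv)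
  finally have "com I0 L = drop N Q"
    by (metis com_def drop_map drop_upt map_nth add_0)
  moreover have "com {} L = Q" by (simp add: com_def map_nth)
  ultimately show ?thesis using Q_prefix append_take_drop_id[of N Q] by simp
qed

lemma com_empty: assumes "p \<le> L" shows "N \<le> p \<Longrightarrow> com {} p = cw @ com I0 p"
  using assms
proof (induction p rule: inc_induct)
  case (step p)
  then have "com {} (Suc p) = cw @ com I0 (Suc p)" by simp
  moreover have "p \<notin> I0" using step by simp
  ultimately show ?case by (simp add: com_Suc)
qed (rule com_empty_L)

lemma f_eq_c_R0: "N \<le> p \<Longrightarrow> p < L \<Longrightarrow> f p = rw cw (R I0 p)"
  by (simp add: f_def R_def vv_def com_empty)

lemma facet_vw: assumes "facet I" shows "vw I L = vw I0 L"
  using facetD(4)[OF assms] rw_eq_iff_ww_eq by (simp add: vv_def vw_def)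

text \<open>The full word is c times the complement of \<open>I0\<close>, and all facets have the
  same complement product. So \<open>vw_prefix\<close> at the end of Q writes c in terms of the
  roots of any facet.\<close>

lemma facet_c: assumes "facet I" shows "c m = m - (\<Sum>i\<in>I. cp (R I i) m *s (A *v f i))"
proof -
  define l where "l = ww (rev (com I L)) m"
  have l: "vw I L l = m" by (simp add: l_def vw_def)
  have "vw {} L l = c (vw I0 L l)" by (simp add: vw_def com_empty_L)
  also have "\<dots> = c m" using l facet_vw[OF assms] by simp
  finally have "c m = vw {} L l" ..
  moreover have "I \<inter> {..<L} = I" using facetD(1)[OF assms] by auto
  ultimately show ?thesis using vw_prefix[of L l I] l by simp
qed

text \<open>Under \<open>G\<close> the claim becomes \<open>facet_c\<close>, and \<open>G\<close> is
  injective. The coroots of a facet are thus coordinates with respect to its weights.\<close>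

lemma label_expansion: assumes "facet I" shows "m = (\<Sum>i\<in>I. cp (R I i) m *s \<gamma> i)"
proof -
  have "A *v G m = A *v (\<Sum>i\<in>I. cp (R I i) m *s f i)"
    using facet_c[OF assms, of m] by (simp add: A_G A_sum matrix_vector_mult_scale)
  then have "G m = (\<Sum>i\<in>I. cp (R I i) m *s f i)" by (rule A_inj)
  also have "\<dots> = (\<Sum>i\<in>I. cp (R I i) m *s G (\<gamma> i))"
    using facet_less[OF assms] by (intro sum.cong) (auto simp: G_label)
  also have "\<dots> = G (\<Sum>i\<in>I. cp (R I i) m *s \<gamma> i)" by (simp add: Gw_sum Gw_linear)
  finally show ?thesis using G_inj by blast
qed

lemma cp_sum_axis:
  assumes "b \<in> roots" shows "(\<Sum>a\<in>UNIV. cp b (axis a 1) * l$a) = cp b l"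
proof -
  have "l = (\<Sum>a\<in>UNIV. l$a *s axis a 1)" using basis_expansion[of l] by simp
  then have "cp b l = (\<Sum>a\<in>UNIV. cp b (l$a *s axis a 1))" using cp_sum[OF assms] by metis
  then show ?thesis using assms by (simp add: cp_linear ac_simps)
qed

text \<open>\<open>label_expansion\<close> says that the square matrices of weights and coroots
  multiply to the identity in one order; duality is the other order. The matrices are made real
  because the argument needs a field.\<close>

lemma cp_label:
  assumes I: "facet I" and ij: "i \<in> I" "j \<in> I"
  shows "cp (R I i) (\<gamma> j) = (if i = j then 1 else 0)"
proof -
  obtain e :: "'i \<Rightarrow> nat" where e: "bij_betw e UNIV I"
    using finite_same_card_bij[of "UNIV :: 'i set" I] facetD[OF I] length_cw by auto
  define P :: "real^'i^'i" where "P = (\<chi> a b. real_of_int (\<gamma> (e b) $ a))"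
  define M :: "real^'i^'i" where "M = (\<chi> b a. real_of_int (cp (R I (e b)) (axis a 1)))"
  have "(P ** M)$a$b = (mat 1 :: real^'i^'i)$a$b" for a b
  proof -
    have "(\<Sum>x\<in>UNIV. \<gamma> (e x) $ a * cp (R I (e x)) (axis b 1)) = (\<Sum>i\<in>I. \<gamma> i $ a * cp (R I i) (axis b 1))"
      by (rule sum.reindex_bij_betw[OF e])
    also have "\<dots> = (axis b 1 :: int^'i)$a"
      using arg_cong[OF label_expansion[OF I, of "axis b 1"], of "\<lambda>v. v$a"] by (simp add: ac_simps)
    finally show ?thesis
      unfolding P_def M_def matrix_matrix_mult_def mat_def by (auto simp flip: of_int_mult of_int_sum)
  qed
  then have "P ** M = mat 1" by (simp add: vec_eq_iff)
  then have MP: "M ** P = mat 1" by (simp add: matrix_left_right_inverse)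
  obtain a b where ab: "i = e a" "j = e b" using ij e by (auto simp: bij_betw_def)
  have "real_of_int (cp (R I (e a)) (\<gamma> (e b))) = (M ** P)$a$b"
    by (simp add: M_def P_def matrix_matrix_mult_def flip: cp_sum_axis[of "R I (e a)" "\<gamma> (e b)"])
  also have "\<dots> = (if a = b then 1 else 0)" unfolding MP by (simp add: mat_def)
  finally have "cp (R I (e a)) (\<gamma> (e b)) = (if a = b then 1 else 0)" by (auto split: if_splits)
  then show ?thesis using ab e by (auto simp: bij_betw_def inj_on_def)
qed

lemma pr_label:
  assumes "facet I" "i \<in> I" "j \<in> I"
  shows "pr (R I i) (\<gamma> j) = (if i = j then d (Q!i) else 0)"
  using cp_label[OF assms] by (simp add: pr_cp)

lemma root_expansion_eqI:
  assumes "facet I" "\<And>i. i \<in> I \<Longrightarrow> pr u (\<gamma> i) = pr v (\<gamma> i)"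
  shows "u = v"
proof (rule pr_left_eqI)
  fix l
  have "pr x l = (\<Sum>i\<in>I. cp (R I i) l * pr x (\<gamma> i))" for x
    by (subst label_expansion[OF assms(1), of l]) (simp add: pr_sum_right pr_simps)
  then show "pr u l = pr v l" using assms(2) by (metis (no_types, lifting) sum.cong)
qed

text \<open>By \<open>f_expand\<close> the root \<open>f i\<close> is \<open>R I i\<close> up to
  roots \<open>f k\<close> with smaller k in I, whose pairings vanish by induction; what remains is
  the duality of roots and weights.\<close>

lemma F_facet:
  assumes "facet I" "i \<in> I" "j \<in> I" "i \<le> j"
  shows "F (\<gamma> i) (\<gamma> j) = (if i = j then d (Q!i) else 0)"
  using assms(2,4)
proof (induction i rule: less_induct)
  case (less i)
  have "F (\<gamma> i) (\<gamma> j) = pr (f i) (\<gamma> j)"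
    using G_label[of i] facet_less[OF assms(1)] less.prems by (simp add: F_def)
  also have "\<dots> = pr (R I i) (\<gamma> j) - (\<Sum>k\<in>I \<inter> {..<i}. cp (R I k) (A *v R I i) * pr (f k) (\<gamma> j))"
    by (subst f_expand[of i I]) (simp add: pr_simps pr_sum_left)
  also have "(\<Sum>k\<in>I \<inter> {..<i}. cp (R I k) (A *v R I i) * pr (f k) (\<gamma> j)) = 0"
  proof (rule sum.neutral, rule ballI)
    fix k assume k: "k \<in> I \<inter> {..<i}"
    then have "pr (f k) (\<gamma> j) = F (\<gamma> k) (\<gamma> j)"
      using G_label[of k] facet_less[OF assms(1)] by (simp add: F_def)
    then show "cp (R I k) (A *v R I i) * pr (f k) (\<gamma> j) = 0"
      using less.IH[of k] k less.prems by simp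
  qed
  finally show ?case using pr_label[OF assms(1) less.prems(1) assms(3)] by simp
qed

text \<open>By \<open>label_expansion\<close>, the coefficient of the weight of i in the root of k.
  The arguments are in the opposite order of the pairing.\<close>

definition cc :: "nat set \<Rightarrow> nat \<Rightarrow> nat \<Rightarrow> int" where
  "cc I k i = cp (R I i) (A *v R I k)"

lemma cc_self: "cc I k k = 2"
  by (simp add: cc_def cp_self)

text \<open>The roots of I at k and at its opposite agree, so their expansions by
  \<open>f_expand\<close> differ only in the positions of I between them. These coefficients become
  the exponents of one term of the exchange relation.\<close>

lemma flip_between:
  assumes I: "facet I" "k \<in> I" "vp (R I k)"
  shows "\<gamma> k + \<gamma> (opp I k) = - (\<Sum>i\<in>I \<inter> {k<..<opp I k}. cc I k i *s \<gamma> i)"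
proof -
  let ?k = "opp I k" and ?b = "R I k"
  have k: "k < ?k" "R I ?k = ?b" "?k < L" "?k \<notin> I" using opp_pos[OF I] opp[OF I(1)] by auto
  have fin: "finite I" using facetD[OF I(1)] by simp
  have fk: "f k = ?b - (\<Sum>i\<in>I \<inter> {..<k}. cc I k i *s f i)"
    using f_expand[of k I] by (simp add: cc_def)
  have split: "I \<inter> {..<?k} = I \<inter> {..<k} \<union> insert k (I \<inter> {k<..<?k})"
    using k(1) I(2) by auto
  have "f ?k = ?b - (\<Sum>i\<in>I \<inter> {..<?k}. cc I k i *s f i)"
    using f_expand[of ?k I] by (simp add: k(2) cc_def)
  also have "(\<Sum>i\<in>I \<inter> {..<?k}. cc I k i *s f i) =
      (\<Sum>i\<in>I \<inter> {..<k}. cc I k i *s f i) + (\<Sum>i\<in>insert k (I \<inter> {k<..<?k}). cc I k i *s f i)"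
    unfolding split using fin by (intro sum.union_disjoint) auto
  also have "(\<Sum>i\<in>insert k (I \<inter> {k<..<?k}). cc I k i *s f i) =
      2 *s f k + (\<Sum>i\<in>I \<inter> {k<..<?k}. cc I k i *s f i)"
    using fin by (simp add: cc_self)
  also have "?b - ((\<Sum>i\<in>I \<inter> {..<k}. cc I k i *s f i) + \<dots>) = - f k - (\<Sum>i\<in>I \<inter> {k<..<?k}. cc I k i *s f i)"
  proof -
    have b: "?b = f k + (\<Sum>i\<in>I \<inter> {..<k}. cc I k i *s f i)" using fk by simp
    show ?thesis by (subst b) (simp add: vec_eq_iff)
  qed
  finally have "f k + f ?k = - (\<Sum>i\<in>I \<inter> {k<..<?k}. cc I k i *s f i)" by simp
  moreover have "(\<Sum>i\<in>I \<inter> {k<..<?k}. cc I k i *s f i) = (\<Sum>i\<in>I \<inter> {k<..<?k}. cc I k i *s G (\<gamma> i))"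
    using facet_less[OF I(1)] by (intro sum.cong) (auto simp: G_label)
  moreover have "f k = G (\<gamma> k)" "f ?k = G (\<gamma> ?k)" using k facet_less[OF I(1,2)] by (simp_all add: G_label)
  ultimately have "G (\<gamma> k) + G (\<gamma> ?k) = - (\<Sum>i\<in>I \<inter> {k<..<?k}. cc I k i *s G (\<gamma> i))" by metis
  then have "G (\<gamma> k + \<gamma> ?k) = G (- (\<Sum>i\<in>I \<inter> {k<..<?k}. cc I k i *s \<gamma> i))"
    by (simp only: Gw_linear Gw_sum)
  then show ?thesis by (simp only: G_inj)
qed

lemma label_minus_c: assumes "p < L" shows "c (\<gamma> p) = \<gamma> p - A *v f p"
  using A_G[of "\<gamma> p"] by (simp add: G_label[OF assms])

lemma A_R_expansion:
  assumes I: "facet I" "k \<in> I" "vp (R I k)"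
  shows "A *v R I k = 2 *s \<gamma> k + (\<Sum>i\<in>I \<inter> {..<k}. cc I k i *s \<gamma> i)
    + (\<Sum>i\<in>I \<inter> {k<..<opp I k}. cc I k i *s \<gamma> i) + (\<Sum>i\<in>I \<inter> {opp I k<..}. cc I k i *s \<gamma> i)"
proof -
  let ?k = "opp I k"
  have k: "k < ?k" "?k \<notin> I" using opp_pos[OF I] opp[OF I(1)] by auto
  have fin: "finite I" using facetD[OF I(1)] by simp
  have split: "I = insert k (I \<inter> {..<k} \<union> (I \<inter> {k<..<?k} \<union> I \<inter> {?k<..}))"
    using k I(2) by (auto simp: not_less) (metis le_neq_implies_less)
  have "A *v R I k = (\<Sum>i\<in>I. cc I k i *s \<gamma> i)"
    using label_expansion[OF I(1), of "A *v R I k"] by (simp add: cc_def)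
  also have "\<dots> = (\<Sum>i\<in>insert k (I \<inter> {..<k} \<union> (I \<inter> {k<..<?k} \<union> I \<inter> {?k<..})). cc I k i *s \<gamma> i)"
    using split by simp
  also have "\<dots> = 2 *s \<gamma> k + (\<Sum>i\<in>I \<inter> {..<k} \<union> (I \<inter> {k<..<?k} \<union> I \<inter> {?k<..}). cc I k i *s \<gamma> i)"
    using fin k by (subst sum.insert) (auto simp: cc_self)
  also have "(\<Sum>i\<in>I \<inter> {..<k} \<union> (I \<inter> {k<..<?k} \<union> I \<inter> {?k<..}). cc I k i *s \<gamma> i) =
      (\<Sum>i\<in>I \<inter> {..<k}. cc I k i *s \<gamma> i) + ((\<Sum>i\<in>I \<inter> {k<..<?k}. cc I k i *s \<gamma> i) +
      (\<Sum>i\<in>I \<inter> {?k<..}. cc I k i *s \<gamma> i))"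
  proof -
    have "(I \<inter> {..<k}) \<inter> (I \<inter> {k<..<?k} \<union> I \<inter> {?k<..}) = {}"
      "(I \<inter> {k<..<?k}) \<inter> (I \<inter> {?k<..}) = {}" using k by auto
    then show ?thesis using fin by (simp add: sum.union_disjoint)
  qed
  finally show ?thesis by (simp add: add.assoc)
qed

text \<open>Subtracting \<open>flip_between\<close> from the weight expansion of the root of k
  leaves the positions outside the interval, those on the left being twisted by c. They give the
  exponents of the other term of the exchange relation.\<close>

lemma flip_out:
  assumes I: "facet I" "k \<in> I" "vp (R I k)"
  shows "\<gamma> (opp I k) - c (\<gamma> k) =
    (\<Sum>i\<in>I \<inter> {..<k}. cc I k i *s c (\<gamma> i)) + (\<Sum>i\<in>I \<inter> {opp I k<..}. cc I k i *s \<gamma> i)"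
proof -
  let ?S = "\<Sum>i\<in>I \<inter> {..<k}. cc I k i *s \<gamma> i"
  have 1: "A *v f k = A *v R I k - (\<Sum>i\<in>I \<inter> {..<k}. cc I k i *s (A *v f i))"
    by (subst f_expand[of k I])
      (simp add: matrix_vector_mult_diff_distrib A_sum matrix_vector_mult_scale cc_def)
  have 2: "(\<Sum>i\<in>I \<inter> {..<k}. cc I k i *s c (\<gamma> i)) = ?S - (\<Sum>i\<in>I \<inter> {..<k}. cc I k i *s (A *v f i))"
  proof -
    have "(\<Sum>i\<in>I \<inter> {..<k}. cc I k i *s c (\<gamma> i)) =
        (\<Sum>i\<in>I \<inter> {..<k}. cc I k i *s \<gamma> i - cc I k i *s (A *v f i))"
      using facet_less[OF I(1)] by (intro sum.cong) (auto simp: label_minus_c vec_eq_iff algebra_simps)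
    then show ?thesis by (simp add: sum_subtractf)
  qed
  have 3: "\<gamma> (opp I k) = - \<gamma> k - (\<Sum>i\<in>I \<inter> {k<..<opp I k}. cc I k i *s \<gamma> i)"
  proof -
    have "\<gamma> (opp I k) = (\<gamma> k + \<gamma> (opp I k)) - \<gamma> k" by simp
    then show ?thesis unfolding flip_between[OF I] by simp
  qed
  show ?thesis
    unfolding 2 label_minus_c[OF facet_less[OF I(1,2)]] 1 3 A_R_expansion[OF I]
    by (simp add: vec_eq_iff algebra_simps)
qed

lemma pr_refl: "b \<in> roots \<Longrightarrow> pr (refl b v) l = pr v (wrefl b l)"
  using pr_refl_wrefl[of b v "wrefl b l"] by simp

lemma wrefl_fixed: "b \<in> roots \<Longrightarrow> pr b l = 0 \<Longrightarrow> wrefl b l = l"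
  using cp_unique[of b l 0] by (simp add: wrefl_def)

lemma cp_opp_label: assumes "facet I" "k \<in> I" shows "cp (R I k) (\<gamma> (opp I k)) = - 1"
  using cp_label[OF facet_flip[OF assms] opp_mem_flip opp_mem_flip] R_flip_opp[OF assms]
  by (simp add: cp_linear)

text \<open>Roots at positions outside a facet become computable from F alone. In the induction the
  weight of the new position is a combination of old weights whose positions lie on one side of p
  (\<open>flip_between\<close>), unless p lies in the interval of the flip.\<close>

lemma pr_R_label:
  assumes "facet I" "i \<in> I" "p < L" "p \<notin> I"
  shows "pr (R I p) (\<gamma> i) = (if i < p then - F (\<gamma> i) (\<gamma> p) else F (\<gamma> p) (\<gamma> i))"
  using assms
proof (induction arbitrary: i p rule: facet_induct)
  case base
  then have ip: "i < N" "N \<le> p" by auto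
  then have iL: "i < L" using N_le_L by simp
  have "pr (R I0 p) (\<gamma> i) = pr (f p) (c (\<gamma> i))"
    using ip base by (simp add: f_eq_c_R0 pr_rw_ww)
  also have "\<dots> = - F (\<gamma> i) (\<gamma> p)" using base by (simp add: F_c flip: G_label F_def)
  finally show ?case using ip by simp
next
  case (step I k)
  let ?k = "opp I k" and ?b = "R I k" and ?J = "flip I k"
  note I = step.hyps
  have k: "k < ?k" "R I ?k = ?b" "?k < L" "?k \<notin> I" using opp_pos[OF I] opp[OF I(1)] by auto
  have kL: "k < L" using facet_less[OF I(1,2)] .
  have RJ: "R ?J p = (if k < p \<and> p \<le> ?k then refl ?b (R I p) else R I p)"
    using R_flip[OF I(1,2) step.prems(2)] k by (simp add: min_def max_def)
  have b0: "pr ?b (\<gamma> i) = 0" if "i \<in> I" "i \<noteq> k" for i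
    using pr_label[OF I(1,2) that(1)] that by auto
  have IH: "pr (R I p) (\<gamma> i) = (if i < p then - F (\<gamma> i) (\<gamma> p) else F (\<gamma> p) (\<gamma> i))"
    if "i \<in> I" "p \<noteq> k" for i
    using step.IH[of i p] step.prems that by (auto simp: flip_def)
  show ?case
  proof (cases "i = ?k")
    case False
    then have i: "i \<in> I" "i \<noteq> k" using step.prems by (auto simp: flip_def)
    show ?thesis
    proof (cases "p = k")
      case True
      then show ?thesis
        using RJ b0[OF i] F_facet[OF I(1) i(1) I(2)] F_facet[OF I(1) I(2) i(1)] i by auto
    next
      case False
      have "pr (R ?J p) (\<gamma> i) = pr (R I p) (\<gamma> i)"
        using b0[OF i] by (simp add: RJ pr_refl wrefl_fixed)
      then show ?thesis using IH[OF i(1) False] by simp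
    qed
  next
    case True
    note bt = flip_between[OF I]
    let ?n = "\<lambda>i. cc I k i"
    have g: "\<gamma> ?k = - \<gamma> k - (\<Sum>i\<in>I \<inter> {k<..<?k}. ?n i *s \<gamma> i)"
    proof -
      have "\<gamma> ?k = (\<gamma> k + \<gamma> ?k) - \<gamma> k" by simp
      then show ?thesis unfolding bt by simp
    qed
    show ?thesis
    proof (cases "p = k")
      case pk: True
      have "pr ?b (\<gamma> ?k) = - d (Q!k)"
        using cp_opp_label[OF I(1,2)] by (simp add: pr_cp)
      moreover have "F (\<gamma> k) (\<gamma> ?k) = - d (Q!k)"
      proof -
        have "F (\<gamma> k) (\<gamma> i) = 0" if "i \<in> I \<inter> {k<..<?k}" for i
          using F_facet[OF I(1,2), of i] that by auto
        then show ?thesis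
          by (subst g) (simp add: F_linear F_sum F_facet[OF I(1,2,2)])
      qed
      ultimately show ?thesis using RJ True pk k by simp
    next
      case pk: False
      have pI: "p \<notin> I" "p \<noteq> ?k" using step.prems pk by (auto simp: flip_def)
      consider "?k < p" | "p < k" | "k < p" "p < ?k" using pk pI by linarith
      then show ?thesis
      proof cases
        case 1
        have "pr (R I p) (\<gamma> i) = - F (\<gamma> i) (\<gamma> p)" if "i \<in> I \<inter> {k<..<?k} \<or> i = k" for i
          using IH[of i] that 1 pk I(2) k by auto
        then have "pr (R I p) (\<gamma> ?k) = - F (\<gamma> ?k) (\<gamma> p)"
          unfolding g by (simp add: pr_simps pr_sum_right F_linear F_sum sum_negf)
        then show ?thesis using RJ 1 True by simp
      next
        case 2
        have "pr (R I p) (\<gamma> i) = F (\<gamma> p) (\<gamma> i)" if "i \<in> I \<inter> {k<..<?k} \<or> i = k" for i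
          using IH[of i] that 2 pk I(2) k by auto
        then have "pr (R I p) (\<gamma> ?k) = F (\<gamma> p) (\<gamma> ?k)"
          unfolding g by (simp add: pr_simps pr_sum_right F_linear F_sum sum_negf)
        then show ?thesis using RJ 2 True k by simp
      next
        case 3
        \<comment> \<open>Inside the interval the root of p is reflected. Moving the reflection to
          the new weight leaves only positions outside the interval, and \<open>flip_out\<close>
          recombines their contributions.\<close>
        have w: "wrefl ?b (\<gamma> ?k) = \<gamma> ?k + A *v ?b"
          using cp_opp_label[OF I(1,2)] by (simp add: wrefl_def vec_eq_iff)
        have w2: "wrefl ?b (\<gamma> ?k) = \<gamma> k + (\<Sum>i\<in>I \<inter> {..<k}. ?n i *s \<gamma> i) + (\<Sum>i\<in>I \<inter> {?k<..}. ?n i *s \<gamma> i)"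
          unfolding w A_R_expansion[OF I] by (subst g) (simp add: vec_eq_iff)
        have e1: "pr (R I p) (\<gamma> i) = - F (\<gamma> i) (\<gamma> p)" if "i \<in> I \<inter> {..<k} \<or> i = k" for i
          using IH[of i] that 3 pk I(2) by auto
        have e2: "pr (R I p) (\<gamma> i) = F (\<gamma> p) (\<gamma> i)" if "i \<in> I \<inter> {?k<..}" for i
          using IH[of i] that 3 pk by auto
        have "pr (R ?J p) (\<gamma> ?k) = pr (R I p) (wrefl ?b (\<gamma> ?k))"
          using RJ 3 by (simp add: pr_refl)
        also have "\<dots> = - F (\<gamma> k) (\<gamma> p) - (\<Sum>i\<in>I \<inter> {..<k}. ?n i * F (\<gamma> i) (\<gamma> p))
            + (\<Sum>i\<in>I \<inter> {?k<..}. ?n i * F (\<gamma> p) (\<gamma> i))"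
          unfolding w2 using e1 e2 by (simp add: pr_simps pr_sum_right sum_negf)
        also have "\<dots> = F (\<gamma> p) (c (\<gamma> k) + ((\<Sum>i\<in>I \<inter> {..<k}. ?n i *s c (\<gamma> i))
            + (\<Sum>i\<in>I \<inter> {?k<..}. ?n i *s \<gamma> i)))"
          by (simp add: F_linear F_sum F_c sum_negf)
        also have "c (\<gamma> k) + ((\<Sum>i\<in>I \<inter> {..<k}. ?n i *s c (\<gamma> i))
            + (\<Sum>i\<in>I \<inter> {?k<..}. ?n i *s \<gamma> i)) = \<gamma> ?k"
          using flip_out[OF I] by (metis add.commute diff_add_cancel)
        finally show ?thesis using 3 True by simp
      qed
    qed
  qed
qed

lemma proportional_roots:
  assumes "a \<in> roots" "b \<in> roots" "x *s a = y *s b" "x \<noteq> 0"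
  shows "a = b \<or> a = - b"
proof -
  obtain w i where b: "b = rw w (axis i 1)" using assms(2) by (auto simp: roots_def)
  let ?a = "rw (rev w) a"
  have e: "x *s ?a = y *s axis i 1" using arg_cong[OF assms(3), of "rw (rev w)"] b by (simp add: rw_linear)
  have "?a$j = 0" if "j \<noteq> i" for j
    using arg_cong[OF e, of "\<lambda>v. v$j"] that assms(4) by simp
  then have "?a = axis i 1 \<or> - ?a = axis i 1"
    using root_multiple_axis[of ?a i] root_multiple_axis[of "- ?a" i] root_cases[of ?a] assms(1) by auto
  then have "rw w ?a = b \<or> rw w (- ?a) = b" unfolding b by metis
  then show ?thesis by (auto simp: rw_linear)
qed

lemma root_on_line:
  assumes "facet I" "k \<in> I" "b \<in> roots" "\<And>i. i \<in> I \<Longrightarrow> i \<noteq> k \<Longrightarrow> pr b (\<gamma> i) = 0"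
  shows "b = R I k \<or> b = - R I k"
proof (rule proportional_roots)
  show "d (Q!k) *s b = pr b (\<gamma> k) *s R I k"
  proof (rule root_expansion_eqI[OF assms(1)])
    fix i assume "i \<in> I"
    then show "pr (d (Q!k) *s b) (\<gamma> i) = pr (pr b (\<gamma> k) *s R I k) (\<gamma> i)"
      using assms(4)[of i] pr_label[OF assms(1,2), of i] by (simp add: pr_simps)
  qed
  show "d (Q!k) \<noteq> 0" using d_pos[of "Q!k"] by simp
qed (use assms in auto)

lemma R_distinct: "facet I \<Longrightarrow> j \<in> I \<Longrightarrow> k \<in> I \<Longrightarrow> j \<noteq> k \<Longrightarrow> R I j \<noteq> R I k \<and> R I j \<noteq> - R I k"
  using pr_label[of I j j] pr_label[of I k j] d_pos[of "Q!j"] by (auto simp: pr_simps)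

section \<open>Rank two links and signs\<close>

text \<open>By duality these are the positions outside I whose root lies in the plane of the roots
  of j and k.\<close>

definition in_link :: "nat set \<Rightarrow> nat \<Rightarrow> nat \<Rightarrow> nat \<Rightarrow> bool" where
  "in_link I j k p \<longleftrightarrow> p < L \<and> p \<notin> I \<and> (\<forall>i\<in>I - {j, k}. pr (R I p) (\<gamma> i) = 0)"

lemma in_link_commute: "in_link I j k p \<longleftrightarrow> in_link I k j p"
  by (simp add: in_link_def insert_commute)

lemma in_link_opp: assumes "facet I" "j \<in> I" shows "in_link I j k (opp I j)"
  using opp[OF assms(1), of j] pr_label[OF assms] by (auto simp: in_link_def pr_simps)

lemma in_link_root:
  assumes "facet I" "j \<in> I" "k \<in> I" "b \<in> roots" "b = x *s R I j + y *s R I k"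
  obtains p where "in_link I j k p" "R I p = b \<or> R I p = - b"
proof -
  obtain p where p: "p < L" "p \<notin> I" "R I p = b \<or> R I p = - b"
    using root_position[OF assms(1,4)] by auto
  have b0: "pr b (\<gamma> i) = 0" if "i \<in> I - {j, k}" for i
    using that pr_label[OF assms(1,2), of i] pr_label[OF assms(1,3), of i] by (auto simp: assms(5) pr_simps)
  have "pr (R I p) (\<gamma> i) = 0" if "i \<in> I - {j, k}" for i
    using b0[OF that] p(3) by (auto simp: pr_simps)
  then have "in_link I j k p" using p by (auto simp: in_link_def)
  then show ?thesis using that p by blast
qed

text \<open>Reflecting one of two roots that are neither orthogonal nor proportional in the other
  gives a third line of roots in their plane.\<close>

lemma link_extra:
  assumes "facet I" "j \<in> I" "k \<in> I" "j \<noteq> k" "bf (R I j) (R I k) \<noteq> 0"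
  obtains x where "in_link I j k x" "x \<noteq> opp I j" "x \<noteq> opp I k"
proof -
  let ?c = "cp (R I j) (A *v R I k)"
  define b where "b = refl (R I j) (R I k)"
  have b: "b = (- ?c) *s R I j + 1 *s R I k" by (simp add: b_def refl_def vec_eq_iff)
  have c: "?c \<noteq> 0" using assms(5) cp_zero_sym[of "R I j" "R I k"] by simp
  obtain x where x: "in_link I j k x" "R I x = b \<or> R I x = - b"
    using in_link_root[OF assms(1-3) _ b] by (auto simp: b_def)
  have prj: "pr b (\<gamma> j) = - ?c * d (Q!j)" "pr b (\<gamma> k) = d (Q!k)"
    using pr_label[OF assms(1)] assms by (auto simp: b pr_simps)
  have "b \<noteq> R I j" "b \<noteq> - R I j" "b \<noteq> R I k" "b \<noteq> - R I k"
    using prj pr_label[OF assms(1)] assms c d_pos[of "Q!k"] d_pos[of "Q!j"] by (auto simp: pr_simps)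
  then have "x \<noteq> opp I j" "x \<noteq> opp I k"
    using x opp(3)[OF assms(1), of j] opp(3)[OF assms(1), of k] by auto
  then show ?thesis using that x by blast
qed

text \<open>Both identities of a flip in either direction, with one unspecified family of
  coefficients; a flip to the left is read as the reverse of a flip to the right.\<close>

lemma flip_between':
  assumes "facet I" "j \<in> I"
  shows "\<exists>n. \<gamma> j + \<gamma> (opp I j) = (\<Sum>i\<in>I \<inter> {min j (opp I j)<..<max j (opp I j)}. n i *s \<gamma> i) \<and>
    \<gamma> (max j (opp I j)) - c (\<gamma> (min j (opp I j))) =
      (\<Sum>i\<in>I \<inter> {..<min j (opp I j)}. n i *s c (\<gamma> i)) + (\<Sum>i\<in>I \<inter> {max j (opp I j)<..}. n i *s \<gamma> i)"
proof -
  have *: ?thesis if J: "facet J" "k \<in> J" "vp (R J k)" "{k, opp J k} = {j, opp I j}"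
      "J - {k} = I - {j}" "opp J k \<notin> J" "opp I j \<notin> I" for J k
  proof -
    let ?k = "opp J k"
    have k: "k < ?k" using opp_pos[OF J(1-3)] by simp
    have mm: "min j (opp I j) = k" "max j (opp I j) = ?k" using J(4) k by (auto simp: doubleton_eq_iff)
    have sets: "I \<inter> {k<..<?k} = J \<inter> {k<..<?k}" "I \<inter> {..<k} = J \<inter> {..<k}" "I \<inter> {?k<..} = J \<inter> {?k<..}"
    proof -
      have "j \<in> {k, ?k}" using J(4) by blast
      then have "i \<in> I \<longleftrightarrow> i \<in> J" if "i \<noteq> k" "i \<noteq> ?k" for i using J(5) that by blast
      then show "I \<inter> {k<..<?k} = J \<inter> {k<..<?k}" "I \<inter> {..<k} = J \<inter> {..<k}" "I \<inter> {?k<..} = J \<inter> {?k<..}"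
        using k by auto
    qed
    define n where "n i = (if k < i \<and> i < ?k then - cc J k i else cc J k i)" for i
    have "\<gamma> j + \<gamma> (opp I j) = \<gamma> k + \<gamma> ?k" using J(4) by (auto simp: doubleton_eq_iff add.commute)
    also have "\<dots> = (\<Sum>i\<in>J \<inter> {k<..<?k}. n i *s \<gamma> i)"
      unfolding flip_between[OF J(1-3)] sum_negf[symmetric]
      by (intro sum.cong) (auto simp: n_def vec_eq_iff)
    finally have 1: "\<gamma> j + \<gamma> (opp I j) = (\<Sum>i\<in>J \<inter> {k<..<?k}. n i *s \<gamma> i)" .
    have 2: "\<gamma> ?k - c (\<gamma> k) = (\<Sum>i\<in>J \<inter> {..<k}. n i *s c (\<gamma> i)) + (\<Sum>i\<in>J \<inter> {?k<..}. n i *s \<gamma> i)"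
      unfolding flip_out[OF J(1-3)]
      by (intro arg_cong2[of _ _ _ _ "(+)"] sum.cong) (use k in \<open>auto simp: n_def\<close>)
    show ?thesis using 1 2 unfolding mm sets by blast
  qed
  show ?thesis
  proof (cases "vp (R I j)")
    case True
    then show ?thesis by (intro *[OF assms(1,2)]) (use opp(2)[OF assms(1)] in auto)
  next
    case False
    let ?J = "flip I j" and ?k = "opp I j"
    have "vp (R ?J ?k)" using False not_vp_iff[of "R I j"] by (simp add: R_flip_opp[OF assms])
    moreover have "?J - {?k} = I - {j}" "j \<notin> ?J" "?k \<notin> I"
      using opp(2)[OF assms(1), of j] assms(2) by (auto simp: flip_def)
    ultimately show ?thesis
      by (intro *[OF facet_flip[OF assms] opp_mem_flip]) (auto simp: opp_flip[OF assms])
  qed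
qed

text \<open>If x were outside the interval, F with x would vanish on the weights in between, hence
  on the sum of the weights of j and its opposite. Both summands are nonpositive, so both vanish.
  This puts the root of x on the line of k, so that x is the opposite of k.\<close>

lemma link_inside:
  assumes I: "facet I" "j \<in> I" "k \<in> I" "j \<noteq> k" and x: "in_link I j k x" "x \<noteq> opp I j" "x \<noteq> opp I k"
    and k: "\<not> (min j (opp I j) < k \<and> k < max j (opp I j))"
  shows "min j (opp I j) < x \<and> x < max j (opp I j)"
proof (rule ccontr)
  assume out': "\<not> ?thesis"
  define lo hi where "lo = min j (opp I j)" and "hi = max j (opp I j)"
  note lohi = lo_def[symmetric] hi_def[symmetric]
  have jlohi: "j = lo \<and> opp I j = hi \<or> j = hi \<and> opp I j = lo" by (auto simp: lo_def hi_def min_def max_def)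
  note out = out'[unfolded lohi] and k = k[unfolded lohi]
  have xI: "x < L" "x \<notin> I" and x0: "\<And>i. i \<in> I - {j, k} \<Longrightarrow> pr (R I x) (\<gamma> i) = 0"
    using x(1) by (auto simp: in_link_def)
  have loj: "j < L" "opp I j < L" using facet_less[OF I(1,2)] opp[OF I(1), of j] by auto
  have xne: "x \<noteq> lo" "x \<noteq> hi" using xI x(2) I(2) jlohi by auto
  obtain n where n: "\<gamma> j + \<gamma> (opp I j) = (\<Sum>i\<in>I \<inter> {lo<..<hi}. n i *s \<gamma> i)"
    using flip_between'[OF I(1,2), unfolded lohi] by blast
  have ij: "i \<noteq> j" "i \<noteq> k" if "i \<in> I \<inter> {lo<..<hi}" for i using that k jlohi by auto
  have "pr (R I x) (\<gamma> j) = 0"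
  proof (cases "x < lo")
    case True
    have "F (\<gamma> x) (\<gamma> i) = 0" if "i \<in> I \<inter> {lo<..<hi}" for i
    proof -
      have "\<not> i < x" "i \<in> I" using that True by auto
      then show ?thesis using pr_R_label[OF I(1) _ xI, of i] x0[of i] ij[OF that] by simp
    qed
    then have "F (\<gamma> x) (\<gamma> j + \<gamma> (opp I j)) = 0" unfolding n by (simp add: F_sum F_linear)
    moreover have "F (\<gamma> x) (\<gamma> j) \<le> 0" "F (\<gamma> x) (\<gamma> (opp I j)) \<le> 0"
      using F_neg[of x j] F_neg[of x "opp I j"] True loj jlohi out xne by (auto simp: lo_def)
    ultimately have "F (\<gamma> x) (\<gamma> j) = 0" by (simp add: F_linear)
    moreover have "\<not> j < x" using True by (auto simp: lo_def)
    ultimately show ?thesis using pr_R_label[OF I(1,2) xI] by simp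
  next
    case False
    then have hx: "hi < x" using out xne by linarith
    have "F (\<gamma> i) (\<gamma> x) = 0" if "i \<in> I \<inter> {lo<..<hi}" for i
    proof -
      have "i < hi" "i \<in> I" using that by auto
      then have "i < x" "i \<in> I" using hx by linarith+
      then show ?thesis using pr_R_label[OF I(1) _ xI, of i] x0[of i] ij[OF that] by simp
    qed
    then have "F (\<gamma> j + \<gamma> (opp I j)) (\<gamma> x) = 0" unfolding n by (simp add: F_sum F_linear)
    moreover have "F (\<gamma> j) (\<gamma> x) \<le> 0" "F (\<gamma> (opp I j)) (\<gamma> x) \<le> 0"
      using F_neg[of j x] F_neg[of "opp I j" x] hx xI by (auto simp: hi_def)
    ultimately have "F (\<gamma> j) (\<gamma> x) = 0" by (simp add: F_linear)
    moreover have "j < x" using hx by (auto simp: hi_def)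
    ultimately show ?thesis using pr_R_label[OF I(1,2) xI] by simp
  qed
  then have "R I x = R I k \<or> R I x = - R I k"
    using root_on_line[OF I(1,3), of "R I x"] x0 by auto
  then show False using opp_eqI[OF I(1) xI, of k] x(3) by auto
qed

text \<open>The argument of \<open>link_inside\<close> with the outer identity: for x inside, F
  turns it into a vanishing sum of two nonpositive numbers.\<close>

lemma link_outside:
  assumes I: "facet I" "j \<in> I" "k \<in> I" "j \<noteq> k" and x: "in_link I j k x" "x \<noteq> opp I j" "x \<noteq> opp I k"
    and k: "min j (opp I j) < k \<and> k < max j (opp I j)"
  shows "\<not> (min j (opp I j) < x \<and> x < max j (opp I j))"
proof
  assume inn': "min j (opp I j) < x \<and> x < max j (opp I j)"
  define lo hi where "lo = min j (opp I j)" and "hi = max j (opp I j)"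
  note lohi = lo_def[symmetric] hi_def[symmetric]
  have jlohi: "j = lo \<and> opp I j = hi \<or> j = hi \<and> opp I j = lo" by (auto simp: lo_def hi_def min_def max_def)
  note inn = inn'[unfolded lohi] and k = k[unfolded lohi]
  have xI: "x < L" "x \<notin> I" and x0: "\<And>i. i \<in> I - {j, k} \<Longrightarrow> pr (R I x) (\<gamma> i) = 0"
    using x(1) by (auto simp: in_link_def)
  have loj: "lo < L" "hi < L" using facet_less[OF I(1,2)] opp[OF I(1), of j] jlohi by auto
  obtain n where n: "\<gamma> hi - c (\<gamma> lo) =
      (\<Sum>i\<in>I \<inter> {..<lo}. n i *s c (\<gamma> i)) + (\<Sum>i\<in>I \<inter> {hi<..}. n i *s \<gamma> i)"
    using flip_between'[OF I(1,2), unfolded lohi] by blast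
  have jl: "lo \<le> j" "j \<le> hi" by (auto simp: lo_def hi_def)
  have 1: "F (\<gamma> i) (\<gamma> x) = 0" if "i \<in> I \<inter> {..<lo}" for i
  proof -
    have i: "i < lo" "i \<in> I" using that by auto
    then have "i < x" "i \<noteq> j" "i \<noteq> k" using inn k jl by linarith+
    then show ?thesis using pr_R_label[OF I(1) _ xI, of i] x0[of i] i by simp
  qed
  have 2: "F (\<gamma> x) (\<gamma> i) = 0" if "i \<in> I \<inter> {hi<..}" for i
  proof -
    have i: "hi < i" "i \<in> I" using that by auto
    then have "\<not> i < x" "i \<noteq> j" "i \<noteq> k" using inn k jl by linarith+
    then show ?thesis using pr_R_label[OF I(1) _ xI, of i] x0[of i] i by simp
  qed
  have "F (\<gamma> x) (\<gamma> hi - c (\<gamma> lo)) = 0" unfolding n using 1 2 by (simp add: F_sum F_linear F_c)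
  then have "F (\<gamma> x) (\<gamma> hi) + F (\<gamma> lo) (\<gamma> x) = 0" by (simp add: F_linear F_c)
  moreover have "F (\<gamma> x) (\<gamma> hi) \<le> 0" "F (\<gamma> lo) (\<gamma> x) \<le> 0"
    using F_neg[of x hi] F_neg[of lo x] inn loj xI by blast+
  ultimately have "F (\<gamma> x) (\<gamma> hi) = 0" "F (\<gamma> lo) (\<gamma> x) = 0" by linarith+
  note zero = this
  from jlohi have "j = lo \<or> j = hi" by blast
  then have "pr (R I x) (\<gamma> j) = 0"
  proof
    assume j: "j = lo"
    then have "j < x" "F (\<gamma> j) (\<gamma> x) = 0" using zero inn by metis+
    then show ?thesis using pr_R_label[OF I(1,2) xI] by simp
  next
    assume j: "j = hi"
    then have "\<not> j < x" "F (\<gamma> x) (\<gamma> j) = 0" using zero inn by (metis less_asym)+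
    then show ?thesis using pr_R_label[OF I(1,2) xI] by simp
  qed
  then have "R I x = R I k \<or> R I x = - R I k"
    using root_on_line[OF I(1,3), of "R I x"] x0 by auto
  then show False using opp_eqI[OF I(1) xI, of k] x(3) by auto
qed

text \<open>Neither root is on the line of j, so both pair nontrivially with the weight of k, which
  can be eliminated.\<close>

lemma link_combination:
  assumes I: "facet I" "j \<in> I" "k \<in> I" "j \<noteq> k" and x: "in_link I j k x" "x \<noteq> opp I j"
    and y: "in_link I j k y" "y \<noteq> opp I j"
  obtains a b t where "a > 0" "b \<noteq> 0" "a *s R I x = b *s R I y + t *s R I j"
proof -
  have nz: "pr (R I p) (\<gamma> k) \<noteq> 0" if "in_link I j k p" "p \<noteq> opp I j" for p
  proof
    assume 0: "pr (R I p) (\<gamma> k) = 0"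
    have "R I p = R I j \<or> R I p = - R I j"
      using root_on_line[OF I(1,2), of "R I p"] 0 that(1) by (auto simp: in_link_def)
    then show False using opp_eqI[OF I(1), of p j] that by (auto simp: in_link_def)
  qed
  define x1 x2 y1 y2 where "x1 = pr (R I x) (\<gamma> j)" "x2 = pr (R I x) (\<gamma> k)"
    "y1 = pr (R I y) (\<gamma> j)" "y2 = pr (R I y) (\<gamma> k)"
  have nz2: "x2 \<noteq> 0" "y2 \<noteq> 0" using nz[OF x] nz[OF y] by (auto simp: x1_x2_y1_y2_def)
  let ?D = "d (Q!j)"
  have D: "?D > 0" by (rule d_pos)
  have eq: "(?D * y2) *s R I x = (?D * x2) *s R I y + (y2 * x1 - x2 * y1) *s R I j"
  proof (rule root_expansion_eqI[OF I(1)])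
    fix i assume "i \<in> I"
    then show "pr ((?D * y2) *s R I x) (\<gamma> i) = pr ((?D * x2) *s R I y + (y2 * x1 - x2 * y1) *s R I j) (\<gamma> i)"
      using x(1) y(1) pr_label[OF I(1,2), of i] I(4)
      by (cases "i = j"; cases "i = k") (auto simp: pr_simps in_link_def x1_x2_y1_y2_def algebra_simps)
  qed
  show thesis
  proof (cases "y2 > 0")
    case True
    then show ?thesis using that[OF _ _ eq] nz2 D by simp
  next
    case False
    have "(- (?D * y2)) *s R I x = (- (?D * x2)) *s R I y + (- (y2 * x1 - x2 * y1)) *s R I j"
      using arg_cong[OF eq, of uminus] by (simp add: vec_eq_iff)
    note that[OF _ _ this]
    moreover have "- (?D * y2) > 0" using False nz2 D by (simp add: mult_less_0_iff)
    ultimately show ?thesis using nz2 D by simp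
  qed
qed

text \<open>Express the root of x by those of y and j. Transported by \<open>vi\<close> to j, to the
  opposite of j and to just behind it, the three roots have known signs, and no choice of
  coefficients is compatible with them.\<close>

lemma link_sides_pos:
  assumes I: "facet I" "j \<in> I" "k \<in> I" "j \<noteq> k" and pos: "vp (R I j)"
    and x: "in_link I j k x" "j < x" "x < opp I j"
    and y: "in_link I j k y" "y < j \<or> opp I j < y"
  shows False
proof -
  let ?j = "opp I j"
  have jj: "j < ?j" "R I ?j = R I j" "?j < L" "?j \<notin> I" using opp_pos[OF I(1,2) pos] opp[OF I(1)] by auto
  have xI: "x < L" "x \<notin> I" and yI: "y < L" "y \<notin> I" using x(1) y(1) by (auto simp: in_link_def)
  obtain a b t where abt: "a > 0" "b \<noteq> 0" "a *s R I x = b *s R I y + t *s R I j"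
    by (rule link_combination[OF I x(1) _ y(1)]) (use x y jj in auto)
  \<comment> \<open>With this sign the root of y is positive at all three places: y on the left has
    already turned its root negative, y on the right has not.\<close>
  define s :: int where "s = (if y < j then - 1 else 1)"
  have s: "s * s = 1" "s \<noteq> 0" by (auto simp: s_def)
  define Y where "Y = s *s R I y"
  define B where "B = b * s"
  have bY: "b *s R I y = B *s Y" using s by (simp add: Y_def B_def vec_eq_iff ac_simps)
  have Ye: "Y = (if y < j then - R I y else R I y)" by (simp add: Y_def s_def vec_eq_iff)
  then have Yr: "Y \<in> roots" by simp
  have eq: "a *s R I x = B *s Y + t *s R I j" using abt bY by simp
  have B0: "B \<noteq> 0" using abt s by (simp add: B_def)
  have sY: "vp (vi I q Y)" if "q = j \<or> q = ?j \<or> q = Suc ?j" for q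
  proof (cases "y < j")
    case True
    have "y < q" "q \<le> L" using that True jj(1,3) by auto
    then have "\<not> vp (vi I q (R I y))" using vi_sign[OF I(1) yI, of q] by simp
    then have "vp (- vi I q (R I y))" using not_vp_iff[of "vi I q (R I y)"] by simp
    then show ?thesis using True by (simp add: Ye vi_linear)
  next
    case False
    then have "q \<le> y" "q \<le> L" using that jj(1,3) y(2) yI(1) by auto
    then have "vp (vi I q (R I y))" using vi_sign[OF I(1) yI, of q] by simp
    then show ?thesis using False by (simp add: Ye)
  qed
  have sx: "vp (vi I j (R I x))" "\<not> vp (vi I ?j (R I x))" "\<not> vp (vi I (Suc ?j) (R I x))"
    using vi_sign[OF I(1) xI] x jj by auto
  have sj: "vp (vi I ?j (R I j))" "\<not> vp (vi I (Suc ?j) (R I j))"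
    using vi_sign[OF I(1) jj(3,4)] jj by auto
  have appl: "a *s vi I q (R I x) = B *s vi I q Y + t *s vi I q (R I j)" for q
    using arg_cong[OF eq, of "vi I q"] by (simp add: vi_linear)
  show False
  proof (cases "B > 0")
    case True
    show ?thesis
    proof (cases "t \<ge> 0")
      case t: True
      have "vp (a *s vi I ?j (R I x))"
        unfolding appl using True t sY sj by (intro vp_add vp_scale) auto
      then have "vp (vi I ?j (R I x))" using abt(1) by (auto simp: vp_def zero_le_mult_iff)
      then show False using sx by simp
    next
      case t: False
      have "B *s (- vi I (Suc ?j) Y) = a *s (- vi I (Suc ?j) (R I x)) + (- t) *s (- vi I (Suc ?j) (R I j))"
        using appl[of "Suc ?j"] by (simp add: vec_eq_iff)
      moreover have "vp (- vi I (Suc ?j) (R I x))" "vp (- vi I (Suc ?j) (R I j))"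
        using sx sj not_vp_iff[of "vi I (Suc ?j) (R I x)"] not_vp_iff[of "vi I (Suc ?j) (R I j)"] by auto
      ultimately have "vp (B *s (- vi I (Suc ?j) Y))"
        using t abt(1) by (metis vp_add vp_scale less_imp_le neg_0_le_iff_le not_le)
      then have "vp (- vi I (Suc ?j) Y)" using True by (auto simp: vp_def mult_le_0_iff zero_le_mult_iff)
      then show False using sY[of "Suc ?j"] vp_not_uminus[of "vi I (Suc ?j) Y"] Yr by auto
    qed
  next
    case False
    then have B: "- B > 0" using B0 by simp
    \<comment> \<open>For negative B the contradiction comes from j itself, where the root of j is
      simple and hence extreme.\<close>
    have e: "t *s axis (Q!j) 1 = a *s vi I j (R I x) + (- B) *s vi I j Y"
      using appl[of j] by (simp add: vec_eq_iff)
    have "t > 0"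
    proof (rule ccontr)
      assume "\<not> t > 0"
      have "vp (a *s vi I j (R I x) + (- B) *s vi I j Y)"
        using sx sY B abt(1) by (intro vp_add vp_scale) auto
      then have "vp (t *s axis (Q!j) 1)" using e by simp
      then have "0 \<le> (t *s axis (Q!j) 1 :: int^'i) $ (Q!j)" unfolding vp_def by blast
      then have "t = 0" using \<open>\<not> t > 0\<close> by simp
      then have z: "a * (vi I j (R I x))$i + (- B) * (vi I j Y)$i = 0" for i
        using arg_cong[OF e, of "\<lambda>v. v$i"] by simp
      have "(vi I j (R I x))$i = 0" for i
      proof -
        have "(vi I j (R I x))$i \<ge> 0" "(vi I j Y)$i \<ge> 0" using sx(1) sY[of j] by (auto simp: vp_def)
        then have "a * (vi I j (R I x))$i \<ge> 0" "(- B) * (vi I j Y)$i \<ge> 0" using B abt(1) by (auto intro: mult_nonpos_nonneg)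
        then have "a * (vi I j (R I x))$i = 0" using z[of i] by linarith
        then show ?thesis using abt(1) by simp
      qed
      then show False using roots_nonzero[of "vi I j (R I x)"] by (simp add: vec_eq_iff)
    qed
    then have "vi I j (R I x) = axis (Q!j) 1"
      using indecomposable_axis(1)[OF _ _ sx(1) sY[of j] abt(1) B _ e] Yr by auto
    then have "R I x = R I j" by (metis vv_vi R_def)
    then show False using R_inj[OF I(1) xI jj(3,4)] jj x by auto
  qed
qed

lemma in_link_flip:
  assumes I: "facet I" "j \<in> I" "k \<in> I" "j \<noteq> k" and x: "in_link I j k x" "x \<noteq> opp I j"
  shows "in_link (flip I j) (opp I j) k x" "x \<noteq> j"
proof -
  have xI: "x < L" "x \<notin> I" using x(1) by (auto simp: in_link_def)
  then show "x \<noteq> j" using I by auto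
  have "pr (R (flip I j) x) (\<gamma> i) = 0" if "i \<in> I - {j, k}" for i
  proof -
    have "pr (R I j) (\<gamma> i) = 0" using pr_label[OF I(1,2), of i] that by auto
    moreover have "pr (R I x) (\<gamma> i) = 0" using x(1) that by (auto simp: in_link_def)
    ultimately show ?thesis using R_flip[OF I(1,2) xI(1)] by (simp add: pr_refl wrefl_fixed)
  qed
  then show "in_link (flip I j) (opp I j) k x"
    using xI x(2) by (auto simp: in_link_def flip_def)
qed

lemma link_sides:
  assumes I: "facet I" "j \<in> I" "k \<in> I" "j \<noteq> k"
    and x: "in_link I j k x" "min j (opp I j) < x" "x < max j (opp I j)"
    and y: "in_link I j k y" "y \<noteq> opp I j" "\<not> (min j (opp I j) < y \<and> y < max j (opp I j))"
  shows False
proof -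
  have yI: "y \<notin> I" using y(1) by (simp add: in_link_def)
  then have yj: "y \<noteq> j" using I by auto
  show False
  proof (cases "vp (R I j)")
    case True
    then show ?thesis
      using link_sides_pos[OF I True x(1) _ _ y(1)] x y yj opp_pos[OF I(1,2)] by auto
  next
    case False
    let ?J = "flip I j" and ?j = "opp I j"
    have J: "facet ?J" "?j \<in> ?J" "k \<in> ?J" "?j \<noteq> k"
      using facet_flip[OF I(1,2)] opp_mem_flip[of I j] I(3,4) opp(2)[OF I(1), of j] by (auto simp: flip_def)
    have neg: "?j < j" using opp_neg[OF I(1,2) False] by simp
    have pos: "vp (R ?J ?j)" using False not_vp_iff[of "R I j"] by (simp add: R_flip_opp[OF I(1,2)])
    have o: "opp ?J ?j = j" by (rule opp_flip[OF I(1,2)])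
    show False
      using link_sides_pos[OF J pos in_link_flip(1)[OF I x(1)] _ _ in_link_flip(1)[OF I y(1,2)]]
        x y yj neg unfolding o by auto
  qed
qed

text \<open>No root of the plane changes sign between j and k. With an acute angle, the reflection
  of the root of k in that of j would stay positive and the simple root at k would
  decompose.\<close>

lemma link_obtuse:
  assumes I: "facet I" "j \<in> I" "k \<in> I" "j < k"
    and none: "\<And>x. in_link I j k x \<Longrightarrow> j < x \<Longrightarrow> x < k \<Longrightarrow> False"
  shows "bf (R I j) (R I k) \<le> 0"
proof (rule ccontr)
  assume "\<not> ?thesis"
  then have bf: "bf (R I j) (R I k) > 0" by simp
  let ?p = "cp (R I j) (A *v R I k)"
  have p: "?p > 0"
    using bf bf_cp[OF R_roots, of I j "R I k"] dd_pos[OF R_roots, of I j] by (simp add: zero_less_mult_iff)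
  have kL: "k < L" using facet_less[OF I(1,3)] .
  have same: "vp (vi I j b) \<longleftrightarrow> vp (vi I k b)" if b: "b \<in> roots" "b = u *s R I j + v *s R I k" for b u v
  proof -
    obtain x where x: "in_link I j k x" "R I x = b \<or> R I x = - b"
      using in_link_root[OF I(1-3) b] by blast
    then have xI: "x < L" "x \<notin> I" by (auto simp: in_link_def)
    then have "x \<noteq> j" "x \<noteq> k" using I by auto
    then have "x < j \<or> k < x" using none[OF x(1)] by (metis nat_neq_iff)
    then have eq: "vp (vi I j (R I x)) \<longleftrightarrow> vp (vi I k (R I x))"
      using vi_sign[OF I(1) xI, of j] vi_sign[OF I(1) xI, of k] I(4) kL by auto
    from x(2) show ?thesis
    proof
      assume "R I x = - b"
      then have "vp (- vi I j b) \<longleftrightarrow> vp (- vi I k b)" using eq by (simp add: vi_linear)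
      then show ?thesis using not_vp_iff[of "vi I j b"] not_vp_iff[of "vi I k b"] b(1) by auto
    next
      assume "R I x = b"
      then show ?thesis using eq by simp
    qed
  qed
  have R1: "R I j = 1 *s R I j + 0 *s R I k" "R I k = 0 *s R I j + 1 *s R I k" by (auto simp: vec_eq_iff)
  have sj: "vp (vi I k (R I j))" using same[OF _ R1(1)] by simp
  have sk: "vp (vi I j (R I k))" using same[OF _ R1(2)] by simp
  define b where "b = refl (R I j) (R I k)"
  have b: "b = (- ?p) *s R I j + 1 *s R I k" by (simp add: b_def refl_def vec_eq_iff)
  have br: "b \<in> roots" by (simp add: b_def)
  have "vi I j b = sr (Q!j) (vi I j (R I k))"
    unfolding b_def using vv_sr[of I j "vi I j (R I k)"] by (metis vi_vv vv_vi)
  moreover have "vi I j (R I k) \<noteq> axis (Q!j) 1"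
    using R_distinct[OF I(1-3)] I(4) by (metis R_def vv_vi less_irrefl)
  ultimately have "vp (vi I j b)" using vp_sr sk by simp
  then have sb: "vp (vi I k b)" using same[OF br b] by simp
  have "1 *s axis (Q!k) 1 = 1 *s vi I k b + ?p *s vi I k (R I j)"
    using arg_cong[OF b, of "vi I k"] by (simp add: vi_linear vec_eq_iff)
  then have "vi I k (R I j) = axis (Q!k) 1"
    using indecomposable_axis(2)[OF _ _ sb sj, of 1 ?p 1] p br by auto
  then have "R I j = R I k" by (metis vv_vi R_def)
  then show False using R_distinct[OF I(1-3)] I(4) by auto
qed

text \<open>Here every root of the plane changes sign between j and k. With an obtuse angle the
  reflected root decomposes the simple root at j or the one at k, depending on the sign with which
  it occurs at a position.\<close>

lemma link_acute:
  assumes I: "facet I" "j \<in> I" "k \<in> I" "j < k" "vp (R I j)" "opp I j < k"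
    and all: "\<And>x. in_link I j k x \<Longrightarrow> x = opp I j \<or> j < x \<and> x < opp I j"
  shows "bf (R I j) (R I k) \<ge> 0"
proof (rule ccontr)
  assume "\<not> ?thesis"
  then have bf: "bf (R I j) (R I k) < 0" by simp
  let ?p = "cp (R I j) (A *v R I k)" and ?j = "opp I j" and ?k = "opp I k"
  have p: "?p < 0"
    using bf bf_cp[OF R_roots, of I j "R I k"] dd_pos[OF R_roots, of I j] by (simp add: mult_less_0_iff)
  have kL: "k < L" using facet_less[OF I(1,3)] .
  have jj: "j < ?j" "R I ?j = R I j" using opp_pos[OF I(1,2,5)] by auto
  have lk: "in_link I j k ?k" using in_link_opp[OF I(1,3), of j] in_link_commute by auto
  have all': "j \<le> x \<and> x < k" if "in_link I j k x" for x using all[OF that] jj I(6) by auto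
  have sgn: "vp (vi I j (R I x))" "\<not> vp (vi I k (R I x))" if "in_link I j k x" for x
    using vi_sign[OF I(1), of x j] vi_sign[OF I(1), of x k] that all'[OF that] kL
    by (auto simp: in_link_def)
  have "\<not> vp (R I k)" using opp_pos[OF I(1,3)] all'[OF lk] by auto
  then have Rk: "R I ?k = - R I k" using opp_neg[OF I(1,3)] by simp
  define b where "b = refl (R I j) (R I k)"
  have b: "b = (- ?p) *s R I j + 1 *s R I k" by (simp add: b_def refl_def vec_eq_iff)
  have br: "b \<in> roots" by (simp add: b_def)
  obtain x where x: "in_link I j k x" "R I x = b \<or> R I x = - b"
    using in_link_root[OF I(1-3) br b] by blast
  have sk: "vp (vi I j (- R I k))" using sgn(1)[OF lk] Rk by simp
  have "\<not> vp (vi I k (R I j))" using sgn(2)[of ?j] jj in_link_opp[OF I(1,2)] by simp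
  then have sj: "vp (- vi I k (R I j))" using not_vp_iff[of "vi I k (R I j)"] by simp
  from x(2) show False
  proof
    assume "R I x = b"
    then have sb: "vp (vi I j b)" using sgn(1)[OF x(1)] by simp
    have e: "(- ?p) *s axis (Q!j) 1 = 1 *s vi I j b + 1 *s vi I j (- R I k)"
      using arg_cong[OF b, of "vi I j"] by (simp add: vi_linear vec_eq_iff)
    have "vi I j (- R I k) = axis (Q!j) 1"
      using indecomposable_axis(2)[OF _ _ sb sk _ _ _ e] p br by auto
    then have "- R I k = R I j" by (metis vv_vi R_def)
    then show False using R_distinct[OF I(1-3)] I(4) by (metis less_irrefl minus_minus)
  next
    assume Rx: "R I x = - b"
    then have "\<not> vp (- vi I k b)" using sgn(2)[OF x(1)] by (simp add: vi_linear)
    then have sb: "vp (vi I k b)" using not_vp_iff[of "vi I k b"] br by auto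
    have e: "1 *s axis (Q!k) 1 = 1 *s vi I k b + (- ?p) *s (- vi I k (R I j))"
      using arg_cong[OF b, of "vi I k"] by (simp add: vi_linear vec_eq_iff)
    have "- vi I k (R I j) = axis (Q!k) 1"
      using indecomposable_axis(2)[OF _ _ sb sj _ _ _ e] p br by auto
    then have "vi I k (- R I j) = axis (Q!k) 1" by (simp add: vi_linear)
    then have "- R I j = R I k" by (metis vv_vi R_def)
    then show False using R_distinct[OF I(1-3)] I(4) by (metis less_irrefl minus_minus)
  qed
qed

text \<open>For nonorthogonal roots a third position of the link exists. Its place decides whether
  the rest of the link lies inside or outside the interval of the flip, and the order of the link
  determines the angle.\<close>

theorem link_signs:
  assumes I: "facet I" "j \<in> I" "k \<in> I" "j \<noteq> k" "vp (R I j)"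
  shows "k < opp I j \<Longrightarrow> bf (R I j) (R I k) \<le> 0" "opp I j < k \<Longrightarrow> bf (R I j) (R I k) \<ge> 0"
proof -
  let ?j = "opp I j"
  have jj: "j < ?j" using opp_pos[OF I(1,2,5)] by auto
  then have mm: "min j ?j = j" "max j ?j = ?j" by auto
  have "(k < ?j \<longrightarrow> bf (R I j) (R I k) \<le> 0) \<and> (?j < k \<longrightarrow> bf (R I j) (R I k) \<ge> 0)"
  proof (cases "bf (R I j) (R I k) = 0")
    case False
    obtain x0 where x0: "in_link I j k x0" "x0 \<noteq> ?j" "x0 \<noteq> opp I k"
      using link_extra[OF I(1-4) False] by blast
    show ?thesis
    proof (cases "j < k \<and> k < ?j")
      case True
      have "\<not> (j < x0 \<and> x0 < ?j)" using link_outside[OF I(1-4) x0] True mm by auto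
      then have "\<not> (j < x \<and> x < ?j)" if "in_link I j k x" for x
        using link_sides[OF I(1-4) that _ _ x0(1,2)] mm by auto
      then have "bf (R I j) (R I k) \<le> 0" using True by (intro link_obtuse I) (meson less_trans)+
      then show ?thesis using True by auto
    next
      case out: False
      have ins: "j < x0 \<and> x0 < ?j" using link_inside[OF I(1-4) x0] out mm by auto
      have all: "x = ?j \<or> j < x \<and> x < ?j" if "in_link I j k x" for x
        using link_sides[OF I(1-4) x0(1) _ _ that] ins mm by auto
      have "k \<noteq> ?j" using opp(2)[OF I(1), of j] I(3) by auto
      then consider "k < j" | "?j < k" using out I(4) by linarith
      then show ?thesis
      proof cases
        case 1
        have "bf (R I k) (R I j) \<le> 0"
        proof (rule link_obtuse[OF I(1,3,2) 1])
          fix x assume "in_link I k j x" "x < j"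
          then show False using all[of x] jj in_link_commute[of I k j x] by auto
        qed
        then show ?thesis using 1 jj bf_sym[of "R I j" "R I k"] by auto
      next
        case 2
        then have "bf (R I j) (R I k) \<ge> 0" using link_acute[OF I(1-3) _ I(5) _ all] jj by auto
        then show ?thesis using 2 by auto
      qed
    qed
  qed simp
  then show "k < opp I j \<Longrightarrow> bf (R I j) (R I k) \<le> 0" "opp I j < k \<Longrightarrow> bf (R I j) (R I k) \<ge> 0" by auto
qed

end

section \<open>Exchange matrices and coefficients of facets\<close>

context coxeter_complex
begin

definition bb :: "nat set \<Rightarrow> nat \<Rightarrow> nat \<Rightarrow> int" where
  "bb I i j = (if i < j then - cc I j i else if j < i then cc I j i else 0)"

definition co :: "nat set \<Rightarrow> nat \<Rightarrow> int^'i \<Rightarrow> int" where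
  "co I p v = (vi I p v) $ (Q!p)"

text \<open>The exponent of the coefficient at p in the y-variable of j: the coordinate, at the
  letter of p, of the root of j read just before p. The tie p = j counts as left, so that
  \<open>yy_self\<close> is 1.\<close>

definition yy :: "nat set \<Rightarrow> nat \<Rightarrow> nat \<Rightarrow> int" where
  "yy I p j = (if p \<le> j then co I p (R I j) else - co I p (R I j))"

lemma co_linear: "co I p (u + v) = co I p u + co I p v" "co I p (u - v) = co I p u - co I p v"
  "co I p (- u) = - co I p u" "co I p (k *s u) = k * co I p u"
  by (simp_all add: co_def vi_linear)

lemma cc_signs:
  assumes "facet I" "k \<in> I" "vp (R I k)" "i \<in> I" "i \<noteq> k"
  shows "i < opp I k \<Longrightarrow> cc I k i \<le> 0 \<and> cc I i k \<le> 0" "opp I k < i \<Longrightarrow> cc I k i \<ge> 0 \<and> cc I i k \<ge> 0"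
  using link_signs[OF assms(1,2,4) assms(5)[symmetric] assms(3)] cp_sign[of "R I k" "R I i"]
    cp_sign[of "R I i" "R I k"] bf_sym[of "R I k" "R I i"]
  by (simp_all add: cc_def)

lemma R_flip_pos:
  assumes "facet I" "k \<in> I" "vp (R I k)" "p < L"
  shows "R (flip I k) p = (if k < p \<and> p \<le> opp I k then refl (R I k) (R I p) else R I p)"
  using R_flip[OF assms(1,2,4)] opp_pos[OF assms(1-3)] by (simp add: min_def max_def)

lemma cp_refl_left:
  assumes "b \<in> roots" "u \<in> roots"
  shows "cp (refl b u) (A *v v) = cp u (A *v v) - cp b (A *v v) * cp u (A *v b)"
proof -
  have "cp (refl b u) (A *v v) = cp (refl b u) (wrefl b (wrefl b (A *v v)))" using assms by simp
  also have "\<dots> = cp u (wrefl b (A *v v))" by (rule cp_refl[OF assms])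
  finally show ?thesis using assms by (simp add: wrefl_def cp_linear)
qed

lemma cp_refl_right:
  assumes "b \<in> roots" "u \<in> roots"
  shows "cp u (A *v refl b v) = cp u (A *v v) - cp b (A *v v) * cp u (A *v b)"
  using assms by (simp add: A_refl wrefl_def cp_linear)

text \<open>The flip reflects exactly the roots strictly inside the interval, so an entry between i
  and j changes only if one of them is inside. By \<open>cc_signs\<close> these are the cases where
  the two factors in the mutation rule can have a common sign.\<close>

lemma bb_flip:
  assumes I: "facet I" "k \<in> I" "vp (R I k)" and ij: "i \<in> I" "j \<in> I" "i \<noteq> k" "j \<noteq> k"
  shows "bb (flip I k) i j = bb I i j + pos (bb I i k) * pos (bb I k j) - pos (- bb I i k) * pos (- bb I k j)"
    and "bb (flip I k) (opp I k) j = - bb I k j"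
    and "bb (flip I k) i (opp I k) = - bb I i k"
proof -
  let ?k = "opp I k" and ?J = "flip I k" and ?b = "R I k"
  have k: "k < ?k" "?k \<notin> I" using opp_pos[OF I] opp[OF I(1)] by auto
  have ne: "i \<noteq> ?k" "j \<noteq> ?k" using ij k by auto
  have RJ: "R ?J l = (if k < l \<and> l < ?k then refl ?b (R I l) else R I l)" if "l \<in> I" for l
    using R_flip_pos[OF I facet_less[OF I(1) that]] that k by (auto simp: le_less)
  have RJk: "R ?J ?k = - ?b" by (rule R_flip_opp[OF I(1,2)])
  define x where "x = cc I k i"
  define y where "y = cc I j k"
  define z where "z = cc I j i"
  have xs: "i < ?k \<Longrightarrow> x \<le> 0" "?k < i \<Longrightarrow> x \<ge> 0" using cc_signs[OF I ij(1,3)] by (auto simp: x_def)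
  have ys: "j < ?k \<Longrightarrow> y \<le> 0" "?k < j \<Longrightarrow> y \<ge> 0" using cc_signs[OF I ij(2,4)] by (auto simp: y_def)
  have ccJ: "cc ?J j i = (if (k < i \<and> i < ?k) = (k < j \<and> j < ?k) then z else z - y * x)"
    using I cp_refl[of ?b "R I i" "A *v R I j"]
    by (auto simp: cc_def RJ ij z_def y_def x_def cp_refl_left cp_refl_right A_refl[symmetric])
  have bik: "bb I i k = (if i < k then - x else x)" using ij by (auto simp: bb_def x_def)
  have bkj: "bb I k j = (if k < j then - y else y)" using ij by (auto simp: bb_def y_def)
  show "bb ?J i j = bb I i j + pos (bb I i k) * pos (bb I k j) - pos (- bb I i k) * pos (- bb I k j)"
  proof (cases "i = j")
    case True
    then have "bb ?J i j = 0" "bb I i j = 0" by (auto simp: bb_def)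
    moreover have "(x \<le> 0 \<and> y \<le> 0) \<or> (x \<ge> 0 \<and> y \<ge> 0)" using xs ys True ne by (metis linorder_neqE_nat)
    ultimately show ?thesis unfolding bik bkj using True ij by (auto simp: Defs.pos_def max_def)
  next
    case False
    have zz: "bb I i j = (if i < j then - z else z)"
      "bb ?J i j = (if i < j then - cc ?J j i else cc ?J j i)" using False by (auto simp: bb_def z_def)
    have ri: "i < k \<or> k < i \<and> i < ?k \<or> ?k < i" and rj: "j < k \<or> k < j \<and> j < ?k \<or> ?k < j"
      using ij ne by linarith+
    show ?thesis unfolding zz bik bkj ccJ
      using ri rj xs ys k by (elim disjE) (auto simp: Defs.pos_def max_def mult_le_0_iff)
  qed
  have rj: "j < k \<or> k < j \<and> j < ?k \<or> ?k < j" and ri: "i < k \<or> k < i \<and> i < ?k \<or> ?k < i"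
    using ij ne by linarith+
  have c1: "cc ?J j ?k = (if k < j \<and> j < ?k then y else - y)"
    by (auto simp: cc_def RJk RJ ij y_def cp_linear cp_refl_right cp_self)
  have c2: "cc ?J ?k i = (if k < i \<and> i < ?k then x else - x)"
    by (auto simp: cc_def RJk RJ ij x_def cp_linear cp_refl_left A_uminus cp_self)
  show "bb ?J ?k j = - bb I k j" unfolding bkj using c1 rj k by (auto simp: bb_def)
  show "bb ?J i ?k = - bb I i k" unfolding bik using c2 ri k by (auto simp: bb_def)
qed

lemma vi_flip:
  assumes I: "facet I" "k \<in> I" "vp (R I k)" and p: "p \<le> L"
  shows "vi (flip I k) p v = (if k < p \<and> p \<le> opp I k then vi I p (refl (R I k) v) else vi I p v)"
proof -
  let ?J = "flip I k"
  have k: "k < opp I k" using opp_pos[OF I] by auto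
  have vvJ: "vv ?J p u = (if k < p \<and> p \<le> opp I k then refl (R I k) (vv I p u) else vv I p u)" for u
    using vv_flip[OF I(1,2) p, of u] k by (simp add: min_def max_def)
  have "vv ?J p (if k < p \<and> p \<le> opp I k then vi I p (refl (R I k) v) else vi I p v) = v"
    by (simp add: vvJ)
  from arg_cong[OF this, of "vi ?J p"] show ?thesis by simp
qed

lemma co_sign:
  assumes I: "facet I" "k \<in> I" "vp (R I k)" and p: "p < L"
  shows "p \<le> opp I k \<Longrightarrow> co I p (R I k) \<ge> 0" "opp I k < p \<Longrightarrow> co I p (R I k) \<le> 0"
proof -
  let ?k = "opp I k"
  have k: "R I ?k = R I k" "?k < L" "?k \<notin> I" using opp_pos[OF I] opp[OF I(1)] by auto
  have s: "vp (vi I p (R I k)) \<longleftrightarrow> p \<le> ?k" using vi_sign[OF I(1) k(2,3), of p] p k(1) by simp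
  show "p \<le> ?k \<Longrightarrow> co I p (R I k) \<ge> 0" using s by (simp add: co_def vp_def)
  assume "?k < p"
  then have "vp (- vi I p (R I k))" using s not_vp_iff[of "vi I p (R I k)"] by simp
  then show "co I p (R I k) \<le> 0" by (simp add: co_def vp_def)
qed

lemma yy_flip_opp:
  assumes I: "facet I" "k \<in> I" "vp (R I k)" and p: "p < L"
  shows "yy (flip I k) p (opp I k) = - yy I p k"
proof -
  have k: "k < opp I k" using opp_pos[OF I] by auto
  have "co (flip I k) p v = (if k < p \<and> p \<le> opp I k then co I p (refl (R I k) v) else co I p v)" for v
    unfolding co_def using vi_flip[OF I, of p v] p by auto
  then show ?thesis
    using k by (simp add: yy_def R_flip_opp[OF I(1,2)] co_linear)
qed

text \<open>The prefix at p and the root of j are each reflected if they lie in the interval, and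
  two reflections cancel. The signs in \<open>cc_signs\<close> and \<open>co_sign\<close> turn the
  remainder into the tropical mutation rule.\<close>

lemma yy_flip:
  assumes I: "facet I" "k \<in> I" "vp (R I k)" and p: "p < L" and j: "j \<in> I" "j \<noteq> k"
  shows "yy (flip I k) p j = yy I p j + pos (bb I k j) * yy I p k - bb I k j * min (yy I p k) 0"
proof -
  let ?k = "opp I k" and ?J = "flip I k" and ?b = "R I k"
  have k: "k < ?k" "?k \<notin> I" using opp_pos[OF I] opp[OF I(1)] by auto
  have ne: "j \<noteq> ?k" using j k by auto
  have RJ: "R ?J l = (if k < l \<and> l < ?k then refl ?b (R I l) else R I l)" if "l \<in> I" for l
    using R_flip_pos[OF I facet_less[OF I(1) that]] that k by (auto simp: le_less)
  have coJ: "co ?J p v = (if k < p \<and> p \<le> ?k then co I p (refl ?b v) else co I p v)" for v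
    unfolding co_def using vi_flip[OF I, of p v] p by auto
  define y where "y = cc I j k"
  define u where "u = co I p (R I j)"
  define w where "w = co I p ?b"
  have ys: "j < ?k \<Longrightarrow> y \<le> 0" "?k < j \<Longrightarrow> y \<ge> 0" using cc_signs[OF I j] by (auto simp: y_def)
  have ws: "p \<le> ?k \<Longrightarrow> w \<ge> 0" "?k < p \<Longrightarrow> w \<le> 0" using co_sign[OF I p] by (auto simp: w_def)
  have bkj: "bb I k j = (if k < j then - y else y)" using j by (auto simp: bb_def y_def)
  have cr: "co I p (refl ?b (R I j)) = u - y * w"
    by (simp add: refl_def co_linear u_def y_def w_def cc_def)
  have 1: "co ?J p (R ?J j) = (if (k < p \<and> p \<le> ?k) = (k < j \<and> j < ?k) then u else u - y * w)"
    unfolding coJ RJ[OF j(1)] using cr by (simp add: u_def)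
  have yk: "yy I p k = (if p \<le> k then w else - w)" and yj: "yy I p j = (if p \<le> j then u else - u)"
    by (simp_all add: yy_def u_def w_def)
  have rj: "j < k \<or> k < j \<and> j < ?k \<or> ?k < j" using j ne by linarith
  have rp: "p \<le> k \<or> k < p \<and> p \<le> ?k \<or> ?k < p" by linarith
  show "yy ?J p j = yy I p j + pos (bb I k j) * yy I p k - bb I k j * min (yy I p k) 0"
    unfolding yk yj bkj yy_def[of ?J] 1 using rj rp ys ws k
    by (elim disjE) (auto simp: Defs.pos_def max_def min_def)
qed

lemma R_flip_mutation:
  assumes I: "facet I" "k \<in> I" "vp (R I k)" and j: "j \<in> I" "j \<noteq> k"
  shows "R (flip I k) j = R I j + pos (bb I k j) *s R I k"
proof -
  have k: "k < opp I k" "opp I k \<notin> I" using opp_pos[OF I] opp[OF I(1)] by auto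
  have "j \<noteq> opp I k" using j k by auto
  moreover have "R (flip I k) j = (if k < j \<and> j \<le> opp I k then R I j - cc I j k *s R I k else R I j)"
    using R_flip_pos[OF I facet_less[OF I(1) j(1)]] by (simp add: refl_def cc_def)
  moreover have "j < opp I k \<Longrightarrow> cc I j k \<le> 0" "opp I k < j \<Longrightarrow> cc I j k \<ge> 0"
    using cc_signs[OF I j] by auto
  ultimately show ?thesis using j k by (auto simp: bb_def Defs.pos_def max_def vec_eq_iff)
qed

text \<open>Matrices indexed by \<open>'i\<close> need an enumeration \<open>e\<close> of the facet.\<close>

definition lfacet :: "('i \<Rightarrow> nat) \<Rightarrow> bool" where
  "lfacet e \<longleftrightarrow> inj e \<and> facet (range e)"

definition lflip :: "('i \<Rightarrow> nat) \<Rightarrow> 'i \<Rightarrow> 'i \<Rightarrow> nat" where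
  "lflip e k = e(k := opp (range e) (e k))"

definition BB :: "('i \<Rightarrow> nat) \<Rightarrow> int^'i^'i" where
  "BB e = (\<chi> a b. bb (range e) (e a) (e b))"

lemma lflip_simps [simp]: "lflip e k k = opp (range e) (e k)" "j \<noteq> k \<Longrightarrow> lflip e k j = e j"
  by (simp_all add: lflip_def)

lemma range_lflip: assumes "lfacet e" shows "range (lflip e k) = flip (range e) (e k)"
proof -
  have "range e - {e k} = e ` (UNIV - {k})" using assms by (auto simp: lfacet_def inj_def)
  then show ?thesis unfolding flip_def lflip_def by auto
qed

lemma lfacetD: "lfacet e \<Longrightarrow> facet (range e)" "lfacet e \<Longrightarrow> e a = e b \<longleftrightarrow> a = b" "lfacet e \<Longrightarrow> e a < L"
  using facet_less[of "range e" "e a"] by (auto simp: lfacet_def inj_def)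

lemma lfacet_lflip: assumes "lfacet e" shows "lfacet (lflip e k)"
proof -
  have "opp (range e) (e k) \<notin> range e" using opp(2)[OF lfacetD(1)[OF assms]] by simp
  then have ne: "opp (range e) (e k) \<noteq> e j" "e j \<noteq> opp (range e) (e k)" for j by (metis rangeI)+
  have "lflip e k a = lflip e k b \<Longrightarrow> a = b" for a b
    using assms ne by (cases "a = k"; cases "b = k") (auto simp: lfacet_def inj_def)
  then have "inj (lflip e k)" by (simp add: inj_def)
  then show ?thesis
    using facet_flip[OF lfacetD(1)[OF assms], of "e k"] by (simp add: lfacet_def range_lflip[OF assms])
qed

lemma lflip_lflip: assumes "lfacet e" shows "lflip (lflip e k) k = e"
proof -
  have "opp (range (lflip e k)) (lflip e k k) = e k"
    using opp_flip[OF lfacetD(1)[OF assms], of "e k"] by (simp add: range_lflip[OF assms])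
  then show ?thesis unfolding lflip_def[of "lflip e k"] by (auto simp: fun_eq_iff)
qed

lemma bb_self [simp]: "bb I i i = 0"
  by (simp add: bb_def)

lemma BB_lflip_pos:
  assumes e: "lfacet e" and pos: "vp (R (range e) (e k))"
  shows "BB (lflip e k) = matrix_mutation k (BB e)"
proof -
  note I = lfacetD(1)[OF e] rangeI[of e k] pos
  have ne: "e a \<noteq> e k" if "a \<noteq> k" for a using lfacetD(2)[OF e] that by simp
  have "BB (lflip e k) $ a $ b = matrix_mutation k (BB e) $ a $ b" for a b
    unfolding BB_def range_lflip[OF e]
    using bb_flip[OF I, of "e a" "e b"] bb_flip(2)[OF I, of "e b" "e b"] bb_flip(3)[OF I, of "e a" "e a"] ne
    by (cases "a = k"; cases "b = k") (auto simp: matrix_mutation_def)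
  then show ?thesis by (simp add: vec_eq_iff)
qed

lemma matrix_mutation_involution:
  assumes "B$k$k = 0" shows "matrix_mutation k (matrix_mutation k B) = B"
  using assms by (auto simp: vec_eq_iff matrix_mutation_def Defs.pos_def max_def)

lemma lflip_neg:
  assumes e: "lfacet e" and neg: "\<not> vp (R (range e) (e k))"
  shows "vp (R (range (lflip e k)) (lflip e k k))"
  using neg not_vp_iff[of "R (range e) (e k)"] R_flip_opp[OF lfacetD(1)[OF e], of "e k"]
  by (simp add: range_lflip[OF e])

text \<open>A flip to the left is the inverse of a flip to the right, and mutation is an
  involution.\<close>

lemma BB_lflip:
  assumes e: "lfacet e" shows "BB (lflip e k) = matrix_mutation k (BB e)"
proof (cases "vp (R (range e) (e k))")
  case False
  have "BB (lflip (lflip e k) k) = matrix_mutation k (BB (lflip e k))"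
    using BB_lflip_pos[OF lfacet_lflip[OF e] lflip_neg[OF e False]] .
  then have "matrix_mutation k (BB e) = matrix_mutation k (matrix_mutation k (BB (lflip e k)))"
    by (simp add: lflip_lflip[OF e])
  then show ?thesis by (simp add: matrix_mutation_involution BB_def)
qed (rule BB_lflip_pos[OF e])

text \<open>Mutation of a single tropical exponent: the exponent of y_k \<oplus> 1 is the minimum of
  that of y_k and 0.\<close>

definition mut_row :: "'i \<Rightarrow> int^'i^'i \<Rightarrow> ('i \<Rightarrow> int) \<Rightarrow> 'i \<Rightarrow> int" where
  "mut_row k B y j = (if j = k then - y k else y j + pos (B$k$j) * y k - B$k$j * min (y k) 0)"

lemma mut_row_involution:
  assumes "B$k$k = 0" shows "mut_row k (matrix_mutation k B) (mut_row k B y) = y"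
  using assms by (auto simp: fun_eq_iff mut_row_def matrix_mutation_def Defs.pos_def max_def min_def)

definition YY :: "('i \<Rightarrow> nat) \<Rightarrow> nat \<Rightarrow> 'i \<Rightarrow> int" where
  "YY e p j = yy (range e) p (e j)"

lemma YY_lflip_pos:
  assumes e: "lfacet e" and pos: "vp (R (range e) (e k))" and p: "p < L"
  shows "YY (lflip e k) p = mut_row k (BB e) (YY e p)"
proof
  fix j
  note I = lfacetD(1)[OF e] rangeI[of e k] pos
  have ne: "e j \<noteq> e k" if "j \<noteq> k" using lfacetD(2)[OF e] that by simp
  have "YY (lflip e k) p k = - YY e p k"
    using yy_flip_opp[OF I p] by (simp add: YY_def range_lflip[OF e])
  then show "YY (lflip e k) p j = mut_row k (BB e) (YY e p) j"
    using yy_flip(1)[OF I p, of "e j"] ne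
    by (cases "j = k") (auto simp: mut_row_def YY_def BB_def range_lflip[OF e])
qed

lemma YY_lflip:
  assumes e: "lfacet e" and p: "p < L" shows "YY (lflip e k) p = mut_row k (BB e) (YY e p)"
proof (cases "vp (R (range e) (e k))")
  case False
  have "YY (lflip (lflip e k) k) p = mut_row k (BB (lflip e k)) (YY (lflip e k) p)"
    using YY_lflip_pos[OF lfacet_lflip[OF e] lflip_neg[OF e False] p] .
  then have "YY e p = mut_row k (BB (lflip e k)) (YY (lflip e k) p)"
    by (simp add: lflip_lflip[OF e])
  moreover have "BB e = matrix_mutation k (BB (lflip e k))"
    using BB_lflip[OF lfacet_lflip[OF e], of k k] by (simp add: lflip_lflip[OF e])
  ultimately have "mut_row k (BB e) (YY e p) =
      mut_row k (matrix_mutation k (BB (lflip e k))) (mut_row k (BB (lflip e k)) (YY (lflip e k) p))" by simp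
  then show ?thesis by (simp add: mut_row_involution BB_def)
qed (rule YY_lflip_pos[OF e _ p])

end

section \<open>Rank two periodicity\<close>

text \<open>Each variable is kept as a monomial C times an F-polynomial, and the second term of a
  relation as the monomial of its first term times h. An exchange then splits into an update of C
  and the identity \<open>F1 ^ e + h1 = F0 * F2\<close>.\<close>

lemma rank2_step:
  fixes Z0 :: "'f::field"
  assumes "Z0 = C0 * F0" "Z1 = C1 * F1" "Z0 \<noteq> 0" "Z0 * Z2 = a1 * Z1 ^ e + b1"
    and "b1 = a1 * C1 ^ e * h1" "b0 = a0 * C0 ^ k * h0" "b2 * b0 = a2 * a0 * b1 ^ k"
    and "h2 * h0 = h1 ^ k" "F1 ^ e + h1 = F0 * F2" "C2 = a1 * C1 ^ e / C0" "a0 \<noteq> 0" "h0 \<noteq> 0"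
  shows "Z2 = C2 * F2" "b2 = a2 * C2 ^ k * h2"
proof -
  have nz: "C0 \<noteq> 0" "F0 \<noteq> 0" using assms by auto
  have "C0 * F0 * Z2 = a1 * C1 ^ e * (F1 ^ e + h1)"
    using assms(4) unfolding assms(1,2,5) by (simp add: power_mult_distrib algebra_simps)
  also have "\<dots> = C0 * F0 * (C2 * F2)" using nz by (simp add: assms(9,10))
  finally show "Z2 = C2 * F2" using nz by simp
  have "b2 * (a0 * C0 ^ k * h0) = a2 * a0 * (a1 * C1 ^ e) ^ k * (h2 * h0)"
    using assms(7) unfolding assms(6,5,8) by (simp add: power_mult_distrib)
  also have "\<dots> = (a2 * C2 ^ k * h2) * (a0 * C0 ^ k * h0)"
    using nz by (simp add: assms(10) power_divide)
  finally show "b2 = a2 * C2 ^ k * h2" using nz assms by simp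
qed

text \<open>Exponents of the frozen variables in the relations around a rank two link satisfy a tropical
  recursion, and those of the two terms of a relation are the positive and the negative part of one
  integer.\<close>

locale rank2_link =
  fixes V :: "'s \<Rightarrow> 'f::field" and S :: "'s set" and y :: "nat \<Rightarrow> 's \<Rightarrow> int"
    and Z :: "nat \<Rightarrow> 'f" and r s m :: nat
  assumes V_nz: "i \<in> S \<Longrightarrow> V i \<noteq> 0" and Z_nz: "t \<le> m + 1 \<Longrightarrow> Z t \<noteq> 0"
    and y_rec: "1 \<le> t \<Longrightarrow> t < m \<Longrightarrow> i \<in> S \<Longrightarrow>
      y (t + 1) i = int (if odd t then r else s) * pos (y t i) - y (t - 1) i"
    and y_wrap: "i \<in> S \<Longrightarrow> y (m + 1) i = int s * pos (y 0 i) - y 1 i"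
    and cases_rs: "(r, s, m) \<in> {(0, 0, 2), (1, 1, 3), (1, 2, 4), (2, 1, 4), (1, 3, 6), (3, 1, 6)}"
begin

definition mon :: "('s \<Rightarrow> int) \<Rightarrow> 'f" where
  "mon u = (\<Prod>i\<in>S. V i ^ nat (u i))"

definition a :: "nat \<Rightarrow> 'f" where "a t = mon (\<lambda>i. pos (- y t i))"
definition b :: "nat \<Rightarrow> 'f" where "b t = mon (\<lambda>i. pos (y t i))"

lemma mon_nz: "mon u \<noteq> 0"
  unfolding mon_def using V_nz by (cases "finite S") auto

lemma a_nz: "a t \<noteq> 0" and b_nz: "b t \<noteq> 0"
  by (simp_all add: a_def b_def mon_nz)

lemma mon_mult: "(\<And>i. i \<in> S \<Longrightarrow> u i \<ge> 0) \<Longrightarrow> (\<And>i. i \<in> S \<Longrightarrow> v i \<ge> 0) \<Longrightarrow> mon u * mon v = mon (\<lambda>i. u i + v i)"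
  unfolding mon_def prod.distrib[symmetric]
  by (intro prod.cong) (auto simp: nat_add_distrib power_add)

lemma mon_power: "(\<And>i. i \<in> S \<Longrightarrow> u i \<ge> 0) \<Longrightarrow> mon u ^ k = mon (\<lambda>i. int k * u i)"
  unfolding mon_def prod_power_distrib
  by (intro prod.cong) (auto simp: nat_mult_distrib simp flip: power_mult simp: mult.commute)

lemma mon_cong: "(\<And>i. i \<in> S \<Longrightarrow> u i = v i) \<Longrightarrow> mon u = mon v"
  unfolding mon_def by (intro prod.cong) auto

lemma pos_nonneg: "pos x \<ge> 0"
  by (simp add: Defs.pos_def)

lemmas mon_simps = mon_mult mon_power pos_nonneg

lemma pos_split: "pos x = x + pos (- x)"
  by (simp add: Defs.pos_def max_def)

lemma ratio:
  assumes "1 \<le> t" "t < m"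
  shows "b (t + 1) * b (t - 1) = a (t + 1) * a (t - 1) * b t ^ (if odd t then r else s)"
proof -
  define k where "k = (if odd t then r else s)"
  have "pos (y (t + 1) i) + pos (y (t - 1) i) = pos (- y (t + 1) i) + pos (- y (t - 1) i) + int k * pos (y t i)"
    if "i \<in> S" for i
    using y_rec[OF assms that] pos_split[of "y (t + 1) i"] pos_split[of "y (t - 1) i"]
    unfolding k_def by linarith
  then show ?thesis
    unfolding a_def b_def k_def[symmetric] by (simp add: mon_simps cong: mon_cong)
qed

lemma ratio_wrap: "b (m + 1) * b 1 = a (m + 1) * a 1 * b 0 ^ s"
proof -
  have "pos (y (m + 1) i) + pos (y 1 i) = pos (- y (m + 1) i) + pos (- y 1 i) + int s * pos (y 0 i)"
    if "i \<in> S" for i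
    using y_wrap[OF that] pos_split[of "y (m + 1) i"] pos_split[of "y 1 i"] by linarith
  then show ?thesis
    unfolding a_def b_def by (simp add: mon_simps cong: mon_cong)
qed

text \<open>Here and in the following lemmas: the monomials collected around the polygon close up.
  All exponents are determined by y 0 and y 1, so these are piecewise linear identities, decided by
  signs. They are what \<open>finish\<close> asks for.\<close>

lemma lead_11: assumes "r = 1" "s = 1" "m = 3" shows "a 3 * a 2 = b 0" "a 2 * a 1 = b 4"
proof -
  have y: "y 2 i = pos (y 1 i) - y 0 i" "y 3 i = pos (y 2 i) - y 1 i" "y 4 i = pos (y 0 i) - y 1 i"
    if "i \<in> S" for i
    using y_rec[of 1 i] y_rec[of 2 i] y_wrap[of i] that assms by (simp_all flip: numeral_2_eq_2)
  show "a 3 * a 2 = b 0" "a 2 * a 1 = b 4"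
    unfolding a_def b_def
    by (simp_all add: mon_simps del: of_nat_mult) (intro mon_cong, simp add: y Defs.pos_def max_def)+
qed

lemma lead_12: assumes "r = 1" "s = 2" "m = 4" shows "a 4 * a 3 * a 2 = b 0" "a 3 * a 2 ^ 2 * a 1 = b 5"
proof -
  have y: "y 2 i = pos (y 1 i) - y 0 i" "y 3 i = 2 * pos (y 2 i) - y 1 i"
    "y 4 i = pos (y 3 i) - y 2 i" "y 5 i = 2 * pos (y 0 i) - y 1 i"
    if "i \<in> S" for i
    using y_rec[of 1 i] y_rec[of 2 i] y_rec[of 3 i] y_wrap[of i] that assms by (simp_all flip: numeral_2_eq_2)
  show "a 4 * a 3 * a 2 = b 0" "a 3 * a 2 ^ 2 * a 1 = b 5"
    unfolding a_def b_def
    by (simp_all add: mon_simps del: of_nat_mult) (intro mon_cong, simp add: y Defs.pos_def max_def)+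
qed

lemma lead_21: assumes "r = 2" "s = 1" "m = 4" shows "a 4 * a 3 ^ 2 * a 2 = b 0" "a 3 * a 2 * a 1 = b 5"
proof -
  have y: "y 2 i = 2 * pos (y 1 i) - y 0 i" "y 3 i = pos (y 2 i) - y 1 i"
    "y 4 i = 2 * pos (y 3 i) - y 2 i" "y 5 i = pos (y 0 i) - y 1 i"
    if "i \<in> S" for i
    using y_rec[of 1 i] y_rec[of 2 i] y_rec[of 3 i] y_wrap[of i] that assms by (simp_all flip: numeral_2_eq_2)
  show "a 4 * a 3 ^ 2 * a 2 = b 0" "a 3 * a 2 * a 1 = b 5"
    unfolding a_def b_def
    by (simp_all add: mon_simps del: of_nat_mult) (intro mon_cong, simp add: y Defs.pos_def max_def)+
qed

lemma lead_13: assumes "r = 1" "s = 3" "m = 6"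
  shows "a 6 * a 5 * a 4 ^ 2 * a 3 * a 2 = b 0" "a 5 * a 4 ^ 3 * a 3 ^ 2 * a 2 ^ 3 * a 1 = b 7"
proof -
  have y: "y 2 i = pos (y 1 i) - y 0 i" "y 3 i = 3 * pos (y 2 i) - y 1 i"
    "y 4 i = pos (y 3 i) - y 2 i" "y 5 i = 3 * pos (y 4 i) - y 3 i"
    "y 6 i = pos (y 5 i) - y 4 i" "y 7 i = 3 * pos (y 0 i) - y 1 i"
    if "i \<in> S" for i
    using y_rec[of 1 i] y_rec[of 2 i] y_rec[of 3 i] y_rec[of 4 i] y_rec[of 5 i] y_wrap[of i] that assms
    by (simp_all flip: numeral_2_eq_2)
  show "a 6 * a 5 * a 4 ^ 2 * a 3 * a 2 = b 0" "a 5 * a 4 ^ 3 * a 3 ^ 2 * a 2 ^ 3 * a 1 = b 7"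
    unfolding a_def b_def
    by (simp_all add: mon_simps del: of_nat_mult) (intro mon_cong, simp add: y, smt (verit) Defs.pos_def max_def)+
qed

lemma lead_31: assumes "r = 3" "s = 1" "m = 6"
  shows "a 6 * a 5 ^ 3 * a 4 ^ 2 * a 3 ^ 3 * a 2 = b 0" "a 5 * a 4 * a 3 ^ 2 * a 2 * a 1 = b 7"
proof -
  have y: "y 2 i = 3 * pos (y 1 i) - y 0 i" "y 3 i = pos (y 2 i) - y 1 i"
    "y 4 i = 3 * pos (y 3 i) - y 2 i" "y 5 i = pos (y 4 i) - y 3 i"
    "y 6 i = 3 * pos (y 5 i) - y 4 i" "y 7 i = pos (y 0 i) - y 1 i"
    if "i \<in> S" for i
    using y_rec[of 1 i] y_rec[of 2 i] y_rec[of 3 i] y_rec[of 4 i] y_rec[of 5 i] y_wrap[of i] that assms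
    by (simp_all flip: numeral_2_eq_2)
  show "a 6 * a 5 ^ 3 * a 4 ^ 2 * a 3 ^ 3 * a 2 = b 0" "a 5 * a 4 * a 3 ^ 2 * a 2 * a 1 = b 7"
    unfolding a_def b_def
    by (simp_all add: mon_simps del: of_nat_mult) (intro mon_cong, simp add: y, smt (verit) Defs.pos_def max_def)+
qed

lemma lead_00: assumes "m = 2" "r = 0" "s = 0" shows "a 2 = b 0" "b 2 = a 0" "a 3 = b 1" "b 3 = a 1"
proof -
  have y: "y 2 i = - y 0 i" "y 3 i = - y 1 i" if "i \<in> S" for i
    using y_rec[of 1 i] y_wrap[of i] that assms by (simp_all flip: numeral_2_eq_2)
  show "a 2 = b 0" "b 2 = a 0" "a 3 = b 1" "b 3 = a 1"
    unfolding a_def b_def by (intro mon_cong, simp add: y)+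
qed

definition rel :: "nat \<Rightarrow> bool" where
  "rel t \<longleftrightarrow> Z (t - 1) * Z (t + 1) = a t * Z t ^ (if odd t then s else r) + b t"

end

text \<open>With \<open>\<alpha> = b 1 / (a 1 * Z 1 ^ s)\<close> and \<open>\<beta> = a 0 * Z 0 ^ r / b 0\<close>, every \<open>Z t\<close> is a monomial
  times a polynomial in \<open>\<alpha>\<close> and \<open>\<beta>\<close> (an F-polynomial); these are the polynomials \<open>Ft\<close> below.\<close>

locale rank2_relations = rank2_link +
  assumes lower: "1 \<le> t \<Longrightarrow> t < m \<Longrightarrow> rel t" and wrap: "Z 1 * Z (m + 1) = a 0 * Z 0 ^ r + b 0"
begin

definition "al = b 1 / (a 1 * Z 1 ^ s)"
definition "be = a 0 * Z 0 ^ r / b 0"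

lemma al_be_nz: "al \<noteq> 0" "be \<noteq> 0"
  using a_nz b_nz Z_nz[of 0] Z_nz[of 1] by (auto simp: al_def be_def)

lemma b1: "b 1 = a 1 * Z 1 ^ s * al" and b0: "b 0 = a 0 * Z 0 ^ r * (1 / be)"
  using a_nz b_nz Z_nz[of 0] Z_nz[of 1] by (auto simp: al_def be_def)

lemma Z_last: "Z (m + 1) = b 0 / Z 1 * (1 + be)"
proof -
  have "a 0 * Z 0 ^ r + b 0 = b 0 * (1 + be)" using b_nz[of 0] by (simp add: be_def distrib_left)
  then show ?thesis using wrap Z_nz[of 1] by (simp add: eq_divide_eq mult.commute)
qed

lemma next_step:
  assumes "1 \<le> t" "t < m" and "e = (if odd t then s else r)" "k = (if odd t then r else s)"
    and "Z (t - 1) = C0 * F0" "Z t = C1 * F1" "b (t - 1) = a (t - 1) * C0 ^ k * h0" "b t = a t * C1 ^ e * h1"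
    and "h2 * h0 = h1 ^ k" "F1 ^ e + h1 = F0 * F2" "C2 = a t * C1 ^ e / C0" "h0 \<noteq> 0"
  shows "Z (t + 1) = C2 * F2" "b (t + 1) = a (t + 1) * C2 ^ k * h2"
proof -
  have Z: "Z (t - 1) * Z (t + 1) = a t * Z t ^ e + b t"
    using lower[OF assms(1,2)] assms(3) by (simp add: rel_def)
  have r: "b (t + 1) * b (t - 1) = a (t + 1) * a (t - 1) * b t ^ k"
    using ratio[OF assms(1,2)] assms(4) by simp
  have nz: "Z (t - 1) \<noteq> 0" using assms by (intro Z_nz) simp
  note * = rank2_step[OF assms(5,6) nz Z assms(8,7) r assms(9,10,11) a_nz assms(12)]
  show "Z (t + 1) = C2 * F2" by (rule *(1))
  show "b (t + 1) = a (t + 1) * C2 ^ k * h2" by (rule *(2))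
qed

text \<open>The last F-polynomial must be 1 + al (1 + be)^s, because the last relation then is the
  definition of al raised through \<open>Z_last\<close>; the assumptions on \<open>C0\<close> and
  \<open>C1\<close> say that the monomials close up.\<close>

lemma finish:
  assumes e: "e = (if odd m then s else r)" and m: "m \<ge> 1"
    and Z: "Z (m - 1) = C0 * F0" "Z m = C1 * (1 + al * (1 + be) ^ s)" "b m = a m * C1 ^ e * h1"
    and F: "(1 + al * (1 + be) ^ s) ^ e + h1 = F0 * (1 + be)" and C: "a m * C1 ^ e / C0 = b 0 / Z 1"
    and C': "C1 * Z 0 = b (m + 1)"
  shows "rel m" "Z 0 * Z m = a (m + 1) * Z (m + 1) ^ s + b (m + 1)"
proof -
  have nz: "Z 1 \<noteq> 0" "Z 0 \<noteq> 0" "a 1 \<noteq> 0" "b 1 \<noteq> 0" using Z_nz a_nz b_nz by auto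
  have "C0 \<noteq> 0" using Z(1) Z_nz[of "m - 1"] by auto
  then have C2: "a m * C1 ^ e = C0 * (b 0 / Z 1)" using C by (simp add: field_simps)
  have "a m * (C1 * F) ^ e + a m * C1 ^ e * h1 = a m * C1 ^ e * (F ^ e + h1)" for F
    by (simp add: power_mult_distrib distrib_left)
  then have "a m * Z m ^ e + b m = a m * C1 ^ e * ((1 + al * (1 + be) ^ s) ^ e + h1)"
    unfolding Z by blast
  also have "\<dots> = Z (m - 1) * Z (m + 1)"
    unfolding F C2 Z(1) Z_last by simp
  finally show "rel m" using e by (simp add: rel_def)
  have "a (m + 1) * b 0 ^ s = b (m + 1) * b 1 / a 1"
    using ratio_wrap nz by (simp add: field_simps)
  then have "a (m + 1) * Z (m + 1) ^ s = b (m + 1) * al * (1 + be) ^ s"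
  proof -
    have "a (m + 1) * (b 0 / Z 1 * (1 + be)) ^ s = (a (m + 1) * b 0 ^ s) * (1 + be) ^ s / Z 1 ^ s"
      by (simp add: power_mult_distrib power_divide)
    also have "\<dots> = b (m + 1) * al * (1 + be) ^ s"
      unfolding \<open>a (m + 1) * b 0 ^ s = b (m + 1) * b 1 / a 1\<close> by (simp add: al_def)
    finally show ?thesis unfolding Z_last .
  qed
  then show "Z 0 * Z m = a (m + 1) * Z (m + 1) ^ s + b (m + 1)"
    unfolding Z(2) C'[symmetric] by (simp add: algebra_simps)
qed

lemma init: "Z 0 = Z 0 * 1" "Z 1 = Z 1 * 1" by simp_all

lemma case_00: assumes rs: "r = 0" "s = 0" "m = 2"
  shows "rel m" "Z 0 * Z m = a (m + 1) * Z (m + 1) ^ s + b (m + 1)"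
proof -
  have 1: "Z 0 * Z 2 = a 1 + b 1" using lower[of 1] rs(3) unfolding rel_def by (simp add: rs(1,2) flip: numeral_2_eq_2)
  have 2: "Z 1 * Z 3 = a 0 + b 0" using wrap unfolding rs by simp
  have n: "m - 1 = 1" "m + 1 = 3" "(if odd m then s else r) = 0" using rs by auto
  have m2: "Z m = Z 2" "a m = b 0" "b m = a 0" using lead_00[OF rs(3,1,2)] rs(3) by auto
  show "rel m" unfolding rel_def n m2 using 2 by (simp add: add.commute)
  show "Z 0 * Z m = a (m + 1) * Z (m + 1) ^ s + b (m + 1)"
    unfolding n m2 rs(2) using 1 lead_00[OF rs(3,1,2)] by (simp add: add.commute)
qed

lemma case_11: assumes rs: "r = 1" "s = 1" "m = 3"
  shows "rel m" "Z 0 * Z m = a (m + 1) * Z (m + 1) ^ s + b (m + 1)"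
proof -
  define C2 where "C2 = a 1 * Z 1 / Z 0"
  define C3 where "C3 = a 2 * C2 / Z 1"
  have nz: "Z 1 \<noteq> 0" "Z 0 \<noteq> 0" using Z_nz by auto
  note nzs = nz a_nz b_nz al_be_nz
  have 2: "Z 2 = C2 * (1 + al)" "b 2 = a 2 * C2 * (al * be)"
    using next_step[of 1 1 1 "Z 0" 1 "Z 1" 1 "1 / be" al "al * be" "1 + al" C2] b0 b1 nzs rs
    by (simp_all add: C2_def numeral_eq_Suc)
  have 3: "Z 3 = C3 * (1 + al + al * be)" "b 3 = a 3 * C3 * be"
    using next_step[of 2 1 1 "Z 1" 1 C2 "1 + al" al "al * be" be "1 + al + al * be" C3] b1 nzs rs 2
    by (simp_all add: C3_def)
  have C: "a 3 * C3 / C2 = b 0 / Z 1" "C3 * Z 0 = b 4"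
    using lead_11[OF rs] nzs by (simp_all add: C2_def C3_def flip: lead_11[OF rs])
  show "rel m" "Z 0 * Z m = a (m + 1) * Z (m + 1) ^ s + b (m + 1)"
    using finish[of 1 C2 "1 + al" C3 be] 2 3 C rs by (simp_all add: algebra_simps)
qed

lemma case_12: assumes rs: "r = 1" "s = 2" "m = 4"
  shows "rel m" "Z 0 * Z m = a (m + 1) * Z (m + 1) ^ s + b (m + 1)"
proof -
  define C2 where "C2 = a 1 * Z 1 ^ 2 / Z 0"
  define C3 where "C3 = a 2 * C2 / Z 1"
  define C4 where "C4 = a 3 * C3 ^ 2 / C2"
  have nz: "Z 1 \<noteq> 0" "Z 0 \<noteq> 0" using Z_nz by auto
  note nzs = nz a_nz b_nz al_be_nz
  have 2: "Z 2 = C2 * (1 + al)" "b 2 = a 2 * C2 * (al * be)"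
    using next_step[of 1 2 1 "Z 0" 1 "Z 1" 1 "1 / be" al "al * be" "1 + al" C2] b0 b1 nzs rs
    by (simp_all add: C2_def numeral_eq_Suc)
  have 3: "Z 3 = C3 * (1 + al + al * be)" "b 3 = a 3 * C3 ^ 2 * (al * be ^ 2)"
    using next_step[of 2 1 2 "Z 1" 1 C2 "1 + al" al "al * be" "al * be ^ 2" "1 + al + al * be" C3] b1 nzs rs 2
    by (simp_all add: C3_def power2_eq_square)
  have 4: "Z 4 = C4 * (1 + al * (1 + be) ^ 2)" "b 4 = a 4 * C4 * be"
    using next_step[of 3 2 1 C2 "1 + al" C3 "1 + al + al * be" "al * be" "al * be ^ 2" be "1 + al * (1 + be) ^ 2" C4]
      nzs rs 2 3
    by (simp_all add: C4_def power2_eq_square algebra_simps)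
  have C: "a 4 * C4 / C3 = b 0 / Z 1" "C4 * Z 0 = b 5"
    using nzs by (simp_all add: C2_def C3_def C4_def power2_eq_square flip: lead_12[OF rs])
  show "rel m" "Z 0 * Z m = a (m + 1) * Z (m + 1) ^ s + b (m + 1)"
    using finish[of 1 C3 "1 + al + al * be" C4 be] 3 4 C rs by (simp_all add: algebra_simps power2_eq_square)
qed

lemma case_21: assumes rs: "r = 2" "s = 1" "m = 4"
  shows "rel m" "Z 0 * Z m = a (m + 1) * Z (m + 1) ^ s + b (m + 1)"
proof -
  define C2 where "C2 = a 1 * Z 1 / Z 0"
  define C3 where "C3 = a 2 * C2 ^ 2 / Z 1"
  define C4 where "C4 = a 3 * C3 / C2"
  have nz: "Z 1 \<noteq> 0" "Z 0 \<noteq> 0" using Z_nz by auto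
  note nzs = nz a_nz b_nz al_be_nz
  have 2: "Z 2 = C2 * (1 + al)" "b 2 = a 2 * C2 ^ 2 * (al ^ 2 * be)"
    using next_step[of 1 1 2 "Z 0" 1 "Z 1" 1 "1 / be" al "al ^ 2 * be" "1 + al" C2] b0 b1 nzs rs
    by (simp_all add: C2_def numeral_eq_Suc)
  have 3: "Z 3 = C3 * ((1 + al) ^ 2 + al ^ 2 * be)" "b 3 = a 3 * C3 * (al * be)"
    using next_step[of 2 2 1 "Z 1" 1 C2 "1 + al" al "al ^ 2 * be" "al * be" "(1 + al) ^ 2 + al ^ 2 * be" C3] b1 nzs rs 2
    by (simp_all add: C3_def power2_eq_square)
  have 4: "Z 4 = C4 * (1 + al * (1 + be))" "b 4 = a 4 * C4 ^ 2 * be"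
    using next_step[of 3 1 2 C2 "1 + al" C3 "(1 + al) ^ 2 + al ^ 2 * be" "al ^ 2 * be" "al * be" be "1 + al * (1 + be)" C4]
      nzs rs 2 3
    by (simp_all add: C4_def power2_eq_square algebra_simps)
  have C: "a 4 * C4 ^ 2 / C3 = b 0 / Z 1" "C4 * Z 0 = b 5"
    using nzs by (simp_all add: C2_def C3_def C4_def power2_eq_square flip: lead_21[OF rs])
  show "rel m" "Z 0 * Z m = a (m + 1) * Z (m + 1) ^ s + b (m + 1)"
    using finish[of 2 C3 "(1 + al) ^ 2 + al ^ 2 * be" C4 be] 3 4 C rs
    by (simp_all add: algebra_simps power2_eq_square)
qed

lemma case_13: assumes rs: "r = 1" "s = 3" "m = 6"
  shows "rel m" "Z 0 * Z m = a (m + 1) * Z (m + 1) ^ s + b (m + 1)"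
proof -
  define C2 where "C2 = a 1 * Z 1 ^ 3 / Z 0"
  define C3 where "C3 = a 2 * C2 / Z 1"
  define C4 where "C4 = a 3 * C3 ^ 3 / C2"
  define C5 where "C5 = a 4 * C4 / C3"
  define C6 where "C6 = a 5 * C5 ^ 3 / C4"
  \<comment> \<open>The F-polynomials of type G2; the monomials \<open>h1\<close> to
    \<open>h6\<close> are the h of \<open>rank2_step\<close>. Both follow from their recursions
    \<open>P\<close> and \<open>H\<close>.\<close>
  define F2 where "F2 = 1 + al"
  define F3 where "F3 = 1 + al + al * be"
  define F4 where "F4 = (1 + al) ^ 2 + 3 * (1 + al) * (al * be) + 3 * (al * be) ^ 2 + al ^ 2 * be ^ 3"
  define F5 where "F5 = 1 + al + 2 * al * be + al * be ^ 2"
  define F6 where "F6 = 1 + al * (1 + be) ^ 3"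
  define h1 where "h1 = al"
  define h2 where "h2 = al * be"
  define h3 where "h3 = al ^ 2 * be ^ 3"
  define h4 where "h4 = al * be ^ 2"
  define h5 where "h5 = al * be ^ 3"
  define h6 where "h6 = be"
  have P: "F2 + h2 = F3" "F3 ^ 3 + h3 = F2 * F4" "F4 + h4 = F3 * F5" "F5 ^ 3 + h5 = F4 * F6" "F6 + h6 = F5 * (1 + be)"
    unfolding F2_def F3_def F4_def F5_def F6_def h2_def h3_def h4_def h5_def h6_def by algebra+
  have H: "h3 * h1 = h2 ^ 3" "h4 * h2 = h3" "h5 * h3 = h4 ^ 3" "h6 * h4 = h5"
    unfolding h1_def h2_def h3_def h4_def h5_def h6_def by algebra+
  have nz: "Z 1 \<noteq> 0" "Z 0 \<noteq> 0" using Z_nz by auto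
  note nzs = nz a_nz b_nz al_be_nz
  have hnz: "h1 \<noteq> 0" "h2 \<noteq> 0" "h3 \<noteq> 0" "h4 \<noteq> 0" "h5 \<noteq> 0"
    using al_be_nz by (simp_all add: h1_def h2_def h3_def h4_def h5_def)
  define h0 where "h0 = 1 / be"
  have h0: "h0 \<noteq> 0" using al_be_nz by (simp add: h0_def)
  have 0: "b 0 = a 0 * Z 0 * h0" using b0 by (simp add: h0_def rs(1))
  have 1: "b 1 = a 1 * Z 1 ^ 3 * h1" using b1 by (simp add: h1_def rs(2))
  have H0: "h2 * h0 = h1" using al_be_nz by (simp add: h0_def h1_def h2_def)
  have P0: "1 + h1 = F2" by (simp add: h1_def F2_def)
  have 2: "Z 2 = C2 * F2" "b 2 = a 2 * C2 * h2"
    using next_step[of 1 3 1 "Z 0" 1 "Z 1" 1 h0 h1 h2 F2 C2] 0 1 H0 P0 h0 nzs(1,2) rs(3)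
    unfolding rs(1,2) C2_def by (simp_all flip: numeral_2_eq_2)
  have 3: "Z 3 = C3 * F3" "b 3 = a 3 * C3 ^ 3 * h3"
    using next_step[of 2 1 3 "Z 1" 1 C2 F2 h1 h2 h3 F3 C3] rs(3) 1 2 P(1) H(1) hnz
    unfolding rs(1,2) C3_def by simp_all
  have 4: "Z 4 = C4 * F4" "b 4 = a 4 * C4 * h4"
    using next_step[of 3 3 1 C2 F2 C3 F3 h2 h3 h4 F4 C4] rs(3) 2 3 P(2) H(2) hnz
    unfolding rs(1,2) C4_def by simp_all
  have 5: "Z 5 = C5 * F5" "b 5 = a 5 * C5 ^ 3 * h5"
    using next_step[of 4 1 3 C3 F3 C4 F4 h3 h4 h5 F5 C5] rs(3) 3 4 P(3) H(3) hnz
    unfolding rs(1,2) C5_def by simp_all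
  have 6: "Z 6 = C6 * F6" "b 6 = a 6 * C6 * h6"
    using next_step[of 5 3 1 C4 F4 C5 F5 h4 h5 h6 F6 C6] rs(3) 4 5 P(4) H(4) hnz
    unfolding rs(1,2) C6_def by simp_all
  have C: "a 6 * C6 / C5 = b 0 / Z 1" "C6 * Z 0 = b 7"
    using nzs by (simp_all add: C2_def C3_def C4_def C5_def C6_def power2_eq_square power3_eq_cube
        flip: lead_13[OF rs])
  have F6: "F6 = 1 + al * (1 + be) ^ s" by (simp add: F6_def rs(2))
  have m: "m - 1 = 5" "m + 1 = 7" "odd m \<longleftrightarrow> False" using rs(3) by auto
  show "rel m"
    by (rule finish(1)[of 1 C5 F5 C6 h6]; use 5 6 C P(5) rs F6 m in simp)
  show "Z 0 * Z m = a (m + 1) * Z (m + 1) ^ s + b (m + 1)"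
    by (rule finish(2)[of 1 C5 F5 C6 h6]; use 5 6 C P(5) rs F6 m in simp)
qed

lemma case_31: assumes rs: "r = 3" "s = 1" "m = 6"
  shows "rel m" "Z 0 * Z m = a (m + 1) * Z (m + 1) ^ s + b (m + 1)"
proof -
  define C2 where "C2 = a 1 * Z 1 / Z 0"
  define C3 where "C3 = a 2 * C2 ^ 3 / Z 1"
  define C4 where "C4 = a 3 * C3 / C2"
  define C5 where "C5 = a 4 * C4 ^ 3 / C3"
  define C6 where "C6 = a 5 * C5 / C4"
  define F2 where "F2 = 1 + al"
  define F3 where "F3 = (1 + al) ^ 3 + al ^ 3 * be"
  define F4 where "F4 = (1 + al) ^ 2 + al ^ 2 * be"
  define F5 where "F5 = (1 + al) ^ 3 + al ^ 3 * be ^ 2 + 3 * al ^ 2 * be + 2 * al ^ 3 * be"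
  define F6 where "F6 = 1 + al * (1 + be)"
  define h1 where "h1 = al"
  define h2 where "h2 = al ^ 3 * be"
  define h3 where "h3 = al ^ 2 * be"
  define h4 where "h4 = al ^ 3 * be ^ 2"
  define h5 where "h5 = al * be"
  define h6 where "h6 = be"
  have P: "F2 ^ 3 + h2 = F3" "F3 + h3 = F2 * F4" "F4 ^ 3 + h4 = F3 * F5" "F5 + h5 = F4 * F6" "F6 ^ 3 + h6 = F5 * (1 + be)"
    unfolding F2_def F3_def F4_def F5_def F6_def h2_def h3_def h4_def h5_def h6_def by algebra+
  have H: "h3 * h1 = h2" "h4 * h2 = h3 ^ 3" "h5 * h3 = h4" "h6 * h4 = h5 ^ 3"
    unfolding h1_def h2_def h3_def h4_def h5_def h6_def by algebra+
  have nz: "Z 1 \<noteq> 0" "Z 0 \<noteq> 0" using Z_nz by auto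
  note nzs = nz a_nz b_nz al_be_nz
  have hnz: "h1 \<noteq> 0" "h2 \<noteq> 0" "h3 \<noteq> 0" "h4 \<noteq> 0" "h5 \<noteq> 0"
    using al_be_nz by (simp_all add: h1_def h2_def h3_def h4_def h5_def)
  define h0 where "h0 = 1 / be"
  have h0: "h0 \<noteq> 0" using al_be_nz by (simp add: h0_def)
  have 0: "b 0 = a 0 * Z 0 ^ 3 * h0" using b0 by (simp add: h0_def rs(1))
  have 1: "b 1 = a 1 * Z 1 * h1" using b1 by (simp add: h1_def rs(2))
  have H0: "h2 * h0 = h1 ^ 3" using al_be_nz by (simp add: h0_def h1_def h2_def)
  have P0: "1 + h1 = F2" by (simp add: h1_def F2_def)
  have 2: "Z 2 = C2 * F2" "b 2 = a 2 * C2 ^ 3 * h2"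
    using next_step[of 1 1 3 "Z 0" 1 "Z 1" 1 h0 h1 h2 F2 C2] 0 1 H0 P0 h0 nzs(1,2) rs(3)
    unfolding rs(1,2) C2_def by (simp_all flip: numeral_2_eq_2)
  have 3: "Z 3 = C3 * F3" "b 3 = a 3 * C3 * h3"
    using next_step[of 2 3 1 "Z 1" 1 C2 F2 h1 h2 h3 F3 C3] rs(3) 1 2 P(1) H(1) hnz
    unfolding rs(1,2) C3_def by simp_all
  have 4: "Z 4 = C4 * F4" "b 4 = a 4 * C4 ^ 3 * h4"
    using next_step[of 3 1 3 C2 F2 C3 F3 h2 h3 h4 F4 C4] rs(3) 2 3 P(2) H(2) hnz
    unfolding rs(1,2) C4_def by simp_all
  have 5: "Z 5 = C5 * F5" "b 5 = a 5 * C5 * h5"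
    using next_step[of 4 3 1 C3 F3 C4 F4 h3 h4 h5 F5 C5] rs(3) 3 4 P(3) H(3) hnz
    unfolding rs(1,2) C5_def by simp_all
  have 6: "Z 6 = C6 * F6" "b 6 = a 6 * C6 ^ 3 * h6"
    using next_step[of 5 1 3 C4 F4 C5 F5 h4 h5 h6 F6 C6] rs(3) 4 5 P(4) H(4) hnz
    unfolding rs(1,2) C6_def by simp_all
  have C: "a 6 * C6 ^ 3 / C5 = b 0 / Z 1" "C6 * Z 0 = b 7"
    using nzs by (simp_all add: C2_def C3_def C4_def C5_def C6_def power2_eq_square power3_eq_cube
        flip: lead_31[OF rs])
  have F6: "F6 = 1 + al * (1 + be) ^ s" by (simp add: F6_def rs(2))
  have m: "m - 1 = 5" "m + 1 = 7" "odd m \<longleftrightarrow> False" using rs(3) by auto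
  show "rel m"
    by (rule finish(1)[of 3 C5 F5 C6 h6]; use 5 6 C P(5) rs F6 m in simp)
  show "Z 0 * Z m = a (m + 1) * Z (m + 1) ^ s + b (m + 1)"
    by (rule finish(2)[of 3 C5 F5 C6 h6]; use 5 6 C P(5) rs F6 m in simp)
qed

theorem top_relations: "rel m" "Z 0 * Z m = a (m + 1) * Z (m + 1) ^ s + b (m + 1)"
proof -
  have "rel m \<and> Z 0 * Z m = a (m + 1) * Z (m + 1) ^ s + b (m + 1)"
  proof -
    from cases_rs consider "r = 0" "s = 0" "m = 2" | "r = 1" "s = 1" "m = 3" | "r = 1" "s = 2" "m = 4"
      | "r = 2" "s = 1" "m = 4" | "r = 1" "s = 3" "m = 6" | "r = 3" "s = 1" "m = 6" by auto
    then show ?thesis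
    proof cases
      case 1 show ?thesis using case_00[OF 1] by blast
    next
      case 2 show ?thesis using case_11[OF 2] by blast
    next
      case 3 show ?thesis using case_12[OF 3] by blast
    next
      case 4 show ?thesis using case_21[OF 4] by blast
    next
      case 5 show ?thesis using case_13[OF 5] by blast
    next
      case 6 show ?thesis using case_31[OF 6] by blast
    qed
  qed
  then show "rel m" "Z 0 * Z m = a (m + 1) * Z (m + 1) ^ s + b (m + 1)" by blast+
qed

end

section \<open>Cluster variables and exchange relations\<close>

text \<open>\<open>Pos\<close> contains the coefficients and the initial variables, is closed under
  the semifield operations and omits 0. Hence no variable vanishes, and every exchange relation can
  be solved for its new variable.\<close>

locale cluster_values = coxeter_complex A d Q cw for A :: "int^'i^'i" and d Q cw +
  fixes pv x0 :: "nat \<Rightarrow> 'f::field" and Pos :: "'f set"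
  assumes Pos_add: "u \<in> Pos \<Longrightarrow> v \<in> Pos \<Longrightarrow> u + v \<in> Pos"
    and Pos_mult: "u \<in> Pos \<Longrightarrow> v \<in> Pos \<Longrightarrow> u * v \<in> Pos"
    and Pos_divide: "u \<in> Pos \<Longrightarrow> v \<in> Pos \<Longrightarrow> u / v \<in> Pos"
    and Pos_one: "1 \<in> Pos" and Pos_zero: "0 \<notin> Pos"
    and pv_Pos: "p < L \<Longrightarrow> pv p \<in> Pos" and x0_Pos: "x0 k \<in> Pos"
begin

lemma Pos_power: "u \<in> Pos \<Longrightarrow> u ^ n \<in> Pos"
  by (induction n) (auto simp: Pos_one Pos_mult)

lemma Pos_prod: "(\<And>i. i \<in> S \<Longrightarrow> g i \<in> Pos) \<Longrightarrow> prod g S \<in> Pos"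
  by (induction S rule: infinite_finite_induct) (auto simp: Pos_one Pos_mult)

definition mp :: "(nat \<Rightarrow> int) \<Rightarrow> 'f" where
  "mp y = (\<Prod>p<L. pv p ^ nat (y p))"

lemma mp_Pos: "mp y \<in> Pos"
  unfolding mp_def by (intro Pos_prod Pos_power pv_Pos) auto

text \<open>Right-hand side after division by y_k \<oplus> 1: the coefficients of the two terms
  carry the positive and the negative parts of the exponents of y_k.\<close>

definition exr :: "nat set \<Rightarrow> nat \<Rightarrow> (nat \<Rightarrow> 'f) \<Rightarrow> 'f" where
  "exr I k X = mp (\<lambda>p. pos (yy I p k)) * (\<Prod>i\<in>I. X i ^ nat (pos (bb I i k))) +
     mp (\<lambda>p. pos (- yy I p k)) * (\<Prod>i\<in>I. X i ^ nat (pos (- bb I i k)))"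

lemma exr_Pos: "(\<And>i. i \<in> I \<Longrightarrow> X i \<in> Pos) \<Longrightarrow> exr I k X \<in> Pos"
  unfolding exr_def by (intro Pos_add Pos_mult mp_Pos Pos_prod Pos_power) auto

lemma exr_cong: "(\<And>i. i \<in> I \<Longrightarrow> i \<noteq> k \<Longrightarrow> X i = X' i) \<Longrightarrow> exr I k X = exr I k X'"
proof -
  assume *: "\<And>i. i \<in> I \<Longrightarrow> i \<noteq> k \<Longrightarrow> X i = X' i"
  have "X i ^ nat (pos (u * bb I i k)) = X' i ^ nat (pos (u * bb I i k))" if "i \<in> I" for i u
    using * that by (cases "i = k") (auto simp: Defs.pos_def)
  from this[of _ 1] this[of _ "-1"] show ?thesis
    unfolding exr_def by (intro arg_cong2[of _ _ _ _ "(+)"] arg_cong2[of _ _ _ _ "(*)"] prod.cong refl) auto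
qed

lemma exr_lfacet:
  assumes "lfacet e"
  shows "exr (range e) (e k) X = mp (\<lambda>p. pos (YY e p k)) * (\<Prod>i\<in>UNIV. X (e i) ^ nat (pos (BB e$i$k))) +
     mp (\<lambda>p. pos (- YY e p k)) * (\<Prod>i\<in>UNIV. X (e i) ^ nat (pos (- BB e$i$k)))"
  using assms by (simp add: exr_def YY_def BB_def lfacet_def prod.reindex)

definition bottom :: "nat set \<Rightarrow> nat \<Rightarrow> bool" where
  "bottom I k \<longleftrightarrow> facet I \<and> k \<in> I \<and> \<not> vp (R I k) \<and> (\<forall>j\<in>I - {k}. vp (R I j))"

lemma R_I0_initial: "k < N \<Longrightarrow> vp (R I0 k)"
proof -
  assume "k < N"
  then have "com I0 k = []" by (auto simp: com_def filter_empty_conv)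
  then show ?thesis by (simp add: R_def vv_def)
qed

lemma bottomD:
  assumes "bottom I k" shows "i \<in> I \<Longrightarrow> i \<le> k" "\<not> k < N" "opp I k < k"
proof -
  have I: "facet I" "k \<in> I" "\<not> vp (R I k)" "\<And>j. j \<in> I \<Longrightarrow> j \<noteq> k \<Longrightarrow> vp (R I j)"
    using assms by (auto simp: bottom_def)
  have fin: "finite I" "I \<noteq> {}" using facetD(3)[OF I(1)] I(2) by auto
  have ne: "I \<noteq> I0" using I(2,3) R_I0_initial by auto
  have "Max I = k" using facet_max_neg[OF I(1) ne] I(4) Max_in[OF fin] by auto
  then show le: "i \<in> I \<Longrightarrow> i \<le> k" for i using Max_ge[OF fin(1)] by auto
  show "opp I k < k" using opp_neg[OF I(1-3)] by simp
  show "\<not> k < N"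
  proof
    assume "k < N"
    then have "I \<subseteq> I0" using le by fastforce
    then have "I = I0" using facetD(2)[OF I(1)] card_subset_eq[of I0 I] by auto
    then show False using ne by simp
  qed
qed

lemma bottom_unique: "bottom I k \<Longrightarrow> bottom J k \<Longrightarrow> I = J"
  by (rule greedy_unique[of I J "{k}"]) (auto simp: bottom_def)

text \<open>A position which is not initial is the only descent of at most one facet, and the other
  positions of that facet are smaller. The corresponding exchange relation defines its variable.\<close>

primrec Xs :: "nat \<Rightarrow> nat \<Rightarrow> 'f" where
  "Xs 0 = (\<lambda>_. 1)"
| "Xs (Suc k) = (Xs k)(k := if k < N then x0 k else if \<exists>I. bottom I k
     then let I = SOME I. bottom I k in exr I k (Xs k) / Xs k (opp I k) else 1)"

definition X :: "nat \<Rightarrow> 'f" where "X k = Xs (Suc k) k"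

text \<open>Stage k sets only the value at k, so \<open>Xs\<close> is a course-of-values recursion
  and later stages do not disturb earlier values.\<close>

lemma Xs_eq: "i < n \<Longrightarrow> Xs n i = X i"
  by (induction n) (auto simp: X_def less_Suc_eq)

lemma Xs_Pos: "Xs n i \<in> Pos"
  by (induction n arbitrary: i) (auto simp: Pos_one x0_Pos Let_def intro!: Pos_divide exr_Pos)

lemma X_Pos: "X k \<in> Pos"
  unfolding X_def by (rule Xs_Pos)

lemma X_nz: "X k \<noteq> 0"
  using X_Pos[of k] Pos_zero by auto

lemma X_initial: "k < N \<Longrightarrow> X k = x0 k"
  by (simp add: X_def)

definition Rel :: "nat set \<Rightarrow> nat \<Rightarrow> bool" where
  "Rel I k \<longleftrightarrow> X k * X (opp I k) = exr I k X"

lemma Rel_bottom: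
  assumes "bottom I k" shows "Rel I k"
proof -
  have "(SOME I. bottom I k) = I" using assms bottom_unique by (intro some_equality) auto
  then have "X k = exr I k (Xs k) / Xs k (opp I k)"
    unfolding X_def using assms bottomD(2)[OF assms] by auto
  also have "exr I k (Xs k) = exr I k X"
    using bottomD(1)[OF assms] by (intro exr_cong Xs_eq) (simp add: le_neq_implies_less)
  also have "Xs k (opp I k) = X (opp I k)" by (rule Xs_eq[OF bottomD(3)[OF assms]])
  finally show ?thesis using X_nz by (simp add: Rel_def)
qed

lemma Rel_lflip:
  assumes e: "lfacet e"
  shows "Rel (range (lflip e k)) (lflip e k k) \<longleftrightarrow> Rel (range e) (e k)"
proof -
  have "X (lflip e k i) ^ nat (pos (BB (lflip e k)$i$k)) = X (e i) ^ nat (pos (- BB e$i$k)) \<and>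
      X (lflip e k i) ^ nat (pos (- BB (lflip e k)$i$k)) = X (e i) ^ nat (pos (BB e$i$k))" for i
    by (cases "i = k") (simp_all add: BB_lflip[OF e] matrix_mutation_def, simp_all add: BB_def Defs.pos_def)
  moreover have "YY (lflip e k) p k = - YY e p k" if "p < L" for p
    using YY_lflip[OF e that] by (simp add: mut_row_def)
  then have "mp (\<lambda>p. pos (YY (lflip e k) p k)) = mp (\<lambda>p. pos (- YY e p k))"
    "mp (\<lambda>p. pos (- YY (lflip e k) p k)) = mp (\<lambda>p. pos (YY e p k))"
    unfolding mp_def by (auto intro!: prod.cong)
  ultimately have "exr (range (lflip e k)) (lflip e k k) X = exr (range e) (e k) X"
    by (simp only: exr_lfacet[OF e] exr_lfacet[OF lfacet_lflip[OF e]] add.commute)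
  moreover have "opp (range (lflip e k)) (lflip e k k) = e k"
    using opp_flip[OF lfacetD(1)[OF e], of "e k"] by (simp add: range_lflip[OF e])
  ultimately show ?thesis by (simp add: Rel_def mult.commute)
qed

lemma lfacet_exists:
  assumes "facet I" obtains e where "lfacet e" "range e = I"
proof -
  have "card I = CARD('i)" "finite I" using facetD[OF assms] length_cw by auto
  then obtain e :: "'i \<Rightarrow> nat" where "bij_betw e UNIV I"
    using finite_same_card_bij[of "UNIV :: 'i set" I] by auto
  then show ?thesis using that[of e] assms by (auto simp: lfacet_def bij_betw_def)
qed

section \<open>Polygons of rank two links and the induction on the sum of positions\<close>

lemma sum_flip_pos:
  assumes "facet I" "k \<in> I" "vp (R I k)" shows "\<Sum>I < \<Sum>(flip I k)"
proof -
  have "\<Sum>(flip I k) = opp I k + \<Sum>(I - {k})"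
    unfolding flip_def using opp[OF assms(1)] facetD(3)[OF assms(1)] by (subst sum.insert) auto
  moreover have "\<Sum>I = k + \<Sum>(I - {k})" using sum.remove[of I k "\<lambda>x. x"] facetD(3)[OF assms(1)] assms by simp
  ultimately show ?thesis using opp_pos[OF assms] by simp
qed

lemma sum_flip_neg:
  assumes "facet I" "k \<in> I" "\<not> vp (R I k)" shows "\<Sum>(flip I k) < \<Sum>I"
  using sum_flip_pos[OF facet_flip[OF assms(1,2)] opp_mem_flip] R_flip_opp[OF assms(1,2)]
    not_vp_iff[of "R I k"] assms flip_flip[OF assms(1,2)] by simp

text \<open>Flipping negative positions outside K keeps K and lowers the sum, so it ends at the
  bottom of the link of K.\<close>

lemma descend:
  assumes "facet I" "K \<subseteq> I"
  obtains J where "facet J" "K \<subseteq> J" "\<Sum>J \<le> \<Sum>I" "\<And>j. j \<in> J - K \<Longrightarrow> vp (R J j)"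
proof -
  have "\<exists>J. facet J \<and> K \<subseteq> J \<and> \<Sum>J \<le> \<Sum>I \<and> (\<forall>j\<in>J - K. vp (R J j))"
    using assms
  proof (induction "\<Sum>I" arbitrary: I rule: less_induct)
    case less
    show ?case
    proof (cases "\<forall>j\<in>I - K. vp (R I j)")
      case False
      then obtain j where j: "j \<in> I" "j \<notin> K" "\<not> vp (R I j)" by auto
      have "K \<subseteq> flip I j" using less.prems j by (auto simp: flip_def)
      then show ?thesis
        using less.hyps[OF sum_flip_neg[OF less.prems(1) j(1,3)] facet_flip[OF less.prems(1) j(1)]]
          sum_flip_neg[OF less.prems(1) j(1,3)] by (meson less_imp_le order_trans)
    qed (use less in auto)
  qed
  then show ?thesis using that by blast
qed

text \<open>Cauchy-Schwarz for two nonproportional roots, through the positive square of the vector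
  w orthogonal to u, bounds the product of the two entries by 3.\<close>

lemma link_numbers:
  assumes e: "lfacet e" and ab: "a \<noteq> b" and nn: "0 \<le> BB e$a$b"
  shows "(nat (BB e$a$b), nat (- BB e$b$a)) \<in> {(0, 0), (1, 1), (1, 2), (2, 1), (1, 3), (3, 1)}"
    "- BB e$b$a \<ge> 0"
proof -
  define u where "u = R (range e) (e a)"
  define v where "v = R (range e) (e b)"
  define x where "x = BB e$a$b"
  define y where "y = - BB e$b$a"
  have ne: "e a \<noteq> e b" using lfacetD(2)[OF e] ab by simp
  have uv: "u \<in> roots" "v \<in> roots" "v \<noteq> u" "v \<noteq> - u"
    using R_distinct[OF lfacetD(1)[OF e] rangeI[of e b] rangeI[of e a]] ne by (auto simp: u_def v_def)
  define t :: int where "t = (if e a < e b then - 1 else 1)"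
  have t: "t * t = 1" by (simp add: t_def)
  have x: "x = t * cp u (A *v v)" and y: "y = t * cp v (A *v u)"
    using ne by (auto simp: x_def y_def u_def v_def t_def BB_def bb_def cc_def)
  have D: "dd u > 0" "dd v > 0" using uv dd_pos by auto
  have dx: "dd u * x = t * bf u v" and dy: "dd v * y = t * bf u v"
    using bf_cp[of u v] bf_cp[of v u] uv bf_sym[of u v] by (simp_all add: x y)
  have x0: "x \<ge> 0" using nn by (simp add: x_def)
  have "dd v * y \<ge> 0" using dx dy x0 D by (metis mult_nonneg_nonneg less_imp_le)
  then have y0: "y \<ge> 0" using D by (simp add: zero_le_mult_iff)
  then show "- BB e$b$a \<ge> 0" by (simp add: y_def)
  have z: "x = 0 \<longleftrightarrow> y = 0" using dx dy D by (metis mult_eq_0_iff less_irrefl)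
  define w where "w = (2 * dd u) *s v - bf u v *s u"
  have "w \<noteq> 0"
  proof
    assume "w = 0"
    then have "(2 * dd u) *s v = bf u v *s u" by (simp add: w_def)
    from proportional_roots[OF uv(2,1) this] D uv show False by auto
  qed
  from bf_pos[OF this] have "2 * dd u * (4 * dd u * dd v - bf u v * bf u v) > 0"
    using bf_root[OF uv(1)] bf_root[OF uv(2)] bf_sym[of v u] by (simp add: w_def bf_simps algebra_simps)
  then have "bf u v * bf u v < 4 * dd u * dd v" using D by (simp add: zero_less_mult_iff)
  moreover have "(dd u * x) * (dd v * y) = bf u v * bf u v"
    unfolding dx dy using t by (simp add: algebra_simps)
  ultimately have "(dd u * dd v) * (x * y) < (dd u * dd v) * 4" by (simp add: ac_simps)
  then have xy: "x * y < 4" using D by (simp add: mult_less_cancel_left)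
  have "(x, y) \<in> {(0, 0), (1, 1), (1, 2), (2, 1), (1, 3), (3, 1)}"
  proof (cases "x = 0")
    case False
    then have p: "x \<ge> 1" "y \<ge> 1" using x0 y0 z by auto
    then have "x * 1 \<le> x * y" "1 * y \<le> x * y" using mult_right_mono[of 1 x y] mult_left_mono[of 1 y x] by auto
    then have "x < 4" "y < 4" using xy by auto
    then have "x = 1 \<or> x = 2 \<or> x = 3" "y = 1 \<or> y = 2 \<or> y = 3" using p by linarith+
    then show ?thesis using xy by auto
  qed (use z in auto)
  then have "(nat x, nat y) \<in> {(0, 0), (1, 1), (1, 2), (2, 1), (1, 3), (3, 1)}"
    by (elim insertE) simp_all
  then show "(nat (BB e$a$b), nat (- BB e$b$a)) \<in> {(0, 0), (1, 1), (1, 2), (2, 1), (1, 3), (3, 1)}"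
    by (simp only: x_def y_def)
qed

text \<open>Seen from a rank two link, coefficients and variables at common positions are equally
  frozen. S is their disjoint union, and the exponents come from rows of \<open>YY\<close> and of
  \<open>BB\<close>.\<close>

lemma exr_pair:
  assumes e: "lfacet e" and ab: "a \<noteq> b" and e0: "\<And>i. i \<noteq> a \<Longrightarrow> i \<noteq> b \<Longrightarrow> e i = e0 i"
  defines "S \<equiv> Inl ` {..<L} \<union> Inr ` (UNIV - {a, b})"
    and "V \<equiv> case_sum pv (\<lambda>i. X (e0 i))"
    and "rho \<equiv> case_sum (YY e) (\<lambda>i j. BB e$i$j)"
  shows "exr (range e) (e a) X =
    (\<Prod>i\<in>S. V i ^ nat (pos (rho i a))) * X (e b) ^ nat (pos (BB e$b$a)) +
    (\<Prod>i\<in>S. V i ^ nat (pos (- rho i a))) * X (e b) ^ nat (pos (- BB e$b$a))"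
proof -
  have BBaa: "BB e$a$a = 0" by (simp add: BB_def)
  have split: "(\<Prod>i\<in>S. V i ^ nat (pos (u * rho i a))) =
      mp (\<lambda>p. pos (u * YY e p a)) * (\<Prod>i\<in>UNIV - {a, b}. X (e i) ^ nat (pos (u * BB e$i$a)))" for u
    unfolding S_def mp_def
    by (subst prod.union_disjoint) (auto simp: prod.reindex V_def rho_def e0 intro!: arg_cong2[of _ _ _ _ "(*)"] prod.cong)
  have UN: "(\<Prod>i\<in>UNIV. g i) = g b * (\<Prod>i\<in>UNIV - {a, b}. g i)" if "g a = 1" for g :: "'i \<Rightarrow> 'f"
  proof -
    have "(\<Prod>i\<in>UNIV. g i) = g a * (\<Prod>i\<in>UNIV - {a}. g i)" by (simp add: prod.remove)
    also have "(\<Prod>i\<in>UNIV - {a}. g i) = g b * (\<Prod>i\<in>UNIV - {a} - {b}. g i)" using ab by (simp add: prod.remove)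
    also have "UNIV - {a} - {b} = UNIV - {a, b}" by auto
    finally show ?thesis using that by simp
  qed
  show ?thesis
    using split[of 1] split[of "-1"]
    unfolding exr_lfacet[OF e]
    by (subst (1 2) UN) (simp_all add: BBaa Defs.pos_def ac_simps)
qed

text \<open>Rows of the exchange matrix at positions that stay put mutate like rows of coefficients,
  so both kinds of frozen variables can be treated alike.\<close>

lemma mut_row_BB:
  assumes "lfacet e" "i \<noteq> k" shows "BB (lflip e k)$i$j = mut_row k (BB e) (\<lambda>j. BB e$i$j) j"
  unfolding BB_lflip[OF assms(1)] using assms(2)
  by (auto simp: matrix_mutation_def mut_row_def Defs.pos_def max_def min_def)

text \<open>U runs through the positive roots of the rank two system in convex order, from -v, u to
  v, -u; m is the number of positive roots, that is 2, 3, 4 or 6.\<close>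

lemma polygon_roots:
  fixes u v :: "int^'i" and U :: "nat \<Rightarrow> int^'i" and r s m :: nat
  assumes "(r, s, m) \<in> {(0, 0, 2), (1, 1, 3), (1, 2, 4), (2, 1, 4), (1, 3, 6), (3, 1, 6)}"
    and U: "U 0 = - v" "U 1 = u"
      "\<And>t. U (Suc (Suc t)) = int (if even t then r else s) *s U (Suc t) - U t"
    and pos: "vp u" "vp v"
  shows "1 \<le> t \<Longrightarrow> t \<le> m \<Longrightarrow> vp (U t)" "U m = v" "U (m + 1) = - u"
proof -
  have "(\<forall>t\<in>{1..m}. vp (U t)) \<and> U m = v \<and> U (m + 1) = - u"
  proof -
    have S: "U 2 = int r *s U 1 - U 0" "U 3 = int s *s U 2 - U 1" "U 4 = int r *s U 3 - U 2"
      "U 5 = int s *s U 4 - U 3" "U 6 = int r *s U 5 - U 4" "U 7 = int s *s U 6 - U 5"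
      using U(3)[of 0] U(3)[of 1] U(3)[of 2] U(3)[of 3] U(3)[of 4] U(3)[of 5]
      by (simp_all flip: numeral_2_eq_2 numeral_3_eq_3)
    have nn: "u$i \<ge> 0" "v$i \<ge> 0" for i using pos by (auto simp: vp_def)
    have I: "{Suc 0..2} = {1, 2}" "{Suc 0..3} = {1, 2, 3}" "{Suc 0..4} = {1, 2, 3, 4}"
      "{Suc 0..6} = {1, 2, 3, 4, 5, 6}" by auto
    from assms(1) show ?thesis
      by (elim insertE emptyE) (simp_all add: I S U(1,2) U(2)[unfolded One_nat_def] vp_def vec_eq_iff nn pos[unfolded vp_def])
  qed
  then show "1 \<le> t \<Longrightarrow> t \<le> m \<Longrightarrow> vp (U t)" "U m = v" "U (m + 1) = - u" by auto
qed

text \<open>The facets sharing these positions form a polygon with m + 2 edges, bottom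
  \<open>e0\<close> and top I. A long side E flips a and b alternately m times, a short side flips b
  and then a. The relations of the edges below the top are known, and \<open>top_relations\<close>
  gives the two edges at the top.\<close>

lemma polygon:
  assumes e0: "lfacet e0" and ab: "a \<noteq> b" and vpu: "vp (R (range e0) (e0 a))"
    and vpv: "vp (R (range e0) (e0 b))" and nn: "0 \<le> BB e0$a$b"
    and I: "facet I" "e0 ` (UNIV - {a, b}) \<subseteq> I"
    and neg: "\<And>j. j \<in> I - e0 ` (UNIV - {a, b}) \<Longrightarrow> \<not> vp (R I j)"
    and IH: "\<And>J j. facet J \<Longrightarrow> \<Sum>J < \<Sum>I \<Longrightarrow> j \<in> J \<Longrightarrow> \<not> vp (R J j) \<Longrightarrow> Rel J j"
    and k: "k \<in> I - e0 ` (UNIV - {a, b})"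
  shows "Rel I k"
proof -
  define r where "r = nat (BB e0$a$b)"
  define s where "s = nat (- BB e0$b$a)"
  obtain m :: nat where rsm: "(r, s, m) \<in> {(0, 0, 2), (1, 1, 3), (1, 2, 4), (2, 1, 4), (1, 3, 6), (3, 1, 6)}"
    using link_numbers(1)[OF e0 ab nn] unfolding r_def[symmetric] s_def[symmetric] by auto
  have m2: "m \<ge> 2" using rsm by auto
  have rs: "BB e0$a$b = int r" "BB e0$b$a = - int s"
    using nn link_numbers(2)[OF e0 ab nn] by (simp_all add: r_def s_def)
  define ka la where "ka t = (if even t then a else b)" and "la t = (if even t then b else a)" for t :: nat
  define K where "K t = int (if even t then r else s)" for t :: nat
  have kala: "ka (Suc t) = la t" "la (Suc t) = ka t" "K (Suc (Suc t)) = K t" "ka t \<noteq> la t" "la t \<noteq> ka t" for t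
    using ab by (auto simp: ka_def la_def K_def)
  define E where "E = rec_nat e0 (\<lambda>t e. lflip e (ka t))"
  have E0: "E 0 = e0" and ES: "E (Suc t) = lflip (E t) (ka t)" for t by (simp_all add: E_def)
  have lf: "lfacet (E t)" for t by (induction t) (auto simp: E0 ES e0 lfacet_lflip)
  have eq: "E t i = e0 i" if "i \<noteq> a" "i \<noteq> b" for t i
    using that by (induction t) (auto simp: E0 ES ka_def lflip_def)
  have BBE: "BB (E t)$(ka t)$(la t) = K t \<and> BB (E t)$(la t)$(ka t) = - K (Suc t)" for t
  proof (induction t)
    case 0 then show ?case using rs by (simp add: E0 ka_def la_def K_def)
  next
    case (Suc t)
    then show ?case unfolding ES kala BB_lflip[OF lf] by (simp add: matrix_mutation_def)
  qed
  define u v where "u = R (range e0) (e0 a)" and "v = R (range e0) (e0 b)"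
  define W where "W = rec_nat (- v, u) (\<lambda>t (x, y). (y, K t *s y - x))"
  define U where "U t = fst (W t)" for t
  have U: "U 0 = - v" "U 1 = u" "U (Suc (Suc t)) = int (if even t then r else s) *s U (Suc t) - U t" for t
    by (simp_all add: U_def W_def K_def case_prod_beta)
  have vpuv: "vp u" "vp v" "u \<in> roots" "v \<in> roots" using vpu vpv by (simp_all add: u_def v_def)
  note Upos = polygon_roots(1)[OF rsm U vpuv(1,2)] and Utop = polygon_roots(2,3)[OF rsm U vpuv(1,2)]
  have RE: "t \<le> m \<Longrightarrow> R (range (E t)) (E t (ka t)) = U (Suc t) \<and> R (range (E t)) (E t (la t)) = - U t" for t
  proof (induction t)
    case 0 then show ?case using U by (simp add: E0 ka_def la_def u_def v_def)
  next
    case (Suc t)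
    note fl = lfacetD(1)[OF lf[of t]] rangeI[of "E t" "ka t"]
    have p: "vp (R (range (E t)) (E t (ka t)))" using Suc Upos[of "Suc t"] by simp
    have 1: "R (range (E (Suc t))) (E (Suc t) (ka t)) = - U (Suc t)"
      using R_flip_opp[OF fl] Suc by (simp add: ES range_lflip[OF lf])
    have ne: "E t (la t) \<noteq> E t (ka t)" using lfacetD(2)[OF lf] kala by simp
    have "R (range (E (Suc t))) (E (Suc t) (la t)) = - U t + pos (BB (E t)$(ka t)$(la t)) *s U (Suc t)"
      using R_flip_mutation[OF fl p rangeI ne] Suc kala by (simp add: ES range_lflip[OF lf] BB_def)
    also have "\<dots> = U (Suc (Suc t))"
      using BBE[of t] U(3)[of t] by (simp add: K_def Defs.pos_def)
    finally show ?case using 1 by (simp add: kala)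
  qed
  have up: "t < m \<Longrightarrow> \<Sum>(range (E t)) < \<Sum>(range (E (Suc t)))" for t
    using sum_flip_pos[OF lfacetD(1)[OF lf[of t]] rangeI[of "E t" "ka t"]] RE[of t] Upos[of "Suc t"]
    by (simp add: ES range_lflip[OF lf])
  have out: "j \<in> range e - e0 ` (UNIV - {a, b}) \<Longrightarrow> j = e a \<or> j = e b" if "\<And>i. i \<noteq> a \<Longrightarrow> i \<noteq> b \<Longrightarrow> e i = e0 i"
    for e :: "'i \<Rightarrow> nat" and j using that by (auto, metis DiffI UNIV_I empty_iff imageI insert_iff)
  have sub: "e0 ` (UNIV - {a, b}) \<subseteq> range e" if "\<And>i. i \<noteq> a \<Longrightarrow> i \<noteq> b \<Longrightarrow> e i = e0 i"
    for e :: "'i \<Rightarrow> nat" using that by (auto, metis rangeI)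
  have nvp: "\<not> vp (- u)" "\<not> vp (- v)" using vpuv vp_not_uminus by auto
  have top: "range e = I" if e: "lfacet e" "\<And>i. i \<noteq> a \<Longrightarrow> i \<noteq> b \<Longrightarrow> e i = e0 i"
      "\<not> vp (R (range e) (e a))" "\<not> vp (R (range e) (e b))" for e
  proof (rule greedy_unique_neg[OF lfacetD(1)[OF e(1)] I(1) sub[OF e(2)] I(2)])
    show "\<not> vp (R (range e) j)" if "j \<in> range e - e0 ` (UNIV - {a, b})" for j
      using out[of e, OF e(2) that] e(3,4) by auto
  qed (use e(2) neg in auto)
  have Em: "range (E m) = I"
  proof (rule top[OF lf eq])
    have "\<not> vp (R (range (E m)) (E m (ka m))) \<and> \<not> vp (R (range (E m)) (E m (la m)))"
      using RE[of m] Utop nvp by simp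
    then show "\<not> vp (R (range (E m)) (E m a))" "\<not> vp (R (range (E m)) (E m b))"
      by (auto simp: ka_def la_def split: if_splits)
  qed
  have less: "t < m \<Longrightarrow> \<Sum>(range (E t)) < \<Sum>I" for t
  proof -
    assume "t < m"
    then have "Suc t \<le> m" by simp
    then have "\<Sum>(range (E (Suc t))) \<le> \<Sum>I"
      by (induction rule: inc_induct) (auto simp: Em intro: less_imp_le[OF less_le_trans[OF up]])
    then show ?thesis using up[OF \<open>t < m\<close>] by simp
  qed
  \<comment> \<open>The short side. The signs of the entries between a and b are such that neither
    of these two flips changes the other root.\<close>
  define F1 F2 where "F1 = lflip e0 b" and "F2 = lflip F1 a"
  have lfF: "lfacet F1" "lfacet F2" using e0 by (auto simp: F1_def F2_def lfacet_lflip)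
  have neab: "e0 a \<noteq> e0 b" "F1 a \<noteq> F1 b" "F1 b \<noteq> F1 a" using lfacetD(2)[OF e0] lfacetD(2)[OF lfF(1)] ab by auto
  have eqF: "F1 i = e0 i" "F2 i = e0 i" if "i \<noteq> a" "i \<noteq> b" for i using that by (auto simp: F1_def F2_def)
  have BBF: "BB F1$b$a = int s" "BB F1$a$b = - int r"
    using ab rs by (auto simp: F1_def BB_lflip[OF e0] matrix_mutation_def)
  note fl0 = lfacetD(1)[OF e0] rangeI[of e0 b] vpv
  have RF1: "R (range F1) (F1 b) = - v" "R (range F1) (F1 a) = u"
    using R_flip_opp[OF fl0(1,2)] R_flip_mutation[OF fl0 rangeI[of e0 a] neab(1)] ab rs(2)
    by (simp_all add: F1_def range_lflip[OF e0] u_def v_def BB_def Defs.pos_def)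
  note fl1 = lfacetD(1)[OF lfF(1)] rangeI[of F1 a]
  have RF2: "R (range F2) (F2 a) = - u" "R (range F2) (F2 b) = - v"
    using R_flip_opp[OF fl1] R_flip_mutation[OF fl1 _ rangeI[of F1 b] neab(3)] ab BBF(2) RF1 vpuv
    by (simp_all add: F2_def range_lflip[OF lfF(1)] BB_def Defs.pos_def)
  have F2I: "range F2 = I" by (rule top[OF lfF(2) eqF(2)]) (auto simp: RF2 nvp)
  have F1less: "\<Sum>(range F1) < \<Sum>I"
    using sum_flip_pos[OF fl1] RF1 vpuv by (simp flip: F2I add: F2_def range_lflip[OF lfF(1)])
  have inj: "x = y" if "x \<in> I" "y \<in> I" "R I x = R I y" for x y
    using R_distinct[OF I(1) that(1,2)] that(3) by blast
  \<comment> \<open>Both sides end at the same facet, and equal roots identify the positions there: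
    the polygon closes up.\<close>
  have match: "E m (ka m) = F2 a" "E m (la m) = F2 b"
    using RE[of m] Utop RF2 Em F2I by (auto intro!: inj)
  define S where "S = Inl ` {..<L} \<union> Inr ` (UNIV - {a, b})"
  define V where "V = case_sum pv (\<lambda>i. X (e0 i))"
  define rho where "rho e = case_sum (YY e) (\<lambda>i j. BB e$i$j)" for e
  have rho_flip: "rho (lflip e x) i j = mut_row x (BB e) (rho e i) j" if "lfacet e" "x = a \<or> x = b" "i \<in> S" for e x i j
  proof (cases i)
    case (Inr l)
    then have "l \<noteq> x" using that(2,3) by (auto simp: S_def)
    then show ?thesis using mut_row_BB[OF that(1), of l x j] by (simp add: Inr rho_def)
  qed (use that YY_lflip[OF that(1)] in \<open>auto simp: S_def rho_def\<close>)
  \<comment> \<open>The entries 0 and m + 1 belong to the two edges of the short side. They have the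
    opposite sign because these edges are traversed downwards when going around the polygon.\<close>
  define y where "y t i = (case t of 0 \<Rightarrow> - rho e0 i b
      | Suc t' \<Rightarrow> if t' = m then - rho F1 i a else rho (E t') i (ka t'))" for t i
  define Z where "Z t = X (E t (ka t))" for t
  have yS: "t < m \<Longrightarrow> y (Suc t) i = rho (E t) i (ka t)" for t i by (simp add: y_def)
  have link: "rank2_link V S y Z r s m"
  proof
    fix i assume iS: "i \<in> S"
    moreover have "pv p \<noteq> 0" if "p < L" for p using pv_Pos[OF that] Pos_zero by auto
    ultimately show "V i \<noteq> 0" using X_nz by (auto simp: V_def S_def)
    have "rho F1 i a = rho e0 i a + int s * min (rho e0 i b) 0"
      using ab rs rho_flip[OF e0 _ iS, of b a] by (simp add: F1_def mut_row_def Defs.pos_def)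
    then show "y (m + 1) i = int s * pos (y 0 i) - y 1 i"
      using m2 by (simp add: y_def E0 ka_def Defs.pos_def max_def min_def)
    fix t assume "1 \<le> t" "t < m"
    then obtain t' where t': "t = Suc t'" by (cases t) auto
    have "rho (E (Suc t')) i (ka (Suc t')) = rho (E t') i (la t') + K t' * pos (rho (E t') i (ka t'))"
      using rho_flip[OF lf[of t'] _ iS, of "ka t'" "la t'"] BBE[of t'] kala
      by (simp add: ES mut_row_def ka_def) (simp add: K_def Defs.pos_def max_def min_def algebra_simps)
    moreover have "rho (E t') i (la t') = - y t' i"
    proof (cases t')
      case 0 then show ?thesis by (simp add: E0 la_def y_def)
    next
      case (Suc t'')
      then show ?thesis using rho_flip[OF lf[of t''] _ iS, of "ka t''" "ka t''"] kala \<open>t < m\<close> t'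
        by (simp add: ES yS mut_row_def ka_def)
    qed
    ultimately show "y (t + 1) i = int (if odd t then r else s) * pos (y t i) - y (t - 1) i"
      using \<open>t < m\<close> t' yS[of t i] yS[of t' i] by (simp add: K_def)
  qed (use rsm X_nz in \<open>auto simp: Z_def\<close>)
  interpret Lk: rank2_link V S y Z r s m by (rule link)
  have pair: "exr (range e) (e x) X = Lk.mon (\<lambda>i. pos (rho e i x)) * X (e z) ^ nat (pos (BB e$z$x)) +
      Lk.mon (\<lambda>i. pos (- rho e i x)) * X (e z) ^ nat (pos (- BB e$z$x))"
    if "lfacet e" "\<And>i. i \<noteq> a \<Longrightarrow> i \<noteq> b \<Longrightarrow> e i = e0 i" "x = a \<and> z = b \<or> x = b \<and> z = a" for e x z
  proof -
    have "S = Inl ` {..<L} \<union> Inr ` (UNIV - {x, z})" using that(3) by (auto simp: S_def)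
    then show ?thesis
      using exr_pair[OF that(1), of x z e0] that(2,3) ab
      unfolding Lk.mon_def unfolding V_def rho_def by auto
  qed
  have RelE: "Rel (range (E t)) (E t (ka t)) \<longleftrightarrow> Lk.rel (Suc t)" if "t < m" for t
  proof -
    have "exr (range (E t)) (E t (ka t)) X = Lk.a (Suc t) * Z (Suc t) ^ (if odd (Suc t) then s else r) + Lk.b (Suc t)"
      using pair[OF lf[of t] eq, of "ka t" "la t"] BBE[of t] yS[OF that] kala
      by (auto simp: Lk.a_def Lk.b_def Z_def ES K_def ka_def la_def Defs.pos_def)
    moreover have "E (Suc (Suc t)) (ka (Suc (Suc t))) = opp (range (E t)) (E t (ka t))"
      using kala by (simp add: ES)
    ultimately show ?thesis by (simp add: Rel_def Lk.rel_def Z_def)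
  qed
  interpret Lr: rank2_relations V S y Z r s m
  proof
    fix t assume t: "1 \<le> t" "t < m"
    then obtain t' where t': "t = Suc t'" by (cases t) auto
    have "\<not> vp (R (range (E t)) (E t (ka t')))"
      using RE[of t] Upos[of t] t t' kala vp_not_uminus[of "U t"] lf
      by (metis R_roots less_imp_le minus_minus uminus_roots)
    then have "Rel (range (E t)) (E t (ka t'))"
      using IH[OF lfacetD(1)[OF lf] less] t by blast
    then show "Lk.rel t" using Rel_lflip[OF lf[of t'], of "ka t'"] RelE[of t'] t by (simp add: t' ES)
  next
    have "Rel (range F1) (F1 b)"
      using IH[OF lfacetD(1)[OF lfF(1)] F1less rangeI] RF1(1) nvp by simp
    then have "Rel (range e0) (e0 b)" using Rel_lflip[OF e0] by (simp add: F1_def)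
    moreover have "exr (range e0) (e0 b) X = Lk.a 0 * Z 0 ^ r + Lk.b 0"
      using pair[OF e0, of b a] rs by (simp add: Lk.a_def Lk.b_def Z_def E0 ka_def y_def Defs.pos_def)
    moreover have "E (m + 1) (ka (m + 1)) = opp (range e0) (e0 b)"
      using match(2) kala ab by (simp add: ES F2_def) (simp add: F1_def)
    ultimately show "Z 1 * Z (m + 1) = Lk.a 0 * Z 0 ^ r + Lk.b 0"
      using ab by (simp add: Rel_def Z_def ES E0 ka_def)
  qed
  have "Rel (range (E (m - 1))) (E (m - 1) (ka (m - 1)))"
    using RelE[of "m - 1"] Lr.top_relations(1) m2 by simp
  then have "Rel (range (E (Suc (m - 1)))) (E (Suc (m - 1)) (ka (m - 1)))"
    using Rel_lflip[OF lf] by (simp add: ES)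
  moreover have "ka (m - 1) = la m" using kala(2)[of "m - 1"] m2 by simp
  ultimately have 1: "Rel I (E m (la m))" using m2 Em by simp
  have "exr (range F1) (F1 a) X = Lk.a (m + 1) * Z (m + 1) ^ s + Lk.b (m + 1)"
    using pair[OF lfF(1) eqF(1), of a b] BBF match ab kala
    by (simp add: Lk.a_def Lk.b_def Z_def ES y_def Defs.pos_def F2_def)
  moreover have "E m (ka m) = opp (range F1) (F1 a)" using match by (simp add: F2_def)
  ultimately have "Rel (range F1) (F1 a)"
    using Lr.top_relations(2) ab by (simp add: Rel_def Z_def E0 ka_def[of 0]) (simp add: F1_def)
  then have "Rel I (F2 a)" using Rel_lflip[OF lfF(1), of a] F2I by (simp add: F2_def)
  then have 2: "Rel I (E m (ka m))" using match by simp
  have "k = E m a \<or> k = E m b" using out[of "E m", OF eq] k Em by auto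
  then have "k = E m (ka m) \<or> k = E m (la m)" by (auto simp: ka_def la_def)
  then show ?thesis using 1 2 by auto
qed

text \<open>If k is the only descent, the relation is the definition of the variable. Otherwise a
  second descent l exists and I is the top of the polygon of I - {k, l}. Flips to the right are
  reduced to the reverse flips by the symmetry of the relation.\<close>

theorem exchange_relations_hold:
  assumes "facet I" "k \<in> I" shows "X k * X (opp I k) = exr I k X"
proof -
  have desc: "Rel I k" if "facet I" "k \<in> I" "\<not> vp (R I k)" for I k
    using that
  proof (induction "\<Sum>I" arbitrary: I k rule: less_induct)
    case less
    show ?case
    proof (cases "bottom I k")
      case True then show ?thesis by (rule Rel_bottom)
    next
      case False
      then obtain l where l: "l \<in> I" "l \<noteq> k" "\<not> vp (R I l)" using less.prems by (auto simp: bottom_def)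
      define K where "K = I - {k, l}"
      obtain J where J: "facet J" "K \<subseteq> J" "\<Sum>J \<le> \<Sum>I" "\<And>j. j \<in> J - K \<Longrightarrow> vp (R J j)"
        using descend[OF less.prems(1), of K] by (auto simp: K_def)
      have fin: "finite I" "finite J" "finite K" using facetD(3) less.prems(1) J(1) by (auto simp: K_def)
      have "card (J - K) = card (I - K)"
        using facetD(2)[OF less.prems(1)] facetD(2)[OF J(1)] fin J(2)
        by (subst (1 2) card_Diff_subset) (auto simp: K_def)
      moreover have "I - K = {k, l}" using less.prems l by (auto simp: K_def)
      ultimately obtain p q where pq: "J - K = {p, q}" "p \<noteq> q"
        using l by (metis card_2_iff)
      obtain e where e: "lfacet e" "range e = J" using lfacet_exists[OF J(1)] .
      obtain x z where xz: "e x = p" "e z = q" using pq e(2) by (metis DiffD1 insertI1 insertI2 rangeE)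
      have ne: "x \<noteq> z" using xz pq by auto
      have im: "e ` (UNIV - {x, z}) = K"
      proof -
        have "e ` (UNIV - {x, z}) = range e - {p, q}"
          using e(1) xz by (auto simp: lfacet_def inj_def)
        then show ?thesis using e(2) pq J(2) by auto
      qed
      \<comment> \<open>The two entries have opposite signs or vanish, so one of the two orders of x
        and z has the long side that \<open>polygon\<close> expects.\<close>
      have sgn: "0 \<le> BB e$x$z \<or> 0 \<le> BB e$z$x"
      proof (rule ccontr)
        assume n: "\<not> ?thesis"
        define t :: int where "t = (if p < q then - 1 else 1)"
        have "BB e$x$z = t * cp (R J p) (A *v R J q)" "BB e$z$x = - t * cp (R J q) (A *v R J p)"
          using pq(2) xz e(2) by (auto simp: BB_def bb_def cc_def t_def)
        then show False
          using n cp_sign[of "R J p" "R J q"] cp_sign[of "R J q" "R J p"] bf_sym[of "R J p" "R J q"]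
          by (auto simp: t_def split: if_splits)
      qed
      have vps: "vp (R (range e) (e x))" "vp (R (range e) (e z))" using J(4) pq e(2) xz by auto
      have IH: "Rel J' j" if "facet J'" "\<Sum>J' < \<Sum>I" "j \<in> J'" "\<not> vp (R J' j)" for J' j
        using less.hyps that by blast
      have neg: "\<not> vp (R I j)" if "j \<in> I - K" for j
        using that less.prems l by (auto simp: K_def)
      have KI: "K \<subseteq> I" "k \<in> I - K" using less.prems by (auto simp: K_def)
      show ?thesis
      proof (cases "0 \<le> BB e$x$z")
        case True
        show ?thesis by (rule polygon[OF e(1) ne vps True less.prems(1), unfolded im, OF KI(1) neg IH KI(2)])
      next
        case False
        then have nn: "0 \<le> BB e$z$x" using sgn by simp
        show ?thesis
          by (rule polygon[OF e(1) ne[symmetric] vps(2,1) nn less.prems(1),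
                unfolded insert_commute[of z] im, OF KI(1) neg IH KI(2)])
      qed
    qed
  qed
  have "Rel I k"
  proof (cases "vp (R I k)")
    case True
    obtain e where e: "lfacet e" "range e = I" using lfacet_exists[OF assms(1)] .
    obtain x where x: "k = e x" using assms(2) e(2) by auto
    have "Rel (flip I k) (opp I k)"
      using True R_flip_opp[OF assms] vp_not_uminus[of "R I k"]
      by (intro desc facet_flip[OF assms] opp_mem_flip) auto
    then show ?thesis using Rel_lflip[OF e(1), of x] by (simp add: range_lflip[OF e(1)] e(2) x)
  qed (use desc assms in blast)
  then show ?thesis by (simp add: Rel_def)
qed

end

section \<open>Orbits of a Coxeter element\<close>

context cartan
begin

lemma inversion_word:
  assumes "v \<in> roots" "vp v" "\<not> vp (rw (rev w) v)"
  shows "\<exists>j<length w. v = rw (take j w) (axis (w!j) 1)"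
  using assms
proof (induction w arbitrary: v)
  case (Cons i w)
  show ?case
  proof (cases "v = axis i 1")
    case False
    have "vp (sr i v)" using vp_sr[OF Cons.prems(1,2) False] .
    moreover have "\<not> vp (rw (rev w) (sr i v))" using Cons.prems by simp
    ultimately obtain j where j: "j < length w" "sr i v = rw (take j w) (axis (w!j) 1)"
      using Cons.IH[of "sr i v"] Cons.prems(1) by auto
    have "v = sr i (sr i v)" by simp
    then show ?thesis unfolding j(2) using j(1) by (intro exI[of _ "Suc j"]) simp
  qed (auto intro!: exI[of _ 0])
qed simp

lemma rw_coord: "i \<notin> set w \<Longrightarrow> rw w v $ i = v $ i"
  by (induction w) (auto simp: sr_def)

lemma ww_fixed: "(\<And>j. j \<in> set w \<Longrightarrow> l$j = 0) \<Longrightarrow> ww w l = l"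
  by (induction w) (auto simp: sw_eq)

text \<open>If the root of a letter in the word is orthogonal to the final image of l, then the
  letter fixes the image of l on which it acts.\<close>

lemma ww_drop:
  assumes "\<And>k. k < length xs \<Longrightarrow> \<not> P (xs!k) \<Longrightarrow>
      pr (rw (map f (take k xs)) (axis (f (xs!k)) 1)) (ww (map f xs) l) = 0"
  shows "ww (map f (filter P xs)) l = ww (map f xs) l"
  using assms
proof (induction xs)
  case (Cons x xs)
  have "ww (map f (filter P xs)) l = ww (map f xs) l"
  proof (rule Cons.IH)
    fix k assume "k < length xs" "\<not> P (xs!k)"
    then show "pr (rw (map f (take k xs)) (axis (f (xs!k)) 1)) (ww (map f xs) l) = 0"
      using Cons.prems[of "Suc k"] by (simp add: pr_sr_sw)
  qed
  moreover have "\<not> P x \<Longrightarrow> (ww (map f xs) l)$(f x) = 0"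
    using Cons.prems[of 0] d_pos[of "f x"] by (simp add: pr_axis_left sw_eq A_axis_nth)
  ultimately show ?case by (auto simp: sw_eq)
qed simp

end

locale coxeter_cartan = cartan A d for A :: "int^'i^'i" and d +
  fixes cw :: "'i list"
  assumes cw_distinct: "distinct cw" and cw_set: "set cw = UNIV"
begin

abbreviation "cq \<equiv> ww cw"
abbreviation "cr \<equiv> rw cw"
abbreviation "n \<equiv> length cw"

definition idx :: "'i \<Rightarrow> nat" where "idx i = (THE j. j < n \<and> cw!j = i)"

lemma idx: "idx i < n" "cw!(idx i) = i"
proof -
  obtain j where "j < n" "cw!j = i" using cw_set by (metis UNIV_I in_set_conv_nth)
  then have "\<exists>!j. j < n \<and> cw!j = i" using cw_distinct by (auto simp: nth_eq_iff_index_eq)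
  from theI'[OF this] show "idx i < n" "cw!(idx i) = i" by (auto simp: idx_def)
qed

lemma idx_nth: "j < n \<Longrightarrow> idx (cw!j) = j"
  using idx[of "cw!j"] cw_distinct by (simp add: nth_eq_iff_index_eq)

lemma idx_inj: "idx i = idx j \<longleftrightarrow> i = j"
  by (metis idx(2))

lemma n_pos: "n > 0"
  using idx(1)[of undefined] by linarith

text \<open>These are the positive roots that the inverse of c makes negative
  (\<open>fo_neg\<close>, \<open>first_root\<close>); each starts a segment of positive roots in its
  c-orbit.\<close>

definition fo :: "'i \<Rightarrow> int^'i" where "fo i = rw (take (idx i) cw) (axis i 1)"

lemma set_take_idx: "j \<in> set (take (idx i) cw) \<longleftrightarrow> idx j < idx i"
proof
  assume "j \<in> set (take (idx i) cw)"
  then obtain t where "t < idx i" "t < n" "j = cw!t" by (auto simp: in_set_conv_nth)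
  then show "idx j < idx i" by (simp add: idx_nth)
next
  assume "idx j < idx i"
  then show "j \<in> set (take (idx i) cw)"
    using idx[of j] by (auto simp: in_set_conv_nth intro!: exI[of _ "idx j"])
qed

lemma cw_split: "cw = take (idx i) cw @ i # drop (Suc (idx i)) cw"
  using id_take_nth_drop[OF idx(1)[of i]] idx(2)[of i] by simp

lemma not_in_rest: "i \<notin> set (drop (Suc (idx i)) cw)"
  using cw_distinct cw_split[of i] by (metis distinct.simps(2) distinct_append)

lemma fo_roots [simp]: "fo i \<in> roots" and dd_fo [simp]: "dd (fo i) = d i"
  by (simp_all add: fo_def)

lemma fo_coord: "idx i \<le> idx j \<Longrightarrow> fo i $ j = (if i = j then 1 else 0)"
  unfolding fo_def by (subst rw_coord) (auto simp: set_take_idx)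

lemma vp_fo: "vp (fo i)"
  by (rule vp_pos_coord[of _ i]) (auto simp: fo_coord)

lemma c_fundamental: "cq (axis i 1) = axis i 1 - A *v fo i"
proof -
  have "cq (axis i 1) = ww (take (idx i) cw) (sw i (ww (drop (Suc (idx i)) cw) (axis i 1)))"
    by (subst cw_split[of i]) simp
  also have "ww (drop (Suc (idx i)) cw) (axis i 1) = axis i 1"
    by (rule ww_fixed) (use not_in_rest in auto)
  also have "ww (take (idx i) cw) (sw i (axis i 1)) = ww (take (idx i) cw) (axis i 1) - A *v fo i"
    by (simp add: sw_eq ww_linear fo_def A_rw)
  also have "ww (take (idx i) cw) (axis i 1) = axis i 1"
    by (rule ww_fixed) (auto simp: set_take_idx)
  finally show ?thesis .
qed

lemma Gw_fundamental: "Gw cw (axis i 1) = fo i"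
  by (rule A_inj) (simp add: A_Gw c_fundamental)

lemma c_fixed: "cq l = l \<Longrightarrow> l = 0"
proof -
  assume "cq l = l"
  then have "A *v Gw cw l = A *v 0" by (simp add: A_Gw)
  then have "Gw cw l = 0" by (rule A_inj)
  then show ?thesis using Gw_inj_aux[OF cw_distinct, of l] cw_set by (simp add: vec_eq_iff)
qed

lemma cr_fixed: "cr v = v \<Longrightarrow> v = 0"
  using c_fixed[of "A *v v"] A_rw[of cw v] A_inj[of v 0] by simp

lemma Gw_c: "Gw cw (cq l) = cr (Gw cw l)"
  by (rule A_inj) (simp add: A_Gw A_rw ww_linear)

lemma Gw_c_pow: "Gw cw ((cq^^m) l) = (cr^^m) (Gw cw l)"
  by (induction m) (auto simp: Gw_c)

abbreviation "wt i m \<equiv> (cq^^m) (axis i 1)"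
abbreviation "rt i m \<equiv> (cr^^m) (fo i)"

lemma Gw_wt: "Gw cw (wt i m) = rt i m"
  by (simp add: Gw_c_pow Gw_fundamental)

lemma Gw_eq_iff: "Gw cw l = Gw cw m \<longleftrightarrow> l = m"
proof
  assume "Gw cw l = Gw cw m"
  then have "Gw cw (l - m) = 0" by (simp add: Gw_linear)
  then show "l = m" using Gw_inj_aux[OF cw_distinct, of "l - m"] cw_set by (simp add: vec_eq_iff)
qed simp

lemma wt_Suc: "wt i m - wt i (Suc m) = A *v rt i m"
  using A_Gw[of cw "wt i m"] by (simp add: Gw_wt)

lemma rt_roots [simp]: "rt i m \<in> roots" and dd_rt [simp]: "dd (rt i m) = d i"
  by (induction m) auto

lemma cr_rev [simp]: "rw (rev cw) (cr v) = v" "cr (rw (rev cw) v) = v"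
  by simp_all

lemma cr_inj: "cr u = cr v \<longleftrightarrow> u = v"
  by (metis cr_rev(1))

lemma cr_pow_inj: "(cr^^m) u = (cr^^m) v \<longleftrightarrow> u = v"
  by (induction m) (auto simp: cr_inj)

lemma cr_pow_linear: "(cr^^m) (- u) = - (cr^^m) u"
  by (induction m) (auto simp: rw_linear)

lemma first_root: assumes "v \<in> roots" "vp v" "\<not> vp (rw (rev cw) v)" obtains i where "v = fo i"
proof -
  obtain j where "j < n" "v = rw (take j cw) (axis (cw!j) 1)" using inversion_word[OF assms] by auto
  then have "v = fo (cw!j)" by (simp add: fo_def idx_nth)
  then show ?thesis using that by blast
qed

lemma fo_neg: "\<not> vp (rw (rev cw) (fo i))"
proof -
  have "rw (rev cw) (fo i) = - rw (rev (drop (Suc (idx i)) cw)) (axis i 1)"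
    by (subst cw_split[of i]) (simp add: fo_def rw_linear del: append_take_drop_id)
  also have "\<dots> $ i = - 1" using not_in_rest by (simp add: rw_coord)
  finally have "rw (rev cw) (fo i) $ i < 0" by simp
  then show ?thesis by (auto simp: vp_def) (metis not_le)
qed

text \<open>The orbit is finite, hence periodic, and its sum over a period is fixed by g, hence 0. A
  sum of nonnegative vectors, one of them nonzero, cannot be 0.\<close>

lemma orbit_leaves_positive:
  assumes "\<And>v. g v = v \<Longrightarrow> v = 0" "\<And>u v. g (u + v) = g u + g v" "inj g" "\<And>v. v \<in> roots \<Longrightarrow> g v \<in> roots"
    and v: "v \<in> roots"
  obtains m where "\<not> vp ((g^^m) v)"
proof -
  have r: "(g^^m) v \<in> roots" for m by (induction m) (auto simp: v assms)
  have "\<not> inj (\<lambda>m. (g^^m) v)"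
    using finite_subset[OF _ finite_roots, of "range (\<lambda>m. (g^^m) v)"] r
    by (auto dest: finite_imageD)
  then obtain a b where ab: "a < b" "(g^^a) v = (g^^b) v" by (auto simp: inj_def) (metis linorder_neqE_nat)
  define k where "k = b - a"
  have "(g^^a) ((g^^k) v) = (g^^a) v" using ab funpow_add[of a k g] by (simp add: k_def)
  moreover have "inj (g^^a)" using assms(3) by (rule inj_fn)
  ultimately have k: "(g^^k) v = v" by (meson injD)
  have k0: "k > 0" using ab(1) by (simp add: k_def)
  define s where "s = (\<Sum>m<k. (g^^m) v)"
  have g0: "g 0 = 0" using assms(2)[of 0 0] by simp
  have "g (\<Sum>m\<in>S. u m) = (\<Sum>m\<in>S. g (u m))" for S and u :: "nat \<Rightarrow> int^'i"
    by (induction S rule: infinite_finite_induct) (auto simp: g0 assms(2))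
  then have "g s = (\<Sum>m<k. (g^^Suc m) v)" by (simp add: s_def)
  also have "\<dots> = s"
    using sum.lessThan_Suc_shift[of "\<lambda>m. (g^^m) v" k] k by (simp add: s_def sum.lessThan_Suc del: funpow.simps)
  finally have "s = 0" by (rule assms(1))
  show ?thesis
  proof (rule ccontr)
    assume "\<not> thesis"
    then have all: "vp ((g^^m) v)" for m using that by blast
    have "v$i = 0" for i
    proof -
      have "(\<Sum>m<k. ((g^^m) v)$i) = 0" using \<open>s = 0\<close> by (simp add: s_def vec_eq_iff)
      then have "\<forall>m\<in>{..<k}. ((g^^m) v)$i = 0"
        using all by (subst (asm) sum_nonneg_eq_0_iff) (auto simp: vp_def)
      from bspec[OF this, of 0] show ?thesis using k0 by simp
    qed
    then show False using roots_nonzero[OF v] by (simp add: vec_eq_iff)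
  qed
qed

text \<open>The length of the positive segment; \<open>cox_h_eq\<close> identifies it with
  h(i;c).\<close>

definition h :: "'i \<Rightarrow> nat" where "h i = (LEAST m. \<not> vp (rt i m))"

lemma h_neg: "\<not> vp (rt i (h i))"
proof -
  obtain m where "\<not> vp (rt i m)"
    by (rule orbit_leaves_positive[of cr "fo i"]) (auto simp: cr_fixed rw_linear inj_def cr_inj)
  then show ?thesis unfolding h_def by (rule LeastI)
qed

lemma h_pos: "m < h i \<Longrightarrow> vp (rt i m)"
  using not_less_Least[of m "\<lambda>m. \<not> vp (rt i m)"] by (auto simp: h_def)

lemma h_gt_0: "0 < h i"
  using h_neg[of i] vp_fo[of i] by (cases "h i") auto

text \<open>The negative of the first negative root is positive, and the inverse of c makes it
  negative again, so it is one of the roots \<open>fo j\<close>.\<close>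

lemma rt_h_ex: "\<exists>j. rt i (h i) = - fo j"
proof -
  obtain m where m: "h i = Suc m" using h_gt_0[of i] by (cases "h i") auto
  have neg: "vp (- rt i (h i))" using h_neg[of i] not_vp_iff[of "rt i (h i)"] by simp
  have "rw (rev cw) (- rt i (h i)) = - rt i m" by (simp add: m rw_linear)
  then have "\<not> vp (rw (rev cw) (- rt i (h i)))" using h_pos[of m i] vp_not_uminus[of "rt i m"] m by simp
  then obtain j where "- rt i (h i) = fo j" using first_root[of "- rt i (h i)"] neg by auto
  then show ?thesis by (metis minus_minus)
qed

definition st :: "'i \<Rightarrow> 'i" where "st i = (SOME j. rt i (h i) = - fo j)"

lemma rt_h: "rt i (h i) = - fo (st i)"
  unfolding st_def using rt_h_ex by (rule someI_ex)

lemma wt_h: "wt i (h i) = - axis (st i) 1"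
proof -
  have "Gw cw (wt i (h i)) = Gw cw (- axis (st i) 1)"
    by (simp add: Gw_wt rt_h Gw_linear Gw_fundamental)
  then show ?thesis by (simp only: Gw_eq_iff)
qed

lemma d_st [simp]: "d (st i) = d i"
  using dd_rt[of "h i" i] unfolding rt_h by simp

lemma rt_unique_aux: assumes "rt i a = rt j b" "a \<le> b" "b - a < h j" shows "a = b \<and> i = j"
proof -
  have "rt j b = (cr^^a) (rt j (b - a))" using assms(2) funpow_add[of a "b - a" cr] by simp
  then have eq: "fo i = rt j (b - a)" using assms(1) by (simp add: cr_pow_inj)
  have ba: "b - a = 0"
  proof (rule ccontr)
    assume "b - a \<noteq> 0"
    then obtain k where k: "b - a = Suc k" by (cases "b - a") auto
    have "rw (rev cw) (fo i) = rt j k" by (simp add: eq k)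
    then show False using fo_neg[of i] h_pos[of k j] k assms(3) by simp
  qed
  then have "Gw cw (axis i 1) = Gw cw (axis j 1)" using eq by (simp add: Gw_fundamental)
  then have "axis i 1 = (axis j 1 :: int^'i)" by (simp only: Gw_eq_iff)
  then show ?thesis using ba assms(2) by (simp add: axis_eq_axis)
qed

lemma fo_inj: "fo i = fo j \<longleftrightarrow> i = j"
proof
  assume "fo i = fo j"
  then have "rt i 0 = rt j 0" by simp
  from rt_unique_aux[OF this] show "i = j" using h_gt_0[of j] by simp
qed simp

lemma rt_unique: assumes "rt i a = rt j b" "a < h i" "b < h j" shows "a = b \<and> i = j"
proof (cases "a \<le> b")
  case True then show ?thesis using rt_unique_aux[OF assms(1)] assms(3) by simp
next
  case False
  then have "b \<le> a" "a - b < h i" using assms(2) by auto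
  from rt_unique_aux[OF assms(1)[symmetric] this] show ?thesis by simp
qed

lemma st_inj: "st i = st j \<longleftrightarrow> i = j"
proof
  assume "st i = st j"
  then have eq: "rt i (h i) = rt j (h j)" by (simp add: rt_h)
  show "i = j"
  proof (cases "h i \<le> h j")
    case True then show ?thesis using rt_unique_aux[OF eq] h_gt_0[of i] h_gt_0[of j] by simp
  next
    case False
    then have "h j \<le> h i" "h i - h j < h i" using h_gt_0[of j] by auto
    from rt_unique_aux[OF eq[symmetric] this] show ?thesis by simp
  qed
qed simp

lemma st_surj: obtains j where "i = st j"
proof -
  have "inj st" by (simp add: inj_def st_inj)
  then have "surj st" using finite_UNIV_inj_surj finite by blast
  then show ?thesis using that by auto
qed

text \<open>Walking backwards along the orbit of v, the last positive root before the sign changes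
  is some \<open>fo i\<close>. So the segments exhaust the positive roots.\<close>

lemma rt_surj: assumes "v \<in> roots" "vp v" obtains i m where "m < h i" "v = rt i m"
proof -
  let ?g = "rw (rev cw)"
  define P where "P m \<longleftrightarrow> \<not> vp ((?g^^m) v)" for m
  obtain m0 where "P m0" unfolding P_def
  proof (rule orbit_leaves_positive[of ?g v])
    show "?g u = u \<Longrightarrow> u = 0" for u using cr_fixed[of u] cr_rev(2)[of u] by simp
    show "inj ?g" by (rule injI) (metis cr_rev(2))
  qed (auto simp: rw_linear assms)
  define k where "k = (LEAST m. P m)"
  have k: "P k" "\<And>m. m < k \<Longrightarrow> \<not> P m" unfolding k_def using \<open>P m0\<close> by (auto intro: LeastI dest: not_less_Least)
  have "k \<noteq> 0" using k(1) assms by (intro notI) (simp add: P_def)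
  then obtain m where m: "k = Suc m" by (cases k) auto
  define u where "u = (?g^^m) v"
  have ur: "(?g^^a) v \<in> roots" for a by (induction a) (auto simp: assms)
  have "vp u" "\<not> vp (?g u)" "u \<in> roots" using k m ur by (auto simp: P_def u_def)
  then obtain i where i: "u = fo i" using first_root[of u] by auto
  have bk: "(cr^^a) ((?g^^(a + b)) v) = (?g^^b) v" for a b :: nat
    by (induction a arbitrary: b) (simp_all add: funpow_swap1[of cr])
  have v: "rt i a = (?g^^(m - a)) v" if "a \<le> m" for a
    using bk[of a "m - a"] that by (simp add: u_def flip: i)
  have "vp (rt i a)" if "a \<le> m" for a using v[OF that] k(2)[of "m - a"] m by (simp add: P_def)
  then have "m < h i" using h_neg[of i] by (metis not_le)
  then show ?thesis using that[of m i] v[of m] by simp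
qed

lemma wt_unique: assumes "wt i a = wt j b" "a \<le> h i" "b \<le> h j" shows "a = b \<and> i = j"
proof -
  have eq: "rt i a = rt j b" using assms(1) by (simp flip: Gw_wt)
  consider "a < h i" "b < h j" | "a = h i" "b < h j" | "a < h i" "b = h j" | "a = h i" "b = h j"
    using assms(2,3) by linarith
  then show ?thesis
  proof cases
    case 4
    then have "fo (st i) = fo (st j)" using eq by (simp add: rt_h)
    then show ?thesis using 4 by (simp add: fo_inj st_inj)
  qed (use rt_unique[OF eq] eq h_pos[of b j] h_pos[of a i] h_neg[of i] h_neg[of j] in auto)
qed

lemma pr_rt_wt_shift: "pr (rt i (a + k)) (wt j (b + k)) = pr (rt i a) (wt j b)"
proof -
  have "rt i (a + k) = (cr^^k) (rt i a)" "wt j (b + k) = (cq^^k) (wt j b)"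
    using funpow_add[of k a cr] funpow_add[of k b cq] by (simp_all add: add.commute)
  moreover have "pr ((cr^^k) u) ((cq^^k) l) = pr u l" for u l by (induction k) (auto simp: pr_rw_ww)
  ultimately show ?thesis by simp
qed

lemma pr_rt_wt_gt:
  assumes "a < b" shows "pr (rt i a) (wt j b) = - d i * rt j (b - Suc a) $ i"
proof -
  define k where "k = b - Suc a"
  have b: "b = Suc k + a" using assms by (simp add: k_def)
  have "pr (rt i a) (wt j b) = pr (fo i) (cq (wt j k))"
    using pr_rt_wt_shift[of 0 a i "Suc k" j] by (simp add: b)
  also have "\<dots> = - pr (rt j k) (axis i 1)"
    using pr_Gw_ww[of cw "axis i 1" "wt j k"] by (simp only: Gw_wt Gw_fundamental)
  finally show ?thesis using b by (simp add: pr_axis_right)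
qed

lemma pr_rt_wt_eq: "pr (rt i a) (wt j a) = d j * fo i $ j"
  using pr_rt_wt_shift[of 0 a i 0 j] by (simp add: pr_axis_right)

text \<open>Beyond \<open>h i\<close> the root is also minus a root in the orbit of
  \<open>fo (st i)\<close>. The two descriptions give pairings of opposite sign. The bound is
  \<open>Suc (h j)\<close>, not \<open>h j\<close>, because roots will be treated as differences of
  consecutive weights.\<close>

lemma pr_rt_wt_zero:
  assumes a: "h i < a" "a < b" "b \<le> Suc (h j)" shows "pr (rt i a) (wt j b) = 0"
proof -
  define a' where "a' = a - h i"
  have a': "a = a' + h i" "0 < a'" "a' < b" using a by (auto simp: a'_def)
  have nn: "rt j (b - Suc e) $ l \<ge> 0" if "0 < e" for e l
    using h_pos[of "b - Suc e" j] that a(3) h_gt_0[of j] by (auto simp: vp_def)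
  have "rt i a = (cr^^a') (rt i (h i))" using funpow_add[of a' "h i" cr] by (simp add: a'(1))
  then have "rt i a = - rt (st i) a'" by (simp add: rt_h cr_pow_linear)
  then have "pr (rt i a) (wt j b) = d i * rt j (b - Suc a') $ st i"
    using pr_rt_wt_gt[OF a'(3), of "st i" j] by (simp add: pr_simps)
  then have "pr (rt i a) (wt j b) \<ge> 0" using nn[OF a'(2)] d_pos[of i] by simp
  moreover have "pr (rt i a) (wt j b) \<le> 0"
    using pr_rt_wt_gt[OF a(2), of i j] nn[of a i] d_pos[of i] a(1) by simp
  ultimately show ?thesis by simp
qed

section \<open>The word of a Coxeter element\<close>

text \<open>Positions are first counted in the periodic word c c c ...: k mod n gives the letter and
  k div n the power of c. \<open>kept\<close> retains the powers up to h of the letter.\<close>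

definition lt :: "nat \<Rightarrow> 'i" where "lt k = cw!(k mod n)"
definition keep :: "nat \<Rightarrow> bool" where "keep k \<longleftrightarrow> k div n \<le> h (lt k)"
definition kept :: "nat list" where "kept = filter keep [0..<n * Suc (Max (range h))]"
definition Qw :: "'i list" where "Qw = map lt kept"

lemma map_lt: "t \<le> n \<Longrightarrow> rw (map lt [0..<a * n + t]) v = (cr^^a) (rw (take t cw) v)"
  "t \<le> n \<Longrightarrow> ww (map lt [0..<a * n + t]) l = (cq^^a) (ww (take t cw) l)"
proof -
  assume t: "t \<le> n"
  have 0: "map lt [0..<t] = take t cw" using t by (intro nth_equalityI) (auto simp: lt_def)
  have S: "map lt [0..<Suc a * n + t] = cw @ map lt [0..<a * n + t]" for a
  proof (rule nth_equalityI)
    fix k assume "k < length (map lt [0..<Suc a * n + t])"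
    then show "map lt [0..<Suc a * n + t] ! k = (cw @ map lt [0..<a * n + t]) ! k"
      by (cases "k < n") (auto simp: nth_append lt_def le_mod_geq)
  qed auto
  show "rw (map lt [0..<a * n + t]) v = (cr^^a) (rw (take t cw) v)"
    by (induction a) (auto simp: 0 S simp del: mult_Suc)
  show "ww (map lt [0..<a * n + t]) l = (cq^^a) (ww (take t cw) l)"
    by (induction a) (auto simp: 0 S simp del: mult_Suc)
qed

lemma full_prefix: "rw (map lt [0..<k]) (axis (lt k) 1) = rt (lt k) (k div n)"
  "ww (map lt [0..<k]) (axis (lt k) 1) = wt (lt k) (k div n)"
proof -
  have k: "k mod n \<le> n" "(k div n) * n + k mod n = k" "idx (lt k) = k mod n"
    using n_pos by (auto simp: lt_def idx_nth less_imp_le)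
  have "ww (take (idx (lt k)) cw) (axis (lt k) 1) = axis (lt k) 1"
    by (rule ww_fixed) (auto simp: set_take_idx)
  then show "ww (map lt [0..<k]) (axis (lt k) 1) = wt (lt k) (k div n)"
    using map_lt(2)[OF k(1), of "k div n"] k by simp
  show "rw (map lt [0..<k]) (axis (lt k) 1) = rt (lt k) (k div n)"
    using map_lt(1)[OF k(1), of "k div n"] k by (simp add: fo_def)
qed

text \<open>The letters which are not kept act trivially: the two ways to compute the pairing of their
  roots with the weights of kept positions give opposite signs.\<close>

lemma kept_prefix:
  assumes "keep k"
  shows "ww (map lt (filter keep [0..<k])) (axis (lt k) 1) = wt (lt k) (k div n)"
    and "rw (map lt (filter keep [0..<k])) (axis (lt k) 1) = rt (lt k) (k div n)"
proof -
  let ?j = "lt k" and ?b = "k div n"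
  have b: "?b \<le> h ?j" using assms by (simp add: keep_def)
  have zero: "pr (rt (lt z) (z div n)) (wt ?j ?b) = 0"
    "pr (rt (lt z) (z div n)) (wt ?j (Suc ?b)) = 0" if "z < k" "\<not> keep z" for z
  proof -
    have z: "h (lt z) < z div n" "z div n \<le> ?b" using that by (auto simp: keep_def div_le_mono)
    show "pr (rt (lt z) (z div n)) (wt ?j (Suc ?b)) = 0"
      by (rule pr_rt_wt_zero[OF z(1)]) (use z b in auto)
    show "pr (rt (lt z) (z div n)) (wt ?j ?b) = 0"
    proof (cases "z div n = ?b")
      case True
      then have "z mod n < k mod n" using that(1) by (metis div_mult_mod_eq nat_add_left_cancel_less)
      then have "fo (lt z) $ ?j = 0"
        using n_pos by (subst fo_coord) (auto simp: lt_def idx_nth nth_eq_iff_index_eq cw_distinct)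
      then show ?thesis using True by (simp add: pr_rt_wt_eq)
    next
      case False
      show ?thesis by (rule pr_rt_wt_zero[OF z(1)]) (use z b False in auto)
    qed
  qed
  have tk: "map lt (take z [0..<k]) = map lt [0..<z]" "[0..<k]!z = z" if "z < k" for z
    using that by (simp_all add: take_upt)
  show "ww (map lt (filter keep [0..<k])) (axis ?j 1) = wt ?j ?b"
    unfolding full_prefix(2)[symmetric]
  proof (rule ww_drop)
    fix z assume "z < length [0..<k]" "\<not> keep ([0..<k]!z)"
    then show "pr (rw (map lt (take z [0..<k])) (axis (lt ([0..<k]!z)) 1)) (ww (map lt [0..<k]) (axis ?j 1)) = 0"
      using zero(1)[of z] by (simp add: tk full_prefix)
  qed
  \<comment> \<open>For the root itself, its image under \<open>A\<close> is a difference of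
    consecutive weights; this is where the second half of \<open>zero\<close> enters.\<close>
  have "ww (map lt (filter keep [0..<k])) (A *v axis ?j 1) = ww (map lt [0..<k]) (A *v axis ?j 1)"
  proof (rule ww_drop)
    fix z assume "z < length [0..<k]" "\<not> keep ([0..<k]!z)"
    moreover have "ww (map lt [0..<k]) (A *v axis ?j 1) = wt ?j ?b - wt ?j (Suc ?b)"
      by (simp only: wt_Suc full_prefix flip: A_rw)
    ultimately show "pr (rw (map lt (take z [0..<k])) (axis (lt ([0..<k]!z)) 1)) (ww (map lt [0..<k]) (A *v axis ?j 1)) = 0"
      using zero[of z] by (simp add: tk full_prefix pr_simps del: funpow.simps)
  qed
  then have "A *v rw (map lt (filter keep [0..<k])) (axis ?j 1) = A *v rt ?j ?b"
    by (simp only: full_prefix flip: A_rw)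
  then show "rw (map lt (filter keep [0..<k])) (axis ?j 1) = rt ?j ?b" by (rule A_inj)
qed

lemma filter_upt_nth:
  assumes "p < length (filter P [0..<m])"
  shows "P (filter P [0..<m] ! p)" "filter P [0..<m] ! p < m"
    "take p (filter P [0..<m]) = filter P [0..<filter P [0..<m] ! p]"
proof -
  have "P (filter P [0..<m] ! p) \<and> filter P [0..<m] ! p < m \<and>
      take p (filter P [0..<m]) = filter P [0..<filter P [0..<m] ! p]"
    using assms
  proof (induction m)
    case (Suc m)
    show ?case
    proof (cases "p < length (filter P [0..<m])")
      case True then show ?thesis using Suc.IH[OF True] by (auto simp: nth_append)
    next
      case False
      then have "P m" "p = length (filter P [0..<m])" using Suc.prems by (auto split: if_splits)
      then show ?thesis by (auto simp: nth_append)
    qed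
  qed simp
  then show "P (filter P [0..<m] ! p)" "filter P [0..<m] ! p < m"
    "take p (filter P [0..<m]) = filter P [0..<filter P [0..<m] ! p]" by auto
qed

lemma length_Qw [simp]: "length Qw = length kept"
  by (simp add: Qw_def)

lemma sorted_kept: "sorted_wrt (<) kept"
  by (simp add: kept_def sorted_wrt_filter)

lemma kept_less: "p < length kept \<Longrightarrow> q < length kept \<Longrightarrow> kept!p < kept!q \<longleftrightarrow> p < q"
  using sorted_wrt_nth_less[OF sorted_kept] by (metis linorder_neqE_nat order_less_asym)

definition lv :: "nat \<Rightarrow> nat" where "lv p = kept!p div n"

lemma Qw_nth: "p < length kept \<Longrightarrow> Qw!p = lt (kept!p)"
  by (simp add: Qw_def)

lemma lv_le: "p < length kept \<Longrightarrow> lv p \<le> h (Qw!p)"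
  using filter_upt_nth(1)[of p keep] by (simp add: kept_def lv_def Qw_nth keep_def)

lemma position: assumes "m \<le> h i" obtains p where "p < length kept" "Qw!p = i" "lv p = m"
proof -
  define k where "k = m * n + idx i"
  have k: "k mod n = idx i" "k div n = m" using idx(1)[of i] n_pos by (auto simp: k_def)
  have "h i \<le> Max (range h)" by (rule Max_ge) auto
  then have hM: "m \<le> Max (range h)" using assms by (rule order_trans[rotated])
  have "k < m * n + n" using idx(1)[of i] by (simp add: k_def)
  also have "m * n + n = Suc m * n" by simp
  also have "\<dots> \<le> n * Suc (Max (range h))"
    using hM by (subst mult.commute, intro mult_le_mono2) simp
  finally have "k \<in> set kept" using assms by (auto simp: kept_def keep_def lt_def k idx)
  then obtain p where "p < length kept" "kept!p = k" by (metis in_set_conv_nth)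
  then show ?thesis using that[of p] by (simp add: Qw_nth lv_def lt_def k idx)
qed

lemma position_less:
  assumes "p < length kept" "q < length kept"
  shows "p < q \<longleftrightarrow> lv p < lv q \<or> lv p = lv q \<and> idx (Qw!p) < idx (Qw!q)"
proof -
  have k: "kept!p = lv p * n + idx (Qw!p)" "kept!q = lv q * n + idx (Qw!q)"
    using assms n_pos by (simp_all add: lv_def Qw_nth lt_def idx_nth)
  have *: "a * n + i < b * n + j" if "a < b" "i < n" for a b i j
  proof -
    have "Suc a * n \<le> b * n" using that by (intro mult_le_mono1) simp
    then show ?thesis using that(2) by simp
  qed
  show ?thesis
    using kept_less[OF assms] idx(1)[of "Qw!p"] idx(1)[of "Qw!q"]
      *[of "lv p" "lv q" "idx (Qw!p)" "idx (Qw!q)"] *[of "lv q" "lv p" "idx (Qw!q)" "idx (Qw!p)"]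
    unfolding k by (cases "lv p" "lv q" rule: linorder_cases) auto
qed

lemma position_inj: "p < length kept \<Longrightarrow> q < length kept \<Longrightarrow> Qw!p = Qw!q \<Longrightarrow> lv p = lv q \<Longrightarrow> p = q"
  using position_less[of p q] position_less[of q p] by (auto simp: less_le)

lemma kept_initial: "n \<le> length kept" "t < n \<Longrightarrow> kept!t = t"
proof -
  have k: "filter keep [0..<n] = [0..<n]"
    by (rule filter_True) (auto simp: keep_def)
  have "[0..<n * Suc (Max (range h))] = [0..<n] @ [n..<n * Suc (Max (range h))]"
    by (metis le_add1 mult_Suc_right upt_add_eq_append zero_le le_add_diff_inverse)
  then have *: "kept = [0..<n] @ filter keep [n..<n * Suc (Max (range h))]"
    by (simp only: kept_def filter_append k)
  show "n \<le> length kept" "t < n \<Longrightarrow> kept!t = t" by (simp_all add: * nth_append)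
qed

lemma lv_0_iff: assumes "p < length kept" shows "lv p = 0 \<longleftrightarrow> p < n"
proof (cases "p < n")
  case False
  then have "n - 1 < p" "n - 1 < length kept" using n_pos assms by linarith+
  then have "kept!(n - 1) < kept!p" using kept_less assms by simp
  then have "n \<le> kept!p" using kept_initial(2)[of "n - 1"] n_pos by auto
  then show ?thesis using False n_pos by (simp add: lv_def div_eq_0_iff)
qed (simp add: lv_def kept_initial)

lemma take_Qw: "p < length kept \<Longrightarrow> take p Qw = map lt (filter keep [0..<kept!p])"
  using filter_upt_nth(3)[of p keep] by (simp add: Qw_def take_map kept_def)

lemma Qw_prefix: "take n Qw = cw"
  using kept_initial by (intro nth_equalityI) (auto simp: Qw_nth lt_def)

end

section \<open>The word of a Coxeter element meets the requirements on Q\<close>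

sublocale coxeter_cartan \<subseteq> qword A d Qw ..

context coxeter_cartan
begin

lemma com_empty_take: "p \<le> length kept \<Longrightarrow> com {} p = take p Qw"
  by (intro nth_equalityI) (auto simp: com_def)

lemma \<gamma>_eq: "p < length kept \<Longrightarrow> \<gamma> p = wt (Qw!p) (lv p)"
  using kept_prefix(1)[of "kept!p"] filter_upt_nth(1)[of p keep]
  by (simp add: \<gamma>_def vw_def com_empty_take take_Qw Qw_nth lv_def) (simp add: kept_def)

lemma f_eq: "p < length kept \<Longrightarrow> f p = rt (Qw!p) (lv p)"
  using kept_prefix(2)[of "kept!p"] filter_upt_nth(1)[of p keep]
  by (simp add: f_def R_def vv_def com_empty_take take_Qw Qw_nth lv_def) (simp add: kept_def)

lemma R_initial: assumes "p < length kept" "n \<le> p" shows "R {..<n} p = rt (Qw!p) (lv p - 1)"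
proof -
  have "filter (\<lambda>q. q \<notin> {..<n}) [0..<p] = [n..<p]"
  proof -
    have "[0..<p] = [0..<n] @ [n..<p]" using assms(2) by (metis le_add_diff_inverse upt_add_eq_append zero_le)
    then show ?thesis by (auto simp: filter_empty_conv filter_id_conv)
  qed
  then have "com {..<n} p = drop n (take p Qw)"
    using assms by (intro nth_equalityI) (auto simp: com_def)
  moreover have "take n (take p Qw) = cw" using assms(2) Qw_prefix by (simp add: min_def)
  ultimately have "com {} p = cw @ com {..<n} p"
    using assms(1) append_take_drop_id[of n "take p Qw"] by (simp add: com_empty_take)
  then have "f p = cr (R {..<n} p)" by (simp add: f_def R_def vv_def)
  moreover obtain m where "lv p = Suc m" using lv_0_iff[OF assms(1)] assms(2) by (cases "lv p") auto
  ultimately have "cr (rt (Qw!p) m) = cr (R {..<n} p)" "lv p = Suc m" using f_eq[OF assms(1)] by auto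
  then show ?thesis by (simp add: cr_inj)
qed

text \<open>At different levels the pairing is minus a coordinate of a root in a positive segment;
  at equal levels it vanishes by the triangularity of \<open>fo\<close>.\<close>

lemma label_neg_aux: assumes "p < q" "q < length kept" shows "pr (f p) (\<gamma> q) \<le> 0"
proof -
  have p: "p < length kept" using assms by simp
  have eq: "pr (f p) (\<gamma> q) = pr (rt (Qw!p) (lv p)) (wt (Qw!q) (lv q))" using p assms by (simp add: f_eq \<gamma>_eq)
  consider "lv p < lv q" | "lv p = lv q" "idx (Qw!p) < idx (Qw!q)" using position_less[OF p assms(2)] assms(1) by auto
  then show ?thesis
  proof cases
    case 1
    have "lv q - Suc (lv p) < h (Qw!q)" using lv_le[OF assms(2)] h_gt_0[of "Qw!q"] 1 by linarith
    then have "rt (Qw!q) (lv q - Suc (lv p)) $ (Qw!p) \<ge> 0" using h_pos by (auto simp: vp_def)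
    then show ?thesis using pr_rt_wt_gt[OF 1] d_pos[of "Qw!p"] by (simp add: eq)
  next
    case 2
    then have "fo (Qw!p) $ (Qw!q) = 0" by (subst fo_coord) auto
    then show ?thesis using 2 pr_rt_wt_eq[of "lv q" "Qw!p" "Qw!q"] by (simp add: eq)
  qed
qed

text \<open>After the initial copy of c the roots run through the positive segments of the orbits,
  each exactly once; the level is shifted by 1 because that copy has been removed.\<close>

lemma R0_bij_aux: "bij_betw (R {..<n}) {n..<length kept} proots"
proof (rule bij_betwI')
  have lt: "lv p - 1 < h (Qw!p)" if "p < length kept" for p
    using lv_le[OF that] h_gt_0[of "Qw!p"] by linarith
  fix p assume p: "p \<in> {n..<length kept}"
  then have p1: "0 < lv p" using lv_0_iff[of p] by auto
  show "R {..<n} p \<in> proots"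
    using p lt[of p] h_pos[of "lv p - 1" "Qw!p"] by (simp add: R_initial proots_def)
  fix q assume q: "q \<in> {n..<length kept}"
  then have q1: "0 < lv q" using lv_0_iff[of q] by auto
  show "R {..<n} p = R {..<n} q \<longleftrightarrow> p = q"
  proof
    assume "R {..<n} p = R {..<n} q"
    then have "rt (Qw!p) (lv p - 1) = rt (Qw!q) (lv q - 1)" using p q by (simp add: R_initial)
    from rt_unique[OF this lt lt] p q have "lv p - 1 = lv q - 1" "Qw!p = Qw!q" by auto
    then show "p = q" using position_inj[of p q] p q p1 q1 by auto
  qed simp
next
  fix b assume "b \<in> proots"
  then have "b \<in> roots" "vp b" by (auto simp: proots_def)
  then obtain i m where im: "m < h i" "b = rt i m" by (rule rt_surj)
  then obtain p where p: "p < length kept" "Qw!p = i" "lv p = Suc m" using position[of "Suc m" i] by auto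
  then have "n \<le> p" using lv_0_iff[of p] by auto
  then show "\<exists>p\<in>{n..<length kept}. b = R {..<n} p"
    using p im by (intro bexI[of _ p]) (auto simp: R_initial)
qed

end

sublocale coxeter_cartan \<subseteq> coxeter_complex A d Qw cw
proof
  show "distinct cw" "set cw = UNIV" by (fact cw_distinct cw_set)+
  show "take n Qw = cw" by (rule Qw_prefix)
  show "\<gamma> p - cq (\<gamma> p) = A *v f p" if "p < length Qw" for p
    using that wt_Suc[of "lv p" "Qw!p"] by (simp add: \<gamma>_eq f_eq)
  show "pr (f p) (\<gamma> q) \<le> 0" if "p < q" "q < length Qw" for p q
    using label_neg_aux that by simp
  show "bij_betw (R {..<n}) {n..<length Qw} proots" using R0_bij_aux by simp
qed

context coxeter_cartan
begin

lemma \<gamma>_inj: "p < L \<Longrightarrow> q < L \<Longrightarrow> \<gamma> p = \<gamma> q \<longleftrightarrow> p = q"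
  using wt_unique[of "lv p" "Qw!p" "lv q" "Qw!q"] lv_le position_inj[of p q] by (auto simp: \<gamma>_eq)

lemma \<gamma>_position: assumes "m \<le> h i" obtains p where "p < L" "\<gamma> p = wt i m" "Qw!p = i" "lv p = m"
  using position[OF assms] \<gamma>_eq by (metis length_Qw)

end

section \<open>The longest element\<close>

context cartan
begin

text \<open>The root turned negative is an inversion, and the letter that produces it cancels
  against i.\<close>

lemma deletion:
  assumes "\<not> vp (rw w (axis i 1))"
  obtains w' where "ww (w @ [i]) = ww w'" "length w' < length w"
proof -
  have "\<not> vp (rw (rev (rev w)) (axis i 1))" using assms by simp
  from inversion_word[OF axis_roots vp_axis this] obtain j where
    j: "j < length w" "axis i 1 = rw (take j (rev w)) (axis (rev w!j) 1)" by auto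
  define x k y where "x = take j (rev w)" and "k = rev w!j" and "y = drop (Suc j) (rev w)"
  have w: "w = rev y @ [k] @ rev x"
    using id_take_nth_drop[of j "rev w"] j(1) by (simp add: x_def k_def y_def flip: rev_append) 
      (metis rev_append rev_rev_ident rev.simps(2) append.assoc append_Cons append_Nil)
  have ai: "axis i 1 = rw x (axis k 1)" using j(2) by (simp add: x_def k_def)
  have "sw i l = ww x (sw k (ww (rev x) l))" for l
    using ww_wrefl[of "axis k 1" x "ww (rev x) l"] by (simp add: wrefl_axis flip: ai)
  then have "ww (w @ [i]) l = ww (rev y @ rev x) l" for l by (simp add: w)
  then have "ww (w @ [i]) = ww (rev y @ rev x)" by (simp add: fun_eq_iff)
  moreover have "length (rev y @ rev x) < length w" by (simp add: w)
  ultimately show ?thesis by (rule that)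
qed

definition reduced :: "'i list \<Rightarrow> bool" where
  "reduced w \<longleftrightarrow> (\<forall>w'. ww w' = ww w \<longrightarrow> length w \<le> length w')"

lemma reduced_exists: obtains w' where "reduced w'" "ww w' = ww w"
proof -
  obtain w' where "ww w' = ww w" "\<And>y. ww y = ww w \<Longrightarrow> length w' \<le> length y"
    using ex_has_least_nat[of "\<lambda>y. ww y = ww w" w length] by auto
  then show ?thesis using that[of w'] by (auto simp: reduced_def)
qed

lemma reduced_subword: assumes "reduced (x @ y @ z)" shows "reduced y"
  unfolding reduced_def
proof (intro allI impI)
  fix y' assume "ww y' = ww y"
  then have "ww (x @ y' @ z) = ww (x @ y @ z)" by (simp add: fun_eq_iff)
  then show "length y \<le> length y'" using assms by (force simp: reduced_def)
qed

lemma reduced_step: assumes "reduced (w @ [i])" shows "vp (rw w (axis i 1))"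
proof (rule ccontr)
  assume "\<not> ?thesis"
  from deletion[OF this] obtain w' where "ww (w @ [i]) = ww w'" "length w' < length w" .
  then show False using assms by (metis reduced_def length_append_singleton not_less_eq_eq less_imp_le not_le)
qed

lemma reduced_root: assumes "reduced w" "j < length w" shows "rw (take j w) (axis (w!j) 1) \<in> proots"
proof -
  have "w = [] @ (take j w @ [w!j]) @ drop (Suc j) w" using id_take_nth_drop[OF assms(2)] by simp
  then have "reduced (take j w @ [w!j])" using reduced_subword assms(1) by metis
  then show ?thesis using reduced_step by (simp add: proots_def)
qed

lemma reduced_root_inj:
  assumes "reduced w" "j < k" "k < length w"
  shows "rw (take j w) (axis (w!j) 1) \<noteq> rw (take k w) (axis (w!k) 1)"
proof
  assume eq: "rw (take j w) (axis (w!j) 1) = rw (take k w) (axis (w!k) 1)"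
  define y where "y = drop (Suc j) (take k w)"
  have tk: "take k w = take j w @ [w!j] @ y"
    using id_take_nth_drop[of j "take k w"] assms by (simp add: y_def min_def)
  have "w = (take j w @ [w!j]) @ (y @ [w!k]) @ drop (Suc k) w"
    using id_take_nth_drop[OF assms(3)] unfolding tk by simp
  then have "reduced (y @ [w!k])" using reduced_subword assms(1) by metis
  then have "vp (rw y (axis (w!k) 1))" by (rule reduced_step)
  moreover have "sr (w!j) (rw y (axis (w!k) 1)) = axis (w!j) 1"
    using eq unfolding tk by (metis rw_rev(1) rw_simps append.assoc)
  then have "rw y (axis (w!k) 1) = - axis (w!j) 1" by (metis sr_axis sr_sr)
  ultimately show False using vp_not_uminus[of "axis (w!j) 1"] by simp
qed

lemma reduced_inj: "reduced w \<Longrightarrow> inj_on (\<lambda>j. rw (take j w) (axis (w!j) 1)) {..<length w}"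
  using reduced_root_inj by (intro inj_onI) (metis lessThan_iff linorder_neqE_nat)

lemma reduced_length_le: assumes "reduced w" shows "length w \<le> card proots"
  using card_inj_on_le[OF reduced_inj[OF assms] _ finite_proots] reduced_root[OF assms] by auto

lemma reduced_full:
  assumes "reduced w" "length w = card proots" "b \<in> proots" shows "\<not> vp (rw (rev w) b)"
proof -
  let ?g = "\<lambda>j. rw (take j w) (axis (w!j) 1)"
  have "?g ` {..<length w} = proots"
    using reduced_root[OF assms(1)] card_image[OF reduced_inj[OF assms(1)]] assms(2)
    by (intro card_seteq finite_proots) auto
  then obtain j where j: "j < length w" "b = ?g j" using assms(3) by auto
  have w: "w = take j w @ [w!j] @ drop (Suc j) w" using id_take_nth_drop[OF j(1)] by simp
  have "rw (rev w) b = - rw (rev (drop (Suc j) w)) (axis (w!j) 1)"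
    unfolding j(2) by (subst w) (simp add: rw_linear del: append_take_drop_id)
  moreover have "vp (rw (rev (drop (Suc j) w)) (axis (w!j) 1))"
  proof (rule ccontr)
    assume "\<not> ?thesis"
    from deletion[OF this] obtain w' where
      w': "ww (rev (drop (Suc j) w) @ [w!j]) = ww w'" "length w' < length (rev (drop (Suc j) w))" .
    have r: "ww (rev w) l = ww (w' @ rev (take j w)) l" for l
      using fun_cong[OF w'(1)] by (subst w) simp
    have "ww (rev (w' @ rev (take j w))) (ww (rev w) l) = l" for l unfolding r by (rule ww_rev)
    then have "ww (rev (w' @ rev (take j w))) l = ww w l" for l by (metis ww_rev(1))
    then have "length w \<le> length (w' @ rev (take j w))"
      using assms(1) by (metis ext length_rev reduced_def)
    then show False using w'(2) j(1) by simp
  qed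
  ultimately show ?thesis using vp_not_uminus[of "- rw (rev w) b"] vp_not_uminus[of "rw (rev (drop (Suc j) w)) (axis (w!j) 1)"] by auto
qed

lemma all_negative_length:
  assumes "\<And>b. b \<in> proots \<Longrightarrow> \<not> vp (rw (rev w) b)" shows "card proots \<le> length w"
proof -
  have "proots \<subseteq> (\<lambda>j. rw (take j w) (axis (w!j) 1)) ` {..<length w}"
  proof
    fix b assume b: "b \<in> proots"
    then have "b \<in> roots" "vp b" by (auto simp: proots_def)
    from inversion_word[OF this assms[OF b]]
    show "b \<in> (\<lambda>j. rw (take j w) (axis (w!j) 1)) ` {..<length w}" by auto
  qed
  from surj_card_le[OF _ this] show ?thesis by simp
qed

lemma positive_identity:
  assumes "\<And>b. b \<in> proots \<Longrightarrow> vp (rw w b)" shows "ww w = ww []"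
proof -
  obtain w' where w': "reduced w'" "ww w' = ww w" by (rule reduced_exists)
  have eq: "rw w' = rw w" using w'(2) by (simp only: rw_eq_iff_ww_eq)
  have "w' = []"
  proof (rule ccontr)
    assume "w' \<noteq> []"
    then obtain x i where x: "w' = x @ [i]" by (metis rev_exhaust)
    have "vp (rw x (axis i 1))" using reduced_step w'(1) x by simp
    moreover have "rw w' (axis i 1) = - rw x (axis i 1)" by (simp add: x rw_linear)
    moreover have "vp (rw w (axis i 1))" using assms by (simp add: proots_def)
    ultimately show False using vp_not_uminus[of "rw x (axis i 1)"] eq by simp
  qed
  then show ?thesis using w'(2) by simp
qed

lemma weyl_length_reduced: "reduced w \<Longrightarrow> weyl_length A (ww w) = length w"
  unfolding weyl_length_def by (rule Least_equality) (auto simp: word_prod_ww reduced_def)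

text \<open>Dominant weights in one orbit coincide: the last letter of the word either can be
  cancelled, shortening the word, or fixes l, since a nonnegative coordinate equals minus a
  nonnegative pairing up to positive factors.\<close>

lemma dominant_unique:
  assumes "\<And>i. l$i \<ge> 0" "\<And>i. ww w l$i \<ge> 0" shows "ww w l = l"
  using assms(2)
proof (induction "length w" arbitrary: w rule: less_induct)
  case less
  show ?case
  proof (cases w rule: rev_cases)
    case (snoc x i)
    show ?thesis
    proof (cases "vp (rw x (axis i 1))")
      case False
      obtain w' where w': "ww w = ww w'" "length w' < length x" using deletion[OF False] snoc by auto
      then show ?thesis using less by (simp add: snoc)
    next
      case True
      have "pr (axis i 1) l = - pr (rw x (axis i 1)) (ww w l)"
        using pr_rw_ww[of w "axis i 1" l] by (simp add: snoc rw_linear pr_simps)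
      moreover have "pr (rw x (axis i 1)) (ww w l) \<ge> 0"
        unfolding pr_def using True less.prems d_pos by (intro sum_nonneg mult_nonneg_nonneg) (auto simp: vp_def less_imp_le)
      ultimately have "l$i = 0"
        using assms(1)[of i] d_pos[of i] by (simp add: pr_axis_left) (smt (verit) mult_nonneg_nonneg mult_pos_pos)
      then have "ww w l = ww x l" by (simp add: snoc sw_eq)
      then show ?thesis using less.hyps[of x] less.prems snoc by simp
    qed
  qed simp
qed

text \<open>An element of maximal length has as many inversions as there are positive roots, so its
  inverse makes all of them negative. Combined with w it then preserves positivity, and only the
  identity does that.\<close>

lemma longest_element_eq:
  assumes neg: "\<And>b. b \<in> proots \<Longrightarrow> \<not> vp (rw (rev w) b)" shows "longest_element A = ww w"
proof -
  have len: "length x \<le> card proots \<and> weyl_length A (ww y) = length x" if "reduced x" "ww x = ww y" for x y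
    using reduced_length_le[OF that(1)] weyl_length_reduced[OF that(1)] that(2) by simp
  have full: "weyl_length A (ww y) = card proots" if "\<And>b. b \<in> proots \<Longrightarrow> \<not> vp (rw (rev y) b)" for y
  proof -
    obtain x where x: "reduced x" "ww x = ww y" by (rule reduced_exists)
    have "rw x = rw y" using x(2) by (simp only: rw_eq_iff_ww_eq)
    then have "rw (rev x) b = rw (rev y) b" for b by (metis rw_rev)
    then have "card proots \<le> length x" using all_negative_length[of x] that by simp
    then show ?thesis using len[OF x] by simp
  qed
  have mem: "u \<in> weyl_group A \<longleftrightarrow> (\<exists>x. u = ww x)" for u by (auto simp: weyl_group_def word_prod_ww)
  have le: "weyl_length A v \<le> card proots" if "v \<in> weyl_group A" for v
    using that reduced_exists len unfolding mem by metis
  show ?thesis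
    unfolding longest_element_def
  proof (rule the_equality)
    show "ww w \<in> weyl_group A \<and> (\<forall>v\<in>weyl_group A. weyl_length A v \<le> weyl_length A (ww w))"
      using le full[OF neg] mem by auto
    fix u assume u: "u \<in> weyl_group A \<and> (\<forall>v\<in>weyl_group A. weyl_length A v \<le> weyl_length A u)"
    then obtain y where y: "u = ww y" using mem by auto
    obtain x where x: "reduced x" "ww x = ww y" by (rule reduced_exists)
    have "card proots \<le> weyl_length A u" using u full[OF neg] mem by metis
    then have "length x = card proots" using len[OF x] y by simp
    then have nx: "\<not> vp (rw (rev x) b)" if "b \<in> proots" for b using reduced_full[OF x(1) _ that] by simp
    have "vp (rw (rev x @ w) b)" if b: "b \<in> proots" for b
    proof -
      have "\<not> vp (rw w b)"
      proof
        assume "vp (rw w b)"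
        then have "rw w b \<in> proots" using b by (simp add: proots_def)
        from neg[OF this] b show False by (simp add: proots_def)
      qed
      then have "- rw w b \<in> proots" using b not_vp_iff[of "rw w b"] by (simp add: proots_def)
      from nx[OF this] show ?thesis using not_vp_iff[of "- rw (rev x) (rw w b)"] b
        by (simp add: rw_linear proots_def)
    qed
    then have "ww (rev x @ w) = ww []" by (rule positive_identity)
    then have "ww (rev x) (ww w l) = l" for l by (metis ww_simps(1,3))
    then have "ww w l = ww x l" for l by (metis ww_rev(2))
    then show "u = ww w" using x y by (simp add: fun_eq_iff)
  qed
qed

end

section \<open>Coxeter number data and compatibility degrees\<close>

context coxeter_cartan
begin

text \<open>The weight \<open>- w0 \<omega>_i\<close>, with \<open>w0\<close> the longest element,
  is dominant. It lies in the orbit of the fundamental weight of \<open>st i\<close>, since c^(h i)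
  takes \<open>\<omega>_i\<close> to minus the latter. Dominant weights in one orbit
  coincide.\<close>

lemma star_eq: "star A i = st i"
proof -
  let ?w = "com I0 L"
  have le: "longest_element A = ww ?w"
    using w0_negative by (intro longest_element_eq) (simp add: vi_def)
  have pw: "ww (concat (replicate m cw)) l = (cq^^m) l" for m l
    by (induction m) auto
  let ?x = "rev (concat (replicate (h i) cw))"
  have "ww (?w @ ?x) (axis (st i) 1) = - ww ?w (ww ?x (ww (rev ?x) (axis i 1)))"
    using wt_h[of i] by (simp add: pw ww_linear)
  then have eq: "ww (?w @ ?x) (axis (st i) 1) = - ww ?w (axis i 1)" by (simp del: rev_rev_ident)
  have "ww (?w @ ?x) (axis (st i) 1) = axis (st i) 1"
  proof (rule dominant_unique)
    fix j
    have "axis j 1 \<in> proots" by (simp add: proots_def)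
    from w0_negative[OF this] have "vp (- vi I0 L (axis j 1))" using not_vp_iff[of "vi I0 L (axis j 1)"] by simp
    then have "vi I0 L (axis j 1) $ i \<le> 0" by (simp add: vp_def)
    moreover have "d j * ww ?w (axis i 1) $ j = d i * vi I0 L (axis j 1) $ i"
      using pr_ww[of "axis j 1" ?w "axis i 1"] by (simp add: pr_axis_left pr_axis_right vi_def)
    ultimately have "ww ?w (axis i 1) $ j \<le> 0"
      using d_pos[of i] d_pos[of j] by (smt (verit) mult_nonneg_nonpos mult_pos_pos)
    then show "ww (?w @ ?x) (axis (st i) 1) $ j \<ge> 0" by (simp only: eq) simp
  qed simp
  then have eq2: "axis (st i) 1 = - longest_element A (axis i 1)" by (simp only: eq le)
  show ?thesis
    unfolding star_def fundamental_weight_def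
  proof (rule the_equality)
    fix j assume "axis j 1 = - longest_element A (axis i 1)"
    then have "axis j 1 = (axis (st i) 1 :: int^'i)" by (simp only: eq2)
    then show "j = st i" by (simp add: axis_eq_axis)
  qed (rule eq2)
qed

lemma weight_ge_iff: "weight_ge A l m \<longleftrightarrow> (\<exists>v. vp v \<and> l - m = A *v v)"
proof (rule iffI)
  assume "weight_ge A l m"
  then obtain v :: "'i \<Rightarrow> nat" where "l - m = (\<Sum>i\<in>UNIV. int (v i) *s simple_root A i)"
    by (auto simp: weight_ge_def)
  then have "l - m = A *v (\<chi> i. int (v i))" by (simp add: matrix_mult_sum simple_root_def)
  moreover have "vp (\<chi> i. int (v i))" by (simp add: vp_def)
  ultimately show "\<exists>v. vp v \<and> l - m = A *v v" by blast
next
  assume "\<exists>v. vp v \<and> l - m = A *v v"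
  then obtain v where v: "vp v" "l - m = A *v v" by blast
  then have "l - m = (\<Sum>i\<in>UNIV. int (nat (v$i)) *s simple_root A i)"
    by (simp add: matrix_mult_sum simple_root_def vp_def)
  then show "weight_ge A l m" unfolding weight_ge_def by (rule exI[where x = "\<lambda>i. nat (v$i)"])
qed

text \<open>A smaller exponent would repeat a weight of the orbit. A larger one would require a
  descent at step \<open>h i\<close>, where the root is negative.\<close>

lemma cox_h_eq: "cox_h A cq i = h i"
  unfolding cox_h_def star_eq fundamental_weight_def
proof (rule the_equality)
  have "weight_ge A (wt i m) (wt i (Suc m)) \<and> wt i m \<noteq> wt i (Suc m)" if "m < h i" for m
    using wt_Suc[of m i] h_pos[OF that] roots_nonzero[OF rt_roots[of m i]] A_inj[of "rt i m" 0]
    unfolding weight_ge_iff by (metis diff_self matrix_vector_mult_0_right)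
  then show "0 < h i \<and> (\<forall>m<h i. weight_ge A (wt i m) (wt i (Suc m)) \<and> wt i m \<noteq> wt i (Suc m)) \<and>
      wt i (h i) = - axis (st i) 1"
    using h_gt_0 wt_h by auto
  fix k assume k: "0 < k \<and> (\<forall>m<k. weight_ge A (wt i m) (wt i (Suc m)) \<and> wt i m \<noteq> wt i (Suc m)) \<and>
      wt i k = - axis (st i) 1"
  show "k = h i"
  proof (cases "k \<le> h i")
    case True
    then show ?thesis using wt_unique[of k i "h i" i] k wt_h[of i] by auto
  next
    case False
    then have "weight_ge A (wt i (h i)) (wt i (Suc (h i)))" using k by (metis not_le)
    then obtain v where v: "vp v" "wt i (h i) - wt i (Suc (h i)) = A *v v" by (auto simp: weight_ge_iff)
    then have "A *v rt i (h i) = A *v v" by (simp only: wt_Suc)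
    then have "rt i (h i) = v" by (rule A_inj)
    then show ?thesis using v(1) h_neg[of i] by simp
  qed
qed

abbreviation "W \<equiv> cox_weights A cq"

lemma cox_weights_eq: "W = \<gamma> ` {..<L}"
proof -
  have "wt i m \<in> \<gamma> ` {..<L}" if "m \<le> h i" for i m
    using \<gamma>_position[OF that] by (metis imageI lessThan_iff)
  moreover have "\<exists>i m. \<gamma> p = wt i m \<and> m \<le> h i" if "p < L" for p
    using that lv_le[of p] \<gamma>_eq[of p] by auto
  ultimately show ?thesis
    unfolding cox_weights_def cox_h_eq fundamental_weight_def by auto
qed

text \<open>\<open>prec\<close> admits every factorization of c. But \<open>fo j\<close> depends on
  c only, and its coordinate at a neighbour i is positive if i precedes j in a given factorization
  and 0 if j precedes i.\<close>

lemma prec_iff: "prec A cq i j \<longleftrightarrow> A$i$j \<noteq> 0 \<and> idx i < idx j"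
proof
  assume "A$i$j \<noteq> 0 \<and> idx i < idx j"
  then show "prec A cq i j"
    unfolding prec_def coxeter_word_def word_prod_ww
    using idx[of i] idx[of j] cw_distinct cw_set by (intro conjI exI[of _ cw] exI[of _ "idx i"] exI[of _ "idx j"]) auto
next
  assume pr: "prec A cq i j"
  then obtain w p q where w: "i \<noteq> j" "A$i$j \<noteq> 0" "distinct w" "set w = UNIV" "ww w = cq"
    and pq: "p < q" "q < length w" "w!p = i" "w!q = j"
    unfolding prec_def coxeter_word_def word_prod_ww by auto
  interpret w: coxeter_cartan A d w by unfold_locales (use w in auto)
  have wi: "w.idx i < w.idx j" using pq by (metis w.idx_nth less_trans)
  have "w.fo j = fo j"
    by (rule A_inj) (use c_fundamental[of j] w.c_fundamental[of j] w(5) in simp)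
  moreover have "w.fo j $ i > 0"
  proof -
    define x where "x = take (w.idx i) w"
    define y where "y = drop (Suc (w.idx i)) (take (w.idx j) w)"
    have tj: "take (w.idx j) w = x @ i # y"
      using id_take_nth_drop[of "w.idx i" "take (w.idx j) w"] wi w.idx[of i] w.idx[of j]
      by (simp add: x_def y_def min_def)
    have "distinct (x @ i # y @ j # drop (Suc (w.idx j)) w)"
      using w.cw_split[of j] w(3) unfolding tj by simp
    then have nin: "i \<notin> set x" "i \<notin> set y" "j \<notin> set y" by auto
    define v where "v = rw y (axis j 1)"
    have vi: "v$i = 0" "v$j = 1" using nin w(1) by (auto simp: v_def rw_coord)
    have "vp v" by (rule vp_pos_coord[of v j]) (auto simp: v_def vi[unfolded v_def])
    have "w.fo j $ i = (sr i v)$i" using nin by (simp add: w.fo_def tj rw_coord v_def)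
    also have "\<dots> = - (\<Sum>k\<in>UNIV. A$i$k * v$k)" by (simp add: sr_def vi matrix_vector_mult_def)
    also have "\<dots> = - A$i$j - (\<Sum>k\<in>UNIV - {j}. A$i$k * v$k)" by (simp add: sum.remove[of UNIV j] vi)
    finally have "w.fo j $ i = - A$i$j - (\<Sum>k\<in>UNIV - {j}. A$i$k * v$k)" .
    moreover have "(\<Sum>k\<in>UNIV - {j}. A$i$k * v$k) \<le> 0"
      using \<open>vp v\<close> vi off_diag by (intro sum_nonpos) (metis mult_nonpos_nonneg mult_zero_right order_refl vp_def)
    ultimately show ?thesis using off_diag[OF w(1)] w(2) by simp
  qed
  ultimately have "idx i < idx j" using fo_coord[of j i] w(1) by (cases "idx j \<le> idx i") auto
  then show "A$i$j \<noteq> 0 \<and> idx i < idx j" using w(2) by simp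
qed

lemma \<gamma>_initial: "\<gamma> (idx i) = axis i 1" "Qw!idx i = i" "idx i < L" "lv (idx i) = 0"
proof -
  show L: "idx i < L" using idx(1)[of i] N_le_L by simp
  show "lv (idx i) = 0" "Qw!idx i = i"
    using lv_0_iff[of "idx i"] L idx(1)[of i] kept_initial(2)[of "idx i"] idx(2)[of i] by (auto simp: Qw_nth lt_def)
  then show "\<gamma> (idx i) = axis i 1" using \<gamma>_eq[of "idx i"] L by simp
qed

lemma R_I0: "R I0 (idx i) = axis i 1"
proof -
  have "com I0 (idx i) = []" using idx(1)[of i] by (auto simp: com_def filter_empty_conv)
  then show ?thesis by (simp add: R_def vv_def \<gamma>_initial)
qed

lemma range_idx: "range idx = I0"
  using idx(1) idx_nth by (auto simp: image_iff) metis

lemma lfacet_idx: "lfacet idx"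
  using idx_inj by (auto simp: lfacet_def inj_def range_idx facet_I0)

lemma exch_matrix_eq: "exch_matrix A cq = BB idx"
proof -
  have "exch_matrix A cq $ i $ j = BB idx $ i $ j" for i j
    using zero_sym[of i j] by (cases "idx i" "idx j" rule: linorder_cases)
      (auto simp: exch_matrix_def prec_iff BB_def bb_def cc_def range_idx R_I0 cp_axis A_axis_nth)
  then show ?thesis by (simp add: vec_eq_iff)
qed

lemma root_coeff_eq: "root_coeff A (A *v v) i = v$i"
proof -
  have "(THE u. A *v v = (\<Sum>j\<in>UNIV. u j *s simple_root A j)) = (\<lambda>i. v$i)"
  proof (rule the_equality)
    show "A *v v = (\<Sum>j\<in>UNIV. v$j *s simple_root A j)" by (simp add: matrix_mult_sum simple_root_def)
    fix u :: "'i \<Rightarrow> int" assume "A *v v = (\<Sum>j\<in>UNIV. u j *s simple_root A j)"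
    then have "A *v v = A *v (\<chi> j. u j)" by (simp add: matrix_mult_sum simple_root_def)
    then have "v = (\<chi> j. u j)" by (rule A_inj)
    then show "u = (\<lambda>i. v$i)" by auto
  qed
  then show ?thesis by (simp add: root_coeff_def)
qed

lemma cq_inj: "cq l = cq m \<longleftrightarrow> l = m"
  by (metis ww_rev(1))

section \<open>Neighbours in the orbits and the permutation tau\<close>

definition final :: "nat \<Rightarrow> bool" where "final p \<longleftrightarrow> lv p = h (Qw!p)"

lemma \<gamma>_final: "p < L \<Longrightarrow> final p \<Longrightarrow> \<gamma> p = - axis (st (Qw!p)) 1"
  using \<gamma>_eq[of p] wt_h[of "Qw!p"] by (simp add: final_def)

lemma \<gamma>_next:
  assumes "p < L" "\<not> final p"
  obtains q where "q < L" "\<gamma> q = cq (\<gamma> p)" "Qw!q = Qw!p" "lv q = Suc (lv p)" "p < q"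
proof -
  have "Suc (lv p) \<le> h (Qw!p)" using lv_le[of p] assms by (simp add: final_def)
  then obtain q where q: "q < L" "\<gamma> q = wt (Qw!p) (Suc (lv p))" "Qw!q = Qw!p" "lv q = Suc (lv p)"
    by (rule \<gamma>_position)
  then show ?thesis using that[of q] assms position_less[of p q] by (simp add: \<gamma>_eq)
qed

lemma \<gamma>_prev:
  assumes "p < L" "N \<le> p"
  obtains q where "q < L" "\<not> final q" "\<gamma> p = cq (\<gamma> q)" "Qw!q = Qw!p" "lv p = Suc (lv q)" "q < p"
proof -
  obtain m where m: "lv p = Suc m" using lv_0_iff[of p] assms by (cases "lv p") auto
  then have "m \<le> h (Qw!p)" "m < h (Qw!p)" using lv_le[of p] assms by auto
  obtain q where q: "q < L" "\<gamma> q = wt (Qw!p) m" "Qw!q = Qw!p" "lv q = m"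
    by (rule \<gamma>_position[OF \<open>m \<le> h (Qw!p)\<close>])
  then show ?thesis
    using that[of q] assms m \<open>m < h (Qw!p)\<close> position_less[of q p] by (simp add: \<gamma>_eq final_def)
qed

lemma final_not_initial: "p < L \<Longrightarrow> final p \<Longrightarrow> N \<le> p"
  using lv_0_iff[of p] h_gt_0[of "Qw!p"] by (auto simp: final_def)

lemma F_\<gamma>_axis: "p < L \<Longrightarrow> F (\<gamma> p) (axis j 1) = d j * rt (Qw!p) (lv p) $ j"
  using G_label[of p] f_eq[of p] by (simp add: F_def pr_axis_right)

lemma F_initial: assumes "p < q" "q < N" shows "F (\<gamma> p) (\<gamma> q) = 0"
proof -
  have pq: "idx (Qw!p) = p" "idx (Qw!q) = q" "p < L" "lv p = 0"
    using assms kept_initial N_le_L lv_0_iff[of p] by (auto simp: Qw_nth lt_def idx_nth)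
  then have "\<gamma> q = axis (Qw!q) 1" using \<gamma>_initial[of "Qw!q"] by simp
  then show ?thesis using F_\<gamma>_axis[OF pq(3)] pq assms fo_coord[of "Qw!p" "Qw!q"] by auto
qed

lemma minus_axis_not_nonfinal:
  assumes "p < L" "\<not> final p" shows "\<gamma> p \<noteq> - axis j 1"
proof
  assume eq: "\<gamma> p = - axis j 1"
  obtain i where "j = st i" by (rule st_surj)
  then have "wt (Qw!p) (lv p) = wt i (h i)" using eq assms by (simp add: \<gamma>_eq wt_h)
  then show False using wt_unique[of "lv p" "Qw!p" "h i" i] lv_le[of p] assms by (auto simp: final_def)
qed

text \<open>The witness t negates the negatives of fundamental weights, which are the final weights,
  and applies c to the others; the defining conditions determine it on all of
  \<open>W\<close>.\<close>

lemma tau_eq: "tau A cq permutes W" "p < L \<Longrightarrow> \<not> final p \<Longrightarrow> tau A cq (\<gamma> p) = cq (\<gamma> p)"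
  "tau A cq (- axis i 1) = axis i 1"
proof -
  define t where "t l = (if l \<in> W then if - l \<in> range (\<lambda>j. axis j 1) then - l else cq l else l)" for l :: "int^'i"
  have fin: "- axis i 1 \<in> W" for i
  proof -
    obtain j where "i = st j" by (rule st_surj)
    then have "- axis i 1 = wt j (h j)" by (simp add: wt_h)
    then show ?thesis unfolding cox_weights_def cox_h_eq fundamental_weight_def by blast
  qed
  have t2: "t (- axis i 1) = axis i 1" for i using fin by (simp add: t_def)
  have t1: "t (\<gamma> p) = cq (\<gamma> p)" if "p < L" "\<not> final p" for p
    using minus_axis_not_nonfinal[OF that] that cox_weights_eq by (auto simp: t_def) (metis minus_minus)
  have cases_W: "(\<exists>p<L. \<not> final p \<and> l = \<gamma> p) \<or> (\<exists>i. l = - axis i 1)" if "l \<in> W" for l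
    using that \<gamma>_final unfolding cox_weights_eq by auto
  have init: "axis i 1 \<in> W" for i using \<gamma>_initial[of i] unfolding cox_weights_eq by (metis imageI lessThan_iff)
  have tW: "t l \<in> W" if "l \<in> W" for l
    using cases_W[OF that]
  proof (elim disjE exE conjE)
    fix p assume p: "p < L" "\<not> final p" "l = \<gamma> p"
    obtain q where "q < L" "\<gamma> q = cq (\<gamma> p)" using \<gamma>_next[OF p(1,2)] by blast
    then show ?thesis using t1[OF p(1,2)] unfolding cox_weights_eq p(3) by (metis imageI lessThan_iff)
  qed (use t2 init in auto)
  have nf: "cq (\<gamma> p) \<noteq> axis i 1" if p: "p < L" "\<not> final p" for p i
  proof
    assume eq: "cq (\<gamma> p) = axis i 1"
    obtain q where q: "q < L" "\<gamma> q = cq (\<gamma> p)" "p < q" "lv q = Suc (lv p)" using \<gamma>_next[OF p] by metis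
    then have "q = idx i" using eq \<gamma>_inj[OF q(1) \<gamma>_initial(3)] \<gamma>_initial(1) by auto
    then show False using q(4) \<gamma>_initial(4) by simp
  qed
  have inj: "inj_on t W"
  proof (rule inj_onI)
    fix l m assume lm: "l \<in> W" "m \<in> W" "t l = t m"
    show "l = m"
      using cases_W[OF lm(1)] cases_W[OF lm(2)]
    proof (elim disjE exE conjE)
      fix p q assume "p < L" "\<not> final p" "l = \<gamma> p" "q < L" "\<not> final q" "m = \<gamma> q"
      then show ?thesis using lm(3) t1 cq_inj by auto
    next
      fix p i assume "p < L" "\<not> final p" "l = \<gamma> p" "m = - axis i 1"
      then show ?thesis using lm(3) t1[of p] t2[of i] nf[of p i] by simp
    next
      fix p i assume "p < L" "\<not> final p" "m = \<gamma> p" "l = - axis i 1"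
      then show ?thesis using lm(3) t1[of p] t2[of i] nf[of p i] by simp
    next
      fix i j assume "l = - axis i 1" "m = - axis j 1"
      then show ?thesis using lm(3) t2[of i] t2[of j] by simp
    qed
  qed
  have finW: "finite W" by (simp add: cox_weights_eq)
  have perm: "t permutes W"
  proof (intro bij_imp_permutes)
    have "t ` W \<subseteq> W" using tW by blast
    then show "bij_betw t W W" using inj endo_inj_surj[OF finW] by (simp add: bij_betw_def)
  qed (simp add: t_def)
  have "tau A cq = t"
    unfolding tau_def cox_h_eq fundamental_weight_def
  proof (rule the_equality)
    have "t (wt i (m - 1)) = wt i m" if m: "1 \<le> m \<and> m \<le> h i" for i m
    proof -
      have "m - 1 \<le> h i" using m by linarith
      then obtain p where p: "p < L" "\<gamma> p = wt i (m - 1)" "Qw!p = i" "lv p = m - 1"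
        by (rule \<gamma>_position)
      then have "\<not> final p" using m by (auto simp: final_def)
      then have "t (wt i (m - 1)) = cq (wt i (m - 1))" using t1[OF p(1)] p(2) by simp
      then show ?thesis using m by (cases m) auto
    qed
    then show "t permutes W \<and> (\<forall>i m. 1 \<le> m \<and> m \<le> h i \<longrightarrow> t (wt i (m - 1)) = wt i m) \<and> (\<forall>i. t (- axis i 1) = axis i 1)"
      using perm t2 by blast
    fix g assume g: "g permutes W \<and> (\<forall>i m. 1 \<le> m \<and> m \<le> h i \<longrightarrow> g (wt i (m - 1)) = wt i m) \<and> (\<forall>i. g (- axis i 1) = axis i 1)"
    have "g (\<gamma> p) = cq (\<gamma> p)" if p: "p < L" "\<not> final p" for p
    proof -
      have "1 \<le> Suc (lv p) \<and> Suc (lv p) \<le> h (Qw!p)" using lv_le[of p] p by (simp add: final_def)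
      then have "g (wt (Qw!p) (Suc (lv p) - 1)) = wt (Qw!p) (Suc (lv p))" using g by blast
      then show ?thesis using p by (simp add: \<gamma>_eq)
    qed
    moreover have "g (- axis i 1) = axis i 1" for i using g by blast
    ultimately have "g l = t l" if "l \<in> W" for l using cases_W[OF that] t1 t2 by metis
    moreover have "g l = t l" if "l \<notin> W" for l using that g perm by (metis permutes_def)
    ultimately show "g = t" by blast
  qed
  then show "tau A cq permutes W" "p < L \<Longrightarrow> \<not> final p \<Longrightarrow> tau A cq (\<gamma> p) = cq (\<gamma> p)"
    "tau A cq (- axis i 1) = axis i 1" using perm t1 t2 by auto
qed

section \<open>Compatibility degrees\<close>

definition degree :: "nat \<Rightarrow> nat \<Rightarrow> int" where
  "degree p q = (if p = q then 0 else - F (\<gamma> (min p q)) (\<gamma> (max p q)) div d (Qw!p))"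

lemma degree_nonneg: "p < L \<Longrightarrow> q < L \<Longrightarrow> degree p q \<ge> 0"
  using F_neg[of "min p q" "max p q"] d_pos[of "Qw!p"]
  by (auto simp: degree_def min_def max_def intro!: pos_imp_zdiv_nonneg_iff[THEN iffD2])

text \<open>The weight of p is both minus a fundamental weight and c of an earlier weight. Comparing
  these descriptions with the sign of F bounds both values by 0 from both sides.\<close>

lemma final_before_nonfinal:
  assumes "p < q" "q < L" "final p" "\<not> final q"
  shows "F (\<gamma> p) (\<gamma> q) = 0" "F (\<gamma> q) (\<gamma> p) = 0"
proof -
  let ?b = "st (Qw!p)"
  have p: "p < L" "N \<le> p" using assms final_not_initial by auto
  have gp: "\<gamma> p = - axis ?b 1" using \<gamma>_final p assms(3) by blast
  obtain p0 where p0: "p0 < L" "\<gamma> p = cq (\<gamma> p0)" "p0 < p" using \<gamma>_prev[OF p] by metis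
  have "F (\<gamma> q) (\<gamma> p) \<ge> 0" using F_neg[of p0 q] assms p0 by (simp add: p0(2) F_c)
  moreover have "F (\<gamma> q) (axis ?b 1) \<ge> 0"
    using F_\<gamma>_axis[OF assms(2)] h_pos[of "lv q" "Qw!q"] lv_le[of q] assms(2,4) d_pos[of ?b]
    by (simp add: vp_def final_def)
  ultimately show "F (\<gamma> q) (\<gamma> p) = 0" by (simp add: gp F_linear)
  have "F (\<gamma> (idx ?b)) (\<gamma> q) \<le> 0" using F_neg[of "idx ?b" q] idx(1)[of ?b] p assms by simp
  moreover have "F (\<gamma> p) (\<gamma> q) \<le> 0" using F_neg assms by simp
  ultimately show "F (\<gamma> p) (\<gamma> q) = 0" by (simp add: gp F_linear \<gamma>_initial)
qed

lemma tau_final: "p < L \<Longrightarrow> final p \<Longrightarrow> tau A cq (\<gamma> p) = axis (st (Qw!p)) 1"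
  by (simp add: \<gamma>_final tau_eq)

lemma tau_position:
  assumes "p < L" "p' < L" "\<gamma> p' = tau A cq (\<gamma> p)"
  shows "\<not> final p \<Longrightarrow> \<gamma> p' = cq (\<gamma> p) \<and> Qw!p' = Qw!p \<and> lv p' = Suc (lv p)"
    "final p \<Longrightarrow> p' = idx (st (Qw!p))" "d (Qw!p') = d (Qw!p)"
proof -
  show 1: "\<gamma> p' = cq (\<gamma> p) \<and> Qw!p' = Qw!p \<and> lv p' = Suc (lv p)" if nf: "\<not> final p"
  proof -
    obtain q where q: "q < L" "\<gamma> q = cq (\<gamma> p)" "Qw!q = Qw!p" "lv q = Suc (lv p)" "p < q"
      by (rule \<gamma>_next[OF assms(1) nf])
    then have "q = p'" using \<gamma>_inj[of q p'] assms tau_eq(2)[OF assms(1) nf] by simp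
    then show ?thesis using q by simp
  qed
  show 2: "p' = idx (st (Qw!p))" if "final p"
    using \<gamma>_inj[OF assms(2) \<gamma>_initial(3)] tau_final[OF assms(1) that] assms(3) \<gamma>_initial(1) by metis
  show "d (Qw!p') = d (Qw!p)" using 1 2 by (cases "final p") (auto simp: \<gamma>_initial)
qed

text \<open>On non-final positions tau is c, which preserves order and F. A final position wraps
  around to an initial one with the opposite weight, and F l (c m) = - F m l compensates the change
  of order and sign; in the remaining cases both values vanish.\<close>

lemma degree_tau:
  assumes p: "p < L" "p' < L" "\<gamma> p' = tau A cq (\<gamma> p)" and q: "q < L" "q' < L" "\<gamma> q' = tau A cq (\<gamma> q)"
  shows "degree p' q' = degree p q"
proof -
  have main: "F (\<gamma> (min p' q')) (\<gamma> (max p' q')) = F (\<gamma> p) (\<gamma> q)"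
    if "p < q" "p < L" "p' < L" "\<gamma> p' = tau A cq (\<gamma> p)" "q < L" "q' < L" "\<gamma> q' = tau A cq (\<gamma> q)" for p p' q q'
  proof -
    note P = tau_position[OF that(2-4)] and Q = tau_position[OF that(5-7)]
    have fin: "final x \<Longrightarrow> x < L \<Longrightarrow> x' < L \<Longrightarrow> \<gamma> x' = tau A cq (\<gamma> x) \<Longrightarrow> x' < N \<and> \<gamma> x = - \<gamma> x'" for x x'
      using tau_position(2)[of x x'] idx(1) \<gamma>_final[of x] \<gamma>_initial(1) by simp
    have nfin: "\<not> final x \<Longrightarrow> x < L \<Longrightarrow> x' < L \<Longrightarrow> \<gamma> x' = tau A cq (\<gamma> x) \<Longrightarrow> N \<le> x'" for x x'
      using tau_position(1)[of x x'] lv_0_iff[of x'] by auto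
    consider "\<not> final p" "\<not> final q" | "\<not> final p" "final q" | "final p" "\<not> final q" | "final p" "final q" by blast
    then show ?thesis
    proof cases
      case 1
      then have "p' < q'" using P Q that(1) position_less[of p q] position_less[of p' q'] that by auto
      then show ?thesis using P Q 1 by (simp add: F_cc)
    next
      case 2
      have "q' < p'" using fin[OF 2(2) that(5-7)] nfin[OF 2(1) that(2-4)] by simp
      then show ?thesis using P(1)[OF 2(1)] fin[OF 2(2) that(5-7)] by (simp add: min_def max_def F_c F_linear)
    next
      case 3
      have "p' < q'" using fin[OF 3(1) that(2-4)] nfin[OF 3(2) that(5-7)] by simp
      then show ?thesis
        using Q(1)[OF 3(2)] fin[OF 3(1) that(2-4)] final_before_nonfinal[OF that(1,5) 3]
        by (simp add: F_c F_linear)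
    next
      case 4
      have pq: "\<gamma> p = - \<gamma> p'" "\<gamma> q = - \<gamma> q'" "p' < N" "q' < N" using fin that 4 by auto
      have "p' \<noteq> q'" using pq \<gamma>_inj[of p q] that(1,2,5) by auto
      then have 0: "F (\<gamma> (min p' q')) (\<gamma> (max p' q')) = 0" using pq by (intro F_initial) auto
      have "q' = idx (st (Qw!q))" using Q(2) 4 by simp
      then have "F (\<gamma> p') (\<gamma> q') \<ge> 0"
        using F_\<gamma>_axis[OF that(3)] h_pos[of 0 "Qw!p'"] h_gt_0[of "Qw!p'"] lv_0_iff[of p'] that(3) pq d_pos
        by (simp add: \<gamma>_initial vp_def zero_le_mult_iff less_imp_le)
      moreover have "F (\<gamma> p) (\<gamma> q) \<le> 0" using F_neg that by simp
      ultimately show ?thesis using 0 by (simp add: pq F_linear)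
    qed
  qed
  have eqv: "p' = q' \<longleftrightarrow> p = q"
  proof -
    have "p' = q' \<longleftrightarrow> tau A cq (\<gamma> p) = tau A cq (\<gamma> q)" using \<gamma>_inj[OF p(2) q(2)] p q by simp
    also have "\<dots> \<longleftrightarrow> \<gamma> p = \<gamma> q" using permutes_inj[OF tau_eq(1)] by (simp add: inj_eq)
    finally show ?thesis using \<gamma>_inj p q by simp
  qed
  have "F (\<gamma> (min p' q')) (\<gamma> (max p' q')) = F (\<gamma> (min p q)) (\<gamma> (max p q))" if "p \<noteq> q"
  proof (cases "p < q")
    case True then show ?thesis using main[OF True p q] by (simp add: min_def max_def)
  next
    case False
    then have "q < p" using that by simp
    from main[OF this q p] show ?thesis using \<open>q < p\<close> by (simp add: min.commute max.commute min_def max_def)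
  qed
  then show ?thesis using eqv tau_position(3)[OF p] by (simp add: degree_def)
qed

lemma degree_initial:
  assumes "q < L" "N \<le> q" "\<gamma> q = cq (\<gamma> r)" "r < L" "r < q" shows "degree (idx i) q = rt (Qw!r) (lv r) $ i"
proof -
  have iq: "idx i < q" using idx(1)[of i] assms(2) by simp
  have "F (\<gamma> (idx i)) (\<gamma> q) = - (d i * rt (Qw!r) (lv r) $ i)"
    using F_\<gamma>_axis[OF assms(4), of i] by (simp add: assms(3) F_c \<gamma>_initial)
  then show ?thesis using iq d_pos[of i] by (simp add: degree_def \<gamma>_initial min_def max_def)
qed

text \<open>\<open>degree\<close> has the defining properties, and these determine the function:
  every weight is a power of tau applied to a fundamental weight, so invariance moves the first
  argument to a fundamental weight.\<close>

lemma compat_eq: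
  assumes pq: "p < L" "q < L" shows "int (compat A cq (\<gamma> p) (\<gamma> q)) = degree p q"
proof -
  define spec where "spec g \<longleftrightarrow> (\<forall>l m. \<not> (l \<in> W \<and> m \<in> W) \<longrightarrow> g l m = 0) \<and>
     (\<forall>i j. g (\<omega> i) (\<omega> j) = 0) \<and>
     (\<forall>i. \<forall>l \<in> W - range \<omega>. int (g (\<omega> i) l) = root_coeff A (inv_into UNIV cq l - l) i) \<and>
     (\<forall>l \<in> W. \<forall>m \<in> W. g (tau A cq l) (tau A cq m) = g l m)" for g :: "int^'i \<Rightarrow> int^'i \<Rightarrow> nat"
  define pos where "pos l = inv_into {..<L} \<gamma> l" for l
  have inj: "inj_on \<gamma> {..<L}" using \<gamma>_inj by (auto simp: inj_on_def)
  have pos: "pos (\<gamma> p) = p" if "p < L" for p using inv_into_f_f[OF inj] that by (simp add: pos_def)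
  define g where "g l m = (if l \<in> W \<and> m \<in> W then nat (degree (pos l) (pos m)) else 0)" for l m
  have gdeg: "g (\<gamma> p) (\<gamma> q) = nat (degree p q)" if "p < L" "q < L" for p q
    using that by (simp add: g_def pos cox_weights_eq)
  have om: "\<omega> i = \<gamma> (idx i)" for i by (simp add: fundamental_weight_def \<gamma>_initial)
  have noninit: "N \<le> q" if "q < L" "\<gamma> q \<notin> range \<omega>" for q
  proof (rule ccontr)
    assume "\<not> N \<le> q"
    then have "q = idx (cw!q)" by (simp add: idx_nth)
    then show False using that(2) om by (metis rangeI)
  qed
  have spec_g: "spec g"
    unfolding spec_def
  proof (intro conjI allI ballI impI)
    show "g l m = 0" if "\<not> (l \<in> W \<and> m \<in> W)" for l m using that by (auto simp: g_def)
    show "g (\<omega> i) (\<omega> j) = 0" for i j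
    proof -
      have "degree (idx i) (idx j) = 0"
        using F_initial[of "idx i" "idx j"] F_initial[of "idx j" "idx i"] idx(1)
        by (auto simp: degree_def min_def max_def)
      then show ?thesis using gdeg[OF \<gamma>_initial(3) \<gamma>_initial(3), of i j] by (simp add: om)
    qed
    fix i l assume "l \<in> W - range \<omega>"
    then obtain q where q: "q < L" "l = \<gamma> q" "N \<le> q" using noninit unfolding cox_weights_eq by auto
    obtain r where r: "r < L" "\<gamma> q = cq (\<gamma> r)" "r < q" using \<gamma>_prev[OF q(1,3)] by metis
    have "inv_into UNIV cq l = \<gamma> r" unfolding q(2) r(2) by (rule inv_f_f) (simp add: inj_def cq_inj)
    then have "inv_into UNIV cq l - l = A *v rt (Qw!r) (lv r)"
      using A_G[of "\<gamma> r"] G_label[OF r(1)] f_eq r(1) by (simp add: q(2) r(2))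
    then have "root_coeff A (inv_into UNIV cq l - l) i = degree (idx i) q"
      using degree_initial[OF q(1,3) r(2,1,3)] by (simp add: root_coeff_eq)
    then show "int (g (\<omega> i) l) = root_coeff A (inv_into UNIV cq l - l) i"
      using degree_nonneg[OF \<gamma>_initial(3) q(1)] gdeg[OF \<gamma>_initial(3) q(1)] by (simp add: om q(2))
  next
    fix l m assume "l \<in> W" "m \<in> W"
    then obtain p q where pq: "p < L" "l = \<gamma> p" "q < L" "m = \<gamma> q" unfolding cox_weights_eq by auto
    have ex: "\<exists>x'<L. \<gamma> x' = tau A cq x" if "x \<in> W" for x
    proof -
      have "tau A cq x \<in> W" using permutes_in_image[OF tau_eq(1), of x] that by simp
      then show ?thesis unfolding cox_weights_eq by auto
    qed
    from ex[OF \<open>l \<in> W\<close>] ex[OF \<open>m \<in> W\<close>] obtain p' q' where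
      pq': "p' < L" "\<gamma> p' = tau A cq l" "q' < L" "\<gamma> q' = tau A cq m" by blast
    have "degree p' q' = degree p q" by (rule degree_tau) (use pq pq' in auto)
    then show "g (tau A cq l) (tau A cq m) = g l m"
      using gdeg[of p' q'] gdeg[of p q] pq pq' by simp
  qed
  have unique: "g1 = g2" if g1: "spec g1" and g2: "spec g2" for g1 g2
  proof -
    have base: "g1 (\<omega> i) l = g2 (\<omega> i) l" if "l \<in> W" for i l
    proof (cases "l \<in> range \<omega>")
      case False
      then have "int (g1 (\<omega> i) l) = int (g2 (\<omega> i) l)" using g1 g2 that by (simp add: spec_def)
      then show ?thesis by simp
    qed (use g1 g2 in \<open>auto simp: spec_def\<close>)
    have "m \<le> h i \<Longrightarrow> l \<in> W \<Longrightarrow> g1 (wt i m) l = g2 (wt i m) l" for i m l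
    proof (induction m arbitrary: l)
      case 0 then show ?case using base[of l i] by (simp add: fundamental_weight_def)
    next
      case (Suc m)
      obtain p where p: "p < L" "\<gamma> p = wt i m" "Qw!p = i" "lv p = m" using \<gamma>_position[of m i] Suc.prems(1) by auto
      then have tp: "tau A cq (wt i m) = wt i (Suc m)" using tau_eq(2)[of p] Suc.prems(1) by (simp add: final_def)
      obtain l' where l': "l' \<in> W" "tau A cq l' = l"
        using permutes_image[OF tau_eq(1)] Suc.prems(2) by (metis imageE)
      have "wt i m \<in> W" using p unfolding cox_weights_eq by (metis imageI lessThan_iff)
      then have "g1 (tau A cq (wt i m)) (tau A cq l') = g1 (wt i m) l'"
        "g2 (tau A cq (wt i m)) (tau A cq l') = g2 (wt i m) l'"
        using g1 g2 l' by (auto simp: spec_def)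
      then show ?case using Suc.IH[of l'] Suc.prems(1) l' by (simp add: tp del: funpow.simps)
    qed
    then have "g1 l m = g2 l m" if "l \<in> W" "m \<in> W" for l m
      using that unfolding cox_weights_def cox_h_eq fundamental_weight_def by blast
    moreover have "g1 l m = g2 l m" if "\<not> (l \<in> W \<and> m \<in> W)" for l m using g1 g2 that by (simp add: spec_def)
    ultimately show ?thesis by blast
  qed
  have "compat A cq = g"
    unfolding compat_def spec_def[symmetric] using spec_g unique by (intro the_equality) auto
  then show ?thesis using gdeg[OF pq] degree_nonneg[OF pq] by simp
qed

end

section \<open>Primitive exchange relations\<close>

lemma nat_pos [simp]: "nat (pos z) = nat z"
  by (simp add: Defs.pos_def max_def)

context coxeter_complex
begin

lemma vv_vi_expand: "vv {} p (vi I p v) = v - (\<Sum>i\<in>I \<inter> {..<p}. cp (R I i) (A *v v) *s f i)"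
proof (rule A_inj)
  have "A *v vv {} p (vi I p v) = vw {} p (A *v vi I p v)" by (rule A_vv)
  also have "\<dots> = A *v v - (\<Sum>i\<in>I \<inter> {..<p}. cp (R I i) (A *v v) *s (A *v f i))"
    by (subst vw_prefix[of p _ I]) (simp flip: A_vv)
  finally show "A *v vv {} p (vi I p v) = A *v (v - (\<Sum>i\<in>I \<inter> {..<p}. cp (R I i) (A *v v) *s f i))"
    by (simp add: A_sum matrix_vector_mult_diff_distrib matrix_vector_mult_scale)
qed

text \<open>Together with \<open>vv_vi_expand\<close> this turns the coordinates in
  \<open>yy\<close> into values of F, which can be compared with compatibility degrees.\<close>

lemma co_pr: "d (Q!p) * co I p v = pr (vv {} p (vi I p v)) (\<gamma> p)"
  by (simp add: co_def \<gamma>_def pr_vv_vw pr_axis_right)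

lemma F_label: "p < L \<Longrightarrow> F (\<gamma> p) m = pr (f p) m"
  by (simp add: F_def G_label)

lemma co_R_after:
  assumes I: "facet I" "k \<in> I" and p: "k < p" "p < L"
  shows "d (Q!p) * co I p (R I k) = - F (\<gamma> k) (\<gamma> p) - (\<Sum>i\<in>I \<inter> {k<..<p}. cc I k i * F (\<gamma> i) (\<gamma> p))"
proof -
  have fin: "finite I" using facetD(3)[OF I(1)] .
  have split: "I \<inter> {..<p} = (I \<inter> {..<k}) \<union> insert k (I \<inter> {k<..<p})" using I(2) p(1) by auto
  have "vv {} p (vi I p (R I k)) = R I k - (\<Sum>i\<in>I \<inter> {..<p}. cc I k i *s f i)"
    by (simp add: vv_vi_expand cc_def)
  also have "(\<Sum>i\<in>I \<inter> {..<p}. cc I k i *s f i) = (\<Sum>i\<in>I \<inter> {..<k}. cc I k i *s f i) +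
      (2 *s f k + (\<Sum>i\<in>I \<inter> {k<..<p}. cc I k i *s f i))"
    unfolding split by (subst sum.union_disjoint) (use fin in \<open>auto simp: cc_self\<close>)
  also have "R I k - \<dots> = - f k - (\<Sum>i\<in>I \<inter> {k<..<p}. cc I k i *s f i)"
    using f_expand[of k I] by (simp add: cc_def vec_eq_iff)
  finally show ?thesis
    unfolding co_pr using p by (simp add: pr_simps pr_sum_left F_label)
qed

lemma co_R_before:
  assumes I: "facet I" "k \<in> I" and p: "p \<le> k"
  shows "d (Q!p) * co I p (R I k) = F (\<gamma> k) (\<gamma> p) + (\<Sum>i\<in>I \<inter> {p..<k}. cc I k i * F (\<gamma> i) (\<gamma> p))"
proof -
  have fin: "finite I" using facetD(3)[OF I(1)] .
  have kL: "k < L" using facet_less[OF I] .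
  have split: "I \<inter> {..<k} = (I \<inter> {..<p}) \<union> (I \<inter> {p..<k})" using p by auto
  have "R I k = f k + (\<Sum>i\<in>I \<inter> {..<k}. cc I k i *s f i)" using f_expand[of k I] by (simp add: cc_def)
  also have "(\<Sum>i\<in>I \<inter> {..<k}. cc I k i *s f i) = (\<Sum>i\<in>I \<inter> {..<p}. cc I k i *s f i) +
      (\<Sum>i\<in>I \<inter> {p..<k}. cc I k i *s f i)"
    unfolding split by (subst sum.union_disjoint) (use fin in auto)
  finally have eq: "R I k = f k + ((\<Sum>i\<in>I \<inter> {..<p}. cc I k i *s f i) + (\<Sum>i\<in>I \<inter> {p..<k}. cc I k i *s f i))" .
  have "vv {} p (vi I p (R I k)) = R I k - (\<Sum>i\<in>I \<inter> {..<p}. cc I k i *s f i)"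
    by (simp add: vv_vi_expand cc_def)
  also have "\<dots> = f k + (\<Sum>i\<in>I \<inter> {p..<k}. cc I k i *s f i)" by (subst eq) simp
  finally have "vv {} p (vi I p (R I k)) = f k + (\<Sum>i\<in>I \<inter> {p..<k}. cc I k i *s f i)" .
  then show ?thesis
    unfolding co_pr using kL by (simp add: pr_simps pr_sum_left F_label)
qed

lemma label_independent:
  assumes "facet I" "S \<subseteq> I" "(\<Sum>i\<in>S. x i *s \<gamma> i) = 0" "k \<in> S" shows "x k = 0"
proof -
  have fin: "finite S" using facetD(3)[OF assms(1)] assms(2) by (rule finite_subset[rotated])
  have "0 = cp (R I k) (\<Sum>i\<in>S. x i *s \<gamma> i)" by (simp add: assms(3) cp_linear)
  also have "\<dots> = (\<Sum>i\<in>S. if i = k then x k else 0)"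
    using cp_label[OF assms(1), of k] subsetD[OF assms(2)] assms(4)
    by (simp add: cp_sum cp_linear) (intro sum.cong, auto)
  finally show ?thesis using fin assms(4) by simp
qed

lemma yy_sign:
  assumes I: "facet I" "k \<in> I" "vp (R I k)" and p: "p < L"
  shows "p \<le> k \<or> opp I k < p \<Longrightarrow> yy I p k \<ge> 0" "k < p \<Longrightarrow> p \<le> opp I k \<Longrightarrow> yy I p k \<le> 0"
  using co_sign[OF I p] opp_pos[OF I] by (auto simp: yy_def)

lemma yy_self: "yy I k k = 1"
  by (simp add: yy_def co_def)

lemma yy_opp: assumes "facet I" "k \<in> I" "vp (R I k)" shows "yy I (opp I k) k = - 1"
proof -
  have "co I (opp I k) (R I (opp I k)) = 1" by (simp add: co_def)
  then show ?thesis using opp_pos[OF assms] by (simp add: yy_def)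
qed

text \<open>Rewriting by \<open>flip_out\<close> brings in F with the opposite position. The two
  corrections vanish if the coefficients outside the interval do, and the exponent then is a
  compatibility degree; \<open>yy_after\<close> is the same on the other side.\<close>

lemma yy_before:
  assumes I: "facet I" "k \<in> I" "vp (R I k)" and p: "p \<le> k"
  shows "d (Q!p) * yy I p k = - F (\<gamma> p) (\<gamma> (opp I k)) - (\<Sum>i\<in>I \<inter> {..<p}. cc I k i * F (\<gamma> i) (\<gamma> p))
    + (\<Sum>i\<in>I \<inter> {opp I k<..}. cc I k i * F (\<gamma> p) (\<gamma> i))"
proof -
  have fin: "finite I" using facetD(3)[OF I(1)] .
  have split: "I \<inter> {..<k} = (I \<inter> {..<p}) \<union> (I \<inter> {p..<k})" using p by auto
  have "F (\<gamma> p) (\<gamma> (opp I k)) + F (\<gamma> k) (\<gamma> p) = F (\<gamma> p) (\<gamma> (opp I k) - c (\<gamma> k))"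
    by (simp add: F_linear F_c)
  also have "\<dots> = - (\<Sum>i\<in>I \<inter> {..<k}. cc I k i * F (\<gamma> i) (\<gamma> p)) + (\<Sum>i\<in>I \<inter> {opp I k<..}. cc I k i * F (\<gamma> p) (\<gamma> i))"
    unfolding flip_out[OF I] by (simp add: F_linear F_sum F_c sum_negf)
  also have "(\<Sum>i\<in>I \<inter> {..<k}. cc I k i * F (\<gamma> i) (\<gamma> p)) =
      (\<Sum>i\<in>I \<inter> {..<p}. cc I k i * F (\<gamma> i) (\<gamma> p)) + (\<Sum>i\<in>I \<inter> {p..<k}. cc I k i * F (\<gamma> i) (\<gamma> p))"
    unfolding split by (subst sum.union_disjoint) (use fin in auto)
  finally show ?thesis using co_R_before[OF I(1,2) p] p by (simp add: yy_def)
qed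

lemma yy_after:
  assumes I: "facet I" "k \<in> I" "vp (R I k)" and p: "opp I k < p" "p < L"
  shows "d (Q!p) * yy I p k = - F (\<gamma> (opp I k)) (\<gamma> p) + (\<Sum>i\<in>I \<inter> {opp I k<..<p}. cc I k i * F (\<gamma> i) (\<gamma> p))"
proof -
  have fin: "finite I" using facetD(3)[OF I(1)] .
  have kp: "k < p" "k < opp I k" "opp I k \<notin> I" using opp_pos[OF I] opp[OF I(1)] p by auto
  then have split: "I \<inter> {k<..<p} = (I \<inter> {k<..<opp I k}) \<union> (I \<inter> {opp I k<..<p})" using p by auto (metis linorder_neqE_nat)
  have "F (\<gamma> k) (\<gamma> p) + F (\<gamma> (opp I k)) (\<gamma> p) = - (\<Sum>i\<in>I \<inter> {k<..<opp I k}. cc I k i * F (\<gamma> i) (\<gamma> p))"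
    using arg_cong[OF flip_between[OF I], of "\<lambda>l. F l (\<gamma> p)"] by (simp add: F_linear F_sum)
  moreover have "(\<Sum>i\<in>I \<inter> {k<..<p}. cc I k i * F (\<gamma> i) (\<gamma> p)) =
      (\<Sum>i\<in>I \<inter> {k<..<opp I k}. cc I k i * F (\<gamma> i) (\<gamma> p)) + (\<Sum>i\<in>I \<inter> {opp I k<..<p}. cc I k i * F (\<gamma> i) (\<gamma> p))"
    unfolding split by (subst sum.union_disjoint) (use fin in auto)
  ultimately show ?thesis using co_R_after[OF I(1,2) kp(1) p(2)] kp by (simp add: yy_def)
qed

lemma cc_opp_signs:
  assumes I: "facet I" "k \<in> I" "vp (R I k)" and i: "i \<in> I"
  shows "i < k \<Longrightarrow> cc I k i \<le> 0" "opp I k < i \<Longrightarrow> cc I k i \<ge> 0" "k < i \<Longrightarrow> i < opp I k \<Longrightarrow> cc I k i \<le> 0"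
  using cc_signs[OF I i] opp_pos[OF I] by auto

text \<open>The correction terms in \<open>yy_before\<close> and \<open>yy_after\<close> have a
  definite sign by \<open>cc_opp_signs\<close> and the nonpositivity of F.\<close>

lemma yy_outside_le:
  assumes I: "facet I" "k \<in> I" "vp (R I k)" and p: "p < k \<or> opp I k < p" "p < L"
  shows "d (Q!p) * yy I p k \<le> - F (\<gamma> (min p (opp I k))) (\<gamma> (max p (opp I k)))"
proof -
  have FL: "F (\<gamma> i) (\<gamma> j) \<le> 0" if "i < j" "j < L" for i j using F_neg that .
  show ?thesis
  proof (cases "p < k")
    case True
    have "(\<Sum>i\<in>I \<inter> {..<p}. cc I k i * F (\<gamma> i) (\<gamma> p)) \<ge> 0"
      using cc_opp_signs(1)[OF I] FL p(2) True by (intro sum_nonneg mult_nonpos_nonpos) auto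
    moreover have "(\<Sum>i\<in>I \<inter> {opp I k<..}. cc I k i * F (\<gamma> p) (\<gamma> i)) \<le> 0"
      using cc_opp_signs(2)[OF I] FL facet_less[OF I(1)] True opp_pos[OF I]
      by (intro sum_nonpos mult_nonneg_nonpos) auto
    ultimately show ?thesis using yy_before[OF I, of p] True opp_pos[OF I] by (simp add: min_def max_def)
  next
    case False
    then have "(\<Sum>i\<in>I \<inter> {opp I k<..<p}. cc I k i * F (\<gamma> i) (\<gamma> p)) \<le> 0"
      using cc_opp_signs(2)[OF I] FL p by (intro sum_nonpos mult_nonneg_nonpos) auto
    then show ?thesis using yy_after[OF I _ p(2)] p False by (simp add: min_def max_def)
  qed
qed

end

context coxeter_cartan
begin

text \<open>The division in \<open>degree\<close> is exact. If p is the later position, it is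
  non-initial or F vanishes; in the first case the shift by c moves a weight with the letter of p to
  the first slot.\<close>

lemma degree_mult:
  assumes "p < L" "q < L" "p \<noteq> q"
  shows "d (Qw!p) * degree p q = - F (\<gamma> (min p q)) (\<gamma> (max p q))"
proof -
  have dv: "d (Qw!x) dvd F (\<gamma> x) m" if "x < L" for x m
    using dd_dvd[of "f x" m] F_label[OF that] by simp
  have "d (Qw!p) dvd F (\<gamma> (min p q)) (\<gamma> (max p q))"
  proof (cases "p < q")
    case True then show ?thesis using dv[OF assms(1)] by (simp add: min_def max_def)
  next
    case False
    then have qp: "q < p" using assms(3) by simp
    show ?thesis
    proof (cases "p < n")
      case True then show ?thesis using F_initial[OF qp True] qp by (simp add: min_def max_def)
    next
      case False
      then obtain r where r: "r < L" "\<gamma> p = cq (\<gamma> r)" "Qw!r = Qw!p" using \<gamma>_prev[OF assms(1)] by (metis not_le)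
      then show ?thesis using dv[OF r(1), of "\<gamma> q"] qp by (simp add: min_def max_def F_c)
    qed
  qed
  then show ?thesis using assms(3) by (simp add: degree_def)
qed

lemma rw_expand:
  "rw w v = v - (\<Sum>l<length w. (A *v v)$(w!l) *s rw (take l w) (axis (w!l) 1))"
proof (induction w rule: rev_induct)
  case (snoc i w)
  have "rw (w @ [i]) v = rw w v - (A *v v)$i *s rw w (axis i 1)"
    by (simp add: sr_def rw_linear)
  then show ?case using snoc by (simp add: nth_append)
qed simp

text \<open>The sum over the predecessors of j undoes the passage from simple roots to the roots
  \<open>fo\<close>. It is the origin of the sum in the exponents of the initial
  coefficients.\<close>

lemma fo_expand: "axis j 1 = fo j + (\<Sum>i\<in>UNIV. if prec A cq i j then A$i$j *s fo i else 0)"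
proof -
  have nth: "idx (cw!a) = a" if "a < idx j" for a using idx_nth less_trans[OF that idx(1)] .
  have "(\<Sum>l<idx j. (A *v axis j 1)$(cw!l) *s rw (take l cw) (axis (cw!l) 1)) = (\<Sum>l<idx j. A$(cw!l)$j *s fo (cw!l))"
    using idx(1)[of j] by (intro sum.cong) (auto simp: A_axis_nth fo_def idx_nth)
  also have "\<dots> = (\<Sum>i\<in>idx -` {..<idx j}. A$i$j *s fo i)"
    by (rule sum.reindex_bij_witness[of _ idx "(!) cw"]) (auto simp: idx nth)
  also have "\<dots> = (\<Sum>i\<in>UNIV. if idx i < idx j then A$i$j *s fo i else 0)"
    by (simp add: sum.If_cases vimage_def)
  also have "\<dots> = (\<Sum>i\<in>UNIV. if prec A cq i j then A$i$j *s fo i else 0)"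
    by (intro sum.cong) (auto simp: prec_iff)
  finally have "(\<Sum>l<idx j. (A *v axis j 1)$(cw!l) *s rw (take l cw) (axis (cw!l) 1)) = \<dots>" .
  moreover have "fo j = axis j 1 - (\<Sum>l<idx j. (A *v axis j 1)$(cw!l) *s rw (take l cw) (axis (cw!l) 1))"
    using rw_expand[of "take (idx j) cw" "axis j 1"] idx(1)[of j] by (simp add: fo_def min_def)
  ultimately show ?thesis by simp
qed

lemma first_level: obtains q where "q < L" "\<gamma> q = cq (axis i 1)" "Qw!q = i" "lv q = 1" "N \<le> q"
proof -
  have "1 \<le> h i" using h_gt_0[of i] by simp
  then obtain q where q: "q < L" "\<gamma> q = wt i 1" "Qw!q = i" "lv q = 1" by (rule \<gamma>_position)
  then show ?thesis using that[of q] lv_0_iff[of q] by auto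
qed

lemma yy_I0:
  assumes "N \<le> p" "p < L" "\<gamma> p = cq (\<gamma> r)"
  shows "d (Qw!p) * yy I0 p (idx j) = - (d j * \<gamma> r $ j)"
proof -
  have "cq (vw I0 p (axis (Qw!p) 1)) = cq (\<gamma> r)"
    using com_empty[of p] assms by (simp add: vw_def \<gamma>_def[of p])
  then have "vw I0 p (axis (Qw!p) 1) = \<gamma> r" by (simp only: cq_inj)
  moreover have "d (Qw!p) * co I0 p (axis j 1) = pr (axis j 1) (vw I0 p (axis (Qw!p) 1))"
    using pr_vv_vw[of I0 p "vi I0 p (axis j 1)" "axis (Qw!p) 1"] by (simp add: co_def pr_axis_right)
  ultimately show ?thesis using idx(1)[of j] assms(1) by (simp add: yy_def R_I0 pr_axis_left)
qed

text \<open>By the level of p: at level 0 the right-hand side is a coordinate of the simple root of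
  j, at level 1 all terms vanish, and at higher levels both sides pair the two sides of
  \<open>fo_expand\<close> with the weight before that of p.\<close>

lemma yy_initial:
  assumes p: "p < L" "p \<noteq> idx j" "\<gamma> p \<noteq> cq (axis j 1)"
  shows "yy I0 p (idx j) = int (compat A cq (\<gamma> p) (cq (axis j 1)))
    + (\<Sum>i | prec A cq i j. A$i$j * int (compat A cq (\<gamma> p) (cq (axis i 1))))"
proof -
  have yy0: "yy I0 p (idx j) = 0" if "p < N"
  proof -
    have "com I0 p = []" using that by (auto simp: com_def filter_empty_conv)
    moreover have "Qw!p \<noteq> j" using \<gamma>_initial(2)[of "cw!p"] idx_nth[OF that] p(2) by auto
    ultimately show ?thesis by (simp add: yy_def R_I0 co_def vi_def)
  qed
  define g where "g i = int (compat A cq (\<gamma> p) (cq (axis i 1)))" for i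
  have sum: "(\<Sum>i | prec A cq i j. A$i$j * g i) = (\<Sum>i\<in>UNIV. if prec A cq i j then A$i$j * g i else 0)"
    by (simp add: sum.If_cases)
  have dg: "d (Qw!p) * g i = - F (\<gamma> (min p q)) (\<gamma> (max p q))"
    if "q < L" "\<gamma> q = cq (axis i 1)" "p \<noteq> q" for i q
    using compat_eq[OF p(1) that(1)] degree_mult[OF p(1) that(1,3)] that(2) by (simp add: g_def)
  consider "p < N" | "lv p = 1" | "2 \<le> lv p" using lv_0_iff[of p] p(1) by force
  then have "yy I0 p (idx j) = g j + (\<Sum>i\<in>UNIV. if prec A cq i j then A$i$j * g i else 0)"
  proof cases
    case 1
    then have pi: "p = idx (cw!p)" by (simp add: idx_nth)
    have "g i = fo i $ (cw!p)" for i
    proof -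
      obtain q where q: "q < L" "\<gamma> q = cq (axis i 1)" "Qw!q = i" "lv q = 1" "N \<le> q" by (rule first_level)
      have "degree (idx (cw!p)) q = rt (Qw!idx i) (lv (idx i)) $ (cw!p)"
        by (rule degree_initial) (use q idx(1)[of i] in \<open>auto simp: \<gamma>_initial\<close>)
      then show ?thesis using compat_eq[OF p(1) q(1)] by (simp add: g_def q(2) \<gamma>_initial flip: pi)
    qed
    then have "g j + (\<Sum>i\<in>UNIV. if prec A cq i j then A$i$j * g i else 0) = axis j 1 $ (cw!p)"
      by (subst fo_expand) (simp add: if_distrib[of "\<lambda>v. v $ _"] cong: if_cong)
    then show ?thesis using 1 p(2) idx_nth[OF 1] by (auto simp: yy0)
  next
    case 2
    then have Np: "N \<le> p" using lv_0_iff[of p] p(1) by auto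
    obtain r where r: "r < L" "\<gamma> p = cq (\<gamma> r)" "Qw!r = Qw!p" "lv p = Suc (lv r)" using \<gamma>_prev[OF p(1) Np] by metis
    have gr: "\<gamma> r = axis (Qw!p) 1" using r 2 \<gamma>_eq[of r] by simp
    have "Qw!p \<noteq> j" using gr r(2) p(3) by auto
    then have "d (Qw!p) * yy I0 p (idx j) = 0" using yy_I0[OF Np p(1) r(2)] by (simp add: gr)
    then have "yy I0 p (idx j) = 0" using d_pos[of "Qw!p"] by simp
    moreover have "g i = 0" for i
    proof -
      obtain q where q: "q < L" "\<gamma> q = cq (axis i 1)" "Qw!q = i" "lv q = 1" "N \<le> q" by (rule first_level)
      show ?thesis
      proof (cases "p = q")
        case True then show ?thesis using compat_eq[OF p(1) q(1)] q(2) by (simp add: g_def degree_def)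
      next
        case False
        have less: "p < q \<longleftrightarrow> idx (Qw!p) < idx i" "q < p \<longleftrightarrow> idx i < idx (Qw!p)"
          using position_less[of p q] position_less[of q p] p(1) q 2 by auto
        have "F (\<gamma> (min p q)) (\<gamma> (max p q)) = 0"
          using less False r(2) gr q(2) F_initial[of "idx (Qw!p)" "idx i"] F_initial[of "idx i" "idx (Qw!p)"] idx(1)
          by (cases "p < q") (auto simp: min_def max_def F_cc \<gamma>_initial)
        then show ?thesis using dg[OF q(1,2) False] d_pos[of "Qw!p"] by simp
      qed
    qed
    ultimately show ?thesis by (simp cong: if_cong)
  next
    case 3
    then have Np: "N \<le> p" using lv_0_iff[of p] p(1) by auto
    obtain r where r: "r < L" "\<gamma> p = cq (\<gamma> r)" "Qw!r = Qw!p" "lv p = Suc (lv r)" using \<gamma>_prev[OF p(1) Np] by metis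
    have dgi: "d (Qw!p) * g i = - pr (fo i) (\<gamma> r)" for i
    proof -
      obtain q where q: "q < L" "\<gamma> q = cq (axis i 1)" "Qw!q = i" "lv q = 1" "N \<le> q" by (rule first_level)
      have "q < p" using position_less[of q p] p(1) q 3 by simp
      then show ?thesis
        using dg[OF q(1,2)] by (simp add: min_def max_def q(2) r(2) F_cc) (simp add: F_def Gw_fundamental)
    qed
    have "d (Qw!p) * (g j + (\<Sum>i\<in>UNIV. if prec A cq i j then A$i$j * g i else 0)) =
        d (Qw!p) * g j + (\<Sum>i\<in>UNIV. if prec A cq i j then A$i$j * (d (Qw!p) * g i) else 0)"
      by (simp add: distrib_left sum_distrib_left if_distrib ac_simps cong: if_cong)
    also have "\<dots> = - pr (fo j + (\<Sum>i\<in>UNIV. if prec A cq i j then A$i$j *s fo i else 0)) (\<gamma> r)"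
      by (simp add: dgi pr_simps pr_sum_left sum_negf[symmetric] if_distrib[of "\<lambda>v. pr v _"] if_distrib[of uminus] cong: if_cong)
    also have "\<dots> = - pr (axis j 1) (\<gamma> r)" by (simp flip: fo_expand)
    also have "\<dots> = d (Qw!p) * yy I0 p (idx j)" using yy_I0[OF Np p(1) r(2)] by (simp add: pr_axis_left)
    finally show ?thesis using d_pos[of "Qw!p"] by simp
  qed
  then show ?thesis unfolding sum[symmetric] by (simp add: g_def)
qed

lemma fo_prec_pos: assumes "prec A cq j i" shows "fo i $ j > 0"
proof -
  have ij: "idx j < idx i" "A$j$i \<noteq> 0" "j \<noteq> i" using assms idx_inj[of j i] by (auto simp: prec_iff)
  define g where "g l = (if prec A cq l i then A$l$i * fo l $ j else 0)" for l
  have "g l \<le> 0" for l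
    using off_diag[of l i] vp_fo[of l] idx_inj[of l i] by (auto simp: g_def prec_iff vp_def mult_le_0_iff)
  then have "(\<Sum>l\<in>UNIV. g l) \<le> g j" by (simp add: sum.remove[of UNIV j] sum_nonpos)
  moreover have "g j < 0" using assms ij off_diag[of j i] by (simp add: g_def fo_coord)
  moreover have "0 = fo i $ j + (\<Sum>l\<in>UNIV. g l)"
    using arg_cong[OF fo_expand[of i], of "\<lambda>v. v $ j"] ij(3)
    by (simp add: g_def if_distrib[of "\<lambda>v. v $ _"] cong: if_cong)
  ultimately show ?thesis by simp
qed

definition fin :: "'i \<Rightarrow> nat" where "fin j = (THE p. p < L \<and> \<gamma> p = - axis j 1)"

lemma fin: "fin j < L" "\<gamma> (fin j) = - axis j 1" "final (fin j)" "N \<le> fin j"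
proof -
  obtain i where i: "j = st i" by (rule st_surj)
  obtain p where p: "p < L" "\<gamma> p = wt i (h i)" "Qw!p = i" "lv p = h i" using \<gamma>_position[of "h i" i] by auto
  have gp: "\<gamma> p = - axis j 1" using p(2) by (simp add: wt_h i)
  then have "fin j = p" unfolding fin_def using p(1) \<gamma>_inj[of _ p] by (intro the_equality) auto
  then show "fin j < L" "\<gamma> (fin j) = - axis j 1" "final (fin j)" "N \<le> fin j"
    using p gp final_not_initial[of p] by (auto simp: final_def)
qed

lemma fin_eqI: "p < L \<Longrightarrow> \<gamma> p = - axis j 1 \<Longrightarrow> p = fin j"
  using \<gamma>_inj[of p "fin j"] fin by simp

lemma fin_inj: "fin i = fin j \<longleftrightarrow> i = j"
proof
  assume "fin i = fin j"
  then have "- axis i 1 = (- axis j 1 :: int^'i)" by (simp flip: fin(2))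
  then show "i = j" by (simp add: axis_eq_axis)
qed simp

lemma sum_mset_support:
  assumes "finite S" "inj_on g T" "g ` T \<subseteq> S" "\<And>i. i \<in> S - g ` T \<Longrightarrow> u i = {#}"
  shows "(\<Sum>i\<in>S. u i) = (\<Sum>j\<in>T. u (g j))"
proof -
  have "sum u (g ` T) = sum u S" by (rule sum.mono_neutral_left) (use assms in auto)
  then show ?thesis using sum.reindex[OF assms(2), of u] by simp
qed

text \<open>Without inner positions \<open>flip_between\<close> says that the two exchanged weights
  are opposite, which forces an initial and a final position. The root of k turns out to be simple,
  and its coordinates as a weight give the exponents.\<close>

lemma antipodal_exchange:
  assumes I: "facet I" "k \<in> I" "vp (R I k)" and zero: "\<And>i. i \<in> I \<Longrightarrow> k < i \<Longrightarrow> i < opp I k \<Longrightarrow> cc I k i = 0"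
  shows "\<exists>\<kappa>. k = idx \<kappa> \<and> \<gamma> (opp I k) = - axis \<kappa> 1 \<and>
    (\<forall>p<L. pos (yy I p k) = (if p = k then 1 else 0) \<and> pos (- yy I p k) = degree p k) \<and>
    (\<forall>x :: int^'i \<Rightarrow> 'b. (\<Sum>i\<in>I. replicate_mset (nat (bb I i k)) (x (\<gamma> i))) =
      (\<Sum>i | prec A cq i \<kappa>. replicate_mset (nat (- A$i$\<kappa>)) (x (axis i 1))) +
      (\<Sum>i | prec A cq \<kappa> i. replicate_mset (nat (- A$i$\<kappa>)) (x (- axis i 1))))"
proof -
  let ?k = "opp I k"
  have k: "k < ?k" "?k < L" "?k \<notin> I" "k < L" using opp_pos[OF I] opp[OF I(1)] facet_less[OF I(1,2)] by auto
  have gk: "\<gamma> ?k = - \<gamma> k"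
    using flip_between[OF I] zero by (simp add: add_eq_0_iff2)
  have fk: "f ?k = - f k" using G_label k by (metis gk Gw_linear(5))
  have fvp: "vp (f p)" if "p < L" "\<not> final p" for p
    using h_pos[of "lv p" "Qw!p"] lv_le[of p] that f_eq[of p] by (simp add: final_def)
  \<comment> \<open>Otherwise the opposite position has a positive root, so that of k is negative
    and k is final. Then the opposite position carries a fundamental weight and is initial, hence
    before k.\<close>
  have fink: "final ?k"
  proof (rule ccontr)
    assume nf: "\<not> final ?k"
    then have "\<not> vp (f k)" using fvp[OF k(2)] vp_not_uminus[of "f ?k"] fk by simp
    then have fk: "final k" using fvp k(4) by blast
    then have "\<gamma> ?k = \<gamma> (idx (st (Qw!k)))" using \<gamma>_final[OF k(4)] gk \<gamma>_initial(1) by simp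
    then have "?k < N" using \<gamma>_inj[OF k(2) \<gamma>_initial(3)] idx(1) by simp
    then show False using final_not_initial[OF k(4) fk] k(1) by simp
  qed
  define \<kappa> where "\<kappa> = st (Qw!?k)"
  have gk': "\<gamma> ?k = - axis \<kappa> 1" using \<gamma>_final[OF k(2) fink] by (simp add: \<kappa>_def)
  then have "\<gamma> k = \<gamma> (idx \<kappa>)" using gk by (simp add: \<gamma>_initial)
  then have k\<kappa>: "k = idx \<kappa>" using \<gamma>_inj[OF k(4) \<gamma>_initial(3)] by simp
  have kN: "k < N" "\<gamma> k = axis \<kappa> 1" using idx(1) \<gamma>_initial(1) by (auto simp: k\<kappa>)
  have k'fin: "?k = fin \<kappa>" by (rule fin_eqI[OF k(2) gk'])
  have F0: "F (\<gamma> ?k) (\<gamma> p) = 0 \<and> F (\<gamma> k) (\<gamma> p) = 0" if "?k < p" "p < L" for p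
    using F_neg[OF that] F_neg[of k p] that k gk by (simp add: F_linear)
  have dn0: "t = 0" if "d i * t = 0" for i t using d_pos[of i] that by simp
  have yyz: "yy I p k = 0" if "p < k \<or> ?k < p" "p < L" for p
  proof -
    have "F (\<gamma> (min p ?k)) (\<gamma> (max p ?k)) = 0"
      using that k gk F0[of p] F_initial[of p k] kN by (auto simp: min_def max_def F_linear)
    then have "d (Qw!p) * yy I p k \<le> 0" using yy_outside_le[OF I that] by simp
    then have "yy I p k \<le> 0" using d_pos[of "Qw!p"] by (simp add: mult_le_0_iff)
    then show ?thesis using yy_sign(1)[OF I that(2)] that by auto
  qed
  have yyb: "- yy I p k = degree p k" if "k < p" "p \<le> ?k" for p
  proof -
    have "(\<Sum>i\<in>I \<inter> {k<..<p}. cc I k i * F (\<gamma> i) (\<gamma> p)) = 0" using zero that by (intro sum.neutral) auto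
    then have "d (Qw!p) * co I p (R I k) = d (Qw!p) * degree p k"
      using co_R_after[OF I(1,2) that(1)] degree_mult[of p k] that k by (simp add: min_def max_def)
    then show ?thesis using d_pos[of "Qw!p"] that by (simp add: yy_def)
  qed
  have coef: "pos (yy I p k) = (if p = k then 1 else 0) \<and> pos (- yy I p k) = degree p k" if p: "p < L" for p
  proof -
    consider "p < k \<or> ?k < p" | "p = k" | "k < p" "p \<le> ?k" by linarith
    then show ?thesis
    proof cases
      case 1
      have "F (\<gamma> (min p k)) (\<gamma> (max p k)) = 0"
        using 1 k F0[of p] p F_initial[of p k] kN by (auto simp: min_def max_def)
      then have "degree p k = 0" using degree_mult[OF p k(4)] dn0 1 k by (metis less_irrefl less_trans neg_equal_0_iff_equal)
      then show ?thesis using yyz[OF 1 p] 1 k by (auto simp: Defs.pos_def)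
    next
      case 2 then show ?thesis by (simp add: yy_self degree_def Defs.pos_def)
    next
      case 3
      then show ?thesis using yyb[OF 3] yy_sign(2)[OF I p 3] by (auto simp: Defs.pos_def max_def)
    qed
  qed
  \<comment> \<open>Going back from k, a letter in use has exponent 0 by \<open>yyz\<close>, so it
    is not a neighbour of \<kappa> and fixes the simple root.\<close>
  have "p \<le> k \<Longrightarrow> vi I p (R I k) = axis \<kappa> 1" for p
  proof (induction p rule: inc_induct)
    case base then show ?case by (simp add: k\<kappa> \<gamma>_initial)
  next
    case (step p)
    show ?case
    proof (cases "p \<in> I")
      case False
      then have u: "vi I p (R I k) = sr (Qw!p) (axis \<kappa> 1)" using step.IH by (simp add: vi_Suc) (metis sr_sr)
      have "co I p (R I k) = 0" using yyz[of p] step.hyps k by (simp add: yy_def)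
      moreover have "Qw!p \<noteq> \<kappa>"
        using step.hyps kN k\<kappa> \<gamma>_initial(2)[of "cw!p"] idx_nth[of p] by auto
      ultimately have "(A *v axis \<kappa> 1)$(Qw!p) = 0" by (simp add: co_def u) (simp add: sr_def)
      then show ?thesis unfolding u by (simp add: sr_def)
    qed (use step.IH in \<open>simp add: vi_Suc\<close>)
  qed
  from this[of 0] have Rk: "R I k = axis \<kappa> 1" by simp
  \<comment> \<open>For non-final i, F with the weight of i turns \<open>flip_out\<close> into a
    vanishing sum of nonnegative terms whose diagonal term contains \<open>d\<close>.\<close>
  have nonfin: "cc I k i = 0" if i: "i \<in> I" "?k < i" "\<not> final i" for i
  proof -
    have iL: "i < L" using facet_less[OF I(1) i(1)] .
    have z1: "F (\<gamma> i) (\<gamma> ?k) = 0" by (rule final_before_nonfinal(2)[OF i(2) iL fink i(3)])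
    have "0 = F (\<gamma> i) (\<gamma> ?k - cq (\<gamma> k))" using z1 F0[OF i(2) iL] by (simp add: F_linear F_c)
    also have "\<dots> = (\<Sum>j\<in>I \<inter> {..<k}. cc I k j * F (\<gamma> i) (cq (\<gamma> j))) + (\<Sum>j\<in>I \<inter> {?k<..}. cc I k j * F (\<gamma> i) (\<gamma> j))"
      unfolding flip_out[OF I] by (simp add: F_linear F_sum)
    also have "(\<Sum>j\<in>I \<inter> {..<k}. cc I k j * F (\<gamma> i) (cq (\<gamma> j))) = 0"
      using F_facet[OF I(1) _ i(1)] k(1) i(2) by (intro sum.neutral) (auto simp: F_c)
    finally have s0: "(\<Sum>j\<in>I \<inter> {?k<..}. cc I k j * F (\<gamma> i) (\<gamma> j)) = 0" by simp
    have nn: "cc I k j * F (\<gamma> i) (\<gamma> j) \<ge> 0" if j: "j \<in> I" "?k < j" for j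
    proof (cases "i \<le> j")
      case True
      then show ?thesis using F_facet[OF I(1) i(1) j(1) True] cc_opp_signs(2)[OF I j] d_pos[of "Qw!i"] by auto
    next
      case False
      have jL: "j < L" "N \<le> j" using facet_less[OF I(1) j(1)] j(2) fin(4)[of \<kappa>] k'fin by auto
      obtain r where r: "r < j" "\<gamma> j = cq (\<gamma> r)" using \<gamma>_prev[OF jL] by metis
      then have "F (\<gamma> i) (\<gamma> j) \<ge> 0" using F_neg[of r i] False iL by (simp add: r(2) F_c)
      then show ?thesis using cc_opp_signs(2)[OF I j] by simp
    qed
    have "cc I k i * F (\<gamma> i) (\<gamma> i) = 0"
      using s0 nn facetD(3)[OF I(1)] i by (subst (asm) sum_nonneg_eq_0_iff) auto
    then show ?thesis using F_facet[OF I(1) i(1) i(1)] d_pos[of "Qw!i"] by simp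
  qed
  \<comment> \<open>The contributions, up to sign, of the initial position and of the final position
    of j to coordinate j of the simple root of \<kappa>.\<close>
  define a where "a j = (if idx j \<in> I \<and> idx j < k then cc I k (idx j) else 0)" for j
  define b where "b j = (if fin j \<in> I \<and> ?k < fin j then cc I k (fin j) else 0)" for j
  have finI: "finite I" using facetD(3)[OF I(1)] .
  have eq: "A$j$\<kappa> = a j - b j" if j: "j \<noteq> \<kappa>" for j
  proof -
    have 1: "(\<Sum>i\<in>I \<inter> {..<k}. cc I k i * \<gamma> i $ j) = a j"
    proof -
      have "cc I k i * \<gamma> i $ j = (if i = idx j then cc I k i else 0)" if "i < k" for i
        using that kN \<gamma>_initial(1)[of "cw!i"] idx_nth[of i] idx_inj[of "cw!i" j] by auto
      then have "(\<Sum>i\<in>I \<inter> {..<k}. cc I k i * \<gamma> i $ j) = (\<Sum>i\<in>I \<inter> {..<k}. if i = idx j then cc I k i else 0)"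
        by (intro sum.cong) auto
      then show ?thesis using finI by (simp add: a_def)
    qed
    have 2: "(\<Sum>i\<in>I \<inter> {?k<..}. cc I k i * \<gamma> i $ j) = - b j"
    proof -
      have "cc I k i * \<gamma> i $ j = (if i = fin j then - cc I k i else 0)" if i: "i \<in> I" "?k < i" for i
      proof (cases "final i")
        case True
        have "i = fin (st (Qw!i))" using fin_eqI \<gamma>_final True facet_less[OF I(1) i(1)] by blast
        then show ?thesis using fin(2)[of "st (Qw!i)"] fin(2)[of j] by (cases "st (Qw!i) = j") (auto simp: axis_eq_axis)
      next
        case False
        then show ?thesis using nonfin[OF i] by auto
      qed
      then have "(\<Sum>i\<in>I \<inter> {?k<..}. cc I k i * \<gamma> i $ j) = (\<Sum>i\<in>I \<inter> {?k<..}. if i = fin j then - cc I k i else 0)"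
        by (intro sum.cong) auto
      then show ?thesis using finI by (simp add: b_def)
    qed
    have "(A *v R I k)$j = 2 * \<gamma> k $ j + (\<Sum>i\<in>I \<inter> {..<k}. cc I k i * \<gamma> i $ j)
        + (\<Sum>i\<in>I \<inter> {k<..<?k}. cc I k i * \<gamma> i $ j) + (\<Sum>i\<in>I \<inter> {?k<..}. cc I k i * \<gamma> i $ j)"
      by (subst A_R_expansion[OF I]) simp
    moreover have "(\<Sum>i\<in>I \<inter> {k<..<?k}. cc I k i * \<gamma> i $ j) = 0" using zero by (intro sum.neutral) auto
    ultimately show ?thesis using j 1 2 by (simp add: Rk A_axis_nth kN(2))
  qed
  have ab: "a j \<le> 0" "b j \<ge> 0" for j using cc_opp_signs(1,2)[OF I] by (auto simp: a_def b_def)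
  have A1: "idx j \<in> I \<and> cc I k (idx j) = A$j$\<kappa>" if j: "prec A cq j \<kappa>" for j
  proof -
    have jk: "idx j < k" "A$j$\<kappa> \<noteq> 0" "j \<noteq> \<kappa>" using j by (auto simp: prec_iff k\<kappa>)
    \<comment> \<open>If j precedes \<kappa>, cancellation between \<open>a j\<close> and
      \<open>b j\<close> is excluded: a final position of j behind that of \<kappa> would make the
      positive coordinate \<open>fo \<kappa> $ j\<close> nonpositive.\<close>
    have "b j = 0"
    proof (rule ccontr)
      assume "b j \<noteq> 0"
      then have "?k < fin j" by (auto simp: b_def split: if_splits)
      then have "F (\<gamma> ?k) (\<gamma> (fin j)) \<le> 0" using F_neg fin(1) by blast
      then have "F (\<gamma> k) (axis j 1) \<le> 0" by (simp add: gk fin(2) F_linear)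
      then show False
        using F_\<gamma>_axis[OF k(4), of j] fo_prec_pos[OF j] d_pos[of j] by (simp add: k\<kappa> \<gamma>_initial mult_le_0_iff)
    qed
    then show ?thesis using eq[OF jk(3)] jk by (auto simp: a_def split: if_splits)
  qed
  have A2: "fin j \<in> I \<and> ?k < fin j \<and> cc I k (fin j) = - A$j$\<kappa>" if j: "prec A cq \<kappa> j" for j
  proof -
    have jk: "\<not> idx j < k" "A$j$\<kappa> \<noteq> 0" "j \<noteq> \<kappa>" using j zero_sym[of j \<kappa>] by (auto simp: prec_iff k\<kappa>)
    then show ?thesis using eq[OF jk(3)] by (auto simp: a_def b_def split: if_splits)
  qed
  have A3: "cc I k (idx j) = 0" if j: "\<not> prec A cq j \<kappa>" "idx j \<in> I" "idx j < k" for j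
  proof -
    have "j \<noteq> \<kappa>" using j(3) k\<kappa> by auto
    from eq[OF this] show ?thesis using ab[of j] j by (auto simp: prec_iff k\<kappa> a_def)
  qed
  have A4: "cc I k i = 0" if i: "i \<in> I" "?k < i" "i \<notin> fin ` {j. prec A cq \<kappa> j}" for i
  proof (cases "final i")
    case True
    have if': "i = fin (st (Qw!i))" using fin_eqI \<gamma>_final True facet_less[OF I(1) i(1)] by blast
    define j where "j = st (Qw!i)"
    have j: "i = fin j" "\<not> prec A cq \<kappa> j" using if' i(3) by (auto simp: j_def)
    have jk: "j \<noteq> \<kappa>" using j(1) i(2) k'fin by auto
    have bj: "b j = cc I k i" using i j(1) by (simp add: b_def)
    show ?thesis
    proof (cases "A$j$\<kappa> = 0")
      case True then show ?thesis using eq[OF jk] ab[of j] bj by simp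
    next
      case False
      then have "prec A cq j \<kappa>" using j(2) zero_sym[of j \<kappa>] idx_inj[of j \<kappa>] jk by (auto simp: prec_iff)
      then have "a j = A$j$\<kappa>" using A1[of j] by (auto simp: a_def prec_iff k\<kappa>)
      then show ?thesis using eq[OF jk] bj by simp
    qed
  next
    case False
    then show ?thesis by (rule nonfin[OF i(1,2)])
  qed
  have mset: "(\<Sum>i\<in>I. replicate_mset (nat (bb I i k)) (x (\<gamma> i))) =
      (\<Sum>i | prec A cq i \<kappa>. replicate_mset (nat (- A$i$\<kappa>)) (x (axis i 1))) +
      (\<Sum>i | prec A cq \<kappa> i. replicate_mset (nat (- A$i$\<kappa>)) (x (- axis i 1)))" for x :: "int^'i \<Rightarrow> 'b"
  proof -
    define u where "u i = replicate_mset (nat (bb I i k)) (x (\<gamma> i))" for i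
    have s0: "(\<Sum>i\<in>I. u i) = (\<Sum>i\<in>I \<inter> {..<k}. u i) + (\<Sum>i\<in>I - {..<k}. u i)"
      by (rule sum.Int_Diff[OF finI])
    have s1: "(\<Sum>i\<in>I \<inter> {..<k}. u i) = (\<Sum>j | prec A cq j \<kappa>. u (idx j))"
    proof (rule sum_mset_support[where u = u and g = idx])
      show "finite (I \<inter> {..<k})" using finI by simp
      show "inj_on idx {j. prec A cq j \<kappa>}" by (auto simp: inj_on_def idx_inj)
      show "idx ` {j. prec A cq j \<kappa>} \<subseteq> I \<inter> {..<k}" using A1 by (auto simp: prec_iff k\<kappa>)
      fix i assume i: "i \<in> I \<inter> {..<k} - idx ` {j. prec A cq j \<kappa>}"
      then have "i = idx (cw!i)" using idx_nth[of i] kN by simp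
      then have "cc I k i = 0" using A3[of "cw!i"] i by auto
      then show "u i = {#}" using i by (simp add: u_def bb_def)
    qed
    have s2: "(\<Sum>i\<in>I - {..<k}. u i) = (\<Sum>j | prec A cq \<kappa> j. u (fin j))"
    proof (rule sum_mset_support[where u = u and g = fin])
      show "finite (I - {..<k})" using finI by simp
      show "inj_on fin {j. prec A cq \<kappa> j}" using fin_inj by (auto simp: inj_on_def)
      show "fin ` {j. prec A cq \<kappa> j} \<subseteq> I - {..<k}" using A2 k(1) by force
      fix i assume i: "i \<in> I - {..<k} - fin ` {j. prec A cq \<kappa> j}"
      then have "i \<noteq> k \<Longrightarrow> cc I k i = 0" using A4[of i] zero[of i] k by (cases "i < ?k"; cases "i = ?k") auto
      then show "u i = {#}" using i by (cases "i = k") (auto simp: u_def bb_def)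
    qed
    have s3: "(\<Sum>j | prec A cq j \<kappa>. u (idx j)) = (\<Sum>i | prec A cq i \<kappa>. replicate_mset (nat (- A$i$\<kappa>)) (x (axis i 1)))"
    proof (rule sum.cong[OF HOL.refl])
      fix j assume "j \<in> {j. prec A cq j \<kappa>}"
      then show "u (idx j) = replicate_mset (nat (- A$j$\<kappa>)) (x (axis j 1))"
        using A1[of j] by (auto simp: u_def bb_def prec_iff k\<kappa> \<gamma>_initial)
    qed
    have s4: "(\<Sum>j | prec A cq \<kappa> j. u (fin j)) = (\<Sum>i | prec A cq \<kappa> i. replicate_mset (nat (- A$i$\<kappa>)) (x (- axis i 1)))"
    proof (rule sum.cong[OF HOL.refl])
      fix j assume "j \<in> {j. prec A cq \<kappa> j}"
      then show "u (fin j) = replicate_mset (nat (- A$j$\<kappa>)) (x (- axis j 1))"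
        using A2[of j] k by (auto simp: u_def bb_def fin(2))
    qed
    show ?thesis using s0[unfolded s1 s2 s3 s4] by (simp only: u_def)
  qed
  show ?thesis
  proof (intro exI[of _ \<kappa>] conjI allI impI)
    show "k = idx \<kappa>" "\<gamma> ?k = - axis \<kappa> 1" by (fact k\<kappa> gk')+
    fix p assume "p < L"
    from coef[OF this] show "pos (yy I p k) = (if p = k then 1 else 0)" "pos (- yy I p k) = degree p k" by blast+
  qed (rule mset)
qed

lemma prefix_fundamental:
  "ww (take (idx k) cw) (axis j 1) = (if idx j < idx k then cq (axis j 1) else axis j 1)"
proof (cases "idx j < idx k")
  case True
  have "drop (idx k) cw = drop (idx k - Suc (idx j)) (drop (Suc (idx j)) cw)" using True by simp
  then have "j \<notin> set (drop (idx k) cw)" using not_in_rest[of j] by (metis in_set_dropD)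
  then have "ww (drop (idx k) cw) (axis j 1) = axis j 1" by (intro ww_fixed) auto
  moreover have "cq (axis j 1) = ww (take (idx k) cw) (ww (drop (idx k) cw) (axis j 1))"
    using ww_simps(3)[of "take (idx k) cw" "drop (idx k) cw"] by simp
  ultimately show ?thesis using True by simp
next
  case False
  have "ww (take (idx k) cw) (axis j 1) = axis j 1" by (rule ww_fixed) (use False in \<open>auto simp: set_take_idx\<close>)
  then show ?thesis using False by simp
qed

lemma cq_pow_inj: "(cq^^m) l = (cq^^m) l' \<longleftrightarrow> l = l'"
  by (induction m) (auto simp: cq_inj)

lemma cq_pow_linear': "(cq^^m) (l + l') = (cq^^m) l + (cq^^m) l'" "(cq^^m) (x *s l) = x *s (cq^^m) l"
  "(cq^^m) 0 = 0"
  by (induction m) (auto simp: ww_linear)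

lemma cq_pow_sum: "(cq^^m) (\<Sum>x\<in>S. g x) = (\<Sum>x\<in>S. (cq^^m) (g x))"
  by (induction S rule: infinite_finite_induct) (auto simp: cq_pow_linear')

lemma next_flip_position:
  assumes "k < L" "k' < L" "k < k'" "\<gamma> k' = cq (\<gamma> k)"
  shows "\<not> final k" "Qw!k' = Qw!k" "lv k' = Suc (lv k)"
proof -
  show nf: "\<not> final k"
  proof
    assume fk: "final k"
    let ?b = "st (Qw!k)"
    have Nk: "N \<le> k'" using final_not_initial[OF assms(1) fk] assms(3) by simp
    have gk: "\<gamma> k' = - cq (axis ?b 1)" using assms(4) \<gamma>_final[OF assms(1) fk] by (simp add: ww_linear)
    obtain r where r: "r < L" "\<not> final r" "\<gamma> k' = cq (\<gamma> r)" using \<gamma>_prev[OF assms(2) Nk] by metis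
    have "\<gamma> r = \<gamma> k" using r(3) assms(4) by (simp add: cq_inj)
    then have "r = k" using \<gamma>_inj r(1) assms(1) by simp
    then show False using r(2) fk by simp
  qed
  obtain q where "q < L" "\<gamma> q = cq (\<gamma> k)" "Qw!q = Qw!k" "lv q = Suc (lv k)" using \<gamma>_next[OF assms(1) nf] by metis
  then show "Qw!k' = Qw!k" "lv k' = Suc (lv k)" using \<gamma>_inj[of q k'] assms by auto
qed

text \<open>Without outer positions \<open>flip_out\<close> says that the new weight is c times the
  old one. Between consecutive occurrences of a letter every other letter occurs at most once, so
  \<open>flip_between\<close> determines the exponents.\<close>

lemma shift_exchange:
  assumes I: "facet I" "k \<in> I" "vp (R I k)"
    and zero: "\<And>i. i \<in> I \<Longrightarrow> i < k \<or> opp I k < i \<Longrightarrow> cc I k i = 0"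
  shows "\<exists>\<kappa> m. 1 \<le> m \<and> m \<le> h \<kappa> \<and> \<gamma> k = wt \<kappa> (m - 1) \<and> \<gamma> (opp I k) = wt \<kappa> m \<and>
    (\<forall>p<L. pos (yy I p k) = degree p (opp I k) \<and> pos (- yy I p k) = (if p = opp I k then 1 else 0)) \<and>
    (\<forall>x :: int^'i \<Rightarrow> 'b. (\<Sum>i\<in>I. replicate_mset (nat (- bb I i k)) (x (\<gamma> i))) =
      (\<Sum>i | prec A cq i \<kappa>. replicate_mset (nat (- A$i$\<kappa>)) (x (wt i m))) +
      (\<Sum>i | prec A cq \<kappa> i. replicate_mset (nat (- A$i$\<kappa>)) (x (wt i (m - 1)))))"
proof -
  let ?k = "opp I k"
  have k: "k < ?k" "?k < L" "?k \<notin> I" "k < L" using opp_pos[OF I] opp[OF I(1)] facet_less[OF I(1,2)] by auto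
  have finI: "finite I" using facetD(3)[OF I(1)] .
  have gk: "\<gamma> ?k = cq (\<gamma> k)"
    using flip_out[OF I] zero by simp
  note nxt = next_flip_position[OF k(4,2,1) gk]
  define \<kappa> where "\<kappa> = Qw!k"
  define m where "m = lv ?k"
  have m: "1 \<le> m" "m \<le> h \<kappa>" "lv k = m - 1" using nxt lv_le[of ?k] k by (auto simp: m_def \<kappa>_def)
  have lab: "\<gamma> k = wt \<kappa> (m - 1)" "\<gamma> ?k = wt \<kappa> m" using \<gamma>_eq k nxt m(3) by (auto simp: \<kappa>_def m_def)
  let ?u = "ww (take (idx \<kappa>) cw)"
  have between: "idx (Qw!p) \<noteq> idx \<kappa>" "lv p = (if idx (Qw!p) < idx \<kappa> then m else m - 1)"
    "\<gamma> p = (cq^^(m - 1)) (?u (axis (Qw!p) 1))" if p: "k < p" "p < ?k" for p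
  proof -
    have pL: "p < L" using p k by simp
    have "lv k < lv p \<or> lv k = lv p \<and> idx \<kappa> < idx (Qw!p)"
      using position_less[of k p] p(1) pL k(4) by (simp add: \<kappa>_def)
    moreover have "lv p < lv ?k \<or> lv p = lv ?k \<and> idx (Qw!p) < idx \<kappa>"
      using position_less[of p ?k] p(2) pL k(2) nxt(2) by (simp add: \<kappa>_def)
    ultimately show *: "idx (Qw!p) \<noteq> idx \<kappa>" "lv p = (if idx (Qw!p) < idx \<kappa> then m else m - 1)"
      using nxt(3) unfolding m_def by arith+
    have "Suc (m - 1) = m" using m(1) by simp
    then have "(cq^^(m - 1)) (cq (axis (Qw!p) 1)) = wt (Qw!p) m"
      by (metis comp_apply funpow_Suc_right)
    then show "\<gamma> p = (cq^^(m - 1)) (?u (axis (Qw!p) 1))"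
      using *(2) \<gamma>_eq[of p] pL by (simp add: prefix_fundamental)
  qed
  have same: "p = q" if "k < p" "p < ?k" "k < q" "q < ?k" "Qw!p = Qw!q" for p q
    using \<gamma>_inj[of p q] between(3)[of p] between(3)[of q] that k by simp
  let ?B = "I \<inter> {k<..<?k}"
  \<comment> \<open>\<open>flip_between\<close> with a common power of c and a prefix of c stripped
    off: what is left is the simple root of \<kappa> in fundamental weights.\<close>
  have sum_eq: "(\<Sum>i\<in>?B. (- cc I k i) *s axis (Qw!i) 1) = 2 *s axis \<kappa> 1 - A *v axis \<kappa> 1"
  proof -
    have "cq (axis \<kappa> 1) = axis \<kappa> 1 - ?u (A *v axis \<kappa> 1)"
      by (simp add: c_fundamental fo_def A_rw)
    moreover have "?u (axis \<kappa> 1) = axis \<kappa> 1" by (simp add: prefix_fundamental)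
    moreover have "axis \<kappa> 1 + axis \<kappa> 1 = 2 *s (axis \<kappa> 1 :: int^'i)" by (simp add: vec_eq_iff)
    ultimately have "?u (2 *s axis \<kappa> 1 - A *v axis \<kappa> 1) = axis \<kappa> 1 + cq (axis \<kappa> 1)"
      by (simp add: ww_linear)
    moreover have "\<gamma> k + \<gamma> ?k = (cq^^(m - 1)) (axis \<kappa> 1 + cq (axis \<kappa> 1))"
    proof -
      have "Suc (m - 1) = m" using m(1) by simp
      then have "(cq^^(m - 1)) (cq (axis \<kappa> 1)) = wt \<kappa> m" by (metis comp_apply funpow_Suc_right)
      then show ?thesis by (simp add: lab cq_pow_linear')
    qed
    moreover have "\<gamma> k + \<gamma> ?k = (\<Sum>i\<in>?B. (- cc I k i) *s \<gamma> i)"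
      unfolding flip_between[OF I] sum_negf[symmetric] by (intro sum.cong) (auto simp: vec_eq_iff)
    moreover have "\<dots> = (cq^^(m - 1)) (?u (\<Sum>i\<in>?B. (- cc I k i) *s axis (Qw!i) 1))"
      unfolding ww_sum cq_pow_sum using between(3) by (intro sum.cong) (auto simp: ww_linear cq_pow_linear')
    ultimately have "(cq^^(m - 1)) (?u (\<Sum>i\<in>?B. (- cc I k i) *s axis (Qw!i) 1)) =
        (cq^^(m - 1)) (?u (2 *s axis \<kappa> 1 - A *v axis \<kappa> 1))" by simp
    then have "?u (\<Sum>i\<in>?B. (- cc I k i) *s axis (Qw!i) 1) = ?u (2 *s axis \<kappa> 1 - A *v axis \<kappa> 1)"
      by (simp only: cq_pow_inj)
    from arg_cong[OF this, of "ww (rev (take (idx \<kappa>) cw))"] show ?thesis by (simp only: ww_rev)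
  qed
  have coord: "(\<Sum>i\<in>?B. if Qw!i = j then - cc I k i else 0) = - A$j$\<kappa>" if "j \<noteq> \<kappa>" for j
    using arg_cong[OF sum_eq, of "\<lambda>v. v $ j"] that
    by (simp add: A_axis_nth if_distrib[of "(*) _"] cong: if_cong)
  have ccA: "cc I k i = A$(Qw!i)$\<kappa>" if i: "i \<in> ?B" for i
  proof -
    have "(\<Sum>l\<in>?B. if Qw!l = Qw!i then - cc I k l else 0) = (\<Sum>l\<in>?B. if l = i then - cc I k l else 0)"
      using same i by (intro sum.cong) auto
    then show ?thesis using coord[of "Qw!i"] between(1)[of i] i finI by auto
  qed
  have ex: "\<exists>i\<in>?B. Qw!i = j" if "j \<noteq> \<kappa>" "A$j$\<kappa> \<noteq> 0" for j
  proof (rule ccontr)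
    assume "\<not> ?thesis"
    then have "(\<Sum>i\<in>?B. if Qw!i = j then - cc I k i else 0) = 0" by (intro sum.neutral) auto
    then show False using coord[OF that(1)] that(2) by simp
  qed
  \<comment> \<open>All neighbours of \<kappa> in the interval belong to I, so the letters in use
    there fix the simple root.\<close>
  have vi_const: "Suc k \<le> p \<Longrightarrow> p \<le> ?k \<Longrightarrow> vi I p (R I k) = axis \<kappa> 1" for p
  proof (induction p rule: dec_induct)
    case base then show ?case using I(2) by (simp add: vi_Suc \<kappa>_def)
  next
    case (step p)
    then have IH: "vi I p (R I k) = axis \<kappa> 1" by simp
    show ?case
    proof (cases "p \<in> I")
      case False
      have pk: "k < p" "p < ?k" using step by auto
      have "Qw!p \<noteq> \<kappa>" using between(1)[OF pk] by auto
      have "A$(Qw!p)$\<kappa> = 0"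
      proof (rule ccontr)
        assume "\<not> ?thesis"
        then obtain i where "i \<in> ?B" "Qw!i = Qw!p" using ex[of "Qw!p"] \<open>Qw!p \<noteq> \<kappa>\<close> by auto
        then show False using same[of i p] pk False by auto
      qed
      then show ?thesis using IH False by (simp add: vi_Suc sr_def A_axis_nth)
    qed (use IH in \<open>simp add: vi_Suc\<close>)
  qed
  have coef: "pos (yy I p k) = degree p ?k \<and> pos (- yy I p k) = (if p = ?k then 1 else 0)" if p: "p < L" for p
  proof -
    consider "p < k" | "p = k" | "k < p" "p < ?k" | "p = ?k" | "?k < p" by linarith
    then show ?thesis
    proof cases
      case 1
      have "(\<Sum>i\<in>I \<inter> {..<p}. cc I k i * F (\<gamma> i) (\<gamma> p)) = 0" "(\<Sum>i\<in>I \<inter> {?k<..}. cc I k i * F (\<gamma> p) (\<gamma> i)) = 0"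
        using zero 1 by (intro sum.neutral; force)+
      then have "d (Qw!p) * yy I p k = d (Qw!p) * degree p ?k"
        using yy_before[OF I, of p] degree_mult[OF p k(2)] 1 k by (simp add: min_def max_def)
      then have "yy I p k = degree p ?k" using d_pos[of "Qw!p"] by simp
      then show ?thesis using yy_sign(1)[OF I p] 1 k by (auto simp: Defs.pos_def)
    next
      case 2
      have "d (Qw!k) * degree k ?k = d (Qw!k)"
        using degree_mult[OF k(4,2)] k F_facet[OF I(1,2,2)] by (simp add: min_def max_def gk F_c)
      then have "degree k ?k = 1" using d_pos[of "Qw!k"] by simp
      then show ?thesis using 2 k by (simp add: yy_self Defs.pos_def)
    next
      case 3
      have "d (Qw!p) * degree p ?k = F (\<gamma> k) (\<gamma> p)"
        using degree_mult[OF p k(2)] 3 by (simp add: min_def max_def gk F_c)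
      moreover have "F (\<gamma> k) (\<gamma> p) \<le> 0" using F_neg[OF 3(1) p] .
      ultimately have "degree p ?k \<le> 0" using d_pos[of "Qw!p"] by (metis mult_le_0_iff not_le)
      then have "degree p ?k = 0" using degree_nonneg[OF p] k(2) by (simp add: order_antisym)
      moreover have "yy I p k = 0"
        using vi_const[of p] 3 between(1)[OF 3] by (auto simp: yy_def co_def)
      ultimately show ?thesis using 3 by (simp add: Defs.pos_def)
    next
      case 4 then show ?thesis using yy_opp[OF I] by (simp add: degree_def Defs.pos_def)
    next
      case 5
      have "(\<Sum>i\<in>I \<inter> {?k<..<p}. cc I k i * F (\<gamma> i) (\<gamma> p)) = 0" using zero by (intro sum.neutral) auto
      then have "d (Qw!p) * yy I p k = d (Qw!p) * degree p ?k"
        using yy_after[OF I 5 p] degree_mult[OF p k(2)] 5 by (simp add: min_def max_def)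
      then have "yy I p k = degree p ?k" using d_pos[of "Qw!p"] by simp
      then show ?thesis using yy_sign(1)[OF I p] 5 by (auto simp: Defs.pos_def)
    qed
  qed
  have mset: "(\<Sum>i\<in>I. replicate_mset (nat (- bb I i k)) (x (\<gamma> i))) =
      (\<Sum>i | prec A cq i \<kappa>. replicate_mset (nat (- A$i$\<kappa>)) (x (wt i m))) +
      (\<Sum>i | prec A cq \<kappa> i. replicate_mset (nat (- A$i$\<kappa>)) (x (wt i (m - 1))))" for x :: "int^'i \<Rightarrow> 'b"
  proof -
    define T where "T = {j. prec A cq j \<kappa> \<or> prec A cq \<kappa> j}"
    define g where "g j = (SOME i. i \<in> ?B \<and> Qw!i = j)" for j
    have T: "j \<in> T \<longleftrightarrow> j \<noteq> \<kappa> \<and> A$j$\<kappa> \<noteq> 0" for j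
      using zero_sym[of j \<kappa>] idx_inj[of j \<kappa>] by (auto simp: T_def prec_iff)
    have g: "g j \<in> ?B \<and> Qw!g j = j" if "j \<in> T" for j
      unfolding g_def by (rule someI_ex) (use ex[of j] that T in blast)
    define u where "u i = replicate_mset (nat (- bb I i k)) (x (\<gamma> i))" for i
    define v where "v j = replicate_mset (nat (- A$j$\<kappa>)) (x (if idx j < idx \<kappa> then wt j m else wt j (m - 1)))" for j
    have s1: "(\<Sum>i\<in>I. u i) = (\<Sum>j\<in>T. u (g j))"
    proof (rule sum_mset_support[where u = u and g = g])
      show "finite I" by (rule finI)
      show "inj_on g T" by (rule inj_onI) (metis g)
      show "g ` T \<subseteq> I" using g by auto
      fix i assume i: "i \<in> I - g ` T"
      show "u i = {#}"
      proof (cases "i \<in> ?B")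
        case True
        have "Qw!i \<notin> T" using same[of i "g (Qw!i)"] g[of "Qw!i"] True i by auto
        then have "cc I k i = 0" using ccA[OF True] T[of "Qw!i"] between(1)[of i] True by auto
        then show ?thesis by (simp add: u_def bb_def)
      next
        case False
        then have "i = k \<or> i < k \<or> ?k < i" using i k(3) by auto
        then show ?thesis using zero[of i] i k by (auto simp: u_def bb_def)
      qed
    qed
    have s2: "u (g j) = v j" if "j \<in> T" for j
    proof -
      have gj: "k < g j" "g j < ?k" "Qw!g j = j" "g j \<in> ?B" "g j < L" using g[OF that] k by auto
      have "\<gamma> (g j) = (if idx j < idx \<kappa> then wt j m else wt j (m - 1))"
        using between(2)[OF gj(1,2)] \<gamma>_eq[of "g j"] gj by simp
      then show ?thesis using ccA[OF gj(4)] gj by (simp add: u_def v_def bb_def)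
    qed
    have s3: "(\<Sum>j\<in>T. u (g j)) = (\<Sum>j\<in>T. v j)" by (rule sum.cong[OF HOL.refl s2])
    have "(\<Sum>j\<in>T. v j) = (\<Sum>j\<in>T \<inter> {j. prec A cq j \<kappa>}. v j) + (\<Sum>j\<in>T - {j. prec A cq j \<kappa>}. v j)"
      by (rule sum.Int_Diff) simp
    moreover have "T \<inter> {j. prec A cq j \<kappa>} = {j. prec A cq j \<kappa>}" by (auto simp: T_def)
    moreover have "T - {j. prec A cq j \<kappa>} = {j. prec A cq \<kappa> j}" by (auto simp: T_def prec_iff)
    ultimately have s4: "(\<Sum>j\<in>T. v j) = (\<Sum>j | prec A cq j \<kappa>. v j) + (\<Sum>j | prec A cq \<kappa> j. v j)" by simp
    have s5: "(\<Sum>j | prec A cq j \<kappa>. v j) = (\<Sum>i | prec A cq i \<kappa>. replicate_mset (nat (- A$i$\<kappa>)) (x (wt i m)))"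
      by (rule sum.cong) (auto simp: v_def prec_iff)
    have s6: "(\<Sum>j | prec A cq \<kappa> j. v j) = (\<Sum>i | prec A cq \<kappa> i. replicate_mset (nat (- A$i$\<kappa>)) (x (wt i (m - 1))))"
      by (rule sum.cong) (auto simp: v_def prec_iff)
    show ?thesis using s1 unfolding s3 s4 s5 s6 by (simp only: u_def)
  qed
  show ?thesis
  proof (intro exI[of _ \<kappa>] exI[of _ m] conjI allI impI)
    show "1 \<le> m" "m \<le> h \<kappa>" "\<gamma> k = wt \<kappa> (m - 1)" "\<gamma> ?k = wt \<kappa> m" by (fact m(1) m(2) lab)+
    fix p assume "p < L"
    from coef[OF this] show "pos (yy I p k) = degree p ?k" "pos (- yy I p k) = (if p = ?k then 1 else 0)" by blast+
  qed (rule mset)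
qed

text \<open>The facet \<open>slice t\<close> consists of the next occurrence of every letter, counted from \<open>t\<close>, or of its
  last occurrence if there is none.\<close>

definition slice :: "nat \<Rightarrow> nat set" where
  "slice t = {p. p < L \<and> (t \<le> p \<and> (\<forall>q. t \<le> q \<and> q < p \<longrightarrow> Qw!q \<noteq> Qw!p) \<or> p < t \<and> final p)}"

section \<open>Existence of the primitive exchanges\<close>

lemma same_letter_less:
  "p < L \<Longrightarrow> q < L \<Longrightarrow> Qw!p = Qw!q \<Longrightarrow> p < q \<longleftrightarrow> lv p < lv q"
  using position_less[of p q] by simp

lemma slice_0: "slice 0 = I0"
proof -
  have *: "(\<forall>q<p. Qw!q \<noteq> Qw!p) \<longleftrightarrow> p < N" if p: "p < L" for p
  proof (cases "p < N")
    case True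
    have "lv x = 0" if "x < N" for x using lv_0_iff[of x] that N_le_L by simp
    then show ?thesis using True same_letter_less[of _ p] N_le_L by (metis less_irrefl less_trans p)
  next
    case False
    then have "idx (Qw!p) < p" using idx(1)[of "Qw!p"] by simp
    then show ?thesis using False \<gamma>_initial(2) by metis
  qed
  have "p \<in> slice 0 \<longleftrightarrow> p < N" for p using *[of p] N_le_L by (auto simp: slice_def)
  then show ?thesis by auto
qed

lemma slice_le: "p \<le> t \<Longrightarrow> p \<in> slice (Suc t) \<longleftrightarrow> p < L \<and> final p" "p < t \<Longrightarrow> p \<in> slice t \<longleftrightarrow> p < L \<and> final p"
  by (auto simp: slice_def)

lemma slice_gt: assumes "t < p" shows "p \<in> slice t \<longleftrightarrow> p \<in> slice (Suc t) \<and> Qw!t \<noteq> Qw!p"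
proof -
  have "(\<forall>q. t \<le> q \<and> q < p \<longrightarrow> P q) \<longleftrightarrow> P t \<and> (\<forall>q. Suc t \<le> q \<and> q < p \<longrightarrow> P q)" for P
    using assms by (auto simp: Suc_le_eq) (metis le_neq_implies_less)
  then show ?thesis using assms by (auto simp: slice_def)
qed

lemma slice_self: "t < L \<Longrightarrow> t \<in> slice t"
  by (auto simp: slice_def)

lemma slice_final:
  assumes "t < L" "final t" shows "slice (Suc t) = slice t"
proof -
  have last: "Qw!p \<noteq> Qw!t" if "t < p" "p < L" for p
    using same_letter_less[of t p] lv_le[of p] that assms by (auto simp: final_def)
  have "p \<in> slice (Suc t) \<longleftrightarrow> p \<in> slice t" for p
  proof (cases "p \<le> t")
    case True then show ?thesis using assms slice_le[of p t] slice_self by (cases "p = t") auto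
  next
    case False
    then have "p \<in> slice (Suc t) \<Longrightarrow> Qw!t \<noteq> Qw!p" using last[of p] by (auto simp: slice_def)
    then show ?thesis using slice_gt[of t p] False by auto
  qed
  then show ?thesis by blast
qed

text \<open>The next occurrence q of the letter of t has weight c times that of t, and F l (c m) = -
  F m l makes its root orthogonal to the other weights of the slice. So q is the opposite of t, and
  no position of the slice lies behind q.\<close>

lemma slice_step:
  assumes t: "facet (slice t)" "t < L" "\<not> final t"
  shows "t \<in> slice t" "vp (R (slice t) t)" "\<gamma> (opp (slice t) t) = cq (\<gamma> t)"
    "flip (slice t) t = slice (Suc t)" "\<And>i. i \<in> slice t \<Longrightarrow> i \<le> opp (slice t) t"
proof -
  let ?I = "slice t"
  obtain q where q: "q < L" "\<gamma> q = cq (\<gamma> t)" "Qw!q = Qw!t" "lv q = Suc (lv t)" "t < q"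
    by (rule \<gamma>_next[OF t(2,3)])
  show tI: "t \<in> ?I" by (rule slice_self[OF t(2)])
  have qI: "q \<notin> ?I" using q(3,5) by (auto simp: slice_def)
  have iq: "i \<le> q" if i: "i \<in> ?I" for i
  proof (rule ccontr)
    assume "\<not> i \<le> q"
    then have qi: "q < i" by simp
    have i': "i < L" "\<forall>x. t \<le> x \<and> x < i \<longrightarrow> Qw!x \<noteq> Qw!i" using i qi q(5) by (auto simp: slice_def)
    have 1: "lv q < lv i \<or> lv q = lv i \<and> idx (Qw!t) < idx (Qw!i)" using position_less[of q i] q i' qi by simp
    then have "N \<le> i" using lv_0_iff[of i] i'(1) q(4) by auto
    then obtain r where r: "r < L" "Qw!r = Qw!i" "lv i = Suc (lv r)" "r < i" using \<gamma>_prev[OF i'(1)] by metis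
    then have "r < t" using i'(2) by (metis not_le)
    then have "lv r < lv t \<or> lv r = lv t \<and> idx (Qw!i) < idx (Qw!t)" using position_less[of r t] r t(2) by simp
    then show False using 1 r(3) q(4) by arith
  qed
  have pr0: "pr (R ?I q) (\<gamma> i) = 0" if i: "i \<in> ?I" "i \<noteq> t" for i
  proof -
    have "i < q" using iq[OF i(1)] qI i(1) by (metis le_neq_implies_less)
    moreover have "F (\<gamma> t) (\<gamma> i) = 0"
    proof (cases "t < i")
      case True then show ?thesis using F_facet[OF t(1) tI i(1)] by simp
    next
      case False
      then have "i < t" "final i" using i by (auto simp: slice_def)
      then show ?thesis using final_before_nonfinal(2)[of i t] t by simp
    qed
    ultimately show ?thesis using pr_R_label[OF t(1) i(1) q(1)] qI by (simp add: q(2) F_c)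
  qed
  have "R ?I q = R ?I t \<or> R ?I q = - R ?I t" by (rule root_on_line[OF t(1) tI R_roots pr0])
  then have opp: "opp ?I t = q" by (intro opp_eqI[OF t(1)]) (use q qI in auto)
  show "vp (R ?I t)" using opp_neg[OF t(1) tI] opp q(5) by auto
  show "\<gamma> (opp ?I t) = cq (\<gamma> t)" by (simp add: opp q(2))
  show "i \<le> opp ?I t" if "i \<in> ?I" for i using iq[OF that] by (simp add: opp)
  have bet: "Qw!r \<noteq> Qw!t" if "t < r" "r < q" for r
    using same_letter_less[of t r] same_letter_less[of r q] that q t(2) by (metis Suc_leI less_trans not_less)
  have qS: "q \<in> slice (Suc t)" using bet q by (auto simp: slice_def Suc_le_eq)
  have aft: "p = q" if "p \<in> slice (Suc t)" "t < p" "Qw!p = Qw!t" for p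
  proof (rule ccontr)
    assume "p \<noteq> q"
    then have "q < p" using bet[of p] that by (metis linorder_neqE_nat)
    then show False using that q(3,5) by (auto simp: slice_def)
  qed
  have "p \<in> insert q (?I - {t}) \<longleftrightarrow> p \<in> slice (Suc t)" for p
  proof (cases "p \<le> t")
    case True then show ?thesis using t q(5) slice_le[of p t] by (cases "p = t") auto
  next
    case False
    then have tp: "t < p" by simp
    show ?thesis
    proof (cases "p = q")
      case False
      then have "p \<in> insert q (?I - {t}) \<longleftrightarrow> p \<in> ?I" using tp by simp
      then show ?thesis using slice_gt[OF tp] aft[OF _ tp] False by metis
    qed (use qS in simp)
  qed
  then show "flip ?I t = slice (Suc t)" by (auto simp: flip_def opp)
qed

lemma facet_slice: "t \<le> L \<Longrightarrow> facet (slice t)"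
proof (induction t)
  case 0 then show ?case by (simp add: slice_0 facet_I0)
next
  case (Suc t)
  then have t: "facet (slice t)" "t < L" by auto
  show ?case
  proof (cases "final t")
    case False
    then show ?thesis using facet_flip[OF t(1) slice_step(1)[OF t]] slice_step(4)[OF t] by simp
  qed (use t slice_final in simp)
qed

text \<open>In \<open>slice t\<close> nothing lies behind the opposite of t, so
  \<open>flip_out\<close> becomes a linear relation between independent weights.\<close>

lemma shift_exchange_exists:
  assumes "1 \<le> m" "m \<le> h \<kappa>"
  obtains I k where "facet I" "k \<in> I" "vp (R I k)" "\<gamma> k = wt \<kappa> (m - 1)" "\<gamma> (opp I k) = wt \<kappa> m"
    "\<And>i. i \<in> I \<Longrightarrow> i < k \<or> opp I k < i \<Longrightarrow> cc I k i = 0"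
proof -
  have "m - 1 \<le> h \<kappa>" using assms by linarith
  then obtain t where t: "t < L" "\<gamma> t = wt \<kappa> (m - 1)" "Qw!t = \<kappa>" "lv t = m - 1" by (rule \<gamma>_position)
  have nf: "\<not> final t" using t assms by (auto simp: final_def)
  let ?I = "slice t"
  have I: "facet ?I" using facet_slice t(1) by simp
  note s = slice_step[OF I t(1) nf]
  have "cq (\<gamma> t) = wt \<kappa> m" using assms(1) t(2) by (cases m) auto
  moreover have "cc ?I t i = 0" if i: "i \<in> ?I" "i < t" for i
  proof -
    have "?I \<inter> {opp ?I t<..} = {}" using s(5) by fastforce
    then have "cq (\<Sum>i\<in>?I \<inter> {..<t}. cc ?I t i *s \<gamma> i) = cq 0"
      using flip_out[OF I s(1,2)] s(3) by (simp add: ww_sum ww_linear)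
    then have s0: "(\<Sum>i\<in>?I \<inter> {..<t}. cc ?I t i *s \<gamma> i) = 0" by (simp only: cq_inj)
    show ?thesis using label_independent[OF I _ s0, of i] i by auto
  qed
  ultimately show ?thesis using that[of ?I t] I s t(2) by (metis not_le)
qed

text \<open>\<open>M a\<close> consists of the first a initial positions and of the final positions
  of the remaining letters. Starting from the all-final facet \<open>slice L\<close>, flipping the
  letters back in the order of c passes through every antipodal exchange.\<close>

lemma antipodal_exchange_exists:
  obtains I where "facet I" "idx \<kappa> \<in> I" "vp (R I (idx \<kappa>))" "\<gamma> (opp I (idx \<kappa>)) = - axis \<kappa> 1"
    "\<And>i. i \<in> I \<Longrightarrow> idx \<kappa> < i \<Longrightarrow> i < opp I (idx \<kappa>) \<Longrightarrow> cc I (idx \<kappa>) i = 0"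
proof -
  define M where "M a = {..<a} \<union> fin ` {j. a \<le> idx j}" for a
  have step: "facet (M (Suc a)) \<and> opp (M a) (fin (cw!a)) = a \<and> flip (M a) (fin (cw!a)) = M (Suc a)"
    if a: "facet (M a)" "a < N" for a
  proof -
    let ?k = "cw!a"
    have ak: "idx ?k = a" "\<gamma> a = axis ?k 1" "a < L" using idx_nth[OF a(2)] \<gamma>_initial[of ?k] by auto
    have kM: "fin ?k \<in> M a" using ak by (auto simp: M_def)
    have aM: "a \<notin> M a" using fin(4) a(2) by (auto simp: M_def) (metis leD)
    have "pr (R (M a) a) (\<gamma> i) = 0" if i: "i \<in> M a" "i \<noteq> fin ?k" for i
    proof (cases "i < a")
      case True
      then show ?thesis using pr_R_label[OF a(1) i(1) ak(3) aM] F_initial[OF True a(2)] by simp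
    next
      case False
      then obtain j where j: "i = fin j" "a \<le> idx j" using i(1) by (auto simp: M_def)
      have "idx j \<noteq> a" using j(1) i(2) ak(1) by (metis idx_inj)
      then have "F (\<gamma> a) (\<gamma> (idx j)) = 0" using F_initial[of a "idx j"] idx(1)[of j] j(2) by simp
      then show ?thesis using pr_R_label[OF a(1) i(1) ak(3) aM] False by (simp add: j(1) fin(2) F_linear \<gamma>_initial)
    qed
    then have "R (M a) a = R (M a) (fin ?k) \<or> R (M a) a = - R (M a) (fin ?k)"
      by (intro root_on_line[OF a(1) kM]) auto
    then have opp: "opp (M a) (fin ?k) = a" by (intro opp_eqI[OF a(1) ak(3) aM])
    have "{j. a \<le> idx j} = insert ?k {j. Suc a \<le> idx j}" using ak(1) by (auto simp: Suc_le_eq le_less) (metis idx_inj)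
    then have "M a = insert (fin ?k) ({..<a} \<union> fin ` {j. Suc a \<le> idx j})" by (auto simp: M_def)
    moreover have "fin ?k \<notin> {..<a} \<union> fin ` {j. Suc a \<le> idx j}"
      using fin(4)[of ?k] a(2) ak(1) by (auto simp: fin_inj)
    ultimately have "flip (M a) (fin ?k) = M (Suc a)" unfolding flip_def opp by (auto simp: M_def lessThan_Suc)
    then show ?thesis using facet_flip[OF a(1) kM] opp by simp
  qed
  have M0: "M 0 = slice L"
  proof -
    have "p \<in> fin ` UNIV" if "p < L" "final p" for p using fin_eqI[OF that(1) \<gamma>_final[OF that]] by simp
    then show ?thesis using fin(1,3) by (auto simp: M_def slice_def)
  qed
  have facM: "a \<le> N \<Longrightarrow> facet (M a)" for a
    by (induction a) (auto simp: M0 facet_slice step)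
  let ?a = "idx \<kappa>"
  have a: "facet (M ?a)" "?a < N" "cw!?a = \<kappa>" using facM idx(1)[of \<kappa>] idx(2)[of \<kappa>] by (auto simp: less_imp_le)
  note s = step[OF a(1,2), unfolded a(3)]
  have kM: "fin \<kappa> \<in> M ?a" by (auto simp: M_def)
  let ?I = "M (Suc ?a)"
  have opp: "opp ?I ?a = fin \<kappa>" using opp_flip[OF a(1) kM] s by simp
  have aI: "?a \<in> ?I" by (simp add: M_def)
  have less: "?a < fin \<kappa>" using fin(4)[of \<kappa>] a(2) by simp
  have I: "facet ?I" using s by simp
  have vp: "vp (R ?I ?a)" using opp_neg[OF I aI] opp less by auto
  have "\<gamma> ?a + \<gamma> (opp ?I ?a) = 0" by (simp add: opp fin(2) \<gamma>_initial)
  then have s0: "(\<Sum>i\<in>?I \<inter> {?a<..<opp ?I ?a}. cc ?I ?a i *s \<gamma> i) = 0" using flip_between[OF I aI vp] by simp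
  have "cc ?I ?a i = 0" if "i \<in> ?I" "?a < i" "i < opp ?I ?a" for i
    using label_independent[OF I _ s0, of i] that by auto
  then show ?thesis using that[OF I aI vp] opp fin(2) by simp
qed

end

section \<open>Laurent monomials and evaluation\<close>

type_synonym intpoly = "(nat \<Rightarrow>\<^sub>0 nat) \<Rightarrow>\<^sub>0 int"

definition Var :: "nat \<Rightarrow> ratfun" where
  "Var k = Fract (Poly_Mapping.single (Poly_Mapping.single k 1) 1) 1"

definition mval :: "(nat \<Rightarrow> 'g::field) \<Rightarrow> (nat \<Rightarrow>\<^sub>0 nat) \<Rightarrow> 'g" where
  "mval v m = (\<Prod>k\<in>Poly_Mapping.keys m. v k ^ Poly_Mapping.lookup m k)"

definition peval :: "(nat \<Rightarrow> 'g::field) \<Rightarrow> intpoly \<Rightarrow> 'g" where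
  "peval v a = (\<Sum>m\<in>Poly_Mapping.keys a. of_int (Poly_Mapping.lookup a m) * mval v m)"

lemma mval_superset:
  assumes "finite S" "Poly_Mapping.keys m \<subseteq> S" shows "mval v m = (\<Prod>k\<in>S. v k ^ Poly_Mapping.lookup m k)"
  unfolding mval_def using assms by (intro prod.mono_neutral_left) (auto simp: in_keys_iff)

lemma mval_add: "mval v (m + m') = mval v m * mval v m'"
proof -
  let ?S = "Poly_Mapping.keys m \<union> Poly_Mapping.keys m'"
  have "Poly_Mapping.keys (m + m') \<subseteq> ?S" by (rule Poly_Mapping.keys_add)
  then show ?thesis
    by (simp add: mval_superset[of ?S] lookup_add power_add prod.distrib)
qed

lemma peval_superset:
  assumes "finite S" "Poly_Mapping.keys a \<subseteq> S"
  shows "peval v a = (\<Sum>m\<in>S. of_int (Poly_Mapping.lookup a m) * mval v m)"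
  unfolding peval_def using assms by (intro sum.mono_neutral_left) (auto simp: in_keys_iff)

lemma peval_add: "peval v (a + b) = peval v a + peval v b"
proof -
  let ?S = "Poly_Mapping.keys a \<union> Poly_Mapping.keys b"
  have "Poly_Mapping.keys (a + b) \<subseteq> ?S" by (rule Poly_Mapping.keys_add)
  then show ?thesis
    by (simp add: peval_superset[of ?S] lookup_add sum.distrib algebra_simps)
qed

lemma peval_zero [simp]: "peval v 0 = 0"
  by (simp add: peval_def)

lemma peval_sum: "peval v (\<Sum>x\<in>S. g x) = (\<Sum>x\<in>S. peval v (g x))"
  by (induction S rule: infinite_finite_induct) (auto simp: peval_add)

lemma peval_single: "peval v (Poly_Mapping.single m c) = of_int c * mval v m"
  by (cases "c = 0") (auto simp: peval_def)

lemma peval_one [simp]: "peval v 1 = 1"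
  using peval_single[of v 0 1] by (simp add: mval_def)

lemma poly_mapping_sum: "a = (\<Sum>m\<in>Poly_Mapping.keys a. Poly_Mapping.single m (Poly_Mapping.lookup a m))"
proof (rule poly_mapping_eqI)
  fix k
  show "Poly_Mapping.lookup a k =
      Poly_Mapping.lookup (\<Sum>m\<in>Poly_Mapping.keys a. Poly_Mapping.single m (Poly_Mapping.lookup a m)) k"
    by (simp add: lookup_sum lookup_single when_def in_keys_iff)
qed

lemma peval_mult: "peval v (a * b) = peval v a * peval v b"
proof -
  let ?s = "\<lambda>a m. Poly_Mapping.single m (Poly_Mapping.lookup a m) :: intpoly"
  have "a * b = (\<Sum>m\<in>Poly_Mapping.keys a. ?s a m) * (\<Sum>m\<in>Poly_Mapping.keys b. ?s b m)"
    using poly_mapping_sum[of a] poly_mapping_sum[of b] by simp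
  also have "\<dots> = (\<Sum>m\<in>Poly_Mapping.keys a. \<Sum>m'\<in>Poly_Mapping.keys b. ?s a m * ?s b m')"
    by (rule sum_product)
  finally have "peval v (a * b) = (\<Sum>m\<in>Poly_Mapping.keys a. \<Sum>m'\<in>Poly_Mapping.keys b. peval v (?s a m * ?s b m'))"
    by (simp add: peval_sum)
  moreover have "peval v (?s a m * ?s b m') =
      (of_int (Poly_Mapping.lookup a m) * mval v m) * (of_int (Poly_Mapping.lookup b m') * mval v m')" for m m'
    by (simp add: mult_single peval_single mval_add ac_simps)
  ultimately show ?thesis by (simp only: peval_def[of v a] peval_def[of v b] sum_product)
qed

text \<open>Evaluation as a relation: a value exists if some representing fraction has a denominator
  that does not vanish at v. This allows points with coordinates 0.\<close>

definition Ev :: "(nat \<Rightarrow> 'g::field) \<Rightarrow> ratfun \<Rightarrow> 'g \<Rightarrow> bool" where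
  "Ev v z w \<longleftrightarrow> (\<exists>a b. z = Fract a b \<and> peval v b \<noteq> 0 \<and> w = peval v a / peval v b)"

lemma Ev_unique: assumes "Ev v z w" "Ev v z w'" shows "w = w'"
proof -
  obtain a b where ab: "z = Fract a b" "peval v b \<noteq> 0" "w = peval v a / peval v b" using assms(1) by (auto simp: Ev_def)
  obtain a' b' where ab': "z = Fract a' b'" "peval v b' \<noteq> 0" "w' = peval v a' / peval v b'" using assms(2) by (auto simp: Ev_def)
  have "b \<noteq> 0" "b' \<noteq> 0" using ab(2) ab'(2) by auto
  then have "a * b' = a' * b" using ab(1) ab'(1) by (simp add: eq_fract)
  then have "peval v a * peval v b' = peval v a' * peval v b" by (metis peval_mult)
  then show ?thesis using ab ab' by (simp add: frac_eq_eq)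
qed

lemma Ev_add: assumes "Ev v z w" "Ev v z' w'" shows "Ev v (z + z') (w + w')"
proof -
  obtain a b where ab: "z = Fract a b" "peval v b \<noteq> 0" "w = peval v a / peval v b" using assms(1) by (auto simp: Ev_def)
  obtain a' b' where ab': "z' = Fract a' b'" "peval v b' \<noteq> 0" "w' = peval v a' / peval v b'" using assms(2) by (auto simp: Ev_def)
  have "b \<noteq> 0" "b' \<noteq> 0" using ab(2) ab'(2) by auto
  then have "z + z' = Fract (a * b' + a' * b) (b * b')" by (simp add: ab(1) ab'(1))
  then show ?thesis unfolding Ev_def
    by (intro exI[of _ "a * b' + a' * b"] exI[of _ "b * b'"]) (use ab ab' in \<open>simp add: peval_mult peval_add add_frac_eq\<close>)
qed

lemma Ev_mult: assumes "Ev v z w" "Ev v z' w'" shows "Ev v (z * z') (w * w')"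
proof -
  obtain a b where ab: "z = Fract a b" "peval v b \<noteq> 0" "w = peval v a / peval v b" using assms(1) by (auto simp: Ev_def)
  obtain a' b' where ab': "z' = Fract a' b'" "peval v b' \<noteq> 0" "w' = peval v a' / peval v b'" using assms(2) by (auto simp: Ev_def)
  show ?thesis unfolding Ev_def
    by (intro exI[of _ "a * a'"] exI[of _ "b * b'"]) (use ab ab' in \<open>simp add: peval_mult\<close>)
qed

lemma Ev_inverse: assumes "Ev v z w" "w \<noteq> 0" shows "Ev v (inverse z) (inverse w)"
proof -
  obtain a b where ab: "z = Fract a b" "peval v b \<noteq> 0" "w = peval v a / peval v b" using assms(1) by (auto simp: Ev_def)
  show ?thesis unfolding Ev_def
    by (intro exI[of _ b] exI[of _ a]) (use ab assms(2) in auto)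
qed

lemma Ev_divide: "Ev v z w \<Longrightarrow> Ev v z' w' \<Longrightarrow> w' \<noteq> 0 \<Longrightarrow> Ev v (z / z') (w / w')"
  using Ev_mult[OF _ Ev_inverse] by (simp add: divide_inverse)

lemma Ev_one: "Ev v 1 1"
  unfolding Ev_def by (intro exI[of _ 1]) (simp add: One_fract_def)

lemma Ev_zero: "Ev v 0 0"
  unfolding Ev_def by (intro exI[of _ 0] exI[of _ 1]) (simp add: Zero_fract_def)

lemma Ev_Var: "Ev v (Var k) (v k)"
  unfolding Ev_def Var_def
  by (intro exI[of _ "Poly_Mapping.single (Poly_Mapping.single k 1) 1"] exI[of _ 1]) (simp add: peval_single mval_def)

lemma Ev_power: "Ev v z w \<Longrightarrow> Ev v (z ^ n) (w ^ n)"
  by (induction n) (auto simp: Ev_one Ev_mult)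

lemma Ev_prod: "(\<And>i. i \<in> S \<Longrightarrow> Ev v (g i) (g' i)) \<Longrightarrow> Ev v (prod g S) (prod g' S)"
  by (induction S rule: infinite_finite_induct) (auto simp: Ev_one Ev_mult)

lemma Var_nz: "Var k \<noteq> 0"
  using Ev_unique[OF Ev_Var[of "\<lambda>_. 1::real" k]] Ev_zero[of "\<lambda>_. 1::real"] by (metis zero_neq_one)

definition lmon :: "nat \<Rightarrow> (nat \<Rightarrow> int) \<Rightarrow> ratfun" where
  "lmon n u = (\<Prod>k<n. Var k powi u k)"

lemma Var_power_prod:
  "(\<Prod>k<n. Var k ^ e k) = Fract (Poly_Mapping.single (\<Sum>k<n. Poly_Mapping.single k (e k)) 1) 1"
proof -
  have "Var k ^ j = Fract (Poly_Mapping.single (Poly_Mapping.single k j) 1) 1" for k j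
    by (induction j) (auto simp: Var_def One_fract_def mult_single simp flip: single_add single_one)
  then show ?thesis
    by (induction n) (auto simp: One_fract_def mult_single simp flip: single_one)
qed

text \<open>Multiplication by a monomial with large exponents s clears all negative exponents and
  leaves distinct monomials of the polynomial ring.\<close>

lemma lmon_independent:
  assumes fin: "finite T" and dist: "\<And>s t. s \<in> T \<Longrightarrow> t \<in> T \<Longrightarrow> s \<noteq> t \<Longrightarrow> \<exists>k<n. u s k \<noteq> u t k"
    and zero: "(\<Sum>t\<in>T. of_int (c t) * lmon n (u t)) = 0" and t: "t \<in> T"
  shows "c t = 0"
proof -
  define s where "s k = (\<Sum>t\<in>T. nat (- u t k))" for k
  define e where "e t k = nat (u t k + int (s k))" for t k
  define E where "E t = (\<Sum>k<n. Poly_Mapping.single k (e t k))" for t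
  have nn: "u t k + int (s k) \<ge> 0" if "t \<in> T" for t k
  proof -
    have "nat (- u t k) \<le> s k" unfolding s_def using member_le_sum[OF that _ fin, of "\<lambda>t. nat (- u t k)"] by simp
    then show ?thesis by linarith
  qed
  have mon: "lmon n (u t) * (\<Prod>k<n. Var k ^ s k) = Fract (Poly_Mapping.single (E t) 1) 1" if "t \<in> T" for t
  proof -
    have "Var k powi u t k * Var k ^ s k = Var k ^ e t k" for k
    proof -
      have "Var k powi u t k * Var k powi int (s k) = Var k powi (u t k + int (s k))"
        by (rule power_int_add[symmetric]) (simp add: Var_nz)
      also have "\<dots> = Var k powi int (e t k)" using nn[OF that] by (simp add: e_def)
      finally show ?thesis by simp
    qed
    then show ?thesis by (simp add: lmon_def E_def flip: prod.distrib Var_power_prod)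
  qed
  have of_int_Fract: "of_int x = Fract (Poly_Mapping.single 0 x) (1 :: intpoly)" for x
  proof -
    have "of_int x = (Fract (of_int x) 1 :: ratfun)"
      by (cases x rule: int_cases2) (auto simp: of_nat_fract)
    moreover have "of_int x = (Poly_Mapping.single 0 x :: intpoly)"
      by (cases x rule: int_cases2) (simp_all flip: single_of_nat single_uminus)
    ultimately show ?thesis by simp
  qed
  have lk: "Poly_Mapping.lookup (E t) k = e t k" if "k < n" for t k
    using that by (simp add: E_def lookup_sum lookup_single when_def)
  have E_inj: "E t \<noteq> E t'" if tt: "t \<in> T" "t' \<in> T" "t \<noteq> t'" for t t'
  proof
    assume "E t = E t'"
    moreover obtain k where k: "k < n" "u t k \<noteq> u t' k" using dist[OF tt] by auto
    ultimately have "e t k = e t' k" using lk by metis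
    then show False using nn[OF tt(1), of k] nn[OF tt(2), of k] k(2) by (simp add: e_def)
  qed
  have Fract_sum: "(\<Sum>t\<in>S. Fract (g t) 1) = Fract (\<Sum>t\<in>S. g t) (1 :: intpoly)" for S :: "'a set" and g
    by (induction S rule: infinite_finite_induct) (auto simp: Zero_fract_def)
  have "0 = (\<Sum>t\<in>T. of_int (c t) * lmon n (u t)) * (\<Prod>k<n. Var k ^ s k)" by (simp add: zero)
  also have "\<dots> = (\<Sum>t\<in>T. Fract (Poly_Mapping.single (E t) (c t)) 1)"
    by (simp add: sum_distrib_right mult.assoc mon of_int_Fract mult_single)
  finally have "Fract (\<Sum>t\<in>T. Poly_Mapping.single (E t) (c t)) 1 = (0 :: ratfun)" by (simp add: Fract_sum)
  then have "(\<Sum>t\<in>T. Poly_Mapping.single (E t) (c t)) = 0" by (simp add: Zero_fract_def eq_fract)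
  then have "0 = (\<Sum>t'\<in>T. Poly_Mapping.lookup (Poly_Mapping.single (E t') (c t')) (E t))"
    by (simp flip: lookup_sum)
  also have "\<dots> = (\<Sum>t'\<in>T. if t' = t then c t else 0)"
    using E_inj t by (intro sum.cong) (auto simp: lookup_single when_def)
  finally show ?thesis using fin t by simp
qed

section \<open>The coefficient field\<close>

locale laurent =
  fixes \<gamma> :: "nat \<Rightarrow> 'j" and L :: nat and e :: "'i::finite \<Rightarrow> nat" and N :: nat
  assumes inj_label: "inj_on \<gamma> {..<L}" and bij_e: "bij_betw e UNIV {..<N}"
begin

definition J :: "'j set" where "J = \<gamma> ` {..<L}"

text \<open>The first L variables of the universe serve as coefficients, indexed by positions, and
  the next N as the initial cluster.\<close>

definition emb :: "('j \<Rightarrow>\<^sub>0 int) \<Rightarrow> ratfun" where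
  "emb g = (\<Prod>p<L. Var p powi Poly_Mapping.lookup g (\<gamma> p))"

definition xv :: "'i \<Rightarrow> ratfun" where "xv i = Var (L + e i)"

lemma emb_zero: "emb 0 = 1"
  by (simp add: emb_def)

lemma emb_add: "emb (g + h) = emb g * emb h"
  by (simp add: emb_def lookup_add power_int_add Var_nz prod.distrib)

lemma emb_nz: "emb g \<noteq> 0"
  by (simp add: emb_def Var_nz)

lemma emb_eq_iff_lookup:
  assumes "Poly_Mapping.keys g \<subseteq> J" "Poly_Mapping.keys h \<subseteq> J" "g \<noteq> h"
  shows "\<exists>k<L. Poly_Mapping.lookup g (\<gamma> k) \<noteq> Poly_Mapping.lookup h (\<gamma> k)"
proof (rule ccontr)
  assume n: "\<not> ?thesis"
  have "Poly_Mapping.lookup g j = Poly_Mapping.lookup h j" for j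
  proof (cases "j \<in> J")
    case True then show ?thesis using n by (auto simp: J_def)
  next
    case False
    then show ?thesis using assms(1,2) by (metis in_keys_iff subsetD)
  qed
  then show False using assms(3) by (simp add: poly_mapping_eqI)
qed

lemma group_ringI:
  assumes "finite S" "S \<subseteq> carrier (Trop J)"
  shows "(\<Sum>g\<in>S. of_int (c g) * emb g) \<in> group_ring (Trop J) emb"
proof -
  define r where "r = (\<Sum>g\<in>S. Poly_Mapping.single g (c g))"
  have lk: "Poly_Mapping.lookup r g = (if g \<in> S then c g else 0)" for g
    using assms(1) by (simp add: r_def lookup_sum lookup_single when_def)
  have keys: "Poly_Mapping.keys r \<subseteq> S" by (auto simp: in_keys_iff lk split: if_splits)
  have "group_ring_map emb r = (\<Sum>g\<in>S. of_int (Poly_Mapping.lookup r g) * emb g)"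
    unfolding group_ring_map_def using assms(1) keys by (intro sum.mono_neutral_left) (auto simp: in_keys_iff)
  also have "\<dots> = (\<Sum>g\<in>S. of_int (c g) * emb g)" by (intro sum.cong) (auto simp: lk)
  finally show ?thesis using keys assms(2) unfolding group_ring_def by (metis (mono_tags, lifting) image_eqI mem_Collect_eq subset_trans)
qed

lemma group_ringE:
  assumes "r \<in> group_ring (Trop J) emb"
  obtains \<rho> where "r = (\<Sum>g\<in>Poly_Mapping.keys \<rho>. of_int (Poly_Mapping.lookup \<rho> g) * emb g)"
    "Poly_Mapping.keys \<rho> \<subseteq> carrier (Trop J)"
  using assms unfolding group_ring_def group_ring_map_def by blast

lemma group_ring_one: "1 \<in> group_ring (Trop J) emb"
  using group_ringI[of "{0}" "\<lambda>_. 1"] by (simp add: emb_zero)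

lemma group_ring_mult:
  assumes "r \<in> group_ring (Trop J) emb" "s \<in> group_ring (Trop J) emb"
  shows "r * s \<in> group_ring (Trop J) emb"
proof -
  obtain \<rho> where \<rho>: "r = (\<Sum>g\<in>Poly_Mapping.keys \<rho>. of_int (Poly_Mapping.lookup \<rho> g) * emb g)"
    "Poly_Mapping.keys \<rho> \<subseteq> carrier (Trop J)" by (rule group_ringE[OF assms(1)])
  obtain \<sigma> where \<sigma>: "s = (\<Sum>g\<in>Poly_Mapping.keys \<sigma>. of_int (Poly_Mapping.lookup \<sigma> g) * emb g)"
    "Poly_Mapping.keys \<sigma> \<subseteq> carrier (Trop J)" by (rule group_ringE[OF assms(2)])
  let ?P = "Poly_Mapping.keys \<rho> \<times> Poly_Mapping.keys \<sigma>"
  let ?f = "\<lambda>(g, h). g + h"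
  have car: "?f ` ?P \<subseteq> carrier (Trop J)"
    using \<rho>(2) \<sigma>(2) Poly_Mapping.keys_add by fastforce
  have "r * s = (\<Sum>(g, h)\<in>?P. of_int (Poly_Mapping.lookup \<rho> g * Poly_Mapping.lookup \<sigma> h) * emb (g + h))"
    unfolding \<rho>(1) \<sigma>(1) sum_product sum.cartesian_product by (intro sum.cong) (auto simp: emb_add)
  also have "\<dots> = (\<Sum>x\<in>?P. of_int (Poly_Mapping.lookup \<rho> (fst x) * Poly_Mapping.lookup \<sigma> (snd x)) * emb (?f x))"
    by (intro sum.cong) auto
  also have "\<dots> = (\<Sum>k\<in>?f ` ?P. \<Sum>x | x \<in> ?P \<and> ?f x = k. of_int (Poly_Mapping.lookup \<rho> (fst x) * Poly_Mapping.lookup \<sigma> (snd x)) * emb (?f x))"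
    by (rule sum.image_gen) simp
  also have "\<dots> = (\<Sum>k\<in>?f ` ?P. of_int (\<Sum>x | x \<in> ?P \<and> ?f x = k. Poly_Mapping.lookup \<rho> (fst x) * Poly_Mapping.lookup \<sigma> (snd x)) * emb k)"
    unfolding of_int_sum sum_distrib_right by (intro sum.cong HOL.refl) auto
  finally have eq: "r * s = \<dots>" .
  show ?thesis unfolding eq by (rule group_ringI[OF _ car]) simp
qed

lemma group_ring_prod: "(\<And>m. m \<in> S \<Longrightarrow> g m \<in> group_ring (Trop J) emb) \<Longrightarrow> prod g S \<in> group_ring (Trop J) emb"
  by (induction S rule: infinite_finite_induct) (auto simp: group_ring_one group_ring_mult)

lemma coeff_embedding: "coeff_embedding (Trop J) emb"
  unfolding coeff_embedding_def
proof (intro conjI ballI)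
  show "inj_on (group_ring_map emb) {r. Poly_Mapping.keys r \<subseteq> carrier (Trop J)}"
  proof (rule inj_onI)
    fix r s assume rs: "r \<in> {r. Poly_Mapping.keys r \<subseteq> carrier (Trop J)}" "s \<in> {r. Poly_Mapping.keys r \<subseteq> carrier (Trop J)}"
      and eq: "group_ring_map emb r = group_ring_map emb s"
    let ?T = "Poly_Mapping.keys r \<union> Poly_Mapping.keys s"
    have ext: "group_ring_map emb q = (\<Sum>g\<in>?T. of_int (Poly_Mapping.lookup q g) * emb g)" if "Poly_Mapping.keys q \<subseteq> ?T" for q
      unfolding group_ring_map_def using that by (intro sum.mono_neutral_left) (auto simp: in_keys_iff)
    have sum0: "(\<Sum>g\<in>?T. of_int (Poly_Mapping.lookup r g - Poly_Mapping.lookup s g) * lmon L (\<lambda>p. Poly_Mapping.lookup g (\<gamma> p))) = 0"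
      using eq ext[of r] ext[of s] by (simp add: left_diff_distrib sum_subtractf lmon_def emb_def)
    have car: "Poly_Mapping.keys g \<subseteq> J" if "g \<in> ?T" for g using that rs by auto
    have "Poly_Mapping.lookup r g - Poly_Mapping.lookup s g = 0" if "g \<in> ?T" for g
    proof (rule lmon_independent[OF _ _ sum0 that])
      fix x y assume "x \<in> ?T" "y \<in> ?T" "x \<noteq> y"
      then show "\<exists>k<L. Poly_Mapping.lookup x (\<gamma> k) \<noteq> Poly_Mapping.lookup y (\<gamma> k)"
        by (intro emb_eq_iff_lookup car)
    qed simp
    moreover have "Poly_Mapping.lookup r g = Poly_Mapping.lookup s g" if "g \<notin> ?T" for g
      using that by (simp add: in_keys_iff)
    ultimately show "r = s" by (intro poly_mapping_eqI) (metis eq_iff_diff_eq_0)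
  qed
qed (simp_all add: emb_zero emb_add)

definition amb :: "ratfun set" where
  "amb = {poly_eval xv f / poly_eval xv g | f g. f \<in> polys_over (coeff_field (Trop J) emb) \<and>
     g \<in> polys_over (coeff_field (Trop J) emb) \<and> g \<noteq> 0}"

text \<open>After clearing the denominators of the coefficients, a polynomial relation becomes an
  integral relation between distinct Laurent monomials.\<close>

lemma free_generating: "free_generating_set (coeff_field (Trop J) emb) amb xv"
  unfolding free_generating_set_def
proof (intro conjI ballI impI)
  fix f assume f: "f \<in> polys_over (coeff_field (Trop J) emb)" and zero: "poly_eval xv f = 0"
  let ?K = "Poly_Mapping.keys f" and ?R = "group_ring (Trop J) emb"
  have "\<forall>m. \<exists>a b. Poly_Mapping.lookup f m = a / b \<and> a \<in> ?R \<and> b \<in> ?R \<and> b \<noteq> 0"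
    using f by (auto simp: polys_over_def coeff_field_def)
  then obtain a b where ab: "\<And>m. Poly_Mapping.lookup f m = a m / b m" "\<And>m. a m \<in> ?R" "\<And>m. b m \<in> ?R" "\<And>m. b m \<noteq> 0"
    by metis
  define r where "r m = a m * prod b (?K - {m})" for m
  have rR: "r m \<in> ?R" for m unfolding r_def by (intro group_ring_mult group_ring_prod ab)
  have lr: "Poly_Mapping.lookup f m * prod b ?K = r m" if "m \<in> ?K" for m
  proof -
    have "prod b ?K = b m * prod b (?K - {m})" by (rule prod.remove[OF finite_keys that])
    then show ?thesis using ab(4)[of m] by (simp add: ab(1) r_def)
  qed
  have "\<forall>m. \<exists>\<rho>. r m = (\<Sum>g\<in>Poly_Mapping.keys \<rho>. of_int (Poly_Mapping.lookup \<rho> g) * emb g) \<and> Poly_Mapping.keys \<rho> \<subseteq> carrier (Trop J)"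
  proof
    fix m
    show "\<exists>\<rho>. r m = (\<Sum>g\<in>Poly_Mapping.keys \<rho>. of_int (Poly_Mapping.lookup \<rho> g) * emb g) \<and> Poly_Mapping.keys \<rho> \<subseteq> carrier (Trop J)"
      by (rule group_ringE[OF rR[of m]]) blast
  qed
  from choice[OF this] obtain \<rho> where
    "\<forall>m. r m = (\<Sum>g\<in>Poly_Mapping.keys (\<rho> m). of_int (Poly_Mapping.lookup (\<rho> m) g) * emb g) \<and>
      Poly_Mapping.keys (\<rho> m) \<subseteq> carrier (Trop J)" by blast
  then have \<rho>: "\<And>m. r m = (\<Sum>g\<in>Poly_Mapping.keys (\<rho> m). of_int (Poly_Mapping.lookup (\<rho> m) g) * emb g)"
    "\<And>m. Poly_Mapping.keys (\<rho> m) \<subseteq> carrier (Trop J)" by blast+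
  define T where "T = Sigma ?K (\<lambda>m. Poly_Mapping.keys (\<rho> m))"
  define u where "u t k = (if k < L then Poly_Mapping.lookup (snd t) (\<gamma> k)
    else int (Poly_Mapping.lookup (fst t) (inv_into UNIV e (k - L))))" for t :: "('i \<Rightarrow>\<^sub>0 nat) \<times> ('j \<Rightarrow>\<^sub>0 int)" and k
  have e_inv: "inv_into UNIV e (e i) = i" "e i < N" for i using bij_e by (auto simp: bij_betw_def)
  have lm: "lmon (L + N) (u (m, g)) = emb g * (\<Prod>i\<in>UNIV. xv i ^ Poly_Mapping.lookup m i)" for m g
  proof -
    have split: "(\<Prod>k<L + n. g k) = (\<Prod>k<L. g k) * (\<Prod>k<n. g (L + k))" for g :: "nat \<Rightarrow> ratfun" and n
      by (induction n) (simp_all add: mult.assoc)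
    have "lmon (L + N) (u (m, g)) = (\<Prod>k<L. Var k powi u (m, g) k) * (\<Prod>k<N. Var (L + k) powi u (m, g) (L + k))"
      unfolding lmon_def by (rule split)
    moreover have "(\<Prod>k<N. Var (L + k) powi u (m, g) (L + k)) = (\<Prod>i\<in>UNIV. Var (L + e i) powi u (m, g) (L + e i))"
      by (rule prod.reindex_bij_betw[OF bij_e, symmetric])
    ultimately show ?thesis by (simp add: emb_def u_def e_inv xv_def)
  qed
  have "0 = poly_eval xv f * prod b ?K" by (simp add: zero)
  also have "\<dots> = (\<Sum>m\<in>?K. r m * (\<Prod>i\<in>UNIV. xv i ^ Poly_Mapping.lookup m i))"
    unfolding poly_eval_def sum_distrib_right by (intro sum.cong) (auto simp flip: lr)
  also have "\<dots> = (\<Sum>m\<in>?K. \<Sum>g\<in>Poly_Mapping.keys (\<rho> m). of_int (Poly_Mapping.lookup (\<rho> m) g) * lmon (L + N) (u (m, g)))"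
    by (simp add: \<rho>(1) sum_distrib_right lm mult.assoc)
  also have "\<dots> = (\<Sum>t\<in>T. of_int (Poly_Mapping.lookup (\<rho> (fst t)) (snd t)) * lmon (L + N) (u t))"
    unfolding T_def by (subst sum.Sigma) (auto simp: case_prod_beta)
  finally have sum0: "(\<Sum>t\<in>T. of_int (Poly_Mapping.lookup (\<rho> (fst t)) (snd t)) * lmon (L + N) (u t)) = 0" by simp
  have dist: "\<exists>k<L + N. u s k \<noteq> u t k" if st: "s \<in> T" "t \<in> T" "s \<noteq> t" for s t
  proof (cases "snd s = snd t")
    case True
    then have "fst s \<noteq> fst t" using st(3) by (simp add: prod_eq_iff)
    then obtain i where "Poly_Mapping.lookup (fst s) i \<noteq> Poly_Mapping.lookup (fst t) i" by (metis poly_mapping_eqI)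
    then show ?thesis by (intro exI[of _ "L + e i"]) (simp add: u_def e_inv)
  next
    case False
    have "Poly_Mapping.keys (snd x) \<subseteq> J" if "x \<in> T" for x
      using that subsetD[OF \<rho>(2)[of "fst x"], of "snd x"] by (auto simp: T_def)
    from emb_eq_iff_lookup[OF this[OF st(1)] this[OF st(2)] False] show ?thesis by (auto simp: u_def intro: trans_less_add1)
  qed
  have "Poly_Mapping.lookup (\<rho> m) g = 0" if "m \<in> ?K" "g \<in> Poly_Mapping.keys (\<rho> m)" for m g
    using lmon_independent[OF _ dist sum0, of "(m, g)"] that by (simp add: T_def)
  then have "Poly_Mapping.keys (\<rho> m) = {}" if "m \<in> ?K" for m using that in_keys_iff by (metis equals0I)
  then have "r m = 0" if "m \<in> ?K" for m using that by (simp add: \<rho>(1))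
  then have "Poly_Mapping.lookup f m = 0" if "m \<in> ?K" for m
    using that lr[OF that] ab(4) by simp
  then have "m \<notin> ?K" for m using in_keys_iff by metis
  then have "?K = {}" by blast
  then show "f = 0" by (simp only: keys_eq_empty)
qed (simp add: amb_def)

end

section \<open>Tropical semifields\<close>

lemma Trop_nat_pow: "a [^]\<^bsub>Trop J\<^esub> (n::nat) = frag_cmul (int n) a"
  by (induction n) (simp_all add: nat_pow_def frag_cmul_distrib)

lemma Trop_comm_group: "comm_group (Trop J)"
  using is_semifield_Trop[of J] by (simp only: is_semifield_def)

lemma Trop_inv: assumes "a \<in> carrier (Trop J)" shows "inv\<^bsub>Trop J\<^esub> a = - a"
proof (rule group.inv_equality)
  show "group (Trop J)" using Trop_comm_group[of J] by (simp only: comm_group_def)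
qed (use assms in simp_all)

lemma frag_cmul_carrier: "a \<in> carrier (Trop J) \<Longrightarrow> frag_cmul c a \<in> carrier (Trop J)"
  using keys_cmul[of c a] by auto

lemma Trop_int_pow: assumes "a \<in> carrier (Trop J)" shows "a [^]\<^bsub>Trop J\<^esub> (z::int) = frag_cmul z a"
proof (cases "z < 0")
  case True
  have "a [^]\<^bsub>Trop J\<^esub> z = inv\<^bsub>Trop J\<^esub> (frag_cmul (- z) a)"
    using True by (simp only: int_pow_def2 if_True) (simp add: Trop_nat_pow)
  also have "\<dots> = - frag_cmul (- z) a" by (rule Trop_inv[OF frag_cmul_carrier[OF assms]])
  finally show ?thesis by simp
qed (simp add: int_pow_def2 Trop_nat_pow)

lemma Trop_finprod:
  assumes "finite S" "\<And>x. x \<in> S \<Longrightarrow> g x \<in> carrier (Trop J)"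
  shows "finprod (Trop J) g S = sum g S"
  using assms
proof (induction S)
  case empty
  interpret comm_group "Trop J" by (rule Trop_comm_group)
  show ?case by (simp del: Trop_simps(1))
next
  case (insert x S)
  interpret comm_group "Trop J" by (rule Trop_comm_group)
  have "finprod (Trop J) g (insert x S) = g x \<otimes>\<^bsub>Trop J\<^esub> finprod (Trop J) g S"
    by (rule finprod_insert) (use insert in \<open>auto simp del: Trop_simps(1)\<close>)
  then show ?case using insert by simp
qed

lemma lookup_sum_frag:
  assumes "finite S"
  shows "Poly_Mapping.lookup (\<Sum>l\<in>S. frag_cmul (u l) (frag_of l)) j = (if j \<in> S then u j else 0)"
  using assms by (simp add: lookup_sum if_distrib cong: if_cong)

sublocale coxeter_cartan \<subseteq> Lau: laurent \<gamma> "length kept" idx "length cw"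
proof
  show "inj_on \<gamma> {..<length kept}" using \<gamma>_inj by (auto simp: inj_on_def)
  show "bij_betw idx UNIV {..<N}" using range_idx idx_inj by (auto simp: bij_betw_def inj_on_def)
qed

text \<open>The realization of \<open>Pos\<close>: a value at the point with all coordinates 1
  exists and is positive.\<close>

definition positive_ratfuns :: "ratfun set" where
  "positive_ratfuns = {z. \<exists>w>0. Ev (\<lambda>_. 1 :: real) z w}"

sublocale coxeter_cartan \<subseteq> cluster_values A d Qw cw Var "\<lambda>k. Var (length kept + k)" positive_ratfuns
proof
  show "u + v \<in> positive_ratfuns" "u * v \<in> positive_ratfuns" "u / v \<in> positive_ratfuns"
    if "u \<in> positive_ratfuns" "v \<in> positive_ratfuns" for u v
  proof -
    obtain a b where ab: "a > 0" "Ev (\<lambda>_. 1 :: real) u a" "b > 0" "Ev (\<lambda>_. 1 :: real) v b"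
      using \<open>u \<in> positive_ratfuns\<close> \<open>v \<in> positive_ratfuns\<close> by (auto simp: positive_ratfuns_def)
    show "u + v \<in> positive_ratfuns" unfolding positive_ratfuns_def
      using ab by (intro CollectI exI[of _ "a + b"]) (auto intro: Ev_add)
    show "u * v \<in> positive_ratfuns" unfolding positive_ratfuns_def
      using ab by (intro CollectI exI[of _ "a * b"]) (auto intro: Ev_mult)
    show "u / v \<in> positive_ratfuns" unfolding positive_ratfuns_def
      using ab by (intro CollectI exI[of _ "a / b"]) (auto intro: Ev_divide)
  qed
  show "1 \<in> positive_ratfuns" using Ev_one[of "\<lambda>_. 1 :: real"] zero_less_one unfolding positive_ratfuns_def by blast
  show "0 \<notin> positive_ratfuns" using Ev_unique[OF _ Ev_zero[of "\<lambda>_. 1 :: real"]] by (auto simp: positive_ratfuns_def)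
  show "Var p \<in> positive_ratfuns" for p
    using Ev_Var[of "\<lambda>_. 1 :: real" p] zero_less_one unfolding positive_ratfuns_def by blast
  then show "Var (length kept + k) \<in> positive_ratfuns" for k .
qed

context coxeter_cartan
begin

section \<open>Distinctness of the cluster variables\<close>

lemma co_initial: assumes "p < N" shows "co I p v = v $ (Qw!p)"
proof -
  have pL: "p < L" using assms N_le_L by simp
  have "Qw!p \<notin> set (com I p)"
  proof
    assume "Qw!p \<in> set (com I p)"
    then obtain q where q: "q < p" "Qw!q = Qw!p" by (auto simp: com_def)
    then have "q < L" "lv q = 0" "lv p = 0" using pL lv_0_iff[of q] lv_0_iff[of p] assms by auto
    then show False using position_inj[of p q] q pL by simp
  qed
  then show ?thesis by (simp add: co_def vi_def rw_coord)
qed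

text \<open>For non-initial k these exponents are the coordinates of the positive root of k; for
  initial k the row of k itself has exponent 1. So setting these coefficients to 0 kills exactly the
  first term of a flip to the right.\<close>

lemma yy_initial_rows:
  assumes I: "facet I" "k \<in> I" "vp (R I k)"
  shows "p < N \<Longrightarrow> yy I p k \<ge> 0" "\<exists>p<N. yy I p k > 0"
proof -
  have k: "k < opp I k" using opp_pos[OF I] by simp
  have nn: "yy I p k \<ge> 0" if p: "p < N" for p
  proof (cases "p \<le> k \<or> opp I k < p")
    case True then show ?thesis using yy_sign(1)[OF I _ True] p N_le_L by simp
  next
    case False
    have "k < N" using False p by simp
    have "Qw!p \<noteq> Qw!k"
    proof
      assume "Qw!p = Qw!k"
      moreover have "lv p = 0" "lv k = 0" using p \<open>k < N\<close> N_le_L lv_0_iff[of p] lv_0_iff[of k] by auto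
      ultimately show False using position_inj[of p k] p \<open>k < N\<close> N_le_L False by simp
    qed
    moreover have "R I k $ (Qw!p) = axis (Qw!k) 1 $ (Qw!p)"
      unfolding R_def vv_def
    proof (rule rw_coord)
      show "Qw!p \<notin> set (com I k)"
      proof
        assume "Qw!p \<in> set (com I k)"
        then obtain q where q: "q < k" "Qw!q = Qw!p" by (auto simp: com_def)
        then show False using position_inj[of p q] p \<open>k < N\<close> N_le_L lv_0_iff[of p] lv_0_iff[of q] False by simp
      qed
    qed
    ultimately show ?thesis using co_initial[OF p, of I "R I k"] by (simp add: yy_def)
  qed
  then show "p < N \<Longrightarrow> yy I p k \<ge> 0" .
  show "\<exists>p<N. yy I p k > 0"
  proof (cases "k < N")
    case True then show ?thesis by (intro exI[of _ k]) (simp add: yy_self)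
  next
    case False
    have "yy I (idx i) k = R I k $ i" for i
      using co_initial[of "idx i" I "R I k"] idx(1)[of i] False by (simp add: yy_def \<gamma>_initial)
    moreover obtain i where "R I k $ i > 0"
      using I(3) roots_nonzero[OF R_roots[of I k]] by (auto simp: vp_def vec_eq_iff) (metis order_le_less)
    ultimately show ?thesis using idx(1)[of i] by (intro exI[of _ "idx i"]) simp
  qed
qed

text \<open>Setting the coefficients \<open>p[\<omega>\<^sub>i]\<close> to \<open>0\<close> and the other coefficients to \<open>1\<close> turns \<open>X p\<close> into the
  Laurent monomial in the initial variables with exponent vector \<open>\<gamma> p\<close>: the first term of every
  relation which moves a position to the right vanishes.\<close>

lemma Ev_X:
  fixes i0
  defines "v \<equiv> \<lambda>k. if k < N then 0 else if k = L + idx i0 then 2 else 1 :: real"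
  assumes p: "p < L"
  shows "Ev v (X p) (2 powi (\<gamma> p $ i0))"
proof -
  \<comment> \<open>The initial variable of \<open>i0\<close> is set to 2 and the others to 1, so
    that a monomial becomes a power of 2 showing one coordinate of its exponent.\<close>
  define g where "g l = (2 powi (l $ i0) :: real)" for l :: "int^'i"
  have gnz: "g l \<noteq> 0" and gadd: "g (l + m) = g l * g m" for l m by (simp_all add: g_def power_int_add)
  have gpow: "g (x *s l) = g l ^ nat x" if "x \<ge> 0" for x l
    using that by (cases x) (simp_all add: g_def power_int_mult mult.commute[of _ "l $ i0"])
  have gsum: "g (\<Sum>i\<in>S. l i) = (\<Prod>i\<in>S. g (l i))" if "finite S" for S and l :: "nat \<Rightarrow> int^'i"
    using that by induction (simp_all add: gadd, simp add: g_def)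
  have "\<forall>k\<in>I. Ev v (X k) (g (\<gamma> k))" if "facet I" for I
    using that
  proof (induction rule: facet_induct)
    case base
    show ?case
    proof
      fix k assume k: "k \<in> I0"
      then have ki: "k = idx (cw!k)" by (simp add: idx_nth)
      have gk: "\<gamma> k = axis (cw!k) 1" using \<gamma>_initial(1)[of "cw!k"] by (simp flip: ki)
      have "k = idx i0 \<longleftrightarrow> cw!k = i0" using ki idx_inj[of "cw!k" i0] by simp
      then have "v (L + k) = g (\<gamma> k)" using N_le_L by (simp add: v_def g_def gk)
      then show "Ev v (X k) (g (\<gamma> k))" using X_initial[of k] Ev_Var[of v "L + k"] k by simp
    qed
  next
    case (step I k)
    let ?k = "opp I k"
    note I = step.hyps
    have fin: "finite I" using facetD(3)[OF I(1)] .
    have "Ev v (mp (\<lambda>p. pos (yy I p k))) (\<Prod>p<L. v p ^ nat (pos (yy I p k)))"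
      unfolding mp_def by (intro Ev_prod Ev_power Ev_Var)
    moreover have "(\<Prod>p<L. v p ^ nat (pos (yy I p k))) = 0"
    proof -
      obtain p where p: "p < N" "yy I p k > 0" using yy_initial_rows(2)[OF I] by auto
      then have "v p ^ nat (pos (yy I p k)) = 0" "p \<in> {..<L}" using N_le_L by (auto simp: v_def)
      then show ?thesis by (meson finite_lessThan prod_zero)
    qed
    ultimately have e1: "Ev v (mp (\<lambda>p. pos (yy I p k))) 0" by (simp only:)
    have "Ev v (mp (\<lambda>p. pos (- yy I p k))) (\<Prod>p<L. v p ^ nat (pos (- yy I p k)))"
      unfolding mp_def by (intro Ev_prod Ev_power Ev_Var)
    moreover have "(\<Prod>p<L. v p ^ nat (pos (- yy I p k))) = 1"
      using yy_initial_rows(1)[OF I] by (intro prod.neutral) (auto simp: v_def)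
    ultimately have e2: "Ev v (mp (\<lambda>p. pos (- yy I p k))) 1" by (simp only:)
    have prods: "Ev v (\<Prod>i\<in>I. X i ^ nat (pos (e i))) (\<Prod>i\<in>I. g (\<gamma> i) ^ nat (pos (e i)))" for e
      using step.IH by (intro Ev_prod Ev_power) auto
    have "Ev v (exr I k X) (0 * (\<Prod>i\<in>I. g (\<gamma> i) ^ nat (pos (bb I i k))) + 1 * (\<Prod>i\<in>I. g (\<gamma> i) ^ nat (pos (- bb I i k))))"
      unfolding exr_def by (intro Ev_add Ev_mult e1 e2 prods)
    moreover have "(\<Prod>i\<in>I. g (\<gamma> i) ^ nat (pos (- bb I i k))) = g (\<gamma> k + \<gamma> ?k)"
    proof -
      have kk: "k < ?k" "?k \<notin> I" using opp_pos[OF I] opp[OF I(1)] by auto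
      have "(\<Prod>i\<in>I. g (\<gamma> i) ^ nat (pos (- bb I i k))) = (\<Prod>i\<in>I \<inter> {k<..<?k}. g (\<gamma> i) ^ nat (- cc I k i))"
      proof (rule prod.mono_neutral_cong_right[OF fin])
        show "\<forall>i\<in>I - I \<inter> {k<..<?k}. g (\<gamma> i) ^ nat (pos (- bb I i k)) = 1"
        proof
          fix i assume i: "i \<in> I - I \<inter> {k<..<?k}"
          then have "i \<noteq> ?k" "\<not> (k < i \<and> i < ?k)" using kk(2) by auto
          then consider "i = k" | "i < k" | "?k < i" by linarith
          then show "g (\<gamma> i) ^ nat (pos (- bb I i k)) = 1"
            using cc_opp_signs(1,2)[OF I, of i] i kk(1) by cases (auto simp: bb_def)
        qed
      qed (auto simp: bb_def)
      also have "\<dots> = (\<Prod>i\<in>I \<inter> {k<..<?k}. g ((- cc I k i) *s \<gamma> i))"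
        using cc_opp_signs(3)[OF I] by (intro prod.cong) (auto simp: gpow)
      also have "\<dots> = g (\<Sum>i\<in>I \<inter> {k<..<?k}. (- cc I k i) *s \<gamma> i)" using fin by (simp add: gsum)
      also have "(\<Sum>i\<in>I \<inter> {k<..<?k}. (- cc I k i) *s \<gamma> i) = \<gamma> k + \<gamma> ?k"
        unfolding flip_between[OF I] sum_negf[symmetric] by (intro sum.cong) (auto simp: vec_eq_iff)
      finally show ?thesis .
    qed
    ultimately have "Ev v (exr I k X) (g (\<gamma> k) * g (\<gamma> ?k))" by (simp add: gadd)
    then have "Ev v (exr I k X / X k) (g (\<gamma> k) * g (\<gamma> ?k) / g (\<gamma> k))"
      using step.IH I(2) gnz by (intro Ev_divide) auto
    moreover have "exr I k X / X k = X ?k"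
      using exchange_relations_hold[OF I(1,2)] X_nz[of k] by (simp add: field_simps)
    ultimately have "Ev v (X ?k) (g (\<gamma> ?k))" using gnz[of "\<gamma> k"] by simp
    then show ?case using step.IH by (auto simp: flip_def)
  qed
  from this[OF facet_slice[of p]] slice_self[OF p] p show ?thesis by (simp add: g_def)
qed

lemma X_inj: assumes "p < L" "q < L" "X p = X q" shows "p = q"
proof -
  have "\<gamma> p $ i = \<gamma> q $ i" for i
  proof -
    have "(2::real) powi (\<gamma> p $ i) = 2 powi (\<gamma> q $ i)"
      using Ev_X[OF assms(1), of i] Ev_X[OF assms(2), of i] unfolding assms(3) by (rule Ev_unique)
    then show ?thesis
      using power_int_strict_increasing[of "\<gamma> p $ i" "\<gamma> q $ i" "2::real"]
        power_int_strict_increasing[of "\<gamma> q $ i" "\<gamma> p $ i" "2::real"]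
      by (cases "\<gamma> p $ i" "\<gamma> q $ i" rule: linorder_cases) auto
  qed
  then show ?thesis using \<gamma>_inj[OF assms(1,2)] by (simp add: vec_eq_iff)
qed

section \<open>Seeds\<close>

lemma J_eq: "Lau.J = W"
  by (simp add: Lau.J_def cox_weights_eq)

definition ps :: "int^'i \<Rightarrow> nat" where "ps l = inv_into {..<L} \<gamma> l"

lemma ps_\<gamma> [simp]: "p < L \<Longrightarrow> ps (\<gamma> p) = p"
  unfolding ps_def using inv_into_f_f[OF Lau.inj_label] by simp

definition mono :: "(nat \<Rightarrow> int) \<Rightarrow> (int^'i) \<Rightarrow>\<^sub>0 int" where
  "mono u = (\<Sum>l\<in>W. frag_cmul (u (ps l)) (frag_of l))"

lemma finite_W: "finite W"
  by (simp add: cox_weights_eq)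

lemma lookup_mono: "Poly_Mapping.lookup (mono u) l = (if l \<in> W then u (ps l) else 0)"
  unfolding mono_def by (rule lookup_sum_frag[OF finite_W])

lemma ps_W: "l \<in> W \<Longrightarrow> ps l < L \<and> \<gamma> (ps l) = l"
  unfolding cox_weights_eq by auto

lemma mono_cong: "(\<And>p. p < L \<Longrightarrow> u p = u' p) \<Longrightarrow> mono u = mono u'"
  by (rule poly_mapping_eqI) (use ps_W in \<open>auto simp: lookup_mono\<close>)

lemma mono_ops: "mono u + mono u' = mono (\<lambda>p. u p + u' p)" "- mono u = mono (\<lambda>p. - u p)"
  "frag_cmul z (mono u) = mono (\<lambda>p. z * u p)" "trop_plus (mono u) 0 = mono (\<lambda>p. min (u p) 0)"
proof -
  have "Poly_Mapping.lookup (trop_plus a b) j = min (Poly_Mapping.lookup a j) (Poly_Mapping.lookup b j)"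
    for a b :: "(int^'i) \<Rightarrow>\<^sub>0 int" and j by transfer simp
  then show "mono u + mono u' = mono (\<lambda>p. u p + u' p)" "- mono u = mono (\<lambda>p. - u p)"
    "frag_cmul z (mono u) = mono (\<lambda>p. z * u p)" "trop_plus (mono u) 0 = mono (\<lambda>p. min (u p) 0)"
    by (auto intro!: poly_mapping_eqI simp: lookup_mono lookup_add)
qed

lemma mono_carrier: "mono u \<in> carrier (Trop W)"
  by (auto simp: in_keys_iff lookup_mono split: if_splits)

lemma emb_mono: "Lau.emb (mono u) = (\<Prod>p<L. Var p powi u p)"
  unfolding Lau.emb_def by (intro prod.cong) (auto simp: lookup_mono cox_weights_eq)

abbreviation "P \<equiv> Trop W"

definition sd :: "('i \<Rightarrow> nat) \<Rightarrow> ('i, (int^'i) \<Rightarrow>\<^sub>0 int, ratfun) seed" where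
  "sd e = (\<lambda>i. X (e i), \<lambda>j. mono (\<lambda>p. YY e p j), BB e)"

text \<open>The embedded y_k \<oplus> 1 has exponents min(y, 0). Multiplying the relation by it
  turns the coefficients of the two terms into y_k and 1.\<close>

lemma exchange_variable_sd:
  assumes e: "lfacet e" shows "exchange_variable P Lau.emb k (sd e) = X (lflip e k k)"
proof -
  define y where "y = (\<lambda>p. YY e p k)"
  have split: "Lau.emb (mono y) = mp (\<lambda>p. pos (y p)) * Lau.emb (mono (\<lambda>p. min (y p) 0))"
    "mp (\<lambda>p. pos (- y p)) * Lau.emb (mono (\<lambda>p. min (y p) 0)) = 1"
  proof -
    have "Var p powi y p = Var p ^ nat (y p) * Var p powi min (y p) 0 \<and>
      Var p ^ nat (- y p) * Var p powi min (y p) 0 = 1" for p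
    proof (cases "y p \<ge> 0")
      case False
      then have "min (y p) 0 = y p" "nat (y p) = 0" by auto
      moreover have "Var p powi y p = inverse (Var p) ^ nat (- y p)" using False by (simp add: power_int_def)
      ultimately show ?thesis using Var_nz[of p] by (simp flip: power_mult_distrib)
    qed (simp add: power_int_def)
    then show "Lau.emb (mono y) = mp (\<lambda>p. pos (y p)) * Lau.emb (mono (\<lambda>p. min (y p) 0))"
      "mp (\<lambda>p. pos (- y p)) * Lau.emb (mono (\<lambda>p. min (y p) 0)) = 1"
      unfolding emb_mono mp_def prod.distrib[symmetric] by simp_all
  qed
  let ?m = "Lau.emb (mono (\<lambda>p. min (y p) 0))"
  let ?x = "X (e k)" and ?x' = "X (lflip e k k)"
  define E1 where "E1 = (\<Prod>i\<in>UNIV. X (e i) ^ nat (pos (BB e$i$k)))"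
  define E2 where "E2 = (\<Prod>i\<in>UNIV. X (e i) ^ nat (pos (- BB e$i$k)))"
  have "?x * ?x' = mp (\<lambda>p. pos (y p)) * E1 + mp (\<lambda>p. pos (- y p)) * E2"
    using exchange_relations_hold[OF lfacetD(1)[OF e] rangeI[of e k]]
    by (simp only: exr_lfacet[OF e] lflip_simps y_def E1_def E2_def)
  then have "?m * (?x * ?x') = (mp (\<lambda>p. pos (y p)) * ?m) * E1 + (mp (\<lambda>p. pos (- y p)) * ?m) * E2"
    by (simp add: algebra_simps)
  then have eq: "?m * (?x * ?x') = Lau.emb (mono y) * E1 + E2" by (simp only: split(2) split(1)[symmetric] mult_1)
  have "exchange_variable P Lau.emb k (sd e) = (Lau.emb (mono y) * E1 + E2) / (?m * ?x)"
    by (simp only: exchange_variable_def sd_def y_def E1_def E2_def mono_ops prod.case Trop_simps)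
  then show ?thesis using X_nz[of "e k"] Lau.emb_nz[of "mono (\<lambda>p. min (y p) 0)"] by (simp flip: eq)
qed

lemma sd_lflip: assumes e: "lfacet e" shows "seed_mutation P Lau.emb k (sd e) = sd (lflip e k)"
proof -
  have x: "(\<lambda>i. X (e i))(k := X (lflip e k k)) = (\<lambda>i. X (lflip e k i))" by (auto simp: lflip_def)
  have y: "coeff_mutation P k (\<lambda>j. mono (\<lambda>p. YY e p j)) (BB e) = (\<lambda>j. mono (\<lambda>p. YY (lflip e k) p j))"
  proof
    fix j
    have "coeff_mutation P k (\<lambda>j. mono (\<lambda>p. YY e p j)) (BB e) j = mono (\<lambda>p. mut_row k (BB e) (YY e p) j)"
      using Trop_inv[OF mono_carrier] Trop_int_pow[OF mono_carrier]
      by (auto simp: coeff_mutation_def mut_row_def mono_ops intro!: mono_cong simp del: Trop_simps(1))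
    also have "\<dots> = mono (\<lambda>p. YY (lflip e k) p j)" by (rule mono_cong) (simp add: YY_lflip[OF e])
    finally show "coeff_mutation P k (\<lambda>j. mono (\<lambda>p. YY e p j)) (BB e) j = mono (\<lambda>p. YY (lflip e k) p j)" .
  qed
  have "exchange_variable P Lau.emb k (\<lambda>i. X (e i), \<lambda>j. mono (\<lambda>p. YY e p j), BB e) = X (lflip e k k)"
    using exchange_variable_sd[OF e, of k] by (simp add: sd_def)
  then show ?thesis by (simp only: seed_mutation_def sd_def prod.case x y BB_lflip[OF e])
qed

abbreviation "\<S> \<equiv> mutation_class P Lau.emb (sd idx)"

lemma seeds_lfacet: "s \<in> \<S> \<Longrightarrow> \<exists>e. lfacet e \<and> s = sd e"
  by (induction rule: mutation_class.induct) (use lfacet_idx sd_lflip lfacet_lflip in blast)+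

lemma facet_reachable: assumes "facet I" shows "\<exists>e. lfacet e \<and> range e = I \<and> sd e \<in> \<S>"
  using assms
proof (induction rule: facet_induct)
  case base then show ?case using lfacet_idx range_idx mutation_class.initial by metis
next
  case (step I k)
  then obtain e where e: "lfacet e" "range e = I" "sd e \<in> \<S>" by blast
  obtain i where "k = e i" using step.hyps(2) e(2) by auto
  then have "range (lflip e i) = flip I k" using range_lflip[OF e(1)] e(2) by simp
  moreover have "sd (lflip e i) \<in> \<S>" using mutation_class.mutate[OF e(3), of i] sd_lflip[OF e(1)] by simp
  ultimately show ?case using lfacet_lflip[OF e(1)] by blast
qed

section \<open>The primitive exchange relations as formal objects\<close>

definition erel :: "('i \<Rightarrow> nat) \<Rightarrow> 'i \<Rightarrow> ((int^'i) \<Rightarrow>\<^sub>0 int, ratfun) exch_rel" where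
  "erel e k = ({# X (e k), X (lflip e k k) #},
     {# (mono (\<lambda>p. pos (YY e p k)), \<Sum>i\<in>UNIV. replicate_mset (nat (BB e$i$k)) (X (e i))),
        (mono (\<lambda>p. pos (- YY e p k)), \<Sum>i\<in>UNIV. replicate_mset (nat (- BB e$i$k)) (X (e i))) #})"

lemma exchange_relation_sd:
  assumes e: "lfacet e" shows "exchange_relation P Lau.emb k (sd e) = erel e k"
proof -
  define y where "y = (\<lambda>p. YY e p k)"
  have inv: "inv\<^bsub>P\<^esub> (splus P (mono y) \<one>\<^bsub>P\<^esub>) = mono (\<lambda>p. pos (- y p))"
  proof -
    have "inv\<^bsub>P\<^esub> (splus P (mono y) \<one>\<^bsub>P\<^esub>) = - mono (\<lambda>p. min (y p) 0)"
      using Trop_inv[OF mono_carrier] by (simp add: mono_ops del: Trop_simps(1))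
    also have "\<dots> = mono (\<lambda>p. pos (- y p))"
      unfolding mono_ops by (rule mono_cong) (simp add: Defs.pos_def max_def min_def)
    finally show ?thesis .
  qed
  have "mono y + mono (\<lambda>p. pos (- y p)) = mono (\<lambda>p. pos (y p))"
    unfolding mono_ops by (rule mono_cong) (simp add: Defs.pos_def max_def)
  then show ?thesis
    using exchange_variable_sd[OF e, of k] inv
    by (simp add: exchange_relation_def erel_def sd_def y_def)
qed

lemma erel_lflip: assumes e: "lfacet e" shows "erel (lflip e k) k = erel e k"
proof -
  have B: "BB (lflip e k)$i$k = - BB e$i$k" for i
    by (cases "i = k") (simp_all add: BB_lflip[OF e] matrix_mutation_def)
  have Bk: "BB e$k$k = 0" by (simp add: BB_def)
  have "YY (lflip e k) p k = - YY e p k" if "p < L" for p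
    using YY_lflip[OF e that] by (simp add: mut_row_def)
  then have y: "mono (\<lambda>p. pos (YY (lflip e k) p k)) = mono (\<lambda>p. pos (- YY e p k))"
    "mono (\<lambda>p. pos (- YY (lflip e k) p k)) = mono (\<lambda>p. pos (YY e p k))" by (auto intro: mono_cong)
  have s: "replicate_mset (nat (BB (lflip e k)$i$k)) (X (lflip e k i)) = replicate_mset (nat (- BB e$i$k)) (X (e i))"
    "replicate_mset (nat (- BB (lflip e k)$i$k)) (X (lflip e k i)) = replicate_mset (nat (BB e$i$k)) (X (e i))" for i
    using Bk by (cases "i = k"; simp add: B)+
  show ?thesis unfolding erel_def s y lflip_lflip[OF e] by (simp add: add_mset_commute)
qed

definition xw :: "int^'i \<Rightarrow> ratfun" where "xw l = X (ps l)"

lemma xw_\<gamma>: "p < L \<Longrightarrow> xw (\<gamma> p) = X p"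
  by (simp add: xw_def)

definition T1 :: "'i \<Rightarrow> ((int^'i) \<Rightarrow>\<^sub>0 int, ratfun) exch_rel" where
  "T1 k = ({# xw (- \<omega> k), xw (\<omega> k) #},
     {# (frag_of (\<omega> k),
          (\<Sum>i | prec A cq i k. replicate_mset (nat (- A$i$k)) (xw (\<omega> i))) +
          (\<Sum>i | prec A cq k i. replicate_mset (nat (- A$i$k)) (xw (- \<omega> i)))),
        (finprod P (\<lambda>\<gamma>. frag_of \<gamma> [^]\<^bsub>P\<^esub> compat A cq \<gamma> (\<omega> k)) W, {#}) #})"

definition T2 :: "'i \<Rightarrow> nat \<Rightarrow> ((int^'i) \<Rightarrow>\<^sub>0 int, ratfun) exch_rel" where
  "T2 k m = ({# xw ((cq^^(m-1)) (\<omega> k)), xw ((cq^^m) (\<omega> k)) #},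
     {# (frag_of ((cq^^m) (\<omega> k)),
          (\<Sum>i | prec A cq i k. replicate_mset (nat (- A$i$k)) (xw ((cq^^m) (\<omega> i)))) +
          (\<Sum>i | prec A cq k i. replicate_mset (nat (- A$i$k)) (xw ((cq^^(m-1)) (\<omega> i))))),
        (finprod P (\<lambda>\<gamma>. frag_of \<gamma> [^]\<^bsub>P\<^esub> compat A cq \<gamma> ((cq^^m) (\<omega> k))) W, {#}) #})"

lemma frag_carrier: "l \<in> W \<Longrightarrow> frag_of l \<in> carrier P"
  by (simp add: keys_frag_of)

lemma mono_unit: assumes "q < L" shows "mono (\<lambda>p. if p = q then 1 else 0) = frag_of (\<gamma> q)"
proof (rule poly_mapping_eqI)
  fix l
  show "Poly_Mapping.lookup (mono (\<lambda>p. if p = q then 1 else 0)) l = Poly_Mapping.lookup (frag_of (\<gamma> q)) l"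
    using ps_W[of l] assms cox_weights_eq by (auto simp: lookup_mono)
qed

lemma finprod_degree:
  assumes "q < L"
  shows "finprod P (\<lambda>l. frag_of l [^]\<^bsub>P\<^esub> compat A cq l (\<gamma> q)) W = mono (\<lambda>p. degree p q)"
proof -
  have "finprod P (\<lambda>l. frag_of l [^]\<^bsub>P\<^esub> compat A cq l (\<gamma> q)) W
      = (\<Sum>l\<in>W. frag_of l [^]\<^bsub>P\<^esub> compat A cq l (\<gamma> q))"
    by (rule Trop_finprod[OF finite_W]) (simp only: Trop_nat_pow frag_cmul_carrier frag_carrier)
  also have "\<dots> = mono (\<lambda>p. degree p q)"
    unfolding mono_def
  proof (rule sum.cong[OF HOL.refl])
    fix l assume "l \<in> W"
    then have "ps l < L" "\<gamma> (ps l) = l" using ps_W by auto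
    then have "int (compat A cq l (\<gamma> q)) = degree (ps l) q" using compat_eq[OF _ assms, of "ps l"] by simp
    then show "frag_of l [^]\<^bsub>P\<^esub> compat A cq l (\<gamma> q) = frag_cmul (degree (ps l) q) (frag_of l)"
      by (simp add: Trop_nat_pow)
  qed
  finally show ?thesis .
qed

lemma sum_range_lfacet:
  assumes "lfacet e" shows "(\<Sum>i\<in>UNIV. g (e i)) = (\<Sum>i\<in>range e. g i)"
  using assms by (simp add: lfacet_def sum.reindex)

lemma erel_facet:
  assumes e: "lfacet e"
  shows "erel e k = ({# X (e k), X (opp (range e) (e k)) #},
     {# (mono (\<lambda>p. pos (yy (range e) p (e k))), \<Sum>i\<in>range e. replicate_mset (nat (bb (range e) i (e k))) (xw (\<gamma> i))),
        (mono (\<lambda>p. pos (- yy (range e) p (e k))), \<Sum>i\<in>range e. replicate_mset (nat (- bb (range e) i (e k))) (xw (\<gamma> i))) #})"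
proof -
  have x: "xw (\<gamma> i) = X i" if "i \<in> range e" for i using xw_\<gamma> lfacetD(3)[OF e] that by auto
  have "(\<Sum>i\<in>range e. replicate_mset (nat (u * bb (range e) i (e k))) (xw (\<gamma> i))) =
      (\<Sum>i\<in>UNIV. replicate_mset (nat (u * BB e$i$k)) (X (e i)))" for u
    using sum_range_lfacet[OF e, of "\<lambda>i. replicate_mset (nat (u * bb (range e) i (e k))) (X i)"] x
    by (simp add: BB_def cong: sum.cong)
  from this[of 1] this[of "-1"] show ?thesis by (simp add: erel_def YY_def)
qed

lemma sum_empty: "(\<And>i. i \<in> S \<Longrightarrow> u i = {#}) \<Longrightarrow> (\<Sum>i\<in>S. u i) = {#}"
  by (rule sum.neutral) auto

lemma antipodal_relation:
  assumes e: "lfacet e" and pos: "vp (R (range e) (e k))"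
    and zero: "\<And>i. i \<in> range e \<Longrightarrow> e k < i \<Longrightarrow> i < opp (range e) (e k) \<Longrightarrow> cc (range e) (e k) i = 0"
  shows "\<exists>\<kappa>. e k = idx \<kappa> \<and> erel e k = T1 \<kappa>"
proof -
  let ?I = "range e" and ?k = "e k" and ?o = "opp (range e) (e k)"
  note I = lfacetD(1)[OF e] rangeI[of e k] pos
  obtain \<kappa> where \<kappa>: "?k = idx \<kappa>" "\<gamma> ?o = - axis \<kappa> 1"
    "\<forall>p<L. pos (yy ?I p ?k) = (if p = ?k then 1 else 0) \<and> pos (- yy ?I p ?k) = degree p ?k"
    "\<forall>x :: int^'i \<Rightarrow> ratfun. (\<Sum>i\<in>?I. replicate_mset (nat (bb ?I i ?k)) (x (\<gamma> i))) =
      (\<Sum>i | prec A cq i \<kappa>. replicate_mset (nat (- A$i$\<kappa>)) (x (axis i 1))) +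
      (\<Sum>i | prec A cq \<kappa> i. replicate_mset (nat (- A$i$\<kappa>)) (x (- axis i 1)))"
    using antipodal_exchange[OF I zero] by blast
  have kL: "?k < L" "?o < L" using lfacetD(3)[OF e] opp[OF I(1)] by auto
  have gk: "\<gamma> ?k = axis \<kappa> 1" by (simp add: \<kappa>(1) \<gamma>_initial)
  have m1: "mono (\<lambda>p. pos (yy ?I p ?k)) = frag_of (axis \<kappa> 1)"
  proof -
    have "mono (\<lambda>p. pos (yy ?I p ?k)) = mono (\<lambda>p. if p = ?k then 1 else 0)" by (rule mono_cong) (use \<kappa>(3) in blast)
    then show ?thesis using mono_unit[OF kL(1)] gk by simp
  qed
  have m2: "mono (\<lambda>p. pos (- yy ?I p ?k)) = finprod P (\<lambda>l. frag_of l [^]\<^bsub>P\<^esub> compat A cq l (axis \<kappa> 1)) W"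
  proof -
    have "mono (\<lambda>p. pos (- yy ?I p ?k)) = mono (\<lambda>p. degree p ?k)" by (rule mono_cong) (use \<kappa>(3) in blast)
    then show ?thesis using finprod_degree[OF kL(1)] gk by simp
  qed
  have s2: "(\<Sum>i\<in>?I. replicate_mset (nat (- bb ?I i ?k)) (xw (\<gamma> i))) = {#}"
  proof (rule sum_empty)
    fix i assume i: "i \<in> ?I"
    have "i \<noteq> ?o" using opp(2)[OF I(1), of ?k] i by metis
    then consider "i = ?k" | "i < ?k" | "?k < i" "i < ?o" | "?o < i" by linarith
    then have "- bb ?I i ?k \<le> 0"
      using cc_opp_signs[OF I i] zero[OF i] opp_pos(1)[OF I] by cases (auto simp: bb_def)
    then show "replicate_mset (nat (- bb ?I i ?k)) (xw (\<gamma> i)) = {#}" by simp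
  qed
  have x1: "X ?k = xw (axis \<kappa> 1)" "X ?o = xw (- axis \<kappa> 1)" using xw_\<gamma>[OF kL(1)] xw_\<gamma>[OF kL(2)] gk \<kappa>(2) by auto
  have "erel e k = T1 \<kappa>"
    unfolding erel_facet[OF e] T1_def fundamental_weight_def m1 m2 s2 x1 \<kappa>(4)[rule_format]
    by (simp add: add_mset_commute)
  then show ?thesis using \<kappa>(1) by blast
qed

lemma shift_relation:
  assumes e: "lfacet e" and pos: "vp (R (range e) (e k))"
    and zero: "\<And>i. i \<in> range e \<Longrightarrow> i < e k \<or> opp (range e) (e k) < i \<Longrightarrow> cc (range e) (e k) i = 0"
  shows "\<exists>\<kappa> m. 1 \<le> m \<and> m \<le> h \<kappa> \<and> \<gamma> (e k) = wt \<kappa> (m - 1) \<and> erel e k = T2 \<kappa> m"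
proof -
  let ?I = "range e" and ?k = "e k" and ?o = "opp (range e) (e k)"
  note I = lfacetD(1)[OF e] rangeI[of e k] pos
  obtain \<kappa> m where \<kappa>: "1 \<le> m" "m \<le> h \<kappa>" "\<gamma> ?k = wt \<kappa> (m - 1)" "\<gamma> ?o = wt \<kappa> m"
    "\<forall>p<L. pos (yy ?I p ?k) = degree p ?o \<and> pos (- yy ?I p ?k) = (if p = ?o then 1 else 0)"
    "\<forall>x :: int^'i \<Rightarrow> ratfun. (\<Sum>i\<in>?I. replicate_mset (nat (- bb ?I i ?k)) (x (\<gamma> i))) =
      (\<Sum>i | prec A cq i \<kappa>. replicate_mset (nat (- A$i$\<kappa>)) (x (wt i m))) +
      (\<Sum>i | prec A cq \<kappa> i. replicate_mset (nat (- A$i$\<kappa>)) (x (wt i (m - 1))))"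
    using shift_exchange[OF I zero] by blast
  have kL: "?k < L" "?o < L" using lfacetD(3)[OF e] opp[OF I(1)] by auto
  have m1: "mono (\<lambda>p. pos (- yy ?I p ?k)) = frag_of (wt \<kappa> m)"
  proof -
    have "mono (\<lambda>p. pos (- yy ?I p ?k)) = mono (\<lambda>p. if p = ?o then 1 else 0)" by (rule mono_cong) (use \<kappa>(5) in blast)
    then show ?thesis using mono_unit[OF kL(2)] \<kappa>(4) by simp
  qed
  have m2: "mono (\<lambda>p. pos (yy ?I p ?k)) = finprod P (\<lambda>l. frag_of l [^]\<^bsub>P\<^esub> compat A cq l (wt \<kappa> m)) W"
  proof -
    have "mono (\<lambda>p. pos (yy ?I p ?k)) = mono (\<lambda>p. degree p ?o)" by (rule mono_cong) (use \<kappa>(5) in blast)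
    then show ?thesis using finprod_degree[OF kL(2)] \<kappa>(4) by simp
  qed
  have s2: "(\<Sum>i\<in>?I. replicate_mset (nat (bb ?I i ?k)) (xw (\<gamma> i))) = {#}"
  proof (rule sum_empty)
    fix i assume i: "i \<in> ?I"
    have "i \<noteq> ?o" using opp(2)[OF I(1), of ?k] i by metis
    then consider "i = ?k" | "i < ?k" | "?k < i" "i < ?o" | "?o < i" by linarith
    then have "bb ?I i ?k \<le> 0"
      using cc_opp_signs[OF I i] zero[OF i] opp_pos(1)[OF I] by cases (auto simp: bb_def)
    then show "replicate_mset (nat (bb ?I i ?k)) (xw (\<gamma> i)) = {#}" by simp
  qed
  have x1: "X ?k = xw (wt \<kappa> (m - 1))" "X ?o = xw (wt \<kappa> m)" using xw_\<gamma>[OF kL(1)] xw_\<gamma>[OF kL(2)] \<kappa>(3,4) by auto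
  have "erel e k = T2 \<kappa> m"
    unfolding erel_facet[OF e] T2_def fundamental_weight_def m1 m2 s2 x1 \<kappa>(6)[rule_format]
    by (simp add: add_mset_commute)
  then show ?thesis using \<kappa> by blast
qed

lemma primitive_T: "primitive (T1 k)" "primitive (T2 k m)"
  by (auto simp: primitive_def T1_def T2_def)

text \<open>The factors of the first term sit outside the interval of the flip and those of the
  second inside. An empty term therefore is the hypothesis of \<open>shift_relation\<close> or of
  \<open>antipodal_relation\<close>, respectively.\<close>

lemma primitive_erel:
  assumes e: "lfacet e" and pos: "vp (R (range e) (e k))" and prim: "primitive (erel e k)"
  shows "(\<exists>\<kappa>. erel e k = T1 \<kappa>) \<or> (\<exists>\<kappa> m. 1 \<le> m \<and> m \<le> h \<kappa> \<and> erel e k = T2 \<kappa> m)"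
proof -
  let ?I = "range e" and ?k = "e k" and ?o = "opp (range e) (e k)"
  note I = lfacetD(1)[OF e] rangeI[of e k] pos
  have fin: "finite ?I" by simp
  have emp: "nat (g i) = 0" if "(\<Sum>i\<in>?I. replicate_mset (nat (g i)) (xw (\<gamma> i))) = {#}" "i \<in> ?I" for g :: "nat \<Rightarrow> int" and i
  proof -
    have "replicate_mset (nat (g i)) (xw (\<gamma> i)) = {#}"
      using that sum.remove[OF fin that(2), of "\<lambda>i. replicate_mset (nat (g i)) (xw (\<gamma> i))"] by simp
    then show ?thesis by (metis replicate_mset_eq_empty_iff)
  qed
  have "(\<Sum>i\<in>?I. replicate_mset (nat (bb ?I i ?k)) (xw (\<gamma> i))) = {#} \<or>
      (\<Sum>i\<in>?I. replicate_mset (nat (- bb ?I i ?k)) (xw (\<gamma> i))) = {#}"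
    using prim unfolding erel_facet[OF e] primitive_def by fastforce
  then show ?thesis
  proof
    assume a: "(\<Sum>i\<in>?I. replicate_mset (nat (bb ?I i ?k)) (xw (\<gamma> i))) = {#}"
    have "cc ?I ?k i = 0" if i: "i \<in> ?I" "i < ?k \<or> ?o < i" for i
      using emp[OF a i(1)] cc_opp_signs(1,2)[OF I i(1)] i(2) opp_pos(1)[OF I] by (auto simp: bb_def split: if_splits)
    from shift_relation[OF e pos this] show ?thesis by blast
  next
    assume a: "(\<Sum>i\<in>?I. replicate_mset (nat (- bb ?I i ?k)) (xw (\<gamma> i))) = {#}"
    have "cc ?I ?k i = 0" if i: "i \<in> ?I" "?k < i" "i < ?o" for i
      using emp[OF a i(1)] cc_opp_signs(3)[OF I i] i(2) by (auto simp: bb_def)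
    from antipodal_relation[OF e pos this] show ?thesis by blast
  qed
qed

lemma primitive_relations:
  "{r. (\<exists>k s. r = exchange_relation P Lau.emb k s \<and> s \<in> \<S>) \<and> primitive r} =
    {T1 k | k. True} \<union> {T2 k m | k m. 1 \<le> m \<and> m \<le> h k}"
proof (intro equalityI subsetI)
  fix r assume "r \<in> {r. (\<exists>k s. r = exchange_relation P Lau.emb k s \<and> s \<in> \<S>) \<and> primitive r}"
  then obtain k s where r: "r = exchange_relation P Lau.emb k s" "s \<in> \<S>" "primitive r" by blast
  obtain e where e: "lfacet e" "s = sd e" using seeds_lfacet[OF r(2)] by blast
  have re: "r = erel e k" by (simp add: r(1) e(2) exchange_relation_sd[OF e(1)])
  have "(\<exists>\<kappa>. r = T1 \<kappa>) \<or> (\<exists>\<kappa> m. 1 \<le> m \<and> m \<le> h \<kappa> \<and> r = T2 \<kappa> m)"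
  proof (cases "vp (R (range e) (e k))")
    case True then show ?thesis using primitive_erel[OF e(1)] r(3) re by simp
  next
    case False
    have "r = erel (lflip e k) k" using erel_lflip[OF e(1)] re by simp
    then show ?thesis using primitive_erel[OF lfacet_lflip[OF e(1)] lflip_neg[OF e(1) False]] r(3) by simp
  qed
  then show "r \<in> {T1 k | k. True} \<union> {T2 k m | k m. 1 \<le> m \<and> m \<le> h k}" by blast
next
  fix r assume "r \<in> {T1 k | k. True} \<union> {T2 k m | k m. 1 \<le> m \<and> m \<le> h k}"
  then consider \<kappa> where "r = T1 \<kappa>" | \<kappa> m where "r = T2 \<kappa> m" "1 \<le> m" "m \<le> h \<kappa>" by blast
  then have "\<exists>e k. lfacet e \<and> sd e \<in> \<S> \<and> r = erel e k \<and> primitive r"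
  proof cases
    case 1
    obtain I where I: "facet I" "idx \<kappa> \<in> I" "vp (R I (idx \<kappa>))"
      "\<And>i. i \<in> I \<Longrightarrow> idx \<kappa> < i \<Longrightarrow> i < opp I (idx \<kappa>) \<Longrightarrow> cc I (idx \<kappa>) i = 0"
      by (rule antipodal_exchange_exists[of \<kappa>]) blast
    obtain e where e: "lfacet e" "range e = I" "sd e \<in> \<S>" using facet_reachable[OF I(1)] by blast
    obtain k where k: "e k = idx \<kappa>" using I(2) e(2) by auto
    have "\<exists>\<kappa>'. e k = idx \<kappa>' \<and> erel e k = T1 \<kappa>'"
      by (rule antipodal_relation[OF e(1)]) (simp_all add: e(2) k I)
    then have "erel e k = T1 \<kappa>" using k idx_inj by metis
    then show ?thesis using e 1 primitive_T by metis
  next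
    case 2
    obtain I k where I: "facet I" "k \<in> I" "vp (R I k)" "\<gamma> k = wt \<kappa> (m - 1)"
      "\<And>i. i \<in> I \<Longrightarrow> i < k \<or> opp I k < i \<Longrightarrow> cc I k i = 0"
      by (rule shift_exchange_exists[OF 2(2,3)]) blast
    obtain e where e: "lfacet e" "range e = I" "sd e \<in> \<S>" using facet_reachable[OF I(1)] by blast
    obtain i where i: "e i = k" using I(2) e(2) by auto
    have "\<exists>\<kappa>' m'. 1 \<le> m' \<and> m' \<le> h \<kappa>' \<and> \<gamma> (e i) = wt \<kappa>' (m' - 1) \<and> erel e i = T2 \<kappa>' m'"
      by (rule shift_relation[OF e(1)]) (use e(2) i I in auto)
    then obtain \<kappa>' m' where t: "1 \<le> m'" "m' \<le> h \<kappa>'" "wt \<kappa> (m - 1) = wt \<kappa>' (m' - 1)" "erel e i = T2 \<kappa>' m'"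
      using I(4) i by auto
    have "m - 1 = m' - 1 \<and> \<kappa> = \<kappa>'" by (rule wt_unique[OF t(3)]) (use t 2 in linarith)+
    then have "erel e i = T2 \<kappa> m" using t(1,4) 2(2) by (metis le_add_diff_inverse2)
    then show ?thesis using e 2(1) primitive_T by metis
  qed
  then obtain e k where ek: "lfacet e" "sd e \<in> \<S>" "r = erel e k" "primitive r" by blast
  then have "r = exchange_relation P Lau.emb k (sd e)" by (simp only: exchange_relation_sd)
  then show "r \<in> {r. (\<exists>k s. r = exchange_relation P Lau.emb k s \<and> s \<in> \<S>) \<and> primitive r}"
    using ek(2,4) by blast
qed

lemma variables_eq: "{x i | x y B i. (x, y, B) \<in> \<S>} = xw ` W"
proof (intro equalityI subsetI)
  fix z assume "z \<in> {x i | x y B i. (x, y, B) \<in> \<S>}"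
  then obtain x y B i where z: "z = x i" "(x, y, B) \<in> \<S>" by blast
  obtain e where e: "lfacet e" "(x, y, B) = sd e" using seeds_lfacet[OF z(2)] by blast
  then have "z = xw (\<gamma> (e i))" using z(1) xw_\<gamma>[OF lfacetD(3)[OF e(1)], of i] by (simp add: sd_def)
  moreover have "\<gamma> (e i) \<in> W" using lfacetD(3)[OF e(1), of i] unfolding cox_weights_eq by blast
  ultimately show "z \<in> xw ` W" by blast
next
  fix z assume "z \<in> xw ` W"
  then obtain p where p: "p < L" "z = X p" unfolding cox_weights_eq using xw_\<gamma> by auto
  have "facet (slice p)" using facet_slice p(1) by simp
  then obtain e where e: "lfacet e" "range e = slice p" "sd e \<in> \<S>" using facet_reachable by blast
  obtain i where "e i = p" using slice_self[OF p(1)] e(2) by (metis imageE)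
  then have 1: "z = (\<lambda>i. X (e i)) i" using p(2) by simp
  have 2: "(\<lambda>i. X (e i), \<lambda>j. mono (\<lambda>p. YY e p j), BB e) \<in> \<S>" using e(3) by (simp only: sd_def[of e])
  show "z \<in> {x i | x y B i. (x, y, B) \<in> \<S>}"
    unfolding mem_Collect_eq by (rule exI, rule exI, rule exI, rule exI, rule conjI, rule 1, rule 2)
qed

lemma initial_y:
  "mono (\<lambda>p. YY idx p j) =
    frag_of (\<omega> j) \<otimes>\<^bsub>P\<^esub> inv\<^bsub>P\<^esub> (frag_of (cq (\<omega> j))) \<otimes>\<^bsub>P\<^esub>
      finprod P (\<lambda>l. frag_of l [^]\<^bsub>P\<^esub> (int (compat A cq l (cq (\<omega> j))) +
          (\<Sum>i | prec A cq i j. A$i$j * int (compat A cq l (cq (\<omega> i)))))) (W - {\<omega> j, cq (\<omega> j)})"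
proof -
  define ex where "ex l = int (compat A cq l (cq (\<omega> j))) + (\<Sum>i | prec A cq i j. A$i$j * int (compat A cq l (cq (\<omega> i))))" for l
  let ?S = "W - {\<omega> j, cq (\<omega> j)}"
  obtain q where q: "q < L" "\<gamma> q = cq (axis j 1)" "Qw!q = j" "lv q = 1" "N \<le> q" by (rule first_level)
  have wj: "\<omega> j = \<gamma> (idx j)" "cq (\<omega> j) = \<gamma> q" "idx j < L" "idx j \<noteq> q"
    using q idx(1)[of j] by (auto simp: fundamental_weight_def \<gamma>_initial)
  have inW: "\<gamma> p \<in> W" if "p < L" for p using that unfolding cox_weights_eq by blast
  have "finprod P (\<lambda>l. frag_of l [^]\<^bsub>P\<^esub> ex l) ?S = (\<Sum>l\<in>?S. frag_of l [^]\<^bsub>P\<^esub> ex l)"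
    by (rule Trop_finprod) (auto simp: finite_W Trop_int_pow frag_carrier simp del: Trop_simps(1) intro!: frag_cmul_carrier)
  also have "\<dots> = (\<Sum>l\<in>?S. frag_cmul (ex l) (frag_of l))"
    by (rule sum.cong) (auto simp: Trop_int_pow frag_carrier simp del: Trop_simps(1))
  finally have fp: "finprod P (\<lambda>l. frag_of l [^]\<^bsub>P\<^esub> ex l) ?S = (\<Sum>l\<in>?S. frag_cmul (ex l) (frag_of l))" .
  have yq: "YY idx q j = - 1"
  proof -
    have "d (Qw!q) * yy I0 q (idx j) = - (d j * \<gamma> (idx j) $ j)"
      by (rule yy_I0[OF q(5,1)]) (use q(2) in \<open>simp add: \<gamma>_initial\<close>)
    then have "d j * (yy I0 q (idx j) + 1) = 0" by (simp add: q(3) \<gamma>_initial distrib_left)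
    then show ?thesis using d_pos[of j] by (simp add: YY_def range_idx)
  qed
  have yj: "YY idx (idx j) j = 1" by (simp add: YY_def range_idx yy_self)
  have yp: "YY idx p j = ex (\<gamma> p)" if "p < L" "p \<noteq> idx j" "p \<noteq> q" for p
    using yy_initial[OF that(1,2)] \<gamma>_inj[OF that(1) q(1)] that(3) q(2)
    by (simp add: YY_def range_idx ex_def fundamental_weight_def)
  have "mono (\<lambda>p. YY idx p j) = frag_of (\<omega> j) + - frag_of (cq (\<omega> j)) + (\<Sum>l\<in>?S. frag_cmul (ex l) (frag_of l))"
  proof (rule poly_mapping_eqI)
    fix l
    show "Poly_Mapping.lookup (mono (\<lambda>p. YY idx p j)) l =
      Poly_Mapping.lookup (frag_of (\<omega> j) + - frag_of (cq (\<omega> j)) + (\<Sum>l\<in>?S. frag_cmul (ex l) (frag_of l))) l"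
    proof (cases "l \<in> W")
      case True
      then obtain p where p: "p < L" "l = \<gamma> p" unfolding cox_weights_eq by auto
      have "Poly_Mapping.lookup (\<Sum>l\<in>?S. frag_cmul (ex l) (frag_of l)) l = (if l \<in> ?S then ex l else 0)"
        by (rule lookup_sum_frag) (simp add: finite_W)
      then show ?thesis
        using p \<gamma>_inj[OF p(1) wj(3)] \<gamma>_inj[OF p(1) q(1)] wj yq yj yp[OF p(1)] True
        by (auto simp: lookup_mono lookup_add lookup_minus)
    next
      case False
      then have "l \<noteq> \<omega> j" "l \<noteq> cq (\<omega> j)" using inW wj q(1) by auto
      then show ?thesis using False lookup_sum_frag[of ?S ex l] finite_W by (simp add: lookup_mono lookup_add lookup_minus)
    qed
  qed
  then show ?thesis
    using Trop_inv[OF frag_carrier[OF inW[OF q(1)]]] wj(2) fp unfolding ex_def[symmetric] by simp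
qed

lemma skew_symmetrizable_initial: "skew_symmetrizable (BB idx)"
proof -
  have "d i * BB idx$i$j = - (d j * BB idx$j$i)" for i j
    using symmetrizes[of i j] zero_sym[of i j]
    by (cases "idx i" "idx j" rule: linorder_cases)
      (auto simp: exch_matrix_def prec_iff simp flip: exch_matrix_eq)
  then show ?thesis unfolding skew_symmetrizable_def using d_pos by blast
qed

lemma free_initial: "free_generating_set (coeff_field P Lau.emb) Lau.amb (\<lambda>i. X (idx i))"
proof -
  have "(\<lambda>i. X (idx i)) = Lau.xv" by (auto simp: Lau.xv_def X_initial idx(1))
  then show ?thesis using Lau.free_generating by (simp add: J_eq)
qed

end

lemma coxeter_cartanI:
  assumes "finite_type_cartan A" "distinct cw" "set cw = UNIV"
  obtains d where "coxeter_cartan A d cw"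
proof -
  obtain d where "\<forall>i. d i > 0" "\<forall>i j. d i * A$i$j = d j * A$j$i"
    "\<forall>v :: 'a \<Rightarrow> real. (\<exists>i. v i \<noteq> 0) \<longrightarrow> (\<Sum>i\<in>UNIV. \<Sum>j\<in>UNIV. v i * real_of_int (d i * A$i$j) * v j) > 0"
    using assms(1) unfolding finite_type_cartan_def by blast
  moreover have "\<forall>i. A$i$i = 2" "\<forall>i j. i \<noteq> j \<longrightarrow> A$i$j \<le> 0 \<and> (A$i$j = 0 \<longleftrightarrow> A$j$i = 0)"
    using assms(1) unfolding finite_type_cartan_def by blast+
  moreover from this have "A$i$j = 0 \<longleftrightarrow> A$j$i = 0" for i j by (cases "i = j") auto
  ultimately have "coxeter_cartan A d cw"
    by unfold_locales (use assms(2,3) in auto)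
  then show ?thesis by (rule that)
qed

theorem proposition5p6:
  fixes A :: "int^'i^'i" and c :: "int^'i \<Rightarrow> int^'i"
  assumes "finite_type_cartan A" and "indecomposable A" and "coxeter_element A c"
  shows
    "let P = Trop (cox_weights A c) in
     \<exists>(\<A> :: ('i, (int^'i) \<Rightarrow>\<^sub>0 int, ratfun) cluster_algebra) (x :: int^'i \<Rightarrow> ratfun)
      (y :: 'i \<Rightarrow> (int^'i) \<Rightarrow>\<^sub>0 int).
      is_cluster_algebra \<A> \<and> geometric_type \<A> \<and>
      coeff_semifield \<A> = P \<and>
      bij_betw x (cox_weights A c) (cluster_variables \<A>) \<and>
      initial_seed \<A> = (\<lambda>i. x (\<omega> i), y, exch_matrix A c) \<and>
      (\<forall>j. y j =
         frag_of (\<omega> j) \<otimes>\<^bsub>P\<^esub> inv\<^bsub>P\<^esub> (frag_of (c (\<omega> j))) \<otimes>\<^bsub>P\<^esub>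
         finprod P
           (\<lambda>\<gamma>. frag_of \<gamma> [^]\<^bsub>P\<^esub>
              (int (compat A c \<gamma> (c (\<omega> j))) +
               (\<Sum>i | prec A c i j. A$i$j * int (compat A c \<gamma> (c (\<omega> i))))))
           (cox_weights A c - {\<omega> j, c (\<omega> j)})) \<and>
      {R \<in> exchange_relations \<A>. primitive R} =
        {({# x (- \<omega> k), x (\<omega> k) #},
          {# (frag_of (\<omega> k),
               (\<Sum>i | prec A c i k. replicate_mset (nat (- A$i$k)) (x (\<omega> i))) +
               (\<Sum>i | prec A c k i. replicate_mset (nat (- A$i$k)) (x (- \<omega> i)))),
             (finprod P (\<lambda>\<gamma>. frag_of \<gamma> [^]\<^bsub>P\<^esub> compat A c \<gamma> (\<omega> k)) (cox_weights A c), {#}) #})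
         | k. True}
        \<union>
        {({# x ((c^^(m-1)) (\<omega> k)), x ((c^^m) (\<omega> k)) #},
          {# (frag_of ((c^^m) (\<omega> k)),
               (\<Sum>i | prec A c i k. replicate_mset (nat (- A$i$k)) (x ((c^^m) (\<omega> i)))) +
               (\<Sum>i | prec A c k i. replicate_mset (nat (- A$i$k)) (x ((c^^(m-1)) (\<omega> i))))),
             (finprod P (\<lambda>\<gamma>. frag_of \<gamma> [^]\<^bsub>P\<^esub> compat A c \<gamma> ((c^^m) (\<omega> k))) (cox_weights A c), {#}) #})
         | k m. 1 \<le> m \<and> m \<le> cox_h A c k}"
proof -
  obtain cw where cw: "distinct cw" "set cw = UNIV" "word_prod A cw = c"
    using assms(3) unfolding coxeter_element_def coxeter_word_def by blast
  obtain d where "coxeter_cartan A d cw" by (rule coxeter_cartanI[OF assms(1) cw(1,2)])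
  then interpret coxeter_cartan A d cw .
  have c: "c = ww cw" using cw(3) by (simp add: word_prod_ww)
  define \<A> where "\<A> = \<lparr> coeff_semifield = P, coeff_emb = Lau.emb, ambient = Lau.amb, initial_seed = sd idx,
    elements = generated_subalgebra (group_ring P Lau.emb) (xw ` W) \<rparr>"
  have seeds: "seeds \<A> = \<S>" by (simp add: seeds_def \<A>_def)
  have vars: "cluster_variables \<A> = xw ` W" unfolding cluster_variables_def seeds by (rule variables_eq)
  have x0: "xw (\<omega> i) = X (idx i)" for i
    using xw_\<gamma>[OF \<gamma>_initial(3)[of i]] by (simp add: \<gamma>_initial fundamental_weight_def)
  have "is_cluster_algebra \<A>"
    unfolding is_cluster_algebra_def vars
    using is_semifield_Trop[of W] Lau.coeff_embedding free_initial skew_symmetrizable_initial mono_carrier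
    by (simp add: \<A>_def J_eq is_seed_def sd_def del: Trop_simps(1))
  moreover have "geometric_type \<A>" "coeff_semifield \<A> = P"
    by (auto simp: geometric_type_def \<A>_def)
  moreover have "bij_betw xw W (cluster_variables \<A>)"
  proof -
    have "inj_on xw W" using X_inj ps_W unfolding xw_def by (intro inj_onI) metis
    then show ?thesis unfolding vars by (rule inj_on_imp_bij_betw)
  qed
  moreover have "initial_seed \<A> = (\<lambda>i. xw (\<omega> i), \<lambda>j. mono (\<lambda>p. YY idx p j), exch_matrix A cq)"
    by (simp add: \<A>_def sd_def x0 exch_matrix_eq)
  moreover have "{R \<in> exchange_relations \<A>. primitive R} =
      {T1 k | k. True} \<union> {T2 k m | k m. 1 \<le> m \<and> m \<le> cox_h A cq k}"
    unfolding cox_h_eq primitive_relations[symmetric] exchange_relations_def seeds by (simp add: \<A>_def)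
  ultimately show ?thesis
    unfolding c Let_def
    by (intro exI[of _ \<A>] exI[of _ xw] exI[of _ "\<lambda>j. mono (\<lambda>p. YY idx p j)"] conjI allI initial_y)
      (simp_all only: T1_def T2_def)
qed

end
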